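(* For any $(i,p),(j,s)\in\widehat I$ and any Q-datum $\mathcal{Q}=(\Delta,\sigma,\xi)$ for $\mathfrak{g}$, we have $$-\Lambda^\infty(L(Y_{i,p}),L(Y_{j,s}))=\mathrm{Deg}^\infty\bigl(a_{L(Y_{i,p}),L(Y_{j,s})}(z)\bigr)=(-1)^{k+l}(\alpha,\beta),$$ where $\bar\phi_{\mathcal{Q}}(i,p)=(\alpha,k)$ and $\bar\phi_{\mathcal{Q}}(j,s)=(\beta,l)$. In particular, for any simple modules $V,W$ in $\mathscr{C}^0$, $$\Lambda^\infty(V,W)=-(\mathrm{wt}_{\mathcal{Q}}(V),\mathrm{wt}_{\mathcal{Q}}(W)).$$
   Context: Basic notation. Let $\mathsf{g}$ be a finite-dimensional complex simple Lie algebra of type ADE with Dynkin diagram $\Delta$ (vertex set $\Delta_0$; $\imath\sim\jmath$ means adjacent). $\mathsf{P}=\bigoplus_{\imath\in\Delta_0}\mathbb{Z}\varpi_\imath$ is the weight lattice, $\alpha_\imath$ the simple roots, $\mathsf{Q}=\bigoplus\mathbb{Z}\alpha_\imath$ the root lattice, $(\cdot,\cdot)$ the symmetric form with $(\varpi_\imath,\alpha_\jmath)=\delta_{\imath\jmath}$, $\mathsf{W}$ the Weyl group generated by $s_\imath(\lambda)=\lambda-(\lambda,\alpha_\imath)\alpha_\imath$, $\mathsf{R}=\mathsf{R}^+\sqcup\mathsf{R}^-$ the roots. Let $\sigma$ be an automorphism of $\Delta$ such that there is no $\imath$ with $\imath\sim\sigma(\imath)$, of order $r\in\{1,2,3\}$;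 $\sigma(\varpi_\imath)=\varpi_{\sigma(\imath)}$. $I$ is the set of $\sigma$-orbits, $\imath\mapsto\bar\imath$ the quotient map, $d_i=|i|\in\{1,r\}$. Write $i\sim j$ in $I$ if some representatives are adjacent; $c_{ii}=2$, $c_{ij}=-\lceil d_j/d_i\rceil$ if $i\sim j$, $c_{ij}=0$ otherwise. Then $C=(c_{ij})$ is the Cartan matrix of a complex simple Lie algebra $\mathfrak{g}$; every $\mathfrak{g}$ arises so: $\sigma=\mathrm{id}$, $\mathfrak{g}=\mathsf{g}$ if simply-laced, otherwise $(\mathsf{g},r,\mathfrak{g})=(A_{2n-1},2,B_n),(D_{n+1},2,C_n),(E_6,2,F_4),(D_4,3,G_2)$. $(\Delta,\sigma)$ is fixed; $h^\vee$ is the dual Coxeter number of $\mathfrak{g}$; $C^{-1}=(\widetilde c_{ij})$. Q-data. A height function is $\xi:\Delta_0\to\mathbb{Z}$ such that (a) $|\xi_\imath-\xi_\jmath|=d_{\bar\imath}$ whenever $\imath\sim\jmath$ and $d_{\bar\imath}=d_{\bar\jmath}$; (b) for $i\sim j$ in $I$ with $d_i<d_j$ (so $d_i=1$, $d_j=r$, $i=\{\imath\}$), there is a unique $j^\circ\in j$ with $|\xi_\imath-\xi_{j^\circ}|=1$ and $\xi_{\sigma^l(j^\circ)}=\xi_{j^\circ}-2l$ for $0\le l<r$. A Q-datum for $\mathfrak{g}$ is $\mathcal{Q}=(\Delta,\sigma,\xi)$. Fix a $\sigma$-parity function: integers $\epsilon_\imath$, $0\le\epsilon_\imath<2d_{\bar\imath}$,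 with $\epsilon_{\imath}\equiv\epsilon_{\imath'}\pmod 2$ if $\bar\imath=\bar\imath'$; $\epsilon_{\sigma^l(\imath)}\equiv\epsilon_\imath-2l\pmod{2d_{\bar\imath}}$; $\epsilon_\imath\equiv\epsilon_\jmath+\min(d_{\bar\imath},d_{\bar\jmath})\pmod{2\min(d_{\bar\imath},d_{\bar\jmath})}$ if $\imath\sim\jmath$. All height functions are also required to satisfy (c) $\xi_\imath-\epsilon_\imath\in2d_{\bar\imath}\mathbb{Z}$ (achievable by adding a constant). Repetition quiver. $\widehat\Delta^\sigma$ has vertex set $\widehat\Delta^\sigma_0=\{(\imath,p)\in\Delta_0\times\mathbb{Z}\mid p-\epsilon_\imath\in2d_{\bar\imath}\mathbb{Z}\}$ and arrows $(\imath,p)\to(\jmath,s)$ whenever $\imath\sim\jmath$, $s-p=\min(d_{\bar\imath},d_{\bar\jmath})$; $\pi(\imath,p)=\imath$. For finite $X\subset\widehat\Delta^\sigma_0$, order it as $(x_1,\dots,x_l)$ with $k<k'$ whenever there is an arrow $x_{k'}\to x_k$ and put $w[X]=s_{\pi(x_1)}\cdots s_{\pi(x_l)}$ (well defined). For $i\in I$ let $i^\circ\in i$ be the unique element maximizing $\xi$ on $i$. $X^\circ_{\mathcal{Q}}=\{(i^\circ,\xi_{i^\circ})\mid i\in I\}$, $\tau^\circ_{\mathcal{Q}}=w[X^\circ_{\mathcal{Q}}]\sigma$, $X'_{\mathcal{Q}}=\{(\sigma(i^\circ),p)\in\widehat\Delta^\sigma_0\mid i\in I,\ \xi_{\sigma(i^\circ)}<p\le\xi_{i^\circ}-2\}$,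 $\tau_{\mathcal{Q}}=w[X'_{\mathcal{Q}}]^{-1}\tau^\circ_{\mathcal{Q}}w[X'_{\mathcal{Q}}]$, $\gamma^{\mathcal{Q}}_\imath=(1-\tau_{\mathcal{Q}}^{d_{\bar\imath}})\varpi_\imath\in\mathsf{R}^+$. With $\widehat{\mathsf{R}}^+=\mathsf{R}^+\times\mathbb{Z}$, the bijection $\phi_{\mathcal{Q}}:\widehat\Delta^\sigma_0\to\widehat{\mathsf{R}}^+$ is given by $\phi_{\mathcal{Q}}(\imath,\xi_\imath)=(\gamma^{\mathcal{Q}}_\imath,0)$ and, if $\phi_{\mathcal{Q}}(\imath,p)=(\beta,k)$, $\phi_{\mathcal{Q}}(\imath,p\pm2d_{\bar\imath})=(\tau_{\mathcal{Q}}^{\mp d_{\bar\imath}}\beta,k)$ if $\tau_{\mathcal{Q}}^{\mp d_{\bar\imath}}\beta\in\mathsf{R}^+$, $=(-\tau_{\mathcal{Q}}^{\mp d_{\bar\imath}}\beta,k\pm1)$ otherwise. Let $\epsilon_i\in\{0,1\}$, $\epsilon_i\equiv\epsilon_\imath\pmod2$ for $\imath\in i$, $\widehat I=\{(i,p)\in I\times\mathbb{Z}\mid p-\epsilon_i\in2\mathbb{Z}\}$; $f(\imath,p)=(\bar\imath,p)$ is a bijection $\widehat\Delta^\sigma_0\to\widehat I$ and $\bar\phi_{\mathcal{Q}}=\phi_{\mathcal{Q}}\circ f^{-1}:\widehat I\to\widehat{\mathsf{R}}^+$. Representations. $q$ is an indeterminate, $\mathbf{k}=\overline{\mathbb{Q}(q)}$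 the algebraic closure inside $\bigcup_{m\ge1}\overline{\mathbb{Q}}((q^{1/m}))$, $q_i=q^{d_i/r}$, $q_s=q^{1/r}$. $U_q'(\widehat{\mathfrak{g}})$ is the Drinfeld–Jimbo quantum affine algebra (no degree operator) of the untwisted affine Lie algebra over $\mathbf{k}$ with generators $e_i,f_i,K_i^{\pm1}$ ($i\in I\sqcup\{0\}$, $d_0=r$), $K_ie_jK_i^{-1}=q_i^{c_{ij}}e_j$, and coproduct $e_i\mapsto e_i\otimes K_i^{-1}+1\otimes e_i$, $f_i\mapsto f_i\otimes1+K_i\otimes f_i$, $K_i\mapsto K_i\otimes K_i$. $\mathscr{C}$ is the category of finite-dimensional modules on which each $K_i$ is diagonalizable with eigenvalues in $q_i^{\mathbb{Z}}$; these are modules over the quantum loop algebra $U_q(L\mathfrak{g})$ with Drinfeld generators $k_i^{\pm1},x^\pm_{i,k},h_{i,l}$; $x_i^\pm(z)=\sum_kx^\pm_{i,k}z^k$, $\phi_i^\pm(z)=k_i^{\pm1}\exp(\pm(q_i-q_i^{-1})\sum_{l\ge1}h_{i,\pm l}z^{\pm l})$. Simple objects are $L(P)$, $P\in(1+z\mathbf{k}[z])^I$, having an $\ell$-highest weight vector $v\ne0$ (unique up to scalar) with $x_i^+(z)v=0$, $\phi_i^\pm(z)v=q_i^{\deg P_i}[P_i(q_i^{-1}z)/P_i(q_iz)]^\pm v$ (expansion at $z^{\pm1}=0$). $\pi_{i,a}=((1-az)^{\delta_{ij}})_{j\in I}$; for $(i,p)\in\widehat I$ identify $Y_{i,p}=\pi_{i,q_s^p}$;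 $\mathcal{M}^+$ is the monoid of monomials in the $Y_{i,p}$, $(i,p)\in\widehat I$; $\mathscr{C}^0\subset\mathscr{C}$ is the Serre subcategory with simple objects $\{L(m)\mid m\in\mathcal{M}^+\}$. For $m=\prod Y_{i,p}^{u_{i,p}}\in\mathcal{M}^+$, $\mathrm{wt}_{\mathcal{Q}}(L(m))=\sum u_{i,p}\,h(\bar\phi_{\mathcal{Q}}(i,p))\in\mathsf{Q}$ with $h(\alpha,k)=(-1)^k\alpha$. R-matrices. $W_z=W\otimes\mathbf{k}[z^{\pm1}]$ with $k_i$ acting on $W$, $x^\pm_{i,k}(w\otimes f)=x^\pm_{i,k}w\otimes z^kf$, $h_{i,l}(w\otimes f)=h_{i,l}w\otimes z^lf$. For simple $V,W$ with $\ell$-highest weight vectors $v,w$ and $w_z=w\otimes1$, $R^{\mathrm{norm}}_{V,W_z}$ is the unique $U_q(L\mathfrak{g})\otimes\mathbf{k}(z)$-isomorphism $(V\otimes W_z)\otimes_{\mathbf{k}[z^{\pm1}]}\mathbf{k}(z)\to(W_z\otimes V)\otimes_{\mathbf{k}[z^{\pm1}]}\mathbf{k}(z)$ with $v\otimes w_z\mapsto w_z\otimes v$; $d_{V,W}(z)$ is the monic polynomial of smallest degree such that $d_{V,W}(z)R^{\mathrm{norm}}_{V,W_z}$ maps $V\otimes W_z$ into $W_z\otimes V$. The universal coefficient $a_{V,W}(z)\in\mathbf{k}[[z]]^\times$ is defined by $R^{\mathrm{univ}}_{V,W_z}(v\otimes w_z)=a_{V,W}(z)\,w_z\otimes v$,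 where $R^{\mathrm{univ}}(v'\otimes w')=q^{\langle\lambda,\mu\rangle}\sum_\nu E_\nu w'\otimes F_\nu v'$ is the universal R-matrix ($K_iv'=q_i^{\lambda_i}v'$, $K_iw'=q_i^{\mu_i}w'$, $\langle\lambda,\mu\rangle=\sum d_i\widetilde c_{ij}\lambda_i\mu_j$, $\{E_\nu\},\{F_\nu\}$ dual bases of the subalgebras generated by the $e_i$, resp. the $f_i$). Let $C_{ii}(z)=z^{d_i}+z^{-d_i}$, $C_{ij}(z)=(z^{c_{ij}}-z^{-c_{ij}})/(z-z^{-1})$ for $i\neq j$, $C(z)^{-1}=(\widetilde C_{ij}(z))$, $\widetilde C_{ij}(z)=\sum_u\widetilde c_{ij}(u)z^u$ (expansion at $z=0$). Known facts (Frenkel–Reshetikhin) determining $a_{V,W}$: it is multiplicative, $a_{L(P_1P_2),L(P_3)}=a_{L(P_1),L(P_3)}a_{L(P_2),L(P_3)}$ and $a_{L(P_1),L(P_2P_3)}=a_{L(P_1),L(P_2)}a_{L(P_1),L(P_3)}$, and $a_{L(\pi_{i,a}),L(\pi_{j,b})}(z)=q_i^{\widetilde c_{ij}}\prod_{u\ge0}\Bigl(\frac{1-q_s^{u-d_i}(b/a)z}{1-q_s^{u+d_i}(b/a)z}\Bigr)^{\widetilde c_{ij}(u)}$. Invariant $\Lambda^\infty$. Let $\varphi(z)=\prod_{k\ge0}(1-q^{2kh^\vee}z)$ and let $\mathcal{G}\subset\mathbf{k}((z))^\times$ be the group of elements $f(z)=cz^m\prod_{a\in\mathbf{k}^\times}\varphi(az)^{\mu_a}$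 ($c\in\mathbf{k}^\times$, $m\in\mathbb{Z}$, $\mu_a\in\mathbb{Z}$ almost all zero); it contains $\mathbf{k}(z)^\times$ and all $a_{V,W}(z)$. Put $\mathrm{Deg}^\infty(f)=\sum_{a\in\{q^{2kh^\vee}\mid k\in\mathbb{Z}\}}\mu_a$ and $\Lambda^\infty(V,W)=\mathrm{Deg}^\infty(d_{V,W}(z)/a_{V,W}(z))=-\mathrm{Deg}^\infty(a_{V,W}(z))$. *)

theory Defs
  imports
    "HOL-Algebra.Algebraic_Closure_Type"
    "HOL-Algebra.Generated_Fields"
    "HOL-Computational_Algebra.Computational_Algebra"
    "HOL-Combinatorics.Permutations"
    "HOL-Number_Theory.Cong"
    "HOL-Library.Groups_Big_Fun"
    "Jordan_Normal_Form.Matrix"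
begin


section \<open>The base field\<close>

text \<open>
  Puiseux series over a coefficient field are represented by their coefficient functions on rational
  exponents: the exponents in the support have a common denominator and are bounded below.
  For coefficients in the algebraic numbers this is the union of the fields of Laurent series in
  $q^{1/m}$, $m \ge 1$.
\<close>

definition puiseux_den :: "nat \<Rightarrow> (rat \<Rightarrow> 'a::zero) \<Rightarrow> bool" where
  "puiseux_den m f \<longleftrightarrow> m > 0 \<and>
     (\<exists>N::int. \<forall>x. f x \<noteq> 0 \<longrightarrow> x * of_nat m \<in> \<int> \<and> of_int N \<le> x)"

typedef (overloaded) 'a puiseux = "{f :: rat \<Rightarrow> 'a::zero. \<exists>m. puiseux_den m f}"
  morphisms puiseux_coeff Abs_puiseux
proof
  show "(\<lambda>_. 0) \<in> {f :: rat \<Rightarrow> 'a. \<exists>m. puiseux_den m f}"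
    by (auto simp: puiseux_den_def)
qed

definition fls_ramify :: "nat \<Rightarrow> 'a::zero fls \<Rightarrow> rat \<Rightarrow> 'a" where
  "fls_ramify m F x = (if x * of_nat m \<in> \<int> then fls_nth F \<lfloor>x * of_nat m\<rfloor> else 0)"

definition puiseux_of_fls :: "nat \<Rightarrow> 'a::zero fls \<Rightarrow> 'a puiseux" where
  "puiseux_of_fls m F = Abs_puiseux (fls_ramify m F)"

lemma puiseux_den_fls_ramify:
  fixes F :: "'a::zero fls"
  assumes "m > 0"
  shows "puiseux_den m (fls_ramify m F)"
proof -
  obtain N where N: "\<forall>n>N. fls_nth F (- int n) = 0"
    using fls_nth_vanishes_below_natE by blast
  show ?thesis unfolding puiseux_den_def
  proof (intro conjI assms exI[of _ "- int N"] allI impI)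
    fix x assume "fls_ramify m F x \<noteq> 0"
    then have x: "x * of_nat m \<in> \<int>" and nz: "fls_nth F \<lfloor>x * of_nat m\<rfloor> \<noteq> 0"
      by (auto simp: fls_ramify_def split: if_splits)
    show "x * of_nat m \<in> \<int>" by (fact x)
    have ge: "\<lfloor>x * of_nat m\<rfloor> \<ge> - int N"
    proof (rule ccontr)
      assume "\<not> ?thesis"
      then have "\<lfloor>x * of_nat m\<rfloor> < - int N" by (simp only: not_le)
      then have "\<lfloor>x * of_nat m\<rfloor> = - int (nat (- \<lfloor>x * of_nat m\<rfloor>))" "nat (- \<lfloor>x * of_nat m\<rfloor>) > N"
        by linarith+
      with N nz show False by metis
    qed
    then have le: "of_int (- int N) \<le> x * of_nat m" by linarith
    show "of_int (- int N) \<le> x"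
    proof (rule ccontr)
      assume "\<not> ?thesis"
      then have "x < - of_nat N" by simp
      then have "x * of_nat m < - of_nat N * of_nat m"
        using assms by (intro mult_strict_right_mono) auto
      also have "(- of_nat N * of_nat m::rat) \<le> - of_nat N * 1"
      proof -
        have "(1::rat) \<le> of_nat m" using assms by simp
        then have "(of_nat N :: rat) * 1 \<le> of_nat N * of_nat m" by (intro mult_left_mono) auto
        then show ?thesis by simp
      qed
      finally show False using le by simp
    qed
  qed
qed

lemma puiseux_coeff_of_fls [simp]:
  "m > 0 \<Longrightarrow> puiseux_coeff (puiseux_of_fls m F) = fls_ramify m F"
  unfolding puiseux_of_fls_def by (rule Abs_puiseux_inverse) (auto intro: puiseux_den_fls_ramify)

lemma puiseux_den_mult:
  assumes "puiseux_den m f" "k > 0" shows "puiseux_den (m * k) f"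
proof -
  from assms obtain N where N: "\<And>x. f x \<noteq> 0 \<Longrightarrow> x * of_nat m \<in> \<int> \<and> of_int N \<le> x"
    by (auto simp: puiseux_den_def)
  have "x * of_nat (m * k) \<in> \<int>" if "f x \<noteq> 0" for x
  proof -
    have "x * of_nat m * of_nat k \<in> \<int>" using N[OF that] by (blast intro: Ints_mult Ints_of_nat)
    then show ?thesis by (simp add: mult.assoc)
  qed
  then have "\<forall>x. f x \<noteq> 0 \<longrightarrow> x * of_nat (m * k) \<in> \<int> \<and> of_int N \<le> x" using N by blast
  moreover have "m * k > 0" using assms by (simp add: puiseux_den_def)
  ultimately show ?thesis unfolding puiseux_den_def by blast
qed

lemma puiseux_den_imp_of_fls:
  assumes "puiseux_den m (puiseux_coeff x)"
  obtains F where "x = puiseux_of_fls m F"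
proof -
  let ?f = "puiseux_coeff x"
  from assms obtain N where m: "m > 0" and N: "\<And>y. ?f y \<noteq> 0 \<Longrightarrow> y * of_nat m \<in> \<int> \<and> of_int N \<le> y"
    by (auto simp: puiseux_den_def)
  define F where "F = Abs_fls (\<lambda>n. ?f (of_int n / of_nat m))"
  have van: "?f (of_int n / of_nat m) = 0" if "n < N * int m" for n
  proof (rule ccontr)
    assume "\<not> ?thesis"
    then have "of_int N \<le> (of_int n / of_nat m :: rat)" using N by blast
    then have "of_int N * of_nat m \<le> (of_int n :: rat)" using m by (simp add: field_simps)
    then have "of_int (N * int m) \<le> (of_int n :: rat)" by simp
    then show False using that by (simp only: of_int_le_iff)
  qed
  have F: "fls_nth F n = ?f (of_int n / of_nat m)" for n
    unfolding F_def by (rule nth_Abs_fls_lower_bound[of "N * int m"]) (use van in auto)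
  have "?f = fls_ramify m F"
  proof
    fix y
    show "?f y = fls_ramify m F y"
    proof (cases "y * of_nat m \<in> \<int>")
      case True
      then have "of_int \<lfloor>y * of_nat m\<rfloor> = y * of_nat m" by (rule of_int_floor)
      then show ?thesis using True m by (simp add: fls_ramify_def F)
    qed (use N in \<open>auto simp: fls_ramify_def\<close>)
  qed
  then have "x = puiseux_of_fls m F"
    unfolding puiseux_of_fls_def by (metis puiseux_coeff_inverse)
  then show ?thesis by (rule that)
qed

lemma puiseux_ex_den: "\<exists>m. puiseux_den m (puiseux_coeff x)"
  using puiseux_coeff[of x] by auto

lemma puiseux_of_fls_common3:
  fixes x y z :: "'a::zero puiseux"
  obtains m F G H where "m > 0" "x = puiseux_of_fls m F" "y = puiseux_of_fls m G"
    "z = puiseux_of_fls m H"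
proof -
  obtain a b c where den: "puiseux_den a (puiseux_coeff x)" "puiseux_den b (puiseux_coeff y)"
    "puiseux_den c (puiseux_coeff z)"
    using puiseux_ex_den by metis
  then have pos: "a > 0" "b > 0" "c > 0" by (auto simp: puiseux_den_def)
  have "puiseux_den (a * (b * c)) (puiseux_coeff x)" "puiseux_den (b * (a * c)) (puiseux_coeff y)"
    "puiseux_den (c * (a * b)) (puiseux_coeff z)"
    using den pos by (auto intro!: puiseux_den_mult)
  then have "puiseux_den (a * b * c) (puiseux_coeff x)" "puiseux_den (a * b * c) (puiseux_coeff y)"
    "puiseux_den (a * b * c) (puiseux_coeff z)"
    by (simp_all add: mult_ac)
  then show ?thesis using that pos puiseux_den_imp_of_fls
    by (metis nat_0_less_mult_iff)
qed

lemma puiseux_of_fls_inject: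
  assumes "m > 0" "puiseux_of_fls m F = puiseux_of_fls m G" shows "F = G"
proof (rule fls_eqI)
  fix n
  have "fls_ramify m F (of_int n / of_nat m) = fls_ramify m G (of_int n / of_nat m)"
    using assms by (metis puiseux_coeff_of_fls)
  then show "fls_nth F n = fls_nth G n"
    using assms(1) by (simp add: fls_ramify_def)
qed

instantiation puiseux :: (zero) zero begin
definition "0 = puiseux_of_fls 1 0"
instance ..
end

instantiation puiseux :: ("{zero,one}") one begin
definition "1 = puiseux_of_fls 1 1"
instance ..
end

instantiation puiseux :: (monoid_add) plus begin
definition "x + y = Abs_puiseux (\<lambda>e. puiseux_coeff x e + puiseux_coeff y e)"
instance ..
end

instantiation puiseux :: (group_add) uminus begin
definition "- x = Abs_puiseux (\<lambda>e. - puiseux_coeff x e)"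
instance ..
end

instantiation puiseux :: (group_add) minus begin
definition "x - (y :: 'a puiseux) = x + (- y)"
instance ..
end

instantiation puiseux :: (semiring_0) times begin
definition "x * y = Abs_puiseux (\<lambda>e. \<Sum>d | puiseux_coeff x d \<noteq> 0 \<and> puiseux_coeff y (e - d) \<noteq> 0.
    puiseux_coeff x d * puiseux_coeff y (e - d))"
instance ..
end

lemma puiseux_of_fls_0: "m > 0 \<Longrightarrow> puiseux_of_fls m 0 = 0"
  unfolding zero_puiseux_def puiseux_of_fls_def fls_ramify_def
  by (rule arg_cong[of _ _ Abs_puiseux]) auto

lemma rat_zero_iff_Ints_floor:
  fixes x :: rat assumes "m > 0" "x * of_nat m \<in> \<int>" shows "\<lfloor>x * of_nat m\<rfloor> = 0 \<longleftrightarrow> x = 0"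
proof -
  have "of_int \<lfloor>x * of_nat m\<rfloor> = x * of_nat m" using assms(2) by (rule of_int_floor)
  then have "\<lfloor>x * of_nat m\<rfloor> = 0 \<longleftrightarrow> x * of_nat m = 0" by (metis of_int_0 of_int_eq_0_iff)
  then show ?thesis using assms(1) by simp
qed

lemma fls_ramify_1: "m > 0 \<Longrightarrow> fls_ramify m 1 = (\<lambda>x. if x = 0 then 1 else (0::'a::{zero,one}))"
  using rat_zero_iff_Ints_floor by (fastforce simp: fls_ramify_def)

lemma puiseux_of_fls_1: "m > 0 \<Longrightarrow> puiseux_of_fls m 1 = (1 :: 'a :: {zero,one} puiseux)"
  unfolding one_puiseux_def puiseux_of_fls_def by (simp add: fls_ramify_1)

lemma puiseux_of_fls_add:
  "m > 0 \<Longrightarrow> puiseux_of_fls m F + puiseux_of_fls m G = puiseux_of_fls m (F + G)"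
  unfolding plus_puiseux_def by (simp, unfold puiseux_of_fls_def)
    (rule arg_cong[of _ _ Abs_puiseux], auto simp: fls_ramify_def)

lemma puiseux_of_fls_uminus:
  "m > 0 \<Longrightarrow> - puiseux_of_fls m F = puiseux_of_fls m (- F)"
  unfolding uminus_puiseux_def by (simp, unfold puiseux_of_fls_def)
    (rule arg_cong[of _ _ Abs_puiseux], auto simp: fls_ramify_def)

lemma puiseux_of_fls_mult:
  fixes F G :: "'a::semiring_0 fls"
  assumes m: "m > 0"
  shows "puiseux_of_fls m F * puiseux_of_fls m G = puiseux_of_fls m (F * G)"
proof -
  let ?f = "fls_ramify m F" and ?g = "fls_ramify m G"
  have "(\<Sum>d | ?f d \<noteq> 0 \<and> ?g (e - d) \<noteq> 0. ?f d * ?g (e - d)) = fls_ramify m (F * G) e" for e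
  proof (cases "e * of_nat m \<in> \<int>")
    case False
    have "{d. ?f d \<noteq> 0 \<and> ?g (e - d) \<noteq> 0} = {}"
    proof safe
      fix d assume "?f d \<noteq> 0" "?g (e - d) \<noteq> 0"
      then have "d * of_nat m \<in> \<int>" "(e - d) * of_nat m \<in> \<int>"
        by (auto simp: fls_ramify_def split: if_splits)
      then have "d * of_nat m + (e - d) * of_nat m \<in> \<int>" by (rule Ints_add)
      then show "d \<in> {}" using False by (simp add: algebra_simps)
    qed
    then have "(\<Sum>d | ?f d \<noteq> 0 \<and> ?g (e - d) \<noteq> 0. ?f d * ?g (e - d)) = 0" by (simp only: sum.empty)
    then show ?thesis using False by (simp only: fls_ramify_def if_False)
  next
    case True
    define n where "n = \<lfloor>e * of_nat m\<rfloor>"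
    have n: "of_int n = e * of_nat m" unfolding n_def using True by (rule of_int_floor)
    define I where "I = {i. fls_nth F i \<noteq> 0 \<and> fls_nth G (n - i) \<noteq> 0}"
    have e: "e = of_int n / of_nat m" using n m by (simp add: field_simps)
    have f1: "?f (of_int i / of_nat m) = fls_nth F i" for i
      using m by (simp add: fls_ramify_def)
    have g1: "?g (e - of_int i / of_nat m) = fls_nth G (n - i)" for i
    proof -
      have "(e - of_int i / of_nat m) * of_nat m = of_int (n - i)" using m n by (simp add: field_simps)
      then show ?thesis by (simp only: fls_ramify_def) auto
    qed
    have S: "{d. ?f d \<noteq> 0 \<and> ?g (e - d) \<noteq> 0} = (\<lambda>i. of_int i / of_nat m) ` I"
    proof (intro equalityI subsetI)
      fix d assume d: "d \<in> {d. ?f d \<noteq> 0 \<and> ?g (e - d) \<noteq> 0}"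
      then have "d * of_nat m \<in> \<int>" by (auto simp: fls_ramify_def split: if_splits)
      then have "of_int \<lfloor>d * of_nat m\<rfloor> = d * of_nat m" by (rule of_int_floor)
      moreover have "d = d * of_nat m / of_nat m" using m by simp
      ultimately have "d = of_int \<lfloor>d * of_nat m\<rfloor> / of_nat m" by (simp only:)
      then obtain i where i: "d = of_int i / of_nat m" ..
      with d have "i \<in> I" by (simp add: f1 g1 I_def)
      with i show "d \<in> (\<lambda>i. of_int i / of_nat m) ` I" by blast
    qed (auto simp: f1 g1 I_def)
    have inj: "inj_on (\<lambda>i. of_int i / of_nat m :: rat) I" using m by (auto intro!: inj_onI)
    have "(\<Sum>d | ?f d \<noteq> 0 \<and> ?g (e - d) \<noteq> 0. ?f d * ?g (e - d)) = (\<Sum>i\<in>I. fls_nth F i * fls_nth G (n - i))"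
      unfolding S by (subst sum.reindex[OF inj]) (simp add: f1 g1)
    also have "\<dots> = (\<Sum>i=fls_subdegree F..n - fls_subdegree G. fls_nth F i * fls_nth G (n - i))"
    proof (rule sum.mono_neutral_left)
      show "I \<subseteq> {fls_subdegree F..n - fls_subdegree G}"
      proof
        fix i assume "i \<in> I"
        then have "fls_subdegree F \<le> i" "fls_subdegree G \<le> n - i"
          unfolding I_def by (auto intro: fls_subdegree_leI)
        then show "i \<in> {fls_subdegree F..n - fls_subdegree G}" by auto
      qed
    qed (auto simp: I_def)
    also have "\<dots> = fls_nth (F * G) n" by (simp add: fls_times_nth(2))
    finally show ?thesis using True by (simp add: fls_ramify_def n_def)
  qed
  then show ?thesis
    using m unfolding times_puiseux_def by (simp, simp add: puiseux_of_fls_def)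
qed

lemmas puiseux_of_fls_ops = puiseux_of_fls_add puiseux_of_fls_uminus puiseux_of_fls_mult

instance puiseux :: (ring_1) ring_1
proof
  fix a b c :: "'a puiseux"
  obtain m F G H where m: "m > 0" and a: "a = puiseux_of_fls m F" and b: "b = puiseux_of_fls m G"
    and c: "c = puiseux_of_fls m H" by (rule puiseux_of_fls_common3)
  note z = puiseux_of_fls_0[OF m, symmetric] and o = puiseux_of_fls_1[OF m, symmetric]
  note ops = puiseux_of_fls_ops[OF m]
  show "a + b + c = a + (b + c)" unfolding a b c ops by (simp add: add.assoc)
  show "a + b = b + a" unfolding a b ops by (simp add: add.commute)
  show "0 + a = a" unfolding a z ops by simp
  show "- a + a = 0" unfolding a z ops by simp
  show "a - b = a + - b" by (simp add: minus_puiseux_def)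
  show "a * b * c = a * (b * c)" unfolding a b c ops by (simp add: mult.assoc)
  show "1 * a = a" unfolding a o ops by simp
  show "a * 1 = a" unfolding a o ops by simp
  show "(a + b) * c = a * c + b * c" unfolding a b c ops by (simp add: distrib_right)
  show "a * (b + c) = a * b + a * c" unfolding a b c ops by (simp add: distrib_left)
  show "(0 :: 'a puiseux) \<noteq> 1" using puiseux_of_fls_inject[OF m] unfolding z o by fastforce
qed

instance puiseux :: (comm_ring_1) comm_ring_1
proof
  fix a b c :: "'a puiseux"
  show "1 * a = a" by simp
  show "(a + b) * c = a * c + b * c" by (rule distrib_right)
  obtain m F G H where m: "m > 0" and a: "a = puiseux_of_fls m F" and b: "b = puiseux_of_fls m G"
    and "a = puiseux_of_fls m H" by (rule puiseux_of_fls_common3)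
  show "a * b = b * a" unfolding a b puiseux_of_fls_ops[OF m] by (simp add: mult.commute)
qed

instantiation puiseux :: (field) inverse begin
definition inverse_puiseux :: "'a puiseux \<Rightarrow> 'a puiseux" where
  "inverse_puiseux x = (if x = 0 then 0 else SOME y. y * x = 1)"
definition divide_puiseux :: "'a puiseux \<Rightarrow> 'a puiseux \<Rightarrow> 'a puiseux" where
  "divide_puiseux x y = x * inverse y"
instance ..
end

instance puiseux :: (field) field
proof
  fix a b :: "'a puiseux"
  show "inverse (0 :: 'a puiseux) = 0" by (simp add: inverse_puiseux_def)
  show "a / b = a * inverse b" by (simp add: divide_puiseux_def)
  assume nz: "a \<noteq> 0"
  obtain m F G H where m: "m > 0" and a: "a = puiseux_of_fls m F" and "a = puiseux_of_fls m G"
    and "a = puiseux_of_fls m H" by (rule puiseux_of_fls_common3)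
  have "F \<noteq> 0" using nz a puiseux_of_fls_0[OF m] by metis
  then have "puiseux_of_fls m (inverse F) * a = 1"
    unfolding a puiseux_of_fls_mult[OF m] puiseux_of_fls_1[OF m, symmetric] by simp
  then show "inverse a * a = 1"
    unfolding inverse_puiseux_def using nz by (metis (mono_tags, lifting) someI_ex)
qed


lemma of_nat_puiseux: "m > 0 \<Longrightarrow> of_nat n = puiseux_of_fls m (of_nat n :: 'a::ring_1 fls)"
  by (induction n) (simp_all add: puiseux_of_fls_0 puiseux_of_fls_ops puiseux_of_fls_1[symmetric])

instance puiseux :: (field_char_0) field_char_0
proof
  show "inj (of_nat :: nat \<Rightarrow> 'a puiseux)"
  proof (rule injI)
    have one: "(0::nat) < 1" by simp
    fix a b assume "(of_nat a :: 'a puiseux) = of_nat b"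
    then have "puiseux_of_fls 1 (of_nat a :: 'a fls) = puiseux_of_fls 1 (of_nat b)"
      by (simp only: of_nat_puiseux[OF one, symmetric])
    then have "(of_nat a :: 'a fls) = of_nat b" by (rule puiseux_of_fls_inject[OF one])
    then have "fls_nth (of_nat a :: 'a fls) 0 = fls_nth (of_nat b) 0" by simp
    then show "a = b" by (simp add: fls_of_nat_nth)
  qed
qed

definition puiseux_X_pow :: "rat \<Rightarrow> 'a::{zero,one} puiseux" where
  "puiseux_X_pow e = Abs_puiseux (\<lambda>x. if x = e then 1 else 0)"

lemma puiseux_X_pow_as_fls:
  assumes "m > 0" "e * of_nat m \<in> \<int>"
  shows "puiseux_X_pow e = puiseux_of_fls m (fls_X_intpow \<lfloor>e * of_nat m\<rfloor> :: 'a::{zero,one} fls)"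
proof -
  have "(\<lambda>x. if x = e then 1 else (0::'a)) = fls_ramify m (fls_X_intpow \<lfloor>e * of_nat m\<rfloor>)"
  proof
    fix x :: rat
    show "(if x = e then 1 else (0::'a)) = fls_ramify m (fls_X_intpow \<lfloor>e * of_nat m\<rfloor>) x"
    proof (cases "x * of_nat m \<in> \<int>")
      case True
      have "x = e \<longleftrightarrow> \<lfloor>x * of_nat m\<rfloor> = \<lfloor>e * of_nat m\<rfloor>"
        using of_int_floor[OF True] of_int_floor[OF assms(2)] assms(1)
        by (metis less_irrefl mult_cancel_right of_nat_0_eq_iff)
      then show ?thesis using True by (simp add: fls_ramify_def)
    qed (use assms in \<open>auto simp: fls_ramify_def\<close>)
  qed
  then show ?thesis by (simp add: puiseux_X_pow_def puiseux_of_fls_def)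
qed

text \<open>
  The base field \<open>qfield\<close> consists of the Puiseux series over the algebraic numbers that are algebraic
  over the subfield generated by $q$, i.e. over the rational functions in $q$; \<open>qpow e\<close> is $q^e$.
  Being algebraic is the notion of \<open>HOL-Algebra\<close> for the ring structure of the type.
\<close>

definition Qq :: "rat alg_closure puiseux set" where
  "Qq = generate_field ring_of_type_algebra {puiseux_X_pow 1}"


lemma subfield_algebraic_Qq:
  "subfield {x. ring.algebraic ring_of_type_algebra Qq x} ring_of_type_algebra"
proof -
  interpret field "ring_of_type_algebra :: rat alg_closure puiseux ring"
    by (rule field_from_type_algebra)
  have c: "carrier (ring_of_type_algebra :: rat alg_closure puiseux ring) = UNIV"
    by (simp add: ring_of_type_algebra_def)
  have "subfield Qq ring_of_type_algebra"
    unfolding Qq_def by (rule generate_field_is_subfield) (simp add: c)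
  from subfield_of_algebraics[OF this] show ?thesis by (simp add: c over_def)
qed


typedef qfield = "{x :: rat alg_closure puiseux. ring.algebraic ring_of_type_algebra Qq x}"
  morphisms puiseux_of_qfield Abs_qfield
  using subringE(2)[OF subfieldE(1)[OF subfield_algebraic_Qq]] by auto

setup_lifting type_definition_qfield

lemma algebraic_closed:
  shows algebraic_0: "ring.algebraic ring_of_type_algebra Qq (0::rat alg_closure puiseux)"
    and algebraic_1: "ring.algebraic ring_of_type_algebra Qq (1::rat alg_closure puiseux)"
    and algebraic_add: "ring.algebraic ring_of_type_algebra Qq x \<Longrightarrow>
      ring.algebraic ring_of_type_algebra Qq y \<Longrightarrow> ring.algebraic ring_of_type_algebra Qq (x + y)"
    and algebraic_mult: "ring.algebraic ring_of_type_algebra Qq x \<Longrightarrow>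
      ring.algebraic ring_of_type_algebra Qq y \<Longrightarrow> ring.algebraic ring_of_type_algebra Qq (x * y)"
    and algebraic_uminus: "ring.algebraic ring_of_type_algebra Qq x \<Longrightarrow>
      ring.algebraic ring_of_type_algebra Qq (- x)"
    and algebraic_inverse: "ring.algebraic ring_of_type_algebra Qq x \<Longrightarrow>
      ring.algebraic ring_of_type_algebra Qq (inverse x)"
proof -
  let ?R = "ring_of_type_algebra :: rat alg_closure puiseux ring"
  let ?A = "{x. ring.algebraic ?R Qq x}"
  interpret R: field ?R by (rule field_from_type_algebra)
  interpret A: subfield ?A ?R by (rule subfield_algebraic_Qq)
  have ops: "carrier ?R = UNIV" "\<zero>\<^bsub>?R\<^esub> = 0" "\<one>\<^bsub>?R\<^esub> = 1" "x \<oplus>\<^bsub>?R\<^esub> y = x + y" "x \<otimes>\<^bsub>?R\<^esub> y = x * y" for x y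
    by (simp_all add: ring_of_type_algebra_def)
  have m: "\<ominus>\<^bsub>?R\<^esub> x = - x" for x
    by (rule R.minus_equality) (simp_all add: ops)
  have i: "inv\<^bsub>?R\<^esub> x = inverse x" if "x \<noteq> 0" for x
    by (rule R.comm_inv_char) (use that in \<open>simp_all add: ops\<close>)
  note sr = subfieldE(1)[OF subfield_algebraic_Qq]
  show z: "ring.algebraic ?R Qq 0" using subringE(2)[OF sr] by (simp add: ops)
  show "ring.algebraic ?R Qq 1" using subringE(3)[OF sr] by (simp add: ops)
  show "ring.algebraic ?R Qq x \<Longrightarrow> ring.algebraic ?R Qq y \<Longrightarrow> ring.algebraic ?R Qq (x + y)"
    using subringE(7)[OF sr, of x y] by (simp add: ops)
  show "ring.algebraic ?R Qq x \<Longrightarrow> ring.algebraic ?R Qq y \<Longrightarrow> ring.algebraic ?R Qq (x * y)"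
    using subringE(6)[OF sr, of x y] by (simp add: ops)
  show "ring.algebraic ?R Qq x \<Longrightarrow> ring.algebraic ?R Qq (- x)"
    using subringE(5)[OF sr, of x] by (simp add: ops m)
  show "ring.algebraic ?R Qq x \<Longrightarrow> ring.algebraic ?R Qq (inverse x)"
    using R.subfield_m_inv(1)[OF subfield_algebraic_Qq, of x] i[of x] z
    by (cases "x = 0") (auto simp: ops)
qed

instantiation qfield :: field begin
lift_definition zero_qfield :: qfield is 0 by (rule algebraic_0)
lift_definition one_qfield :: qfield is 1 by (rule algebraic_1)
lift_definition plus_qfield :: "qfield \<Rightarrow> qfield \<Rightarrow> qfield" is "(+)" by (rule algebraic_add)
lift_definition times_qfield :: "qfield \<Rightarrow> qfield \<Rightarrow> qfield" is "(*)" by (rule algebraic_mult)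
lift_definition uminus_qfield :: "qfield \<Rightarrow> qfield" is uminus by (rule algebraic_uminus)
lift_definition minus_qfield :: "qfield \<Rightarrow> qfield \<Rightarrow> qfield" is "(-)"
  unfolding diff_conv_add_uminus by (intro algebraic_add algebraic_uminus)
lift_definition inverse_qfield :: "qfield \<Rightarrow> qfield" is inverse by (rule algebraic_inverse)
lift_definition divide_qfield :: "qfield \<Rightarrow> qfield \<Rightarrow> qfield" is "(/)"
  unfolding divide_inverse by (intro algebraic_mult algebraic_inverse)
instance
  by standard (transfer; simp add: algebra_simps divide_inverse)+
end

instance qfield :: field_char_0
proof
  have "puiseux_of_qfield (of_nat n) = of_nat n" for n
    by (induction n) (simp_all add: zero_qfield.rep_eq plus_qfield.rep_eq one_qfield.rep_eq)
  then show "inj (of_nat :: nat \<Rightarrow> qfield)" by (metis injI of_nat_eq_iff)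
qed

lemma puiseux_X_pow_0: "puiseux_X_pow 0 = 1"
proof -
  have "puiseux_X_pow 0 = (puiseux_of_fls 1 1 :: 'a puiseux)"
    using puiseux_X_pow_as_fls[of 1 0] by simp
  also have "\<dots> = 1" by (rule puiseux_of_fls_1) simp
  finally show ?thesis .
qed

lemma puiseux_X_pow_add:
  "puiseux_X_pow (d + e) = puiseux_X_pow d * (puiseux_X_pow e :: 'a::field puiseux)"
proof -
  obtain a b c d' where d: "d = of_int a / of_int b" "b > 0" and e: "e = of_int c / of_int d'" "d' > 0"
    by (metis quotient_of_denom_pos quotient_of_div surj_pair)
  define m where "m = nat (b * d')"
  have pos: "b * d' > 0" using d(2) e(2) by (rule mult_pos_pos)
  have m: "m > 0" unfolding m_def using pos by simp
  have "(of_nat m :: rat) = of_int (b * d')" unfolding m_def using pos by (intro of_nat_nat) simp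
  then have m2: "(of_nat m :: rat) = of_int b * of_int d'" by (simp only: of_int_mult)
  have nz: "(of_int b :: rat) \<noteq> 0" "(of_int d' :: rat) \<noteq> 0" using d(2) e(2) by auto
  have "of_int a / of_int b * (of_int b * of_int d') = (of_int a * of_int d' :: rat)"
    using nz(1) by (metis mult.assoc nonzero_eq_divide_eq)
  then have i1: "d * of_nat m = of_int (a * d')" unfolding m2 d(1) by (simp only: of_int_mult)
  have "of_int c / of_int d' * (of_int b * of_int d') = (of_int c * of_int b :: rat)"
    using nz(2) by (metis mult.assoc mult.commute nonzero_eq_divide_eq)
  then have i2: "e * of_nat m = of_int (c * b)" unfolding m2 e(1) by (simp only: of_int_mult)
  have s: "(d + e) * of_nat m = of_int (a * d' + c * b)" unfolding distrib_right i1 i2 by simp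
  have "puiseux_X_pow x = puiseux_of_fls m (fls_X_intpow k :: 'a fls)"
    if "x * of_nat m = of_int k" for x k
    using puiseux_X_pow_as_fls[of m x] m that by simp
  from this[OF i1] this[OF i2] this[OF s] show ?thesis
    using m by (simp add: puiseux_of_fls_mult fls_X_intpow_times_fls_X_intpow)
qed

lemma puiseux_X_pow_power: "puiseux_X_pow e ^ n = (puiseux_X_pow (of_nat n * e) :: 'a::field puiseux)"
proof (induction n)
  case (Suc n)
  have "of_nat (Suc n) * e = e + of_nat n * e" by (simp add: distrib_right)
  then show ?case using Suc by (simp only: power_Suc puiseux_X_pow_add)
qed (simp add: puiseux_X_pow_0)

lemma algebraic_puiseux_X_pow_root:
  assumes "n > 0"
  shows "ring.algebraic ring_of_type_algebra Qq (puiseux_X_pow (1 / of_nat n))"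
proof -
  let ?R = "ring_of_type_algebra :: rat alg_closure puiseux ring"
  let ?x = "puiseux_X_pow (1 / of_nat n) :: rat alg_closure puiseux"
  let ?X = "puiseux_X_pow 1 :: rat alg_closure puiseux"
  interpret R: field ?R by (rule field_from_type_algebra)
  have ops: "carrier ?R = UNIV" "\<zero>\<^bsub>?R\<^esub> = 0" "\<one>\<^bsub>?R\<^esub> = 1" "x \<oplus>\<^bsub>?R\<^esub> y = x + y" "x \<otimes>\<^bsub>?R\<^esub> y = x * y" for x y
    by (simp_all add: ring_of_type_algebra_def)
  have pw: "x [^]\<^bsub>?R\<^esub> (k::nat) = x ^ k" for x k
    by (induction k) (simp_all add: ops mult.commute)
  have sf: "subfield Qq ?R"
    unfolding Qq_def by (rule R.generate_field_is_subfield) (simp add: ops)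
  note sr = subringE[OF subfieldE(1)[OF sf]]
  have X: "?X \<in> Qq" unfolding Qq_def by (rule generate_field.incl) simp
  have m: "\<ominus>\<^bsub>?R\<^esub> x = - x" for x
    by (rule R.minus_equality) (simp_all add: ops)
  have X': "- ?X \<in> Qq" using sr(5)[OF X] by (simp add: m)
  let ?p = "1 # replicate (n - 1) 0 @ [- ?X]"
  have "R.eval (replicate k 0 @ [c]) x = c" for k c x
    by (induction k) (simp_all add: ops pw)
  moreover have "?x ^ n = ?X" using assms by (simp add: puiseux_X_pow_power)
  ultimately have ev: "R.eval ?p ?x = \<zero>\<^bsub>?R\<^esub>"
    using assms by (simp add: ops pw)
  have "?p \<in> carrier (Qq[X]\<^bsub>?R\<^esub>)"
    unfolding univ_poly_def polynomial_def using X' sr(2,3) by (auto simp: ops)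
  from R.algebraicI[OF this _ ev] show ?thesis by (simp add: over_def)
qed

lemma algebraic_power:
  "ring.algebraic ring_of_type_algebra Qq x \<Longrightarrow> ring.algebraic ring_of_type_algebra Qq (x ^ n)"
  by (induction n) (simp_all add: algebraic_1 algebraic_mult)

lemma puiseux_X_pow_uminus: "puiseux_X_pow (- e) = inverse (puiseux_X_pow e :: 'a::field puiseux)"
proof -
  have "puiseux_X_pow (- e) * puiseux_X_pow e = (1 :: 'a puiseux)"
    by (simp add: puiseux_X_pow_add[symmetric] puiseux_X_pow_0)
  then show ?thesis by (metis inverse_unique mult.commute)
qed

lift_definition qpow :: "rat \<Rightarrow> qfield" is puiseux_X_pow
proof -
  fix e :: rat
  obtain a b where e: "e = of_int a / of_int b" "b > 0"
    by (metis quotient_of_denom_pos quotient_of_div surj_pair)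
  have *: "ring.algebraic ring_of_type_algebra Qq (puiseux_X_pow (of_nat k * (1 / of_nat (nat b))))" for k
    unfolding puiseux_X_pow_power[symmetric]
    by (intro algebraic_power algebraic_puiseux_X_pow_root) (use e in simp)
  have "e = of_nat (nat a) * (1 / of_nat (nat b)) \<or> e = - (of_nat (nat (- a)) * (1 / of_nat (nat b)))"
    using e by (cases "a \<ge> 0") simp_all
  then show "ring.algebraic ring_of_type_algebra Qq (puiseux_X_pow e)"
    using *[of "nat a"] algebraic_inverse[OF *[of "nat (- a)"]] puiseux_X_pow_uminus by metis
qed

text \<open>The $q$-adic topology, in which the infinite products below converge coefficientwise.\<close>

instantiation qfield :: topological_space begin
definition open_qfield :: "qfield set \<Rightarrow> bool" where
  "open_qfield S \<longleftrightarrow> (\<forall>x\<in>S. \<exists>N. \<forall>y. (\<forall>e<N. puiseux_coeff (puiseux_of_qfield y) e = puiseux_coeff (puiseux_of_qfield x) e)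
      \<longrightarrow> y \<in> S)"
instance
proof
  show "open (UNIV :: qfield set)" by (simp add: open_qfield_def)
  fix S T :: "qfield set" assume S: "open S" and T: "open T"
  show "open (S \<inter> T)" unfolding open_qfield_def
  proof
    fix x assume x: "x \<in> S \<inter> T"
    let ?c = "\<lambda>y e. puiseux_coeff (puiseux_of_qfield y) e"
    obtain M N where "\<forall>y. (\<forall>e<M. ?c y e = ?c x e) \<longrightarrow> y \<in> S" "\<forall>y. (\<forall>e<N. ?c y e = ?c x e) \<longrightarrow> y \<in> T"
      using S T x unfolding open_qfield_def by blast
    then have "\<forall>y. (\<forall>e<max M N. ?c y e = ?c x e) \<longrightarrow> y \<in> S \<inter> T" by simp
    then show "\<exists>N. \<forall>y. (\<forall>e<N. ?c y e = ?c x e) \<longrightarrow> y \<in> S \<inter> T" ..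
  qed
next
  fix K :: "qfield set set" assume K: "\<forall>S\<in>K. open S"
  show "open (\<Union>K)" unfolding open_qfield_def
  proof
    fix x assume "x \<in> \<Union>K"
    then obtain S where S: "S \<in> K" "x \<in> S" by blast
    then have "open S" using K by blast
    with S show "\<exists>N. \<forall>y. (\<forall>e<N. puiseux_coeff (puiseux_of_qfield y) e = puiseux_coeff (puiseux_of_qfield x) e)
      \<longrightarrow> y \<in> \<Union>K"
      unfolding open_qfield_def by (meson UnionI)
  qed
qed
end

instance qfield :: t2_space
proof
  fix x y :: qfield assume "x \<noteq> y"
  let ?c = "\<lambda>z e. puiseux_coeff (puiseux_of_qfield z) e"
  obtain e where e: "?c x e \<noteq> ?c y e"
    using \<open>x \<noteq> y\<close> by (auto simp: puiseux_of_qfield_inject[symmetric] puiseux_coeff_inject[symmetric] fun_eq_iff)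
  let ?B = "\<lambda>u. {z. \<forall>d<e + 1. ?c z d = ?c u d}"
  have "open (?B u)" for u unfolding open_qfield_def by (intro ballI exI[of _ "e + 1"]) simp
  moreover have "?B x \<inter> ?B y = {}" using e by force
  ultimately show "\<exists>U V. open U \<and> open V \<and> x \<in> U \<and> y \<in> V \<and> U \<inter> V = {}"
    by (intro exI[of _ "?B x"] exI[of _ "?B y"]) auto
qed


section \<open>Dynkin diagrams, foldings and Weyl groups\<close>

text \<open>Bourbaki labelling; the edges are listed in one orientation.\<close>

definition edges_A :: "nat \<Rightarrow> (nat \<times> nat) set" where
  "edges_A n = {(a, Suc a) | a. 1 \<le> a \<and> a < n}"

definition edges_D :: "nat \<Rightarrow> (nat \<times> nat) set" where
  "edges_D n = {(a, Suc a) | a. 1 \<le> a \<and> a < n - 1} \<union> {(n - 2, n)}"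

definition edges_E :: "nat \<Rightarrow> (nat \<times> nat) set" where
  "edges_E n = {(1, 3), (2, 4)} \<union> {(a, Suc a) | a. 3 \<le> a \<and> a < n}"

definition ADE_diagram :: "('v \<Rightarrow> 'v \<Rightarrow> bool) \<Rightarrow> bool" where
  "ADE_diagram adj \<longleftrightarrow> (\<exists>n edges f.
     (edges = edges_A n \<and> n \<ge> 1 \<or> edges = edges_D n \<and> n \<ge> 4 \<or> edges = edges_E n \<and> n \<in> {6, 7, 8}) \<and>
     bij_betw f UNIV {1..n} \<and>
     (\<forall>x y. adj x y \<longleftrightarrow> (f x, f y) \<in> edges \<or> (f y, f x) \<in> edges))"

record 'v folding =
  adj :: "'v \<Rightarrow> 'v \<Rightarrow> bool"
  aut :: "'v \<Rightarrow> 'v"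

definition fold_order :: "'v folding \<Rightarrow> nat" where
  "fold_order D = (LEAST n. n > 0 \<and> aut D ^^ n = id)"

definition is_folding :: "'v folding \<Rightarrow> bool" where
  "is_folding D \<longleftrightarrow> ADE_diagram (adj D) \<and> bij (aut D) \<and>
     (\<forall>x y. adj D (aut D x) (aut D y) = adj D x y) \<and>
     (\<forall>x. \<not> adj D x (aut D x)) \<and> fold_order D \<in> {1, 2, 3}"

text \<open>
  The weight lattice of the simply-laced algebra is \<open>'v \<Rightarrow> int\<close>, coordinates being taken with respect
  to the fundamental weights.
\<close>

type_synonym 'v weight = "'v \<Rightarrow> int"

definition fund_weight :: "'v \<Rightarrow> 'v weight" where
  "fund_weight x = (\<lambda>y. if y = x then 1 else 0)"

definition simple_root :: "'v folding \<Rightarrow> 'v \<Rightarrow> 'v weight" where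
  "simple_root D x = (\<lambda>y. if y = x then 2 else if adj D x y then - 1 else 0)"

definition reflection :: "'v folding \<Rightarrow> 'v \<Rightarrow> 'v weight \<Rightarrow> 'v weight" where
  "reflection D x \<kappa> = (\<lambda>y. \<kappa> y - \<kappa> x * simple_root D x y)"

definition aut_weight :: "'v folding \<Rightarrow> 'v weight \<Rightarrow> 'v weight" where
  "aut_weight D \<kappa> = (\<lambda>y. \<kappa> (inv_into UNIV (aut D) y))"

text \<open>Rational coordinates of a weight with respect to the simple roots.\<close>

definition root_coords :: "('v::finite) folding \<Rightarrow> 'v weight \<Rightarrow> 'v \<Rightarrow> rat" where
  "root_coords D \<mu> = (THE c. \<forall>y. of_int (\<mu> y) = (\<Sum>x\<in>UNIV. c x * of_int (simple_root D x y)))"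

definition form :: "('v::finite) folding \<Rightarrow> 'v weight \<Rightarrow> 'v weight \<Rightarrow> rat" where
  "form D \<kappa> \<mu> = (\<Sum>x\<in>UNIV. of_int (\<kappa> x) * root_coords D \<mu> x)"

inductive_set weyl_group :: "'v folding \<Rightarrow> ('v weight \<Rightarrow> 'v weight) set" for D where
  weyl_id: "id \<in> weyl_group D"
| weyl_refl: "w \<in> weyl_group D \<Longrightarrow> reflection D x \<circ> w \<in> weyl_group D"

definition roots :: "'v folding \<Rightarrow> 'v weight set" where
  "roots D = {w (simple_root D x) | w x. w \<in> weyl_group D}"

definition pos_roots :: "('v::finite) folding \<Rightarrow> 'v weight set" where
  "pos_roots D = {\<beta> \<in> roots D. \<exists>c::'v \<Rightarrow> nat. \<beta> = (\<lambda>y. \<Sum>x\<in>UNIV. int (c x) * simple_root D x y)}"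

definition orbit :: "'v folding \<Rightarrow> 'v \<Rightarrow> 'v set" where
  "orbit D x = range (\<lambda>n. (aut D ^^ n) x)"

definition nodes :: "'v folding \<Rightarrow> 'v set set" where
  "nodes D = range (orbit D)"

definition dn :: "'v folding \<Rightarrow> 'v \<Rightarrow> int" where
  "dn D x = int (card (orbit D x))"

definition adj_nodes :: "'v folding \<Rightarrow> 'v set \<Rightarrow> 'v set \<Rightarrow> bool" where
  "adj_nodes D i j \<longleftrightarrow> (\<exists>x\<in>i. \<exists>y\<in>j. adj D x y)"

definition cartan :: "'v folding \<Rightarrow> 'v set \<Rightarrow> 'v set \<Rightarrow> int" where
  "cartan D i j = (if i = j then 2
     else if adj_nodes D i j then - \<lceil>of_nat (card j) / of_nat (card i) :: rat\<rceil> else 0)"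

definition cartan_inv :: "('v::finite) folding \<Rightarrow> 'v set \<Rightarrow> 'v set \<Rightarrow> rat" where
  "cartan_inv D = (THE M. (\<forall>i j. i \<notin> nodes D \<or> j \<notin> nodes D \<longrightarrow> M i j = 0) \<and>
     (\<forall>i\<in>nodes D. \<forall>j\<in>nodes D. (\<Sum>k\<in>nodes D. of_int (cartan D i k) * M k j) = (if i = j then 1 else 0)))"

text \<open>The quantum Cartan matrix and the expansion of its inverse at $z = 0$.\<close>

definition qcartan :: "'v folding \<Rightarrow> 'v set \<Rightarrow> 'v set \<Rightarrow> rat fls" where
  "qcartan D i j = (if i = j then fls_X_intpow (int (card i)) + fls_X_intpow (- int (card i))
     else (fls_X_intpow (cartan D i j) - fls_X_intpow (- cartan D i j)) / (fls_X - fls_X_inv))"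

definition qcartan_inv :: "('v::finite) folding \<Rightarrow> 'v set \<Rightarrow> 'v set \<Rightarrow> rat fls" where
  "qcartan_inv D = (THE M. (\<forall>i j. i \<notin> nodes D \<or> j \<notin> nodes D \<longrightarrow> M i j = 0) \<and>
     (\<forall>i\<in>nodes D. \<forall>j\<in>nodes D. (\<Sum>k\<in>nodes D. qcartan D i k * M k j) = (if i = j then 1 else 0)))"

text \<open>
  The coefficients are integers, since the determinant of the quantum Cartan matrix has leading
  coefficient 1; the floor only changes the type.
\<close>

definition qcartan_inv_coeff :: "('v::finite) folding \<Rightarrow> 'v set \<Rightarrow> 'v set \<Rightarrow> int \<Rightarrow> int" where
  "qcartan_inv_coeff D i j u = \<lfloor>fls_nth (qcartan_inv D i j) u\<rfloor>"

text \<open>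
  Roots of the folded algebra, as integer coordinate vectors with respect to its simple roots. The dual
  Coxeter number is 1 plus the sum of the coordinates of the highest coroot with respect to the simple
  coroots; the long roots have \<open>card i = fold_order D\<close>.
\<close>

inductive_set folded_roots :: "('v::finite) folding \<Rightarrow> ('v set \<Rightarrow> int) set" for D where
  folded_simple: "i \<in> nodes D \<Longrightarrow> (\<lambda>j. if j = i then 1 else 0) \<in> folded_roots D"
| folded_refl: "\<beta> \<in> folded_roots D \<Longrightarrow> i \<in> nodes D \<Longrightarrow>
    (\<lambda>j. \<beta> j - (if j = i then (\<Sum>k\<in>nodes D. cartan D i k * \<beta> k) else 0)) \<in> folded_roots D"

definition highest_root :: "('v::finite) folding \<Rightarrow> 'v set \<Rightarrow> int" where
  "highest_root D = (THE \<theta>. \<theta> \<in> folded_roots D \<and> (\<forall>\<beta>\<in>folded_roots D. \<forall>i. \<beta> i \<le> \<theta> i))"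

definition dual_coxeter :: "('v::finite) folding \<Rightarrow> nat" where
  "dual_coxeter D = nat (1 + (\<Sum>i\<in>nodes D. highest_root D i * int (card i)) div int (fold_order D))"

section \<open>Q-data\<close>

definition parity_function :: "'v folding \<Rightarrow> ('v \<Rightarrow> int) \<Rightarrow> bool" where
  "parity_function D \<epsilon> \<longleftrightarrow>
     (\<forall>x. 0 \<le> \<epsilon> x \<and> \<epsilon> x < 2 * dn D x) \<and>
     (\<forall>x y. orbit D x = orbit D y \<longrightarrow> [\<epsilon> x = \<epsilon> y] (mod 2)) \<and>
     (\<forall>x l. [\<epsilon> ((aut D ^^ l) x) = \<epsilon> x - 2 * int l] (mod (2 * dn D x))) \<and>
     (\<forall>x y. adj D x y \<longrightarrow>
        [\<epsilon> x = \<epsilon> y + min (dn D x) (dn D y)] (mod (2 * min (dn D x) (dn D y))))"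

definition height_function :: "'v folding \<Rightarrow> ('v \<Rightarrow> int) \<Rightarrow> ('v \<Rightarrow> int) \<Rightarrow> bool" where
  "height_function D \<epsilon> \<xi> \<longleftrightarrow>
     (\<forall>x y. adj D x y \<and> dn D x = dn D y \<longrightarrow> \<bar>\<xi> x - \<xi> y\<bar> = dn D x) \<and>
     (\<forall>x. \<forall>j\<in>nodes D. adj_nodes D (orbit D x) j \<and> card (orbit D x) < card j \<longrightarrow>
        (\<exists>!y. y \<in> j \<and> \<bar>\<xi> x - \<xi> y\<bar> = 1 \<and>
           (\<forall>l<fold_order D. \<xi> ((aut D ^^ l) y) = \<xi> y - 2 * int l))) \<and>
     (\<forall>x. 2 * dn D x dvd \<xi> x - \<epsilon> x)"

definition rep_vertices :: "'v folding \<Rightarrow> ('v \<Rightarrow> int) \<Rightarrow> ('v \<times> int) set" where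
  "rep_vertices D \<epsilon> = {(x, p). 2 * dn D x dvd p - \<epsilon> x}"

definition rep_arrow :: "'v folding \<Rightarrow> 'v \<times> int \<Rightarrow> 'v \<times> int \<Rightarrow> bool" where
  "rep_arrow D a b \<longleftrightarrow> adj D (fst a) (fst b) \<and> snd b - snd a = min (dn D (fst a)) (dn D (fst b))"

definition compatible_reading :: "'v folding \<Rightarrow> ('v \<times> int) set \<Rightarrow> ('v \<times> int) list \<Rightarrow> bool" where
  "compatible_reading D Z xs \<longleftrightarrow> distinct xs \<and> set xs = Z \<and>
     (\<forall>k<length xs. \<forall>k'<length xs. rep_arrow D (xs ! k') (xs ! k) \<longrightarrow> k < k')"

definition reading_word :: "'v folding \<Rightarrow> ('v \<times> int) set \<Rightarrow> 'v weight \<Rightarrow> 'v weight" where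
  "reading_word D Z = foldr (\<lambda>a w. reflection D (fst a) \<circ> w) (SOME xs. compatible_reading D Z xs) id"

definition top_vertex :: "('v \<Rightarrow> int) \<Rightarrow> 'v set \<Rightarrow> 'v" where
  "top_vertex \<xi> i = (THE x. x \<in> i \<and> (\<forall>y\<in>i. y \<noteq> x \<longrightarrow> \<xi> y < \<xi> x))"

definition X_top :: "'v folding \<Rightarrow> ('v \<Rightarrow> int) \<Rightarrow> ('v \<times> int) set" where
  "X_top D \<xi> = {(top_vertex \<xi> i, \<xi> (top_vertex \<xi> i)) | i. i \<in> nodes D}"

definition tau_top :: "'v folding \<Rightarrow> ('v \<Rightarrow> int) \<Rightarrow> 'v weight \<Rightarrow> 'v weight" where
  "tau_top D \<xi> = reading_word D (X_top D \<xi>) \<circ> aut_weight D"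

definition X_prime :: "'v folding \<Rightarrow> ('v \<Rightarrow> int) \<Rightarrow> ('v \<Rightarrow> int) \<Rightarrow> ('v \<times> int) set" where
  "X_prime D \<epsilon> \<xi> = {(aut D (top_vertex \<xi> i), p) | i p. i \<in> nodes D \<and>
     (aut D (top_vertex \<xi> i), p) \<in> rep_vertices D \<epsilon> \<and>
     \<xi> (aut D (top_vertex \<xi> i)) < p \<and> p \<le> \<xi> (top_vertex \<xi> i) - 2}"

definition coxeter_tau :: "'v folding \<Rightarrow> ('v \<Rightarrow> int) \<Rightarrow> ('v \<Rightarrow> int) \<Rightarrow> 'v weight \<Rightarrow> 'v weight" where
  "coxeter_tau D \<epsilon> \<xi> =
     inv_into UNIV (reading_word D (X_prime D \<epsilon> \<xi>)) \<circ> tau_top D \<xi> \<circ> reading_word D (X_prime D \<epsilon> \<xi>)"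

definition gamma_root :: "'v folding \<Rightarrow> ('v \<Rightarrow> int) \<Rightarrow> ('v \<Rightarrow> int) \<Rightarrow> 'v \<Rightarrow> 'v weight" where
  "gamma_root D \<epsilon> \<xi> x = (\<lambda>y. fund_weight x y -
     (coxeter_tau D \<epsilon> \<xi> ^^ card (orbit D x)) (fund_weight x) y)"

text \<open>
  \<open>phi_step D t s\<close> is one step of the recursion for the coordinate bijection, with \<open>t\<close> the power of
  \<open>coxeter_tau\<close> that is applied and \<open>s\<close> the change of the second component.
\<close>

definition phi_step :: "('v::finite) folding \<Rightarrow> ('v weight \<Rightarrow> 'v weight) \<Rightarrow> int \<Rightarrow>
    'v weight \<times> int \<Rightarrow> 'v weight \<times> int" where
  "phi_step D t s = (\<lambda>(\<beta>, k). if t \<beta> \<in> pos_roots D then (t \<beta>, k) else ((\<lambda>y. - t \<beta> y), k + s))"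

definition phi :: "('v::finite) folding \<Rightarrow> ('v \<Rightarrow> int) \<Rightarrow> ('v \<Rightarrow> int) \<Rightarrow> 'v \<times> int \<Rightarrow> 'v weight \<times> int" where
  "phi D \<epsilon> \<xi> = (\<lambda>(x, p).
     let t = coxeter_tau D \<epsilon> \<xi> ^^ card (orbit D x); n = (p - \<xi> x) div (2 * dn D x) in
     if n \<ge> 0 then (phi_step D (inv_into UNIV t) 1 ^^ nat n) (gamma_root D \<epsilon> \<xi> x, 0)
     else (phi_step D t (- 1) ^^ nat (- n)) (gamma_root D \<epsilon> \<xi> x, 0))"

definition node_parity :: "'v folding \<Rightarrow> ('v \<Rightarrow> int) \<Rightarrow> 'v set \<Rightarrow> int" where
  "node_parity D \<epsilon> i = (THE e. e \<in> {0, 1} \<and> (\<forall>x\<in>i. [e = \<epsilon> x] (mod 2)))"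

definition I_hat :: "'v folding \<Rightarrow> ('v \<Rightarrow> int) \<Rightarrow> ('v set \<times> int) set" where
  "I_hat D \<epsilon> = {(i, p). i \<in> nodes D \<and> even (p - node_parity D \<epsilon> i)}"

definition phi_bar :: "('v::finite) folding \<Rightarrow> ('v \<Rightarrow> int) \<Rightarrow> ('v \<Rightarrow> int) \<Rightarrow>
    'v set \<times> int \<Rightarrow> 'v weight \<times> int" where
  "phi_bar D \<epsilon> \<xi> = phi D \<epsilon> \<xi> \<circ> inv_into (rep_vertices D \<epsilon>) (\<lambda>(x, p). (orbit D x, p))"

text \<open>The weight of a monomial, a multiset of variables; \<open>if even k then 1 else - 1\<close> is $(-1)^k$.\<close>

definition Q_weight :: "('v::finite) folding \<Rightarrow> ('v \<Rightarrow> int) \<Rightarrow> ('v \<Rightarrow> int) \<Rightarrow>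
    ('v set \<times> int) multiset \<Rightarrow> 'v weight" where
  "Q_weight D \<epsilon> \<xi> m = (\<lambda>y. \<Sum>a\<in>#m. case phi_bar D \<epsilon> \<xi> a of (\<alpha>, k) \<Rightarrow> (if even k then 1 else - 1) * \<alpha> y)"

section \<open>Finite-dimensional modules over the quantum affine algebra\<close>

text \<open>
  Index set of the affine Chevalley generators: \<open>None\<close> is the affine node 0. The symmetrized affine
  Cartan matrix is computed from \<open>\<alpha>\<^sub>0 = \<delta> - \<theta>\<close>, with \<open>(\<alpha>\<^sub>i, \<alpha>\<^sub>j) = d\<^sub>i c\<^sub>i\<^sub>j\<close>.
\<close>

definition aff_nodes :: "'v folding \<Rightarrow> 'v set option set" where
  "aff_nodes D = insert None (Some ` nodes D)"

definition node_form :: "'v folding \<Rightarrow> 'v set \<Rightarrow> 'v set \<Rightarrow> int" where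
  "node_form D i j = int (card i) * cartan D i j"

fun aff_form :: "('v::finite) folding \<Rightarrow> 'v set option \<Rightarrow> 'v set option \<Rightarrow> int" where
  "aff_form D (Some i) (Some j) = node_form D i j"
| "aff_form D None (Some j) = - (\<Sum>i\<in>nodes D. highest_root D i * node_form D i j)"
| "aff_form D (Some j) None = - (\<Sum>i\<in>nodes D. highest_root D i * node_form D i j)"
| "aff_form D None None = 2 * int (fold_order D)"

fun aff_d :: "'v folding \<Rightarrow> 'v set option \<Rightarrow> nat" where
  "aff_d D None = fold_order D"
| "aff_d D (Some i) = card i"

definition aff_cartan :: "('v::finite) folding \<Rightarrow> 'v set option \<Rightarrow> 'v set option \<Rightarrow> int" where
  "aff_cartan D a b = aff_form D a b div int (aff_d D a)"

definition qs :: "'v folding \<Rightarrow> qfield" where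
  "qs D = qpow (1 / of_nat (fold_order D))"

definition qn :: "'v folding \<Rightarrow> 'v set option \<Rightarrow> qfield" where
  "qn D a = qpow (of_nat (aff_d D a) / of_nat (fold_order D))"

definition qint :: "qfield \<Rightarrow> int \<Rightarrow> qfield" where
  "qint t n = (t powi n - t powi (- n)) / (t - inverse t)"

definition qfact :: "qfield \<Rightarrow> nat \<Rightarrow> qfield" where
  "qfact t n = (\<Prod>k=1..n. qint t (int k))"

definition qbinom :: "qfield \<Rightarrow> nat \<Rightarrow> nat \<Rightarrow> qfield" where
  "qbinom t n k = qfact t n / (qfact t k * qfact t (n - k))"

text \<open>
  A finite-dimensional module is given in coordinates, by the matrices of the Chevalley generators
  \<open>e\<^sub>a, f\<^sub>a, K\<^sub>a\<close>, \<open>K\<^sub>a\<^sup>-\<^sup>1\<close> (\<open>a\<close> an affine node) and of the Drinfeld generators \<open>x\<^sup>\<plusminus>\<^sub>i\<^sub>,\<^sub>k, h\<^sub>i\<^sub>,\<^sub>l\<close>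
  (\<open>i\<close> a finite node, \<open>l \<noteq> 0\<close>); the Drinfeld generators \<open>k\<^sub>i\<close> are the \<open>K\<^sub>i\<close>.
\<close>

record ('v, 'a) rep =
  dm :: nat
  chE :: "'v set option \<Rightarrow> 'a mat"
  chF :: "'v set option \<Rightarrow> 'a mat"
  chK :: "'v set option \<Rightarrow> 'a mat"
  chKi :: "'v set option \<Rightarrow> 'a mat"
  drP :: "'v set \<Rightarrow> int \<Rightarrow> 'a mat"
  drM :: "'v set \<Rightarrow> int \<Rightarrow> 'a mat"
  drH :: "'v set \<Rightarrow> int \<Rightarrow> 'a mat"

type_synonym 'v qrep = "('v, qfield) rep"

definition mat_sum :: "nat \<Rightarrow> ('s \<Rightarrow> 'a::comm_monoid_add mat) \<Rightarrow> 's set \<Rightarrow> 'a mat" where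
  "mat_sum n f S = mat n n (\<lambda>ij. \<Sum>s\<in>S. f s $$ ij)"

definition mat_prod :: "nat \<Rightarrow> 'a::semiring_1 mat list \<Rightarrow> 'a mat" where
  "mat_prod n As = foldr (*) As (1\<^sub>m n)"

definition commutator :: "'a::ring_1 mat \<Rightarrow> 'a mat \<Rightarrow> 'a mat" where
  "commutator A B = A * B - B * A"

definition serre :: "('v::finite) folding \<Rightarrow> nat \<Rightarrow> ('v set option \<Rightarrow> qfield mat) \<Rightarrow>
    'v set option \<Rightarrow> 'v set option \<Rightarrow> bool" where
  "serre D n Z a b \<longleftrightarrow> (let s = nat (1 - aff_cartan D a b) in
     mat_sum n (\<lambda>k. ((- 1) ^ k * qbinom (qn D a) s k) \<cdot>\<^sub>m (Z a ^\<^sub>m k * Z b * Z a ^\<^sub>m (s - k))) {..s} = 0\<^sub>m n n)"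

definition drinfeld_jimbo :: "('v::finite) folding \<Rightarrow> 'v qrep \<Rightarrow> bool" where
  "drinfeld_jimbo D V \<longleftrightarrow> (let n = dm V; E = chE V; F = chF V; K = chK V; Ki = chKi V in
     (\<forall>a\<in>aff_nodes D. {E a, F a, K a, Ki a} \<subseteq> carrier_mat n n \<and> K a * Ki a = 1\<^sub>m n \<and> Ki a * K a = 1\<^sub>m n) \<and>
     (\<forall>a\<in>aff_nodes D. \<forall>b\<in>aff_nodes D.
        K a * K b = K b * K a \<and>
        K a * E b * Ki a = (qn D a powi aff_cartan D a b) \<cdot>\<^sub>m E b \<and>
        K a * F b * Ki a = (qn D a powi (- aff_cartan D a b)) \<cdot>\<^sub>m F b \<and>
        commutator (E a) (F b) =
          (if a = b then (1 / (qn D a - inverse (qn D a))) \<cdot>\<^sub>m (K a - Ki a) else 0\<^sub>m n n) \<and>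
        (a \<noteq> b \<longrightarrow> serre D n E a b \<and> serre D n F a b)))"

text \<open>Formal power series with matrix coefficients; the exponential assumes constant term 0.\<close>

definition mat_series_mult :: "nat \<Rightarrow> (nat \<Rightarrow> qfield mat) \<Rightarrow> (nat \<Rightarrow> qfield mat) \<Rightarrow> nat \<Rightarrow> qfield mat" where
  "mat_series_mult n A B m = mat_sum n (\<lambda>l. A l * B (m - l)) {..m}"

primrec mat_series_pow :: "nat \<Rightarrow> (nat \<Rightarrow> qfield mat) \<Rightarrow> nat \<Rightarrow> nat \<Rightarrow> qfield mat" where
  "mat_series_pow n A 0 = (\<lambda>m. if m = 0 then 1\<^sub>m n else 0\<^sub>m n n)"
| "mat_series_pow n A (Suc k) = mat_series_mult n A (mat_series_pow n A k)"

definition mat_series_exp :: "nat \<Rightarrow> (nat \<Rightarrow> qfield mat) \<Rightarrow> nat \<Rightarrow> qfield mat" where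
  "mat_series_exp n A m = mat_sum n (\<lambda>k. (1 / fact k) \<cdot>\<^sub>m mat_series_pow n A k m) {..m}"

text \<open>
  The coefficient of $z^m$ in $\phi_i^{+}(z)$, resp. $\phi_i^{-}(z)$, as a function of the integer $m$.
\<close>

definition phi_plus :: "'v folding \<Rightarrow> 'v qrep \<Rightarrow> 'v set \<Rightarrow> int \<Rightarrow> qfield mat" where
  "phi_plus D V i m = (let n = dm V; t = qn D (Some i) in
     if m < 0 then 0\<^sub>m n n
     else chK V (Some i) * mat_series_exp n
       (\<lambda>l. if l = 0 then 0\<^sub>m n n else (t - inverse t) \<cdot>\<^sub>m drH V i (int l)) (nat m))"

definition phi_minus :: "'v folding \<Rightarrow> 'v qrep \<Rightarrow> 'v set \<Rightarrow> int \<Rightarrow> qfield mat" where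
  "phi_minus D V i m = (let n = dm V; t = qn D (Some i) in
     if m > 0 then 0\<^sub>m n n
     else chKi V (Some i) * mat_series_exp n
       (\<lambda>l. if l = 0 then 0\<^sub>m n n else (- (t - inverse t)) \<cdot>\<^sub>m drH V i (- int l)) (nat (- m)))"

definition drinfeld_serre :: "'v folding \<Rightarrow> nat \<Rightarrow> ('v set \<Rightarrow> int \<Rightarrow> qfield mat) \<Rightarrow>
    'v set \<Rightarrow> 'v set \<Rightarrow> bool" where
  "drinfeld_serre D n Z i j \<longleftrightarrow> (let s = nat (1 - cartan D i j) in
     \<forall>(ms :: nat \<Rightarrow> int) m. mat_sum n (\<lambda>(p, k).
        ((- 1) ^ k * qbinom (qn D (Some i)) s k) \<cdot>\<^sub>m
          (mat_prod n (map (\<lambda>l. Z i (ms (p l))) [0..<k]) * Z j m *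
           mat_prod n (map (\<lambda>l. Z i (ms (p l))) [k..<s])))
        ({p. p permutes {..<s}} \<times> {..s}) = 0\<^sub>m n n)"

text \<open>
  The relations of the quantum loop algebra between Drinfeld generators. The relations involving
  \<open>x\<^sup>+\<close> and those involving \<open>x\<^sup>-\<close> differ by a sign \<open>s\<close>.
\<close>

definition drinfeld_relations_sign :: "'v folding \<Rightarrow> 'v qrep \<Rightarrow> ('v set \<Rightarrow> int \<Rightarrow> qfield mat) \<Rightarrow> int \<Rightarrow> bool" where
  "drinfeld_relations_sign D V Z s \<longleftrightarrow> (let n = dm V in
     \<forall>i\<in>nodes D. \<forall>j\<in>nodes D. let t = qn D (Some i) powi (s * cartan D i j) in
       (\<forall>m. Z j m \<in> carrier_mat n n \<and>
          chK V (Some i) * Z j m * chKi V (Some i) = t \<cdot>\<^sub>m Z j m \<and>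
          (\<forall>l. l \<noteq> 0 \<longrightarrow> commutator (drH V i l) (Z j m) =
             (of_int s * qint (qn D (Some i)) (l * cartan D i j) / of_int l) \<cdot>\<^sub>m Z j (l + m))) \<and>
       (\<forall>m l. Z i (m + 1) * Z j l - t \<cdot>\<^sub>m (Z j l * Z i (m + 1)) =
          t \<cdot>\<^sub>m (Z i m * Z j (l + 1)) - Z j (l + 1) * Z i m) \<and>
       (i \<noteq> j \<longrightarrow> drinfeld_serre D n Z i j))"

definition drinfeld_relations :: "'v folding \<Rightarrow> 'v qrep \<Rightarrow> bool" where
  "drinfeld_relations D V \<longleftrightarrow> (let n = dm V in
     drinfeld_relations_sign D V (drP V) 1 \<and>
     drinfeld_relations_sign D V (drM V) (- 1) \<and>
     (\<forall>i\<in>nodes D. \<forall>j\<in>nodes D. \<forall>l m. l \<noteq> 0 \<longrightarrow>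
        drH V i l \<in> carrier_mat n n \<and>
        chK V (Some j) * drH V i l = drH V i l * chK V (Some j) \<and>
        (m \<noteq> 0 \<longrightarrow> drH V i l * drH V j m = drH V j m * drH V i l)) \<and>
     (\<forall>i\<in>nodes D. \<forall>j\<in>nodes D. \<forall>l m. commutator (drP V i m) (drM V j l) =
        (if i = j then (1 / (qn D (Some i) - inverse (qn D (Some i)))) \<cdot>\<^sub>m
           (phi_plus D V i (m + l) - phi_minus D V i (m + l))
         else 0\<^sub>m n n)))"

text \<open>
  The isomorphism between the two presentations. Choose a sequence of nodes whose partial sums of
  simple roots are roots, ending with the highest root. The iterated $q$-commutator of
  \<open>x\<^sup>-\<^sub>i\<^sub>,\<^sub>1\<close> (\<open>i\<close> the first node) with the \<open>f\<^sub>j\<close> of the following nodes, times \<open>K\<^sub>0\<close>, is the generator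
  \<open>e\<^sub>0\<close>; similarly \<open>f\<^sub>0\<close> is proportional to \<open>K\<^sub>0\<^sup>-\<^sup>1\<close> times the analogous $q$-commutator for \<open>x\<^sup>+\<close>,
  the scalar being determined by the relation for \<open>[e\<^sub>0, f\<^sub>0]\<close>.
  Different sequences and normalizations rescale \<open>e\<^sub>0\<close> by a scalar and \<open>f\<^sub>0\<close> by its inverse, uniformly for
  all modules, which changes neither the modules nor the R-matrices below.
\<close>

definition theta_path :: "('v::finite) folding \<Rightarrow> 'v set list" where
  "theta_path D = (SOME xs. xs \<noteq> [] \<and> set xs \<subseteq> nodes D \<and>
     (\<forall>m\<in>{1..length xs}. (\<lambda>i. int (count_list (take m xs) i)) \<in> folded_roots D) \<and>
     (\<lambda>i. int (count_list xs i)) = highest_root D)"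

text \<open>The nodes are listed in reverse order in the following recursion.\<close>

fun q_bracket :: "'v folding \<Rightarrow> ('v set \<Rightarrow> qfield mat) \<Rightarrow> ('v set \<Rightarrow> qfield mat) \<Rightarrow>
    'v set list \<Rightarrow> qfield mat" where
  "q_bracket D X0 X1 [] = undefined"
| "q_bracket D X0 X1 [i] = X1 i"
| "q_bracket D X0 X1 (i # j # is) = (let Y = q_bracket D X0 X1 (j # is) in
     X0 i * Y - (qs D powi (\<Sum>k\<leftarrow>j # is. node_form D i k)) \<cdot>\<^sub>m (Y * X0 i))"

definition presentations_match :: "('v::finite) folding \<Rightarrow> 'v qrep \<Rightarrow> bool" where
  "presentations_match D V \<longleftrightarrow>
     (\<forall>i\<in>nodes D. drP V i 0 = chE V (Some i) \<and> drM V i 0 = chF V (Some i)) \<and>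
     chK V None = mat_prod (dm V) (map (\<lambda>i. chKi V (Some i)) (theta_path D)) \<and>
     chE V None = q_bracket D (\<lambda>i. drM V i 0) (\<lambda>i. drM V i 1) (rev (theta_path D)) * chK V None \<and>
     (\<exists>c. chF V None = c \<cdot>\<^sub>m
        (chKi V None * q_bracket D (\<lambda>i. drP V i 0) (\<lambda>i. drP V i (- 1)) (rev (theta_path D))))"

definition in_cat_C :: "('v::finite) folding \<Rightarrow> 'v qrep \<Rightarrow> bool" where
  "in_cat_C D V \<longleftrightarrow> drinfeld_jimbo D V \<and> drinfeld_relations D V \<and> presentations_match D V \<and>
     (\<forall>a\<in>aff_nodes D. \<exists>B. diagonal_mat B \<and> similar_mat (chK V a) B \<and>
        (\<forall>s<dm V. \<exists>m::int. B $$ (s, s) = qn D a powi m))"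

definition simple_rep :: "'v folding \<Rightarrow> 'v qrep \<Rightarrow> bool" where
  "simple_rep D V \<longleftrightarrow> dm V > 0 \<and>
     (\<forall>U \<subseteq> carrier_vec (dm V).
        0\<^sub>v (dm V) \<in> U \<and> (\<forall>u\<in>U. \<forall>v\<in>U. u + v \<in> U) \<and> (\<forall>c. \<forall>u\<in>U. c \<cdot>\<^sub>v u \<in> U) \<and>
        (\<forall>a\<in>aff_nodes D. \<forall>A\<in>{chE V a, chF V a, chK V a, chKi V a}. \<forall>u\<in>U. A *\<^sub>v u \<in> U) \<longrightarrow>
        U = {0\<^sub>v (dm V)} \<or> U = carrier_vec (dm V))"

text \<open>
  Eigenvalues of $\phi_i^{\pm}(z)$ on an $\ell$-highest weight vector: the expansions at $z = 0$ and at
  $z^{-1} = 0$ of $q_i^{\deg P} P(q_i^{-1} z) / P(q_i z)$; in the latter case numerator and denominator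
  are multiplied by $z^{-\deg P}$, which reverses their coefficients. Coefficients of $z^{\pm m}$, $m \ge 0$.
\<close>

definition l_weight_plus :: "qfield \<Rightarrow> qfield poly \<Rightarrow> nat \<Rightarrow> qfield" where
  "l_weight_plus t P m = t ^ Polynomial.degree P *
     fps_nth (fps_of_poly (pcompose P [:0, inverse t:]) / fps_of_poly (pcompose P [:0, t:])) m"

definition l_weight_minus :: "qfield \<Rightarrow> qfield poly \<Rightarrow> nat \<Rightarrow> qfield" where
  "l_weight_minus t P m = t ^ Polynomial.degree P *
     fps_nth (fps_of_poly (reflect_poly (pcompose P [:0, inverse t:])) /
              fps_of_poly (reflect_poly (pcompose P [:0, t:]))) m"

definition l_highest :: "'v folding \<Rightarrow> 'v qrep \<Rightarrow> ('v set \<Rightarrow> qfield poly) \<Rightarrow> qfield vec \<Rightarrow> bool" where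
  "l_highest D V P v \<longleftrightarrow> v \<in> carrier_vec (dm V) \<and> v \<noteq> 0\<^sub>v (dm V) \<and>
     (\<forall>i\<in>nodes D. \<forall>k. drP V i k *\<^sub>v v = 0\<^sub>v (dm V)) \<and>
     (\<forall>i\<in>nodes D. \<forall>m.
        phi_plus D V i (int m) *\<^sub>v v = l_weight_plus (qn D (Some i)) (P i) m \<cdot>\<^sub>v v \<and>
        phi_minus D V i (- int m) *\<^sub>v v = l_weight_minus (qn D (Some i)) (P i) m \<cdot>\<^sub>v v)"

definition drinfeld_tuple :: "'v folding \<Rightarrow> ('v set \<Rightarrow> qfield poly) \<Rightarrow> bool" where
  "drinfeld_tuple D P \<longleftrightarrow> (\<forall>i\<in>nodes D. Polynomial.coeff (P i) 0 = 1)"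

text \<open>\<open>is_L D P V\<close>: the module \<open>V\<close> is isomorphic to the simple object with Drinfeld polynomials \<open>P\<close>.\<close>

definition is_L :: "('v::finite) folding \<Rightarrow> ('v set \<Rightarrow> qfield poly) \<Rightarrow> 'v qrep \<Rightarrow> bool" where
  "is_L D P V \<longleftrightarrow> drinfeld_tuple D P \<and> in_cat_C D V \<and> simple_rep D V \<and> (\<exists>v. l_highest D V P v)"

definition fund_tuple :: "'v set \<Rightarrow> qfield \<Rightarrow> 'v set \<Rightarrow> qfield poly" where
  "fund_tuple i a = (\<lambda>j. if j = i then [:1, - a:] else 1)"

definition monomials :: "'v folding \<Rightarrow> ('v \<Rightarrow> int) \<Rightarrow> ('v set \<times> int) multiset set" where
  "monomials D \<epsilon> = {m. set_mset m \<subseteq> I_hat D \<epsilon>}"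

definition monomial_tuple :: "'v folding \<Rightarrow> ('v set \<times> int) multiset \<Rightarrow> 'v set \<Rightarrow> qfield poly" where
  "monomial_tuple D m = (\<lambda>j. \<Prod>(i, p)\<in>#m. fund_tuple i (qs D powi p) j)"

section \<open>The universal R-matrix\<close>

text \<open>
  Elements of the free algebra on the affine nodes of weight \<open>\<beta>\<close> (a multiset of affine nodes) are
  coefficient functions on the words of content \<open>\<beta>\<close>. \<open>word_pairing\<close> is the Hopf pairing between the free
  algebras on the \<open>e\<^sub>a\<close> and on the \<open>f\<^sub>a\<close> that belongs to the coproduct used below: it is normalized by
  \<open>(e\<^sub>a, f\<^sub>a) = 1/(q\<^sub>a - q\<^sub>a\<^sup>-\<^sup>1)\<close>, and left multiplication by \<open>e\<^sub>a\<close> is adjoint, up to this factor, to the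
  skew derivation removing a letter \<open>f\<^sub>a\<close>. Its radicals are the ideals generated by the quantum Serre
  relations, so it descends to a nondegenerate pairing between the subalgebras generated by the
  \<open>e\<^sub>a\<close> and by the \<open>f\<^sub>a\<close>.
\<close>

fun word_pairing :: "('v::finite) folding \<Rightarrow> 'v set option list \<Rightarrow> 'v set option list \<Rightarrow> qfield" where
  "word_pairing D [] y = (if y = [] then 1 else 0)"
| "word_pairing D (a # x) y = 1 / (qn D a - inverse (qn D a)) *
     (\<Sum>k | k < length y \<and> y ! k = a.
        qs D powi (- (\<Sum>b\<leftarrow>take k y. aff_form D a b)) * word_pairing D x (take k y @ drop (Suc k) y))"

type_synonym 'v free_elt = "'v set option list \<Rightarrow> qfield"

definition words :: "'v set option multiset \<Rightarrow> 'v set option list set" where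
  "words \<beta> = {w. mset w = \<beta>}"

definition pairing :: "('v::finite) folding \<Rightarrow> 'v set option multiset \<Rightarrow> 'v free_elt \<Rightarrow> 'v free_elt \<Rightarrow> qfield" where
  "pairing D \<beta> x y = (\<Sum>w\<in>words \<beta>. \<Sum>u\<in>words \<beta>. x w * y u * word_pairing D w u)"

text \<open>
  Families of representatives \<open>(E\<^sub>\<nu>, F\<^sub>\<nu>)\<close> of dual bases of the two weight spaces; the last condition says
  that the \<open>E\<^sub>\<nu>\<close> span modulo the radical.
\<close>

definition dual_bases :: "('v::finite) folding \<Rightarrow> 'v set option multiset \<Rightarrow> ('v free_elt \<times> 'v free_elt) list \<Rightarrow> bool" where
  "dual_bases D \<beta> B \<longleftrightarrow>
     (\<forall>k<length B. \<forall>l<length B. pairing D \<beta> (fst (B ! k)) (snd (B ! l)) = (if k = l then 1 else 0)) \<and>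
     (\<forall>x y. pairing D \<beta> x y =
        (\<Sum>k<length B. pairing D \<beta> x (snd (B ! k)) * pairing D \<beta> (fst (B ! k)) y))"

definition some_dual_bases :: "('v::finite) folding \<Rightarrow> 'v set option multiset \<Rightarrow> ('v free_elt \<times> 'v free_elt) list" where
  "some_dual_bases D \<beta> = (SOME B. dual_bases D \<beta> B)"

definition free_act :: "nat \<Rightarrow> ('v set option \<Rightarrow> qfield mat) \<Rightarrow> 'v set option multiset \<Rightarrow> 'v free_elt \<Rightarrow> qfield mat" where
  "free_act n Z \<beta> x = mat_sum n (\<lambda>w. x w \<cdot>\<^sub>m mat_prod n (map Z w)) (words \<beta>)"

definition tensor_vec :: "'a::times vec \<Rightarrow> 'a vec \<Rightarrow> 'a vec" where
  "tensor_vec v w = vec (dim_vec v * dim_vec w) (\<lambda>t. v $ (t div dim_vec w) * w $ (t mod dim_vec w))"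

definition tensor_mat :: "'a::times mat \<Rightarrow> 'a mat \<Rightarrow> 'a mat" where
  "tensor_mat A B = mat (dim_row A * dim_row B) (dim_col A * dim_col B)
     (\<lambda>(s, t). A $$ (s div dim_row B, t div dim_col B) * B $$ (s mod dim_row B, t mod dim_col B))"

definition has_weight :: "'v folding \<Rightarrow> 'v qrep \<Rightarrow> ('v set \<Rightarrow> int) \<Rightarrow> qfield vec \<Rightarrow> bool" where
  "has_weight D V \<kappa> v \<longleftrightarrow> (\<forall>i\<in>nodes D. chK V (Some i) *\<^sub>v v = (qn D (Some i) powi \<kappa> i) \<cdot>\<^sub>v v)"

definition weight_form :: "('v::finite) folding \<Rightarrow> ('v set \<Rightarrow> int) \<Rightarrow> ('v set \<Rightarrow> int) \<Rightarrow> rat" where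
  "weight_form D \<kappa> \<mu> = (\<Sum>i\<in>nodes D. \<Sum>j\<in>nodes D. of_nat (card i) * cartan_inv D i j * of_int (\<kappa> i) * of_int (\<mu> j))"

text \<open>
  The coefficient of $z^n$ of $R^{univ}_{V,W_z}(v \otimes w)$, for \<open>v\<close>, \<open>w\<close> of weights \<open>\<kappa>\<close>, \<open>\<mu>\<close>: since \<open>e\<^sub>0\<close> acts on
  $W_z$ as \<open>z e\<^sub>0\<close> and the other \<open>e\<^sub>i\<close> as on \<open>W\<close>, it collects the weights \<open>\<beta>\<close> containing \<open>\<alpha>\<^sub>0\<close> exactly \<open>n\<close> times;
  only finitely many of them contribute. The prefactor is $q_s^{\langle\lambda,\mu\rangle}$: with
  $\langle\alpha_i,\mu\rangle = d_i \mu_i$ and $K_i = q_i^{\mu_i} = q_s^{d_i \mu_i}$ on weight \<open>\<mu>\<close>, this is the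
  normalization that makes the universal R-matrix an intertwiner.
\<close>

definition R_univ_coeff :: "('v::finite) folding \<Rightarrow> 'v qrep \<Rightarrow> 'v qrep \<Rightarrow> ('v set \<Rightarrow> int) \<Rightarrow> ('v set \<Rightarrow> int) \<Rightarrow>
    qfield vec \<Rightarrow> qfield vec \<Rightarrow> nat \<Rightarrow> qfield vec" where
  "R_univ_coeff D V W \<kappa> \<mu> v w n = vec (dm W * dm V) (\<lambda>t.
     qpow (weight_form D \<kappa> \<mu> / of_nat (fold_order D)) *
     Sum_any (\<lambda>\<beta>. if set_mset \<beta> \<subseteq> aff_nodes D \<and> count \<beta> None = n then
       (\<Sum>(x, y)\<leftarrow>some_dual_bases D \<beta>.
          tensor_vec (free_act (dm W) (chE W) \<beta> x *\<^sub>v w) (free_act (dm V) (chF V) \<beta> y *\<^sub>v v) $ t)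
       else 0))"

definition univ_coeff :: "('v::finite) folding \<Rightarrow> 'v qrep \<Rightarrow> 'v qrep \<Rightarrow> qfield fps" where
  "univ_coeff D V W = (THE a. \<forall>P Q \<kappa> \<mu> v w.
     l_highest D V P v \<and> has_weight D V \<kappa> v \<and> l_highest D W Q w \<and> has_weight D W \<mu> w \<longrightarrow>
     (\<forall>n. R_univ_coeff D V W \<kappa> \<mu> v w n = fps_nth a n \<cdot>\<^sub>v tensor_vec w v))"

section \<open>Normalized R-matrices and denominators\<close>

type_synonym ratfun = "qfield poly fract"

definition rf_const :: "qfield \<Rightarrow> ratfun" where
  "rf_const c = to_fract [:c:]"

definition rf_z :: ratfun where
  "rf_z = to_fract [:0, 1:]"

definition base_change :: "'v qrep \<Rightarrow> ('v, ratfun) rep" where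
  "base_change V = \<lparr> dm = dm V,
     chE = (\<lambda>a. map_mat rf_const (chE V a)), chF = (\<lambda>a. map_mat rf_const (chF V a)),
     chK = (\<lambda>a. map_mat rf_const (chK V a)), chKi = (\<lambda>a. map_mat rf_const (chKi V a)),
     drP = (\<lambda>i k. map_mat rf_const (drP V i k)), drM = (\<lambda>i k. map_mat rf_const (drM V i k)),
     drH = (\<lambda>i l. map_mat rf_const (drH V i l)) \<rparr>"

text \<open>
  The module $W_z$ with scalars extended to rational functions; by the formulas for \<open>e\<^sub>0\<close> and \<open>f\<^sub>0\<close>, the
  twist of the Drinfeld generators multiplies \<open>e\<^sub>0\<close> by \<open>z\<close> and \<open>f\<^sub>0\<close> by the inverse of \<open>z\<close>.
\<close>

definition affinization :: "'v qrep \<Rightarrow> ('v, ratfun) rep" where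
  "affinization W = (let B = base_change W in B \<lparr>
     chE := (\<lambda>a. (if a = None then rf_z else 1) \<cdot>\<^sub>m chE B a),
     chF := (\<lambda>a. (if a = None then inverse rf_z else 1) \<cdot>\<^sub>m chF B a),
     drP := (\<lambda>i k. (rf_z powi k) \<cdot>\<^sub>m drP B i k),
     drM := (\<lambda>i k. (rf_z powi k) \<cdot>\<^sub>m drM B i k),
     drH := (\<lambda>i l. (rf_z powi l) \<cdot>\<^sub>m drH B i l) \<rparr>)"

definition coprod_E :: "('v, 'a::semiring_1) rep \<Rightarrow> ('v, 'a) rep \<Rightarrow> 'v set option \<Rightarrow> 'a mat" where
  "coprod_E V W a = tensor_mat (chE V a) (chKi W a) + tensor_mat (1\<^sub>m (dm V)) (chE W a)"

definition coprod_F :: "('v, 'a::semiring_1) rep \<Rightarrow> ('v, 'a) rep \<Rightarrow> 'v set option \<Rightarrow> 'a mat" where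
  "coprod_F V W a = tensor_mat (chF V a) (1\<^sub>m (dm W)) + tensor_mat (chK V a) (chF W a)"

definition coprod_K :: "('v, 'a::semiring_1) rep \<Rightarrow> ('v, 'a) rep \<Rightarrow> 'v set option \<Rightarrow> 'a mat" where
  "coprod_K V W a = tensor_mat (chK V a) (chK W a)"

definition is_R_norm :: "'v folding \<Rightarrow> 'v qrep \<Rightarrow> 'v qrep \<Rightarrow> ratfun mat \<Rightarrow> bool" where
  "is_R_norm D V W R \<longleftrightarrow> (let V' = base_change V; W' = affinization W in
     R \<in> carrier_mat (dm W * dm V) (dm V * dm W) \<and> invertible_mat R \<and>
     (\<forall>a\<in>aff_nodes D.
        R * coprod_E V' W' a = coprod_E W' V' a * R \<and>
        R * coprod_F V' W' a = coprod_F W' V' a * R \<and>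
        R * coprod_K V' W' a = coprod_K W' V' a * R) \<and>
     (\<forall>P Q v w. l_highest D V P v \<and> l_highest D W Q w \<longrightarrow>
        R *\<^sub>v map_vec rf_const (tensor_vec v w) = map_vec rf_const (tensor_vec w v)))"

definition R_norm :: "'v folding \<Rightarrow> 'v qrep \<Rightarrow> 'v qrep \<Rightarrow> ratfun mat" where
  "R_norm D V W = (THE R. is_R_norm D V W R)"

definition is_laurent :: "ratfun \<Rightarrow> bool" where
  "is_laurent f \<longleftrightarrow> (\<exists>p n. f = to_fract p / rf_z ^ n)"

definition clears_denominators :: "'v folding \<Rightarrow> 'v qrep \<Rightarrow> 'v qrep \<Rightarrow> qfield poly \<Rightarrow> bool" where
  "clears_denominators D V W d \<longleftrightarrow> (\<forall>s<dm W * dm V. \<forall>t<dm V * dm W.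
     is_laurent (to_fract d * R_norm D V W $$ (s, t)))"

definition denominator :: "'v folding \<Rightarrow> 'v qrep \<Rightarrow> 'v qrep \<Rightarrow> qfield poly" where
  "denominator D V W = (THE d. Polynomial.lead_coeff d = 1 \<and> clears_denominators D V W d \<and>
     (\<forall>d'. Polynomial.lead_coeff d' = 1 \<and> clears_denominators D V W d' \<longrightarrow>
        Polynomial.degree d \<le> Polynomial.degree d'))"

section \<open>The invariant\<close>

text \<open>Infinite products of power series, converging coefficientwise in the $q$-adic topology.\<close>

definition has_fps_prod :: "(nat \<Rightarrow> qfield fps) \<Rightarrow> qfield fps \<Rightarrow> bool" where
  "has_fps_prod f L \<longleftrightarrow> (\<forall>n. (\<lambda>N. fps_nth (\<Prod>k<N. f k) n) \<longlonglongrightarrow> fps_nth L n)"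

definition varphi :: "('v::finite) folding \<Rightarrow> qfield fps" where
  "varphi D = (THE L. has_fps_prod (\<lambda>k. 1 - fps_const (qpow (2 * of_nat k * of_nat (dual_coxeter D))) * fps_X) L)"

definition varphi_scaled :: "('v::finite) folding \<Rightarrow> qfield \<Rightarrow> qfield fls" where
  "varphi_scaled D a = fps_to_fls (fps_compose (varphi D) (fps_const a * fps_X))"

text \<open>\<open>factorization D f c m \<mu>\<close> witnesses that \<open>f\<close> lies in the group $\mathcal{G}$.\<close>

definition factorization :: "('v::finite) folding \<Rightarrow> qfield fls \<Rightarrow> qfield \<Rightarrow> int \<Rightarrow> (qfield \<Rightarrow> int) \<Rightarrow> bool" where
  "factorization D f c m \<mu> \<longleftrightarrow> c \<noteq> 0 \<and> \<mu> 0 = 0 \<and> finite {a. \<mu> a \<noteq> 0} \<and>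
     f = fls_const c * fls_X_intpow m * (\<Prod>a | \<mu> a \<noteq> 0. varphi_scaled D a powi \<mu> a)"

definition Deg_inf :: "('v::finite) folding \<Rightarrow> qfield fls \<Rightarrow> int" where
  "Deg_inf D f = (THE n. \<exists>c m \<mu>. factorization D f c m \<mu> \<and>
     n = (\<Sum>a | \<mu> a \<noteq> 0 \<and> (\<exists>k::int. a = qpow (2 * of_int k * of_nat (dual_coxeter D))). \<mu> a))"

definition Lambda_inf :: "('v::finite) folding \<Rightarrow> 'v qrep \<Rightarrow> 'v qrep \<Rightarrow> int" where
  "Lambda_inf D V W =
     Deg_inf D (fps_to_fls (fps_of_poly (denominator D V W)) / fps_to_fls (univ_coeff D V W))"

section \<open>Known facts\<close>

text \<open>
  Results about the modules and coefficients defined above on which the theory rests, stated as predicates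
  so that they can be assumed: existence of the simple objects with prescribed Drinfeld polynomials
  (Chari--Pressley), existence and uniqueness of the normalized R-matrices, and the multiplicativity of the
  universal coefficients together with their values on fundamental modules (Frenkel--Reshetikhin).
\<close>

definition simple_objects_exist :: "('v::finite) folding \<Rightarrow> bool" where
  "simple_objects_exist D \<longleftrightarrow> (\<forall>P. drinfeld_tuple D P \<longrightarrow> (\<exists>V. is_L D P V))"

definition R_norm_exists :: "('v::finite) folding \<Rightarrow> bool" where
  "R_norm_exists D \<longleftrightarrow> (\<forall>P Q V W. is_L D P V \<and> is_L D Q W \<longrightarrow> (\<exists>!R. is_R_norm D V W R))"

definition univ_coeff_multiplicative :: "('v::finite) folding \<Rightarrow> bool" where
  "univ_coeff_multiplicative D \<longleftrightarrow> (\<forall>P1 P2 P3 V1 V2 V12 V3.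
     is_L D P1 V1 \<and> is_L D P2 V2 \<and> is_L D (\<lambda>i. P1 i * P2 i) V12 \<and> is_L D P3 V3 \<longrightarrow>
     univ_coeff D V12 V3 = univ_coeff D V1 V3 * univ_coeff D V2 V3 \<and>
     univ_coeff D V3 V12 = univ_coeff D V3 V1 * univ_coeff D V3 V2)"

definition univ_coeff_fundamental :: "('v::finite) folding \<Rightarrow> bool" where
  "univ_coeff_fundamental D \<longleftrightarrow> (\<forall>i\<in>nodes D. \<forall>j\<in>nodes D. \<forall>a b V W.
     a \<noteq> 0 \<and> b \<noteq> 0 \<and> is_L D (fund_tuple i a) V \<and> is_L D (fund_tuple j b) W \<longrightarrow>
     (\<exists>A. has_fps_prod (\<lambda>u.
          ((1 - fps_const (qs D powi (int u - int (card i)) * (b / a)) * fps_X) /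
           (1 - fps_const (qs D powi (int u + int (card i)) * (b / a)) * fps_X))
          powi qcartan_inv_coeff D i j (int u)) A \<and>
        univ_coeff D V W =
          fps_const (qpow (of_nat (card i) * cartan_inv D i j / of_nat (fold_order D))) * A))"

end

theory Submission
  imports Defs "HOL-Combinatorics.Cycles"
begin

text \<open>
  Reflecting, for decreasing time, at all vertices of the repetition quiver gives Weyl group elements
  \<open>state t\<close>, and the weights \<open>E0 x p\<close>, the image of the fundamental weight of \<open>x\<close> under \<open>state p\<close>,
  satisfy the mesh relations. A fixed Weyl group element turns $\tau_{\mathcal Q}$ into the shift
  $(x, p) \mapsto (\sigma(x), p - 2)$ of this family; hence, up to that element, the signed root
  $(-1)^k \alpha$ at $(x, p)$ is the difference of \<open>E0 x p\<close> and \<open>E0 x (p - 2 d)\<close>, with no reference to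
  positivity. Transporting the family to time \<open>s\<close> and taking the coefficient at \<open>y\<close>, summed over orbits,
  one obtains a function on all integers that obeys the recursion and the initial values of the
  coefficients of the inverse quantum Cartan matrix. So $\widetilde c_{ij}(u)$, $u \ge 0$, extends to all
  integers and
  $(-1)^{k+l} (\alpha, \beta) = \widetilde c_{ij}(p - s + d_i) - \widetilde c_{ij}(p - s - d_i)$.

  Every solution of the mesh recursion has period $2 r h^\vee$; this is checked for each type, by eliminating
  all nodes but one. The product for the universal coefficient is therefore a finite product of scaled
  copies of $\varphi$, whose degree is this difference. Denominators are polynomials over an algebraically
  closed field and have degree 0; the general case follows by multiplicativity.
\<close>

section \<open>Algebraic closedness of the base field\<close>

text \<open>Nearly every object in the statement is a definite description or a choice:
  \<open>varphi\<close>, \<open>Deg_inf\<close>, \<open>denominator\<close>,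
  \<open>qcartan_inv\<close>, \<open>highest_root\<close>, the reading words. Each has to be pinned
  down by existence and uniqueness before anything can be computed with it; for reading words this
  takes the form of a statement valid for every compatible reading.

  The base field is cut out of the Puiseux series, so its algebraic closedness is a theorem, of
  Newton--Puiseux type.

  The number \<open>2 r h\<close> has two independent origins. Through the highest root it gives the
  step \<open>q^(2 h)\<close>, which is \<open>q_s^(2 r h)\<close>, of the product
  \<open>varphi\<close>; through the mesh recursion it is a period. To match them, the foldings are
  classified and a candidate vector is recognized as the highest root. The definiteness of the form
  that this requires is itself drawn from the period: a kernel vector of the Cartan matrix would
  give a solution of the recursion that grows linearly.\<close>

lemma bezout_root_power:
  fixes h :: "'a::field poly"
  assumes "poly h c \<noteq> 0"
  obtains a b where "a * [:- c, 1:] ^ k + b * h = 1"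
proof -
  define l where "l = [:- c, 1:]"
  have "l dvd h - [:poly h c:]"
    unfolding l_def by (simp add: poly_eq_0_iff_dvd[symmetric])
  then obtain q where q: "h - [:poly h c:] = l * q" by (auto simp: dvd_def)
  define v where "v = smult (inverse (poly h c)) 1"
  define u where "u = - (v * q)"
  have "v * [:poly h c:] = 1"
    using assms by (simp add: v_def one_poly_def)
  moreover have "v * h - v * [:poly h c:] = v * (l * q)" by (metis q right_diff_distrib)
  ultimately have uv: "1 - v * h = u * l" unfolding u_def by (simp add: algebra_simps)
  \<comment> \<open>From \<open>u * l + v * h = 1\<close> one passes to exponent \<open>k\<close> by
    the geometric sum: \<open>1 - (u * l) ^ k\<close> is a multiple of
    \<open>1 - u * l = v * h\<close>.\<close>
  have "1 - (u * l) ^ k = (1 - u * l) * (\<Sum>i<k. (u * l) ^ i)"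
    by (rule one_diff_power_eq)
  also have "1 - u * l = v * h" using uv by (simp add: algebra_simps)
  finally have "u ^ k * l ^ k + (v * (\<Sum>i<k. (u * l) ^ i)) * h = 1"
    by (simp add: power_mult_distrib algebra_simps)
  then show ?thesis unfolding l_def by (rule that)
qed

text \<open>Replacing the cofactor \<open>f * b\<close> of \<open>h\<close> by its remainder modulo
  \<open>g\<close> bounds one degree; the other bound follows by comparing degrees in
  \<open>g * h' = f - h * g'\<close>, for which \<open>f\<close> must be of degree below that of
  \<open>g * h\<close>.\<close>

lemma bezout_degree_bounded:
  fixes f g h a b :: "'a::field poly"
  assumes ab: "a * g + b * h = 1" and g: "Polynomial.degree g > 0" and h: "Polynomial.degree h > 0"
    and f: "Polynomial.degree f < Polynomial.degree g + Polynomial.degree h"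
  shows "\<exists>g' h'. g * h' + h * g' = f \<and> Polynomial.degree g' < Polynomial.degree g \<and> Polynomial.degree h' < Polynomial.degree h"
proof -
  define g' where "g' = (f * b) mod g"
  define h' where "h' = f * a + h * ((f * b) div g)"
  have nz: "g \<noteq> 0" "h \<noteq> 0" using g h by auto
  have "g * h' + h * g' = f * (a * g) + h * ((f * b) div g * g + (f * b) mod g)"
    by (simp only: g'_def h'_def distrib_left distrib_right mult_ac add_ac)
  also have "\<dots> = f * (a * g) + h * (f * b)" by (simp only: div_mult_mod_eq)
  also have "\<dots> = f * (a * g + b * h)" by (simp only: distrib_left mult_ac)
  finally have eq: "g * h' + h * g' = f" using ab by simp
  have g': "Polynomial.degree g' < Polynomial.degree g"
    unfolding g'_def using g nz(1) degree_mod_less'[of g "f * b"] by (cases "(f * b) mod g = 0") auto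
  have "Polynomial.degree h' < Polynomial.degree h"
  proof (cases "h' = 0")
    case False
    have "g * h' = f - h * g'" using eq by (simp add: algebra_simps)
    moreover have "Polynomial.degree (h * g') < Polynomial.degree g + Polynomial.degree h"
      using g' degree_mult_le[of h g'] by linarith
    ultimately have "Polynomial.degree (g * h') < Polynomial.degree g + Polynomial.degree h"
      using f by (metis degree_diff_less)
    then show ?thesis using False nz by (simp add: degree_mult_eq)
  qed (use h in simp)
  then show ?thesis using eq g' by blast
qed

definition fps_poly_of :: "nat \<Rightarrow> (nat \<Rightarrow> 'a::zero poly) \<Rightarrow> 'a fps poly" where
  "fps_poly_of n F = Poly (map (\<lambda>i. Abs_fps (\<lambda>k. Polynomial.coeff (F k) i)) [0..<Suc n])"

lemma fps_nth_coeff_fps_poly_of: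
  fixes F :: "nat \<Rightarrow> 'a::zero poly"
  assumes "\<And>k. Polynomial.degree (F k) \<le> n"
  shows "fps_nth (Polynomial.coeff (fps_poly_of n F) i) k = Polynomial.coeff (F k) i"
  using assms[of k] unfolding fps_poly_of_def
  by (simp add: nth_default_def coeff_eq_0 del: upt_Suc)

text \<open>
  Hensel's lemma. A polynomial over power series is given by the polynomials \<open>F k\<close> multiplying the powers
  $X^k$; the factors are lifted one power at a time, by solving a Bezout equation.
\<close>

lemma hensel_fps:
  fixes F :: "nat \<Rightarrow> 'a::field poly"
  assumes F0: "F 0 = g0 * h0" and ab: "a * g0 + b * h0 = 1"
    and g0: "Polynomial.degree g0 > 0" and h0: "Polynomial.degree h0 > 0"
    and F: "\<And>k. k > 0 \<Longrightarrow> Polynomial.degree (F k) < Polynomial.degree (F 0)"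
  obtains G H where "fps_poly_of (Polynomial.degree (F 0)) F = G * H"
    "Polynomial.degree G = Polynomial.degree g0" "Polynomial.degree H = Polynomial.degree h0"
proof -
  define m n where "m = Polynomial.degree g0" and "n = Polynomial.degree h0"
  have pos: "m > 0" "n > 0" using g0 h0 by (auto simp: m_def n_def)
  have nz: "g0 \<noteq> 0" "h0 \<noteq> 0" using g0 h0 by auto
  have dF: "Polynomial.degree (F 0) = m + n" unfolding F0 m_def n_def using nz by (rule degree_mult_eq)
  let ?P = "\<lambda>f k r. if k = 0 then r = (g0, h0) else
    g0 * snd r + h0 * fst r = F k - (\<Sum>l\<in>{1..<k}. fst (f l) * snd (f (k - l))) \<and>
    Polynomial.degree (fst r) < m \<and> Polynomial.degree (snd r) < n"
  \<comment> \<open>Well-founded recursion on the order \<open>k\<close>: the unknown pair of order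
    \<open>k\<close> enters only through the two products with \<open>h0\<close> and
    \<open>g0\<close>, so the condition is one Bezout equation whose right side involves earlier
    pairs alone.\<close>
  have "\<exists>f :: nat \<Rightarrow> 'a poly \<times> 'a poly. \<forall>k. ?P f k (f k)"
  proof (rule dependent_wf_choice[of less_than])
    show "?P f k r = ?P g k r" if "\<And>z. (z, k) \<in> less_than \<Longrightarrow> f z = g z" for f g k r
    proof -
      have "(\<Sum>l\<in>{1..<k}. fst (f l) * snd (f (k - l))) = (\<Sum>l\<in>{1..<k}. fst (g l) * snd (g (k - l)))"
        using that by (intro sum.cong) auto
      then show ?thesis by (simp only:)
    qed
    show "\<exists>r. ?P f k r" if IH: "\<And>y. (y, k) \<in> less_than \<Longrightarrow> ?P f y (f y)" for k and f :: "nat \<Rightarrow> 'a poly \<times> 'a poly"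
    proof (cases "k = 0")
      case False
      let ?S = "\<Sum>l\<in>{1..<k}. fst (f l) * snd (f (k - l))"
      have "Polynomial.degree (fst (f l) * snd (f (k - l))) < m + n" if "l \<in> {1..<k}" for l
      proof -
        have "Polynomial.degree (fst (f l)) < m" "Polynomial.degree (snd (f (k - l))) < n"
          using IH[of l] IH[of "k - l"] that by (auto split: if_splits)
        then show ?thesis using degree_mult_le[of "fst (f l)" "snd (f (k - l))"] by linarith
      qed
      then have "Polynomial.degree ?S < m + n" using pos by (intro degree_sum_less) auto
      moreover have "Polynomial.degree (F k) < m + n" using F[of k] False dF by simp
      ultimately have "Polynomial.degree (F k - ?S) < Polynomial.degree g0 + Polynomial.degree h0"
        unfolding m_def[symmetric] n_def[symmetric] by (rule degree_diff_less[rotated])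
      from bezout_degree_bounded[OF ab g0 h0 this] obtain g' h' where
        "g0 * h' + h0 * g' = F k - ?S" "Polynomial.degree g' < m" "Polynomial.degree h' < n"
        unfolding m_def n_def by blast
      then show ?thesis using False by (intro exI[of _ "(g', h')"]) simp
    qed auto
  qed auto
  then obtain f :: "nat \<Rightarrow> 'a poly \<times> 'a poly" where f: "\<And>k. ?P f k (f k)" by blast
  define g h where "g = (\<lambda>k. fst (f k))" and "h = (\<lambda>k. snd (f k))"
  have gh0: "g 0 = g0" "h 0 = h0" using f[of 0] by (auto simp: g_def h_def)
  have dlt: "Polynomial.degree (g k) < m" "Polynomial.degree (h k) < n" if "k > 0" for k
    using f[of k] that by (auto simp: g_def h_def)
  have dg: "Polynomial.degree (g k) \<le> m" and dh: "Polynomial.degree (h k) \<le> n" for k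
    using dlt[of k] gh0 by (cases "k = 0"; simp add: m_def n_def)+
  have conv: "(\<Sum>l\<le>k. g l * h (k - l)) = F k" for k
  proof (cases "k = 0")
    case True then show ?thesis using gh0 F0 by simp
  next
    case False
    have "{..k} = insert 0 (insert k {1..<k})" using False by auto
    then have "(\<Sum>l\<le>k. g l * h (k - l)) = g0 * h k + (g k * h0 + (\<Sum>l\<in>{1..<k}. g l * h (k - l)))"
      using False gh0 by simp
    also have "\<dots> = F k" using f[of k] False by (simp add: g_def h_def algebra_simps)
    finally show ?thesis .
  qed
  define G H where "G = fps_poly_of m g" and "H = fps_poly_of n h"
  have G: "fps_nth (Polynomial.coeff G i) k = Polynomial.coeff (g k) i" for i k
    unfolding G_def by (rule fps_nth_coeff_fps_poly_of) (rule dg)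
  have H: "fps_nth (Polynomial.coeff H i) k = Polynomial.coeff (h k) i" for i k
    unfolding H_def by (rule fps_nth_coeff_fps_poly_of) (rule dh)
  have FF: "fps_nth (Polynomial.coeff (fps_poly_of (Polynomial.degree (F 0)) F) i) k = Polynomial.coeff (F k) i" for i k
    by (rule fps_nth_coeff_fps_poly_of) (use F dF in \<open>metis le_eq_less_or_eq neq0_conv\<close>)
  have "fps_poly_of (Polynomial.degree (F 0)) F = G * H"
  proof (rule poly_eqI, rule fps_ext)
    fix i k
    have "fps_nth (Polynomial.coeff (G * H) i) k =
      (\<Sum>a\<le>i. \<Sum>l=0..k. Polynomial.coeff (g l) a * Polynomial.coeff (h (k - l)) (i - a))"
      by (simp add: coeff_mult fps_sum_nth fps_mult_nth G H)
    also have "\<dots> = (\<Sum>l=0..k. \<Sum>a\<le>i. Polynomial.coeff (g l) a * Polynomial.coeff (h (k - l)) (i - a))"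
      by (rule sum.swap)
    also have "\<dots> = Polynomial.coeff (\<Sum>l\<le>k. g l * h (k - l)) i"
      by (simp add: coeff_sum coeff_mult atMost_atLeast0)
    finally show "fps_nth (Polynomial.coeff (fps_poly_of (Polynomial.degree (F 0)) F) i) k = fps_nth (Polynomial.coeff (G * H) i) k"
      by (simp add: FF conv)
  qed
  \<comment> \<open>No lifted term exceeds degree \<open>m\<close>, and the constant term of the
    coefficient at \<open>m\<close> is the leading coefficient of \<open>g0\<close>, so the degree
    does not drop either.\<close>
  moreover have "Polynomial.degree G = Polynomial.degree g0"
  proof (rule antisym)
    have "Polynomial.coeff G i = 0" if "i > m" for i
      by (rule fps_ext) (use that le_less_trans[OF dg] in \<open>simp add: G coeff_eq_0\<close>)
    then show "Polynomial.degree G \<le> Polynomial.degree g0"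
      unfolding m_def by (intro degree_le) auto
    have "fps_nth (Polynomial.coeff G m) 0 \<noteq> 0" using nz by (simp add: G gh0 m_def)
    then show "Polynomial.degree g0 \<le> Polynomial.degree G"
      unfolding m_def by (metis fps_zero_nth le_degree)
  qed
  moreover have "Polynomial.degree H = Polynomial.degree h0"
  proof (rule antisym)
    have "Polynomial.coeff H i = 0" if "i > n" for i
      by (rule fps_ext) (use that le_less_trans[OF dh] in \<open>simp add: H coeff_eq_0\<close>)
    then show "Polynomial.degree H \<le> Polynomial.degree h0"
      unfolding n_def by (intro degree_le) auto
    have "fps_nth (Polynomial.coeff H n) 0 \<noteq> 0" using nz by (simp add: H gh0 n_def)
    then show "Polynomial.degree h0 \<le> Polynomial.degree H"
      unfolding n_def by (metis fps_zero_nth le_degree)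
  qed
  ultimately show ?thesis by (rule that)
qed

text \<open>Only the two top terms of the expansion reach degree \<open>n\<close>. In characteristic
  0 a suitable \<open>c\<close> therefore cancels the subleading coefficient (Tschirnhaus
  transformation).\<close>

lemma coeff_pcompose_shift:
  fixes p :: "'a::comm_ring_1 poly"
  assumes "Polynomial.degree p = Suc n"
  shows "Polynomial.coeff (pcompose p [:c, 1:]) n = Polynomial.coeff p n + of_nat (Suc n) * c * Polynomial.lead_coeff p"
proof -
  have "pcompose p [:c, 1:] = (\<Sum>i\<le>Suc n. Polynomial.smult (Polynomial.coeff p i) ([:c, 1:] ^ i))"
    by (simp add: pcompose_altdef poly_altdef assms degree_map_poly coeff_map_poly del: sum.atMost_Suc)
  then have "Polynomial.coeff (pcompose p [:c, 1:]) n = (\<Sum>i\<le>Suc n. Polynomial.coeff p i * Polynomial.coeff ([:c, 1:] ^ i) n)"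
    by (simp add: coeff_sum del: sum.atMost_Suc)
  also have "\<dots> = (\<Sum>i\<in>{n, Suc n}. Polynomial.coeff p i * Polynomial.coeff ([:c, 1:] ^ i) n)"
  proof (rule sum.mono_neutral_right)
    have "Polynomial.coeff ([:c, 1:] ^ i) n = 0" if "i < n" for i
      by (rule coeff_eq_0) (use that degree_linear_power[of c i] in simp)
    then show "\<forall>i\<in>{..Suc n} - {n, Suc n}. Polynomial.coeff p i * Polynomial.coeff ([:c, 1:] ^ i) n = 0"
      by (auto simp: less_Suc_eq le_Suc_eq)
  qed auto
  also have "\<dots> = Polynomial.coeff p n + of_nat (Suc n) * c * Polynomial.lead_coeff p"
    using coeff_linear_poly_power[of n n c 1] coeff_linear_poly_power[of n "Suc n" c 1] assms
    by (simp add: algebra_simps)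
  finally show ?thesis .
qed

lemma map_poly_mult_hom:
  assumes "f 0 = 0" and "\<And>x y. f (x + y) = f x + f y" and "\<And>x y. f (x * y) = f x * f y"
  shows "map_poly f (p * q) = map_poly f p * map_poly f q"
proof (rule poly_eqI)
  fix i
  have "f (sum g A) = (\<Sum>a\<in>A. f (g a))" if "finite A" for g and A :: "nat set"
    using that by (induction A) (auto simp: assms)
  then show "Polynomial.coeff (map_poly f (p * q)) i = Polynomial.coeff (map_poly f p * map_poly f q) i"
    by (simp add: coeff_map_poly coeff_mult assms)
qed

section \<open>Power series inside the Puiseux series, and roots of polynomials over Puiseux
  series\<close>

definition puiseux_of_fps :: "nat \<Rightarrow> 'a::zero fps \<Rightarrow> 'a puiseux" where
  "puiseux_of_fps m F = puiseux_of_fls m (fps_to_fls F)"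

lemma puiseux_of_fps_eq_0_iff: "m > 0 \<Longrightarrow> puiseux_of_fps m F = 0 \<longleftrightarrow> F = 0"
  unfolding puiseux_of_fps_def
  by (metis puiseux_of_fls_0 puiseux_of_fls_inject fps_to_fls_eq_0_iff)

lemma puiseux_coeff_X_pow_mult:
  fixes a :: "'a::field puiseux"
  shows "puiseux_coeff (puiseux_X_pow e * a) x = puiseux_coeff a (x - e)"
proof -
  obtain m E F where m: "m > 0" and E: "puiseux_X_pow e = (puiseux_of_fls m E :: 'a puiseux)"
    and a: "a = puiseux_of_fls m F"
    using puiseux_of_fls_common3[of "puiseux_X_pow e" a a] by metis
  \<comment> \<open>The exponent \<open>e\<close> has to be an integral multiple of
    \<open>1 / m\<close>. This is read off from the coefficient 1 of the monomial at
    \<open>e\<close>, since \<open>fls_ramify\<close> vanishes off such multiples.\<close>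
  have "fls_ramify m E e \<noteq> 0"
  proof -
    have "puiseux_coeff (puiseux_X_pow e :: 'a puiseux) e = 1"
    proof -
      obtain u v where q: "e = of_int u / of_int v" "v > 0"
        by (metis quotient_of_denom_pos quotient_of_div surj_pair)
      then have "nat v > 0" "e * of_nat (nat v) = of_int u" by (auto simp: field_simps)
      then show ?thesis
        using puiseux_X_pow_as_fls[of "nat v" e, where 'a = 'a] by (simp add: fls_ramify_def)
    qed
    then show ?thesis using E m by simp
  qed
  then have int: "e * of_nat m \<in> \<int>" by (auto simp: fls_ramify_def split: if_splits)
  then obtain k where k: "e * of_nat m = of_int k" by (elim Ints_cases)
  have "puiseux_X_pow e * a = puiseux_of_fls m (fls_X_intpow k * F)"
    using puiseux_X_pow_as_fls[OF m int, where 'a = 'a] k by (simp add: a puiseux_of_fls_mult m)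
  then have "puiseux_coeff (puiseux_X_pow e * a) x = fls_ramify m (fls_X_intpow k * F) x"
    using m by simp
  also have "\<dots> = fls_ramify m F (x - e)"
  proof -
    have eq: "(x - e) * of_nat m = x * of_nat m - of_int k" using k by (simp add: algebra_simps)
    have "x * of_nat m - of_int k \<in> \<int> \<longleftrightarrow> x * of_nat m \<in> \<int>"
      by (metis Ints_add Ints_diff Ints_of_int diff_add_cancel)
    then show ?thesis
      unfolding fls_ramify_def eq by (simp add: fls_X_intpow_times_conv_shift)
  qed
  finally show ?thesis using a m by simp
qed

lemma puiseux_ord:
  fixes a :: "'a::zero puiseux"
  assumes "a \<noteq> puiseux_of_fls 1 0"
  obtains e where "puiseux_coeff a e \<noteq> 0" "\<And>x. x < e \<Longrightarrow> puiseux_coeff a x = 0"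
proof -
  obtain m F where m: "m > 0" and a: "a = puiseux_of_fls m F"
    using puiseux_of_fls_common3[of a a a] by metis
  have F: "F \<noteq> 0" using assms a m puiseux_of_fls_0 zero_puiseux_def by metis
  let ?e = "of_int (fls_subdegree F) / of_nat m :: rat"
  show ?thesis
  proof (rule that[of ?e])
    show "puiseux_coeff a ?e \<noteq> 0" using m F by (simp add: a fls_ramify_def)
    show "puiseux_coeff a x = 0" if "x < ?e" for x
    proof (cases "x * of_nat m \<in> \<int>")
      case True
      then obtain k where k: "x * of_nat m = of_int k" by (elim Ints_cases)
      with that m have "(of_int k :: rat) < of_int (fls_subdegree F)" by (simp add: field_simps)
      then show ?thesis using m k by (simp add: a fls_ramify_def)
    qed (use m in \<open>simp add: a fls_ramify_def\<close>)
  qed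
qed

lemma puiseux_den_common:
  assumes "finite A"
  shows "\<exists>m>0. \<forall>a\<in>A. puiseux_den m (puiseux_coeff a)"
  using assms
proof induction
  case empty
  show ?case by (rule exI[of _ 1]) simp
next
  case (insert a A)
  then obtain m where m: "m > 0" "\<forall>b\<in>A. puiseux_den m (puiseux_coeff b)" by blast
  obtain k where k: "puiseux_den k (puiseux_coeff a)" using puiseux_ex_den by blast
  then have "k > 0" by (simp add: puiseux_den_def)
  show ?case
  proof (intro exI[of _ "m * k"] conjI ballI)
    fix b assume "b \<in> insert a A"
    then show "puiseux_den (m * k) (puiseux_coeff b)"
      using m k \<open>k > 0\<close> puiseux_den_mult[of m "puiseux_coeff b" k] puiseux_den_mult[of k "puiseux_coeff a" m]
      by (auto simp: mult.commute)
  qed (use m \<open>k > 0\<close> in simp)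
qed

lemma puiseux_of_fps_exists:
  fixes a :: "'a::zero puiseux"
  assumes den: "puiseux_den m (puiseux_coeff a)" and ge: "\<And>x. x < 0 \<Longrightarrow> puiseux_coeff a x = 0"
  obtains F where "a = puiseux_of_fps m F" "fps_nth F 0 = puiseux_coeff a 0"
proof -
  from den have m: "m > 0" by (simp add: puiseux_den_def)
  obtain F where F: "a = puiseux_of_fls m F" using puiseux_den_imp_of_fls[OF den] .
  have "fls_nth F k = 0" if "k < 0" for k
  proof -
    have "fls_nth F k = puiseux_coeff a (of_int k / of_nat m)" using F m by (simp add: fls_ramify_def)
    also have "\<dots> = 0" using that m by (intro ge) (simp add: field_simps)
    finally show ?thesis .
  qed
  then have "F = 0 \<or> fls_subdegree F \<ge> 0" by (metis linorder_not_le nth_fls_subdegree_nonzero)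
  then have "fps_to_fls (fls_regpart F) = F" by (auto simp: fls_regpart_to_fls_trivial)
  then show ?thesis using F m by (intro that[of "fls_regpart F"]) (auto simp: puiseux_of_fps_def fls_ramify_def)
qed

text \<open>
  Newton--Puiseux: once the subleading coefficient is removed and the variable is rescaled by the smallest
  slope, the reduction is not a power of a linear polynomial, so that Hensel's lemma lowers the degree.
\<close>

lemma puiseux_has_root:
  fixes p :: "'a::{alg_closed_field,field_char_0} puiseux poly"
  assumes "Polynomial.degree p > 0"
  shows "\<exists>x. poly p x = 0"
  using assms
proof (induction "Polynomial.degree p" arbitrary: p rule: less_induct)
  case less
  define n where "n = Polynomial.degree p"
  have n: "n > 0" using less.prems by (simp add: n_def)
  show ?case
  proof (cases "n = 1")
    case True
    then obtain a b where "p = [:a, b:]" "b \<noteq> 0"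
      using degree1_coeffs n_def by metis
    then have "poly p (- a / b) = 0" by simp
    then show ?thesis ..
  next
    case False
    then obtain n' where n': "n = Suc n'" "n' > 0" using n by (cases n) auto
    define p1 where "p1 = Polynomial.smult (inverse (Polynomial.lead_coeff p)) p"
    have p0: "Polynomial.lead_coeff p \<noteq> 0" using n by (auto simp: n_def)
    have dp1: "Polynomial.degree p1 = Suc n'"
      using p0 n'(1) unfolding n_def by (simp add: p1_def degree_smult_eq)
    have lp1: "Polynomial.lead_coeff p1 = 1"
      unfolding p1_def lead_coeff_smult using p0 by (rule left_inverse)
    define c where "c = - Polynomial.coeff p1 n' / of_nat (Suc n')"
    define p2 where "p2 = pcompose p1 [:c, 1:]"
    have dp2: "Polynomial.degree p2 = n" using dp1 n' by (simp add: p2_def degree_pcompose)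
    have lp2: "Polynomial.coeff p2 n = 1"
      using lead_coeff_comp[of "[:c, 1:]" p1] lp1 dp2 by (simp add: p2_def)
    have "of_nat (Suc n') * c = - Polynomial.coeff p1 n'"
      unfolding c_def using of_nat_neq_0[of n', where 'a = "'a puiseux"]
      by (metis nonzero_mult_div_cancel_left times_divide_eq_right)
    then have p2n': "Polynomial.coeff p2 n' = 0"
      unfolding p2_def coeff_pcompose_shift[OF dp1] by (simp only: lp1) simp
    show ?thesis
    proof (cases "\<forall>i<n. Polynomial.coeff p2 i = 0")
      case True
      then have "Polynomial.coeff p2 0 = 0" using n by blast
      then have "poly p2 0 = 0" by (simp add: poly_0_coeff_0)
      then have "poly p1 c = 0" by (simp add: p2_def poly_pcompose)
      then show ?thesis using p0 by (auto simp: p1_def)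
    next
      case ex: False
      define I where "I = {i. i < n \<and> Polynomial.coeff p2 i \<noteq> 0}"
      have fI: "finite I" "I \<noteq> {}" using ex by (auto simp: I_def)
      have "\<forall>i. \<exists>e. i \<in> I \<longrightarrow> puiseux_coeff (Polynomial.coeff p2 i) e \<noteq> 0 \<and>
        (\<forall>x<e. puiseux_coeff (Polynomial.coeff p2 i) x = 0)"
      proof
        fix i show "\<exists>e. i \<in> I \<longrightarrow> puiseux_coeff (Polynomial.coeff p2 i) e \<noteq> 0 \<and>
            (\<forall>x<e. puiseux_coeff (Polynomial.coeff p2 i) x = 0)"
        proof (cases "i \<in> I")
          case True
          then have "Polynomial.coeff p2 i \<noteq> puiseux_of_fls 1 0" by (simp add: I_def puiseux_of_fls_0)
          from puiseux_ord[OF this] show ?thesis by metis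
        qed auto
      qed
      then obtain v where v: "\<And>i. i \<in> I \<Longrightarrow> puiseux_coeff (Polynomial.coeff p2 i) (v i) \<noteq> 0"
        and v': "\<And>i x. i \<in> I \<Longrightarrow> x < v i \<Longrightarrow> puiseux_coeff (Polynomial.coeff p2 i) x = 0"
        by metis
      \<comment> \<open>The smallest slope of the Newton polygon. Substituting \<open>X^r y\<close>
        and dividing by \<open>X^(n r)\<close> makes all coefficients integral, and the one at a
        minimizing index \<open>i0\<close> keeps a nonzero constant term.\<close>
      define r where "r = Min ((\<lambda>i. v i / of_nat (n - i)) ` I)"
      have "r \<in> (\<lambda>i. v i / of_nat (n - i)) ` I" unfolding r_def using fI by (intro Min_in) auto
      then obtain i0 where i0: "i0 \<in> I" "r = v i0 / of_nat (n - i0)" by blast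
      have rle: "r \<le> v i / of_nat (n - i)" if "i \<in> I" for i
        unfolding r_def using fI that by (intro Min_le) auto
      define b where "b i = puiseux_X_pow (- (of_nat (n - i) * r)) * Polynomial.coeff p2 i" for i
      have bc: "puiseux_coeff (b i) x = puiseux_coeff (Polynomial.coeff p2 i) (x + of_nat (n - i) * r)" for i x
        unfolding b_def puiseux_coeff_X_pow_mult by simp
      have bge: "puiseux_coeff (b i) x = 0" if "x < 0" "i < n" for i x
      proof (cases "i \<in> I")
        case True
        have "of_nat (n - i) * r \<le> v i" using rle[OF True] that by (simp add: field_simps)
        then show ?thesis unfolding bc using that by (intro v' True) linarith
      next
        case False
        then have "Polynomial.coeff p2 i = 0" using that by (simp add: I_def)
        then have "b i = puiseux_of_fls 1 0" by (simp add: b_def puiseux_of_fls_0)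
        then show ?thesis by (simp add: fls_ramify_def)
      qed
      have "i0 < n" using i0 by (simp add: I_def)
      then have bi0: "puiseux_coeff (b i0) 0 \<noteq> 0"
        unfolding bc using v[OF i0(1)] i0(2) by simp
      have bn: "b n = 1" by (simp add: b_def lp2 puiseux_X_pow_0)
      obtain m where m: "m > 0" "\<And>i. i \<le> n \<Longrightarrow> puiseux_den m (puiseux_coeff (b i))"
        using puiseux_den_common[of "b ` {..n}"] by auto
      have "\<forall>i. \<exists>G. i < n \<longrightarrow> b i = puiseux_of_fps m G \<and> fps_nth G 0 = puiseux_coeff (b i) 0"
        using puiseux_of_fps_exists[OF m(2) bge] by (metis less_imp_le)
      then obtain G' where G': "\<And>i. i < n \<Longrightarrow> b i = puiseux_of_fps m (G' i)"
        "\<And>i. i < n \<Longrightarrow> fps_nth (G' i) 0 = puiseux_coeff (b i) 0" by metis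
      define G where "G i = (if i < n then G' i else if i = n then 1 else 0)" for i
      define F where "F k = Poly (map (\<lambda>i. fps_nth (G i) k) [0..<Suc n])" for k
      have cF: "Polynomial.coeff (F k) i = fps_nth (G i) k" for k i
        unfolding F_def by (simp add: nth_default_def G_def del: upt_Suc)
      have hom: "puiseux_of_fps m (0 :: 'a fps) = 0" "puiseux_of_fps m (x + y) = puiseux_of_fps m x + puiseux_of_fps m y"
        "puiseux_of_fps m (x * y) = puiseux_of_fps m x * puiseux_of_fps m y" for x y :: "'a fps"
        using m(1) by (simp_all add: puiseux_of_fps_def puiseux_of_fls_0 puiseux_of_fls_add
            puiseux_of_fls_mult fps_to_fls_plus fls_times_fps_to_fls)
      have hom1: "puiseux_of_fps m (1 :: 'a fps) = 1"
        using m(1) by (simp add: puiseux_of_fps_def puiseux_of_fls_1)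
      define \<Phi> where "\<Phi> = map_poly (puiseux_of_fps m :: 'a fps \<Rightarrow> _)"
      define q where "q = \<Phi> (fps_poly_of n F)"
      have d0: "Polynomial.degree (F 0) = n"
      proof (rule antisym)
        show "Polynomial.degree (F 0) \<le> n" by (rule degree_le) (auto simp: cF G_def)
        have "Polynomial.coeff (F 0) n = 1" unfolding cF by (simp add: G_def)
        then show "n \<le> Polynomial.degree (F 0)" by (intro le_degree) simp
      qed
      have dk: "Polynomial.degree (F k) < n" if "k > 0" for k
      proof -
        have "Polynomial.coeff (F k) i = 0" if "i > n'" for i
          unfolding cF using that \<open>k > 0\<close> n' by (auto simp: G_def)
        then have "Polynomial.degree (F k) \<le> n'" by (intro degree_le) blast
        then show ?thesis using n' by simp
      qed
      have dFle: "Polynomial.degree (F k) \<le> n" for k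
        using d0 dk[of k] by (cases "k = 0") auto
      have qc: "Polynomial.coeff q i = b i" if "i \<le> n" for i
      proof -
        have "Polynomial.coeff (fps_poly_of n F) i = G i"
          by (rule fps_ext) (simp add: fps_nth_coeff_fps_poly_of[OF dFle] cF)
        then show ?thesis
          using that G' bn hom1 unfolding q_def \<Phi>_def
          by (cases "i = n") (auto simp: coeff_map_poly hom G_def)
      qed
      have dq: "Polynomial.degree q = n"
      proof (rule antisym)
        have "Polynomial.coeff (fps_poly_of n F) i = 0" if "i > n" for i
          by (rule fps_ext) (use that in \<open>simp add: fps_nth_coeff_fps_poly_of[OF dFle] cF G_def\<close>)
        then show "Polynomial.degree q \<le> n"
          unfolding q_def \<Phi>_def by (intro degree_le) (simp add: coeff_map_poly hom)
        show "n \<le> Polynomial.degree q" using qc[of n] bn by (intro le_degree) simp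
      qed
      have red: "\<exists>x. poly p x = 0" if "poly q y = 0" for y
      proof -
        let ?x = "puiseux_X_pow r * y"
        have "poly p2 ?x = (\<Sum>i\<le>n. Polynomial.coeff p2 i * ?x ^ i)" by (simp add: poly_altdef dp2)
        also have "\<dots> = (\<Sum>i\<le>n. puiseux_X_pow (of_nat n * r) * (b i * y ^ i))"
        proof (rule sum.cong)
          fix i assume "i \<in> {..n}"
          then have "of_nat n * r + - (of_nat (n - i) * r) = of_nat i * r"
            by (simp add: of_nat_diff algebra_simps)
          then show "Polynomial.coeff p2 i * ?x ^ i = puiseux_X_pow (of_nat n * r) * (b i * y ^ i)"
            unfolding b_def by (simp add: power_mult_distrib puiseux_X_pow_power puiseux_X_pow_add[symmetric] mult.assoc[symmetric])
        qed auto
        also have "\<dots> = puiseux_X_pow (of_nat n * r) * poly q y"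
          by (simp add: poly_altdef dq qc sum_distrib_left)
        finally have "poly p2 ?x = 0" using that by simp
        then have "poly p1 (c + ?x) = 0" by (simp add: p2_def poly_pcompose)
        then show ?thesis using p0 by (auto simp: p1_def)
      qed
      have "Polynomial.degree (F 0) > 0" using d0 n by simp
      from alg_closed_imp_poly_has_root[OF this] obtain z where z: "poly (F 0) z = 0" by blast
      define k where "k = order z (F 0)"
      have F0: "F 0 \<noteq> 0" using d0 n by auto
      obtain h0 where h0: "F 0 = [:- z, 1:] ^ k * h0" "\<not> [:- z, 1:] dvd h0"
        using order_decomp[OF F0, of z] unfolding k_def by blast
      have k0: "k > 0" using z F0 order_root[of "F 0" z] by (simp add: k_def)
      have h0nz: "h0 \<noteq> 0" using h0 by auto
      have dsum: "n = k + Polynomial.degree h0"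
        using d0 h0(1) h0nz by (simp add: degree_mult_eq degree_linear_power)
      \<comment> \<open>If \<open>h0\<close> were constant, the reduction \<open>F 0\<close> would
        be \<open>(y - z)^n\<close>. Its vanishing subleading coefficient forces
        \<open>z = 0\<close>, so all lower coefficients vanish, contradicting the nonzero constant
        term at \<open>i0\<close>.\<close>
      have dh0: "Polynomial.degree h0 > 0"
      proof (rule ccontr)
        assume "\<not> Polynomial.degree h0 > 0"
        then obtain e where e: "h0 = [:e:]" by (metis degree_eq_zeroE neq0_conv)
        then have kn: "k = n" using dsum by simp
        have "Polynomial.coeff (F 0) n = 1" unfolding cF by (simp add: G_def)
        then have "e = 1" using e h0(1) kn by (simp add: coeff_linear_power)
        then have pw: "F 0 = [:- z, 1:] ^ n" using e h0(1) kn by (simp add: one_pCons[symmetric])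
        have "Polynomial.coeff (F 0) n' = of_nat n * - z"
          unfolding pw using coeff_linear_poly_power[of n' n "- z" 1] n' by simp
        moreover have "Polynomial.coeff (F 0) n' = 0"
        proof -
          have "b n' = 0" by (simp add: b_def p2n')
          then have "G' n' = 0" using G'(1)[of n'] n' m(1) by (simp add: puiseux_of_fps_eq_0_iff)
          then show ?thesis using n' by (simp add: cF G_def)
        qed
        ultimately have "z = 0" using n by simp
        then have "F 0 = monom 1 n" using pw by (simp add: monom_altdef)
        then have "Polynomial.coeff (F 0) i0 = 0" using \<open>i0 < n\<close> by simp
        then show False using bi0 G'(2) \<open>i0 < n\<close> by (simp add: cF G_def)
      qed
      have dzk: "Polynomial.degree ([:- z, 1:] ^ k) > 0" using k0 by (simp add: degree_linear_power)
      have "poly h0 z \<noteq> 0" using h0(2) by (simp add: poly_eq_0_iff_dvd)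
      then obtain a' b' where ab: "a' * [:- z, 1:] ^ k + b' * h0 = 1"
        by (rule bezout_root_power)
      obtain A B where AB: "fps_poly_of n F = A * B" "Polynomial.degree A = k"
        using hensel_fps[of F "[:- z, 1:] ^ k" h0 a' b', OF h0(1) ab dzk dh0] dk unfolding d0 degree_linear_power by blast
      have qAB: "q = \<Phi> A * \<Phi> B"
        unfolding q_def AB(1) \<Phi>_def by (rule map_poly_mult_hom) (rule hom)+
      have "Polynomial.degree (\<Phi> A) = k"
        unfolding \<Phi>_def AB(2)[symmetric]
        by (rule map_poly_degree_eq) (use k0 AB(2) m(1) in \<open>auto simp: puiseux_of_fps_eq_0_iff\<close>)
      moreover have "k < n" using dsum \<open>Polynomial.degree h0 > 0\<close> by simp
      ultimately obtain y where "poly (\<Phi> A) y = 0"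
        using less.hyps[of "\<Phi> A"] k0 by (auto simp: n_def)
      then have "poly q y = 0" by (simp add: qAB)
      then show ?thesis by (rule red)
    qed
  qed
qed

text \<open>Adjoining the finitely many coefficients of \<open>p\<close> to \<open>Qq\<close> is a
  finite extension, and adjoining \<open>x\<close> to that is finite again; by the tower law
  \<open>x\<close> lies in a finite extension of \<open>Qq\<close>.\<close>

lemma algebraic_over_algebraic_Qq:
  fixes p :: "rat alg_closure puiseux poly"
  assumes "p \<noteq> 0" and "\<And>i. ring.algebraic ring_of_type_algebra Qq (Polynomial.coeff p i)" and "poly p x = 0"
  shows "ring.algebraic ring_of_type_algebra Qq x"
proof -
  let ?R = "ring_of_type_algebra :: rat alg_closure puiseux ring"
  interpret R: field ?R by (rule field_from_type_algebra)
  have ops: "carrier ?R = UNIV" "\<zero>\<^bsub>?R\<^esub> = 0" "\<one>\<^bsub>?R\<^esub> = 1" "u \<oplus>\<^bsub>?R\<^esub> v = u + v" "u \<otimes>\<^bsub>?R\<^esub> v = u * v" for u v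
    by (simp_all add: ring_of_type_algebra_def)
  have pw: "u [^]\<^bsub>?R\<^esub> (k::nat) = u ^ k" for u k
    by (induction k) (simp_all add: ops mult.commute)
  have sf: "subfield Qq ?R"
    unfolding Qq_def by (rule R.generate_field_is_subfield) (simp add: ops)
  define cs where "cs = Polynomial.coeffs p"
  let ?K = "R.finite_extension Qq cs"
  have alg: "(R.algebraic over Qq) c" if "c \<in> set cs" for c
  proof -
    have "c \<in> range (Polynomial.coeff p)" using that by (simp add: cs_def range_coeff)
    then show ?thesis using assms(2) by (auto simp: over_def)
  qed
  have sub: "set cs \<subseteq> carrier ?R" by (simp add: ops)
  have K: "subfield ?K ?R" by (rule R.finite_extension_is_subfield[OF sf sub alg])
  have fin: "R.finite_dimension Qq ?K" by (rule R.finite_extension_finite_dimension(1)[OF sf sub alg])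
  have mem: "set cs \<subseteq> ?K" by (rule R.finite_extension_mem[OF subfieldE(1)[OF sf] sub])
  have ev: "R.eval (rev ys) x = poly (Poly ys) x" for ys
  proof (induction ys)
    case (Cons a ys)
    have "R.eval (us @ [a]) x = x * R.eval us x + a" for us
      by (induction us) (simp_all add: ops pw algebra_simps)
    then show ?case using Cons by (simp add: add.commute)
  qed (simp add: ops)
  have "rev cs \<noteq> []" using assms(1) by (simp add: cs_def)
  moreover have "hd (rev cs) \<noteq> 0"
    using assms(1) by (simp add: hd_rev cs_def last_coeffs_eq_coeff_degree)
  ultimately have "rev cs \<in> carrier (?K[X]\<^bsub>?R\<^esub>)"
    using mem by (auto simp: univ_poly_def polynomial_def ops)
  moreover have "R.eval (rev cs) x = \<zero>\<^bsub>?R\<^esub>"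
    unfolding ev using assms(3) by (simp add: cs_def ops)
  ultimately have "(R.algebraic over ?K) x"
    using \<open>rev cs \<noteq> []\<close> by (intro R.algebraicI)
  then have "R.finite_dimension ?K (R.simple_extension ?K x)"
    using R.finite_dimension_simple_extension[OF K, of x] by (simp add: ops)
  then have "R.finite_dimension Qq (R.simple_extension ?K x)"
    by (rule R.telescopic_base_dim(1)[OF sf K fin])
  moreover have "x \<in> R.simple_extension ?K x"
    by (rule R.simple_extension_mem[OF subfieldE(1)[OF K]]) (simp add: ops)
  ultimately have "(R.algebraic over Qq) x"
    using R.finite_dimension_imp_algebraic[OF sf R.simple_extension_is_subring[OF subfieldE(1)[OF K]]] by (simp add: ops)
  then show ?thesis by (simp add: over_def)
qed

text \<open>A root exists among the Puiseux series. Its polynomial has coefficients algebraic over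
  \<open>Qq\<close>, so the root is algebraic over \<open>Qq\<close> as well and belongs to the
  subtype.\<close>

instance qfield :: alg_closed_field
proof
  fix p :: "qfield poly"
  assume "Polynomial.degree p > 0"
  define P where "P = map_poly puiseux_of_qfield p"
  have z: "puiseux_of_qfield y = 0 \<longleftrightarrow> y = 0" for y
    by (metis zero_qfield.rep_eq puiseux_of_qfield_inject)
  have cp: "Polynomial.coeff P i = puiseux_of_qfield (Polynomial.coeff p i)" for i
    unfolding P_def by (simp add: coeff_map_poly zero_qfield.rep_eq)
  have d: "Polynomial.degree P = Polynomial.degree p"
    unfolding P_def by (rule map_poly_degree_eq) (use \<open>Polynomial.degree p > 0\<close> z in auto)
  then have "\<exists>x. poly P x = 0" using \<open>Polynomial.degree p > 0\<close> by (intro puiseux_has_root) simp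
  then obtain x where x: "poly P x = 0" ..
  have "ring.algebraic ring_of_type_algebra Qq (Polynomial.coeff P i)" for i
    using puiseux_of_qfield[of "Polynomial.coeff p i"] by (simp add: cp)
  moreover have "P \<noteq> 0" using d \<open>Polynomial.degree p > 0\<close> by auto
  ultimately have "ring.algebraic ring_of_type_algebra Qq x"
    using algebraic_over_algebraic_Qq[of P x] x by simp
  then obtain y where y: "x = puiseux_of_qfield y" using puiseux_of_qfield_cases by blast
  have pow: "puiseux_of_qfield (y ^ k) = x ^ k" for k
    by (induction k) (simp_all add: one_qfield.rep_eq times_qfield.rep_eq y)
  have "puiseux_of_qfield (\<Sum>k\<in>A. Polynomial.coeff p k * y ^ k) = (\<Sum>k\<in>A. Polynomial.coeff P k * x ^ k)"
    if "finite A" for A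
    using that by (induction A) (simp_all add: zero_qfield.rep_eq plus_qfield.rep_eq times_qfield.rep_eq pow cp)
  then have "puiseux_of_qfield (poly p y) = poly P x"
    by (simp add: poly_altdef d)
  then have "poly p y = 0" using x z by simp
  then show "\<exists>y. poly p y = 0" ..
qed

section \<open>Infinite products in the $q$-adic topology\<close>

lemma puiseux_coeff_add: "puiseux_coeff (a + b) e = puiseux_coeff a e + puiseux_coeff (b :: 'a::ring_1 puiseux) e"
proof -
  obtain m F G where m: "m > 0" and a: "a = puiseux_of_fls m F" and b: "b = puiseux_of_fls m G"
    using puiseux_of_fls_common3[of a b b] by metis
  show ?thesis unfolding a b puiseux_of_fls_add[OF m] using m by (simp add: fls_ramify_def)
qed

text \<open>In every product of the convolution one of the two exponents falls below its bound,
  because the exponents add up to \<open>e < M + N\<close>.\<close>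

lemma puiseux_coeff_mult_eq_0:
  fixes a b :: "'a::semiring_0 puiseux"
  assumes a: "\<And>x. x < M \<Longrightarrow> puiseux_coeff a x = 0" and b: "\<And>x. x < N \<Longrightarrow> puiseux_coeff b x = 0"
    and e: "e < M + N"
  shows "puiseux_coeff (a * b) e = 0"
proof -
  obtain m F G where m: "m > 0" and aF: "a = puiseux_of_fls m F" and bG: "b = puiseux_of_fls m G"
    using puiseux_of_fls_common3[of a b b] by metis
  have z: "fls_nth F i = 0" if "of_int i / of_nat m < M" for i
    using a[OF that] m by (simp add: aF fls_ramify_def)
  have z': "fls_nth G i = 0" if "of_int i / of_nat m < N" for i
    using b[OF that] m by (simp add: bG fls_ramify_def)
  have "fls_ramify m (F * G) e = 0"
  proof (cases "e * of_nat m \<in> \<int>")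
    case True
    then obtain n where n: "e * of_nat m = of_int n" by (elim Ints_cases)
    then have en: "e = of_int n / of_nat m" using m by (simp add: field_simps)
    have "fls_nth F i * fls_nth G (n - i) = 0" for i
    proof (cases "of_int i / of_nat m < M")
      case False
      have "of_int (n - i) / of_nat m = e - of_int i / of_nat m"
        using m by (simp add: en diff_divide_distrib)
      then have "of_int (n - i) / of_nat m < N" using e False by linarith
      then show ?thesis using z' by simp
    qed (use z in simp)
    then have "fls_nth (F * G) n = 0" unfolding fls_times_nth(2) by (intro sum.neutral) blast
    then show ?thesis using n by (simp add: fls_ramify_def)
  qed (simp add: fls_ramify_def)
  then show ?thesis using m unfolding aF bG puiseux_of_fls_mult[OF m] by simp
qed

lemma puiseux_coeff_X_pow: "puiseux_coeff (puiseux_X_pow e :: 'a::{zero,one} puiseux) x = (if x = e then 1 else 0)"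
proof -
  obtain u v where q: "e = of_int u / of_int v" "v > 0"
    by (metis quotient_of_denom_pos quotient_of_div surj_pair)
  define n where "n = nat v"
  have n: "n > 0" and eu: "e * of_nat n = of_int u" using q by (auto simp: n_def)
  have "puiseux_coeff (puiseux_X_pow e :: 'a puiseux) x = fls_ramify n (fls_X_intpow u) x"
    using puiseux_X_pow_as_fls[of n e, where 'a = 'a] n eu by simp
  also have "\<dots> = (if x = e then 1 else 0)"
  proof (cases "x * of_nat n \<in> \<int>")
    case True
    then obtain k where k: "x * of_nat n = of_int k" by (elim Ints_cases)
    have "x = e \<longleftrightarrow> x * of_nat n = e * of_nat n" using n by simp
    also have "\<dots> \<longleftrightarrow> k = u" unfolding k eu by simp
    finally show ?thesis unfolding fls_ramify_def k by simp
  next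
    case False
    then have "x \<noteq> e" using eu by auto
    then show ?thesis using False by (simp add: fls_ramify_def)
  qed
  finally show ?thesis .
qed

section \<open>Lower bounds for the q-adic valuation\<close>

definition qval_ge :: "rat \<Rightarrow> qfield \<Rightarrow> bool" where
  "qval_ge N x \<longleftrightarrow> (\<forall>e<N. puiseux_coeff (puiseux_of_qfield x) e = 0)"

lemma qval_ge_0 [simp]: "qval_ge N 0"
  by (simp add: qval_ge_def zero_qfield.rep_eq zero_puiseux_def fls_ramify_def)

lemma qval_ge_add: "qval_ge N x \<Longrightarrow> qval_ge N y \<Longrightarrow> qval_ge N (x + y)"
  by (simp add: qval_ge_def plus_qfield.rep_eq puiseux_coeff_add)

lemma qval_ge_sum: "(\<And>i. i \<in> A \<Longrightarrow> qval_ge N (f i)) \<Longrightarrow> qval_ge N (\<Sum>i\<in>A. f i)"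
  by (induction A rule: infinite_finite_induct) (auto intro: qval_ge_add)

lemma qval_ge_mult: "qval_ge M x \<Longrightarrow> qval_ge N y \<Longrightarrow> qval_ge (M + N) (x * y)"
  unfolding qval_ge_def times_qfield.rep_eq by (blast intro: puiseux_coeff_mult_eq_0)

lemma qval_ge_mono: "qval_ge M x \<Longrightarrow> N \<le> M \<Longrightarrow> qval_ge N x"
  by (auto simp: qval_ge_def)

lemma qval_ge_qpow: "qval_ge e (qpow e)"
  by (simp add: qval_ge_def qpow.rep_eq puiseux_coeff_X_pow)

lemma qval_ge_ex: "\<exists>N. qval_ge N x"
proof -
  obtain m where "puiseux_den m (puiseux_coeff (puiseux_of_qfield x))" using puiseux_ex_den by blast
  then obtain N :: int where "\<forall>y. puiseux_coeff (puiseux_of_qfield x) y \<noteq> 0 \<longrightarrow> of_int N \<le> y"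
    by (auto simp: puiseux_den_def)
  then have "qval_ge (of_int N) x" by (meson leD qval_ge_def)
  then show ?thesis ..
qed

lemma qfield_tendstoI:
  fixes g :: "nat \<Rightarrow> qfield"
  assumes "\<And>N. eventually (\<lambda>n. qval_ge N (g n - L)) sequentially"
  shows "g \<longlonglongrightarrow> L"
proof (rule topological_tendstoI)
  fix S assume S: "open S" "L \<in> S"
  from S(1)[unfolded open_qfield_def, rule_format, OF S(2)] obtain N where
    N: "\<forall>y. (\<forall>e<N. puiseux_coeff (puiseux_of_qfield y) e = puiseux_coeff (puiseux_of_qfield L) e) \<longrightarrow> y \<in> S" ..
  show "\<forall>\<^sub>F n in sequentially. g n \<in> S"
  proof (rule eventually_mono[OF assms[of N]])
    fix n assume v: "qval_ge N (g n - L)"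
    have "puiseux_coeff (puiseux_of_qfield (g n)) e = puiseux_coeff (puiseux_of_qfield L) e" if "e < N" for e
    proof -
      have "g n = L + (g n - L)" by simp
      then have "puiseux_coeff (puiseux_of_qfield (g n)) e =
          puiseux_coeff (puiseux_of_qfield L) e + puiseux_coeff (puiseux_of_qfield (g n - L)) e"
        by (metis plus_qfield.rep_eq puiseux_coeff_add)
      then show ?thesis using v that by (simp add: qval_ge_def)
    qed
    then show "g n \<in> S" using N by blast
  qed
qed

lemma qpow_0 [simp]: "qpow 0 = 1"
  by transfer (rule puiseux_X_pow_0)

lemma qpow_add: "qpow (d + e) = qpow d * qpow e"
  by transfer (rule puiseux_X_pow_add)

lemma qpow_minus: "qpow (- e) = inverse (qpow e)"
  by transfer (rule puiseux_X_pow_uminus)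

lemma qpow_inject [simp]: "qpow d = qpow e \<longleftrightarrow> d = e"
proof
  assume "qpow d = qpow e"
  then have "puiseux_coeff (puiseux_of_qfield (qpow d)) d = puiseux_coeff (puiseux_of_qfield (qpow e)) d" by simp
  then show "d = e" by (simp add: qpow.rep_eq puiseux_coeff_X_pow split: if_splits)
qed simp

lemma qpow_nonzero [simp]: "qpow e \<noteq> 0"
proof
  assume "qpow e = 0"
  then have "qpow e * qpow (- e) = 0" by simp
  then show False by (simp add: qpow_add[symmetric])
qed

lemma qpow_power: "qpow e ^ n = qpow (of_nat n * e)"
  by (induction n) (simp_all add: qpow_add algebra_simps)

lemma qpow_power_int: "qpow e powi n = qpow (of_int n * e)"
  by (simp add: power_int_def qpow_power qpow_minus[symmetric])

section \<open>Rescaling the variable of a power series, and telescoping products\<close>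

definition fps_scale :: "'a::comm_ring_1 \<Rightarrow> 'a fps \<Rightarrow> 'a fps" where
  "fps_scale a F = fps_compose F (fps_const a * fps_X)"

lemma fps_scale_nth [simp]: "fps_nth (fps_scale a F) n = a ^ n * fps_nth F n"
  by (simp add: fps_scale_def fps_compose_linear)

lemma fps_scale_mult: "fps_scale a (F * G) = fps_scale a F * fps_scale (a :: 'a::idom) G"
  unfolding fps_scale_def by (rule fps_compose_mult_distrib) simp

lemma fps_scale_scale: "fps_scale a (fps_scale b F) = fps_scale (a * b) F"
  by (rule fps_ext) (simp add: power_mult_distrib mult_ac)

lemma fps_scale_1 [simp]: "fps_scale 1 F = F" and fps_scale_one [simp]: "fps_scale a 1 = 1"
  by (rule fps_ext; simp)+

lemma fps_scale_inverse:
  fixes F :: "'a::field fps"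
  assumes "fps_nth F 0 \<noteq> 0"
  shows "fps_scale a (inverse F) = inverse (fps_scale a F)"
  unfolding fps_scale_def by (rule fps_inverse_compose) (use assms in auto)

lemma fps_scale_power: "fps_scale a (F ^ n) = fps_scale (a :: 'a::idom) F ^ n"
  by (induction n) (simp_all add: fps_scale_mult)

lemma fps_scale_power_int:
  fixes F :: "'a::field fps"
  assumes "fps_nth F 0 \<noteq> 0"
  shows "fps_scale a (F powi n) = fps_scale a F powi n"
  using assms by (simp add: power_int_def fps_scale_power fps_scale_inverse)

lemma fps_scale_prod: "fps_scale a (\<Prod>i\<in>A. F i) = (\<Prod>i\<in>A. fps_scale (a :: 'a::idom) (F i))"
  by (induction A rule: infinite_finite_induct) (simp_all add: fps_scale_mult)

definition linear_fps :: "'a::comm_ring_1 \<Rightarrow> 'a fps" where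
  "linear_fps a = 1 - fps_const a * fps_X"

lemma fps_scale_linear: "fps_scale b (linear_fps a) = linear_fps (a * b)"
  by (rule fps_ext) (auto simp: linear_fps_def fps_X_def)

lemma linear_fps_nth_0 [simp]: "fps_nth (linear_fps a) 0 = 1"
  by (simp add: linear_fps_def)

text \<open>\<open>q_telescopes Q F \<Phi>\<close>: $F(z) = \Phi(z)/\Phi(Qz)$, so that $\Phi(z) = \prod_m F(Q^m z)$.\<close>

definition q_telescopes :: "'a::field \<Rightarrow> 'a fps \<Rightarrow> 'a fps \<Rightarrow> bool" where
  "q_telescopes Q F \<Phi> \<longleftrightarrow> fps_nth F 0 = 1 \<and> fps_nth \<Phi> 0 = 1 \<and> F * fps_scale Q \<Phi> = \<Phi>"

lemma q_telescopes_mult: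
  "q_telescopes Q F \<Phi> \<Longrightarrow> q_telescopes Q G \<Psi> \<Longrightarrow> q_telescopes Q (F * G) (\<Phi> * \<Psi>)"
  unfolding q_telescopes_def
proof (elim conjE, intro conjI)
  assume "F * fps_scale Q \<Phi> = \<Phi>" "G * fps_scale Q \<Psi> = \<Psi>"
  then have "(F * fps_scale Q \<Phi>) * (G * fps_scale Q \<Psi>) = \<Phi> * \<Psi>" by simp
  then show "F * G * fps_scale Q (\<Phi> * \<Psi>) = \<Phi> * \<Psi>" by (simp only: fps_scale_mult mult_ac)
qed simp_all

lemma q_telescopes_1 [simp]: "q_telescopes Q 1 1"
  by (simp add: q_telescopes_def)

lemma q_telescopes_prod:
  "(\<And>i. i \<in> A \<Longrightarrow> q_telescopes Q (F i) (\<Phi> i)) \<Longrightarrow> q_telescopes Q (\<Prod>i\<in>A. F i) (\<Prod>i\<in>A. \<Phi> i)"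
  by (induction A rule: infinite_finite_induct) (auto intro: q_telescopes_mult)

lemma q_telescopes_inverse:
  assumes "q_telescopes Q F \<Phi>" shows "q_telescopes Q (inverse F) (inverse \<Phi>)"
proof -
  have 0: "fps_nth F 0 = 1" "fps_nth \<Phi> 0 = 1" and eq: "F * fps_scale Q \<Phi> = \<Phi>"
    using assms by (auto simp: q_telescopes_def)
  have "inverse F * fps_scale Q (inverse \<Phi>) = inverse (F * fps_scale Q \<Phi>)"
    by (simp add: fps_scale_inverse fps_inverse_mult 0)
  then show ?thesis using 0 eq by (simp add: q_telescopes_def)
qed

lemma q_telescopes_power: "q_telescopes Q F \<Phi> \<Longrightarrow> q_telescopes Q (F ^ n) (\<Phi> ^ n)"
  by (induction n) (auto intro: q_telescopes_mult)

lemma q_telescopes_power_int: "q_telescopes Q F \<Phi> \<Longrightarrow> q_telescopes Q (F powi n) (\<Phi> powi n)"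
  by (auto simp: power_int_def intro: q_telescopes_power q_telescopes_inverse)

lemma q_telescopes_scale: "q_telescopes Q F \<Phi> \<Longrightarrow> q_telescopes Q (fps_scale a F) (fps_scale a \<Phi>)"
  unfolding q_telescopes_def
proof (elim conjE, intro conjI)
  assume "F * fps_scale Q \<Phi> = \<Phi>"
  then have "fps_scale a (F * fps_scale Q \<Phi>) = fps_scale a \<Phi>" by simp
  then show "fps_scale a F * fps_scale Q (fps_scale a \<Phi>) = fps_scale a \<Phi>"
    by (simp add: fps_scale_mult fps_scale_scale mult.commute)
qed simp_all

text \<open>The partial products telescope to \<open>\<Phi>(z) / \<Phi>(Q^M z)\<close>. The
  coefficient of \<open>z^i\<close> in the inverse of \<open>\<Phi>(Q^M z)\<close> carries the
  factor \<open>Q^(M i)\<close>, whose valuation is unbounded for \<open>i >= 1\<close> because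
  \<open>c > 0\<close>; only the constant term survives in the limit.\<close>

lemma has_fps_prod_telescopes:
  assumes tele: "q_telescopes (qpow c) F \<Phi>" and c: "c > 0"
  shows "has_fps_prod (\<lambda>m. fps_scale (qpow c ^ m) F) \<Phi>"
  unfolding has_fps_prod_def
proof
  fix n
  have 0: "fps_nth F 0 = 1" "fps_nth \<Phi> 0 = 1" and eq: "F * fps_scale (qpow c) \<Phi> = \<Phi>"
    using tele by (auto simp: q_telescopes_def)
  define S where "S = inverse \<Phi>"
  have "S * \<Phi> = 1" unfolding S_def using 0 by (intro inverse_mult_eq_1) simp
  have S0: "fps_nth S 0 = 1" by (simp add: S_def 0)
  have P: "(\<Prod>m<M. fps_scale (qpow c ^ m) F) * fps_scale (qpow c ^ M) \<Phi> = \<Phi>" for M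
  proof (induction M)
    case (Suc M)
    have "fps_scale (qpow c ^ M) F * fps_scale (qpow c ^ Suc M) \<Phi> = fps_scale (qpow c ^ M) (F * fps_scale (qpow c) \<Phi>)"
      by (simp add: fps_scale_mult fps_scale_scale mult.commute)
    then show ?case using Suc by (simp add: eq mult.assoc)
  qed simp
  have P': "(\<Prod>m<M. fps_scale (qpow c ^ m) F) = \<Phi> * fps_scale (qpow c ^ M) S" for M
  proof -
    have "fps_scale (qpow c ^ M) \<Phi> * fps_scale (qpow c ^ M) S = 1"
      using \<open>S * \<Phi> = 1\<close> by (simp add: fps_scale_mult[symmetric] mult.commute)
    then have "(\<Prod>m<M. fps_scale (qpow c ^ m) F) =
        (\<Prod>m<M. fps_scale (qpow c ^ m) F) * (fps_scale (qpow c ^ M) \<Phi> * fps_scale (qpow c ^ M) S)" by simp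
    then show ?thesis by (simp only: mult.assoc[symmetric] P)
  qed
  have "\<forall>i. \<exists>N. qval_ge N (fps_nth \<Phi> (n - i) * fps_nth S i)" using qval_ge_ex by blast
  then obtain v where v: "\<And>i. qval_ge (v i) (fps_nth \<Phi> (n - i) * fps_nth S i)" by metis
  show "(\<lambda>M. fps_nth (\<Prod>m<M. fps_scale (qpow c ^ m) F) n) \<longlonglongrightarrow> fps_nth \<Phi> n"
  proof (rule qfield_tendstoI)
    fix N :: rat
    \<comment> \<open>Finitely many products contribute to the coefficient of index
      \<open>n\<close>, so their valuations have a common lower bound \<open>V\<close>;
      \<open>M0\<close> is chosen such that \<open>M0 * c\<close> exceeds
      \<open>N - V\<close>.\<close>
    define V where "V = Min (v ` {0..n})"
    obtain M0 where M0: "(N - V) / c < of_nat M0" using reals_Archimedean2 by blast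
    show "\<forall>\<^sub>F M in sequentially. qval_ge N (fps_nth (\<Prod>m<M. fps_scale (qpow c ^ m) F) n - fps_nth \<Phi> n)"
    proof (rule eventually_sequentiallyI[of M0])
      fix M assume M: "M \<ge> M0"
      have "fps_nth (\<Phi> * fps_scale (qpow c ^ M) S) n - fps_nth \<Phi> n =
        (\<Sum>i=1..n. fps_nth \<Phi> (n - i) * (qpow c ^ M) ^ i * fps_nth S i)"
      proof -
        have "fps_nth (fps_scale (qpow c ^ M) S * \<Phi>) n = (\<Sum>i=0..n. (qpow c ^ M) ^ i * fps_nth S i * fps_nth \<Phi> (n - i))"
          by (simp add: fps_mult_nth)
        also have "\<dots> = fps_nth \<Phi> n + (\<Sum>i=1..n. (qpow c ^ M) ^ i * fps_nth S i * fps_nth \<Phi> (n - i))"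
          by (subst sum.atLeast_Suc_atMost) (simp_all add: S0)
        finally show ?thesis by (simp add: mult_ac)
      qed
      also have "qval_ge N \<dots>"
      proof (rule qval_ge_sum)
        fix i assume i: "i \<in> {1..n}"
        have "fps_nth \<Phi> (n - i) * (qpow c ^ M) ^ i * fps_nth S i =
          qpow (of_nat i * (of_nat M * c)) * (fps_nth \<Phi> (n - i) * fps_nth S i)"
          by (simp add: qpow_power mult_ac)
        moreover have "qval_ge (of_nat i * (of_nat M * c) + v i) (qpow (of_nat i * (of_nat M * c)) * (fps_nth \<Phi> (n - i) * fps_nth S i))"
          by (intro qval_ge_mult qval_ge_qpow v)
        moreover have "N \<le> of_nat i * (of_nat M * c) + v i"
        proof -
          have "V \<le> v i" unfolding V_def using i by (intro Min_le) auto
          have "N - V < of_nat M0 * c" using M0 c by (simp add: field_simps)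
          also have "\<dots> \<le> of_nat M * c" using M c by (intro mult_right_mono) auto
          also have "\<dots> = 1 * (of_nat M * c)" by simp
          also have "\<dots> \<le> of_nat i * (of_nat M * c)" using i c by (intro mult_right_mono) auto
          finally show ?thesis using \<open>V \<le> v i\<close> by linarith
        qed
        ultimately show "qval_ge N (fps_nth \<Phi> (n - i) * (qpow c ^ M) ^ i * fps_nth S i)"
          using qval_ge_mono by metis
      qed
      finally show "qval_ge N (fps_nth (\<Prod>m<M. fps_scale (qpow c ^ m) F) n - fps_nth \<Phi> n)"
        unfolding P' .
    qed
  qed
qed

lemma has_fps_prod_unique: "has_fps_prod f L \<Longrightarrow> has_fps_prod f L' \<Longrightarrow> L = L'"
  unfolding has_fps_prod_def by (metis LIMSEQ_unique fps_ext)

text \<open>Partial products over whole blocks form a subsequence of the original ones. With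
  \<open>T\<close> a period, the blocks become rescalings of one finite product, to which
  telescoping applies.\<close>

lemma has_fps_prod_blocks:
  assumes f: "has_fps_prod f A" and T: "T > 0"
  shows "has_fps_prod (\<lambda>m. \<Prod>v<T. f (v + T * m)) A"
  unfolding has_fps_prod_def
proof
  fix n
  have "(\<Prod>m<M. \<Prod>v<T. f (v + T * m)) = (\<Prod>u<T * M. f u)" for M
  proof (induction M)
    case (Suc M)
    have "(\<Prod>u<T * Suc M. f u) = (\<Prod>u\<in>{..<T * M}. f u) * (\<Prod>u\<in>{T * M..<T * M + T}. f u)"
      by (subst prod.union_disjoint[symmetric]) (auto intro!: prod.cong)
    also have "(\<Prod>u\<in>{T * M..<T * M + T}. f u) = (\<Prod>v<T. f (v + T * M))"
      by (rule prod.reindex_bij_witness[of _ "\<lambda>v. v + T * M" "\<lambda>u. u - T * M"]) auto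
    finally show ?case using Suc by simp
  qed simp
  moreover have "strict_mono (\<lambda>M. T * M)" using T by (intro strict_monoI) simp
  then have "(\<lambda>M. fps_nth (\<Prod>u<T * M. f u) n) \<longlonglongrightarrow> fps_nth A n"
    using f unfolding has_fps_prod_def
    using LIMSEQ_subseq_LIMSEQ[of "\<lambda>N. fps_nth (\<Prod>u<N. f u) n" _ "\<lambda>M. T * M"] by (auto simp: o_def)
  ultimately show "(\<lambda>M. fps_nth (\<Prod>m<M. \<Prod>v<T. f (v + T * m)) n) \<longlonglongrightarrow> fps_nth A n" by simp
qed

text \<open>The coefficients \<open>l\<close> solve the functional equation term by term. They are
  \<open>(-1)^n Q^(n(n-1)/2)\<close> divided by \<open>(1 - Q) ... (1 - Q^n)\<close>, Euler's
  expansion of the infinite product; \<open>c > 0\<close> keeps the denominators nonzero.\<close>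

lemma q_exponential_exists:
  assumes "c > 0"
  shows "\<exists>L. q_telescopes (qpow c) (linear_fps 1) L"
proof -
  define l where "l = rec_nat 1 (\<lambda>n x. - (qpow c ^ n) * x / (1 - qpow c ^ Suc n))"
  have l0: "l 0 = 1" and lS: "l (Suc n) = - (qpow c ^ n) * l n / (1 - qpow c ^ Suc n)" for n
    by (simp_all add: l_def)
  have ne: "1 - qpow c ^ Suc n \<noteq> 0" for n
  proof -
    have "of_nat (Suc n) * c \<noteq> 0" using assms by simp
    then have "qpow (of_nat (Suc n) * c) \<noteq> qpow 0" by (simp only: qpow_inject not_False_eq_True)
    then show ?thesis by (simp only: qpow_power[symmetric] qpow_0 right_minus_eq) argo
  qed
  have "linear_fps 1 * fps_scale (qpow c) (Abs_fps l) = Abs_fps l"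
  proof (rule fps_ext)
    fix n
    show "fps_nth (linear_fps 1 * fps_scale (qpow c) (Abs_fps l)) n = fps_nth (Abs_fps l) n"
    proof (cases n)
      case (Suc k)
      have "l (Suc k) * (1 - qpow c ^ Suc k) = - (qpow c ^ k) * l k" using ne[of k] by (simp add: lS)
      then show ?thesis using Suc by (simp add: linear_fps_def algebra_simps)
    qed (simp add: linear_fps_def algebra_simps)
  qed
  then show ?thesis unfolding q_telescopes_def using l0 by (intro exI[of _ "Abs_fps l"]) simp
qed

section \<open>The degree on the group of scaled products\<close>

text \<open>Existence and uniqueness of the limit give meaning to the description of
  \<open>varphi\<close>. From here on \<open>varphi\<close> is handled through the functional
  equation \<open>(1 - z) varphi(Q z) = varphi(z)\<close> with \<open>Q = q^(2 h)\<close>.\<close>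

lemma varphi_telescopes:
  assumes "dual_coxeter D > 0"
  shows "q_telescopes (qpow (2 * of_nat (dual_coxeter D))) (linear_fps 1) (varphi D)"
proof -
  let ?c = "2 * of_nat (dual_coxeter D) :: rat"
  have c: "?c > 0" using assms by simp
  obtain L where L: "q_telescopes (qpow ?c) (linear_fps 1) L" using q_exponential_exists[OF c] by blast
  have "(\<lambda>k. 1 - fps_const (qpow (2 * of_nat k * of_nat (dual_coxeter D))) * fps_X) =
      (\<lambda>m. fps_scale (qpow ?c ^ m) (linear_fps 1))"
    unfolding fps_scale_linear unfolding qpow_power linear_fps_def by (simp add: mult_ac)
  then have "has_fps_prod (\<lambda>k. 1 - fps_const (qpow (2 * of_nat k * of_nat (dual_coxeter D))) * fps_X) L"
    using has_fps_prod_telescopes[OF L c] by simp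
  then have "varphi D = L" unfolding varphi_def by (blast intro: has_fps_prod_unique the_equality)
  then show ?thesis using L by simp
qed

lemma varphi_scaled_conv: "varphi_scaled D a = fps_to_fls (fps_scale a (varphi D))"
  by (simp add: varphi_scaled_def fps_scale_def)

lemma order_linear_power:
  fixes a b :: "'a::field"
  assumes "a \<noteq> 0"
  shows "order (inverse a) ([:1, - b:] ^ m) = (if a = b then m else 0)"
proof (cases "a = b")
  case True
  have "[:1, - a:] = Polynomial.smult (- a) [:- inverse a, 1:]" using assms by simp
  then have "[:1, - a:] ^ m = Polynomial.smult ((- a) ^ m) ([:- inverse a, 1:] ^ m)"
    by (simp only: smult_power)
  moreover have "order (inverse a) (Polynomial.smult ((- a) ^ m) ([:- inverse a, 1:] ^ m)) = m"
  proof -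
    have "(- a) ^ m \<noteq> 0" using assms by simp
    from Polynomial.order_smult[OF this] show ?thesis by (simp only: order_power_n_n)
  qed
  ultimately show ?thesis using True by simp
next
  case False
  then have "poly ([:1, - b:] ^ m) (inverse a) \<noteq> 0" using assms by (simp add: field_simps)
  then show ?thesis using False by (simp add: order_0I)
qed

lemma order_prod_linear_power:
  fixes a :: "'a::field"
  assumes "finite S" "a \<noteq> 0"
  shows "order (inverse a) (\<Prod>b\<in>S. [:1, - b:] ^ m b) = (if a \<in> S then m a else 0)"
  using assms(1)
proof (induction S)
  case (insert b S)
  have "(\<Prod>b\<in>S. [:1, - b:] ^ m b) \<noteq> 0" using insert.hyps by simp
  then have "[:1, - b:] ^ m b * (\<Prod>b\<in>S. [:1, - b:] ^ m b) \<noteq> 0" by simp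
  then show ?case
    using insert assms(2) by (simp add: order_mult order_linear_power del: mult_eq_0_iff)
qed (simp add: order_0I)

text \<open>The exponent of \<open>linear_fps a\<close> is the multiplicity of the root
  \<open>1 / a\<close>, hence determined by the product.\<close>

lemma linear_fps_prod_unique:
  fixes S :: "'a::field set"
  assumes "finite S" "0 \<notin> S" and "(\<Prod>a\<in>S. linear_fps a ^ m a) = (\<Prod>a\<in>S. linear_fps a ^ n a)" and "a \<in> S"
  shows "m a = (n a :: nat)"
proof -
  have "linear_fps b = fps_of_poly [:1, - b:]" for b :: 'a
    by (rule fps_ext) (simp add: linear_fps_def coeff_pCons fps_X_def split: nat.split)
  then have "fps_of_poly (\<Prod>a\<in>S. [:1, - a:] ^ m a) = fps_of_poly (\<Prod>a\<in>S. [:1, - a:] ^ n a)"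
    using assms(3) by (simp only: fps_of_poly_prod fps_of_poly_power)
  then have "(\<Prod>a\<in>S. [:1, - a:] ^ m a) = (\<Prod>a\<in>S. [:1, - a:] ^ n a)"
    by (simp only: fps_of_poly_eq_iff)
  then show ?thesis
    using order_prod_linear_power[of S a m] order_prod_linear_power[of S a n] assms by force
qed

lemma fls_const_X_intpow_times_nth:
  fixes F :: "'a::field fls"
  shows "fls_nth (fls_const c * fls_X_intpow m * F) k = c * fls_nth F (k - m)"
  unfolding mult.assoc fls_X_intpow_times_conv_shift(1) by simp

definition in_coset :: "('v::finite) folding \<Rightarrow> qfield \<Rightarrow> bool" where
  "in_coset D a \<longleftrightarrow> (\<exists>k::int. a = qpow (2 * of_int k * of_nat (dual_coxeter D)))"

text \<open>A possible value of the degree. Additivity is proved for this relation without appeal to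
  uniqueness of factorizations, which is brought in by \<open>Deg_inf_eqI\<close>.\<close>

definition Deg_rel :: "('v::finite) folding \<Rightarrow> qfield fls \<Rightarrow> int \<Rightarrow> bool" where
  "Deg_rel D f n \<longleftrightarrow> (\<exists>c m \<mu>. factorization D f c m \<mu> \<and> n = (\<Sum>a | \<mu> a \<noteq> 0 \<and> in_coset D a. \<mu> a))"

lemma sum_in_coset_superset:
  assumes "finite S" "{a. \<mu> a \<noteq> 0} \<subseteq> S"
  shows "(\<Sum>a | \<mu> a \<noteq> 0 \<and> in_coset D a. \<mu> a) = (\<Sum>a\<in>S. if in_coset D a then \<mu> a else 0)"
proof -
  have "(\<Sum>a | \<mu> a \<noteq> 0 \<and> in_coset D a. \<mu> a) = (\<Sum>a | a \<in> S \<and> in_coset D a. \<mu> a)"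
    using assms by (intro sum.mono_neutral_left) auto
  also have "\<dots> = (\<Sum>a\<in>S. if in_coset D a then \<mu> a else 0)"
    using assms(1) by (simp add: sum.inter_filter[symmetric])
  finally show ?thesis .
qed

lemma prod_power_int_superset:
  assumes "finite S" "{a. \<mu> a \<noteq> 0} \<subseteq> S"
  shows "(\<Prod>a | \<mu> a \<noteq> (0::int). f a powi \<mu> a) = (\<Prod>a\<in>S. (f a :: 'a::field) powi \<mu> a)"
  using assms by (intro prod.mono_neutral_left) auto

context
  fixes D :: "('v::finite) folding"
  assumes h: "dual_coxeter D > 0"
begin

lemma varphi_nth_0: "fps_nth (varphi D) 0 = 1"
  using varphi_telescopes[OF h] by (simp add: q_telescopes_def)

lemma varphi_scaled_nonzero [simp]: "varphi_scaled D a \<noteq> 0"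
  unfolding varphi_scaled_conv by (metis fps_scale_nth fps_to_fls_eq_0_iff fps_zero_nth mult_1 power_0 varphi_nth_0 zero_neq_one)

lemma varphi_scaled_telescopes:
  "q_telescopes (qpow (2 * of_nat (dual_coxeter D))) (linear_fps a) (fps_scale a (varphi D))"
  using q_telescopes_scale[OF varphi_telescopes[OF h], of a] by (simp add: fps_scale_linear)

text \<open>After clearing negative exponents and comparing lowest terms, both factorizations give
  the same power series \<open>P\<close>. Dividing \<open>P(z)\<close> by \<open>P(Q z)\<close>
  replaces each scaled \<open>varphi\<close> by the polynomial \<open>1 - a z\<close>, and
  polynomials factor uniquely.\<close>

lemma factorization_unique:
  assumes f: "factorization D f c m \<mu>" and f': "factorization D f c' m' \<mu>'"
  shows "\<mu> = \<mu>'"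
proof -
  define S where "S = {a. \<mu> a \<noteq> 0} \<union> {a. \<mu>' a \<noteq> 0}"
  have S: "finite S" "0 \<notin> S" and c: "c \<noteq> 0" "c' \<noteq> 0" using f f' by (auto simp: S_def factorization_def)
  \<comment> \<open>Bounds all exponents in absolute value. Multiplying both sides by the
    \<open>K\<close>-th powers of all factors makes the exponents natural numbers.\<close>
  define K where "K = (\<Sum>a\<in>S. \<bar>\<mu> a\<bar> + \<bar>\<mu>' a\<bar>)"
  have K: "\<bar>\<mu> a\<bar> + \<bar>\<mu>' a\<bar> \<le> K" if "a \<in> S" for a
    unfolding K_def using S(1) that by (intro member_le_sum) auto
  define \<phi> where "\<phi> a = fps_scale a (varphi D)" for a
  define P where "P \<nu> = (\<Prod>a\<in>S. \<phi> a ^ nat (\<nu> a + K))" for \<nu> :: "qfield \<Rightarrow> int"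
  have \<phi>0: "fps_nth (\<phi> a) 0 = 1" for a by (simp add: \<phi>_def varphi_nth_0)
  have P0: "fps_nth (P \<nu>) 0 = 1" for \<nu> unfolding P_def
    by (induction S rule: infinite_finite_induct) (simp_all add: fps_power_zeroth \<phi>0)
  have PP: "(\<Prod>a\<in>S. varphi_scaled D a powi \<nu> a) * (\<Prod>a\<in>S. varphi_scaled D a powi K) = fps_to_fls (P \<nu>)"
    if "\<And>a. a \<in> S \<Longrightarrow> \<nu> a + K \<ge> 0" for \<nu>
  proof -
    have "fps_to_fls (P \<nu>) = (\<Prod>a\<in>S. fps_to_fls (\<phi> a ^ nat (\<nu> a + K)))"
      unfolding P_def by (induction S rule: infinite_finite_induct) (simp_all add: fls_times_fps_to_fls)
    also have "\<dots> = (\<Prod>a\<in>S. varphi_scaled D a powi (\<nu> a + K))"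
      using that by (intro prod.cong) (auto simp: fps_to_fls_power varphi_scaled_conv \<phi>_def power_int_def)
    finally show ?thesis by (simp add: power_int_add prod.distrib)
  qed
  have eq: "f * (\<Prod>a\<in>S. varphi_scaled D a powi K) = fls_const c * fls_X_intpow m * fps_to_fls (P \<mu>)"
    if "factorization D f c m \<mu>" "{a. \<mu> a \<noteq> 0} \<subseteq> S" "\<And>a. a \<in> S \<Longrightarrow> \<mu> a + K \<ge> 0" for c m \<mu>
    using that PP[of \<mu>] prod_power_int_superset[OF S(1) that(2), of "varphi_scaled D"]
    by (simp add: factorization_def mult.assoc)
  have "fls_const c * fls_X_intpow m * fps_to_fls (P \<mu>) = fls_const c' * fls_X_intpow m' * fps_to_fls (P \<mu>')"
    using eq[OF f] eq[OF f'] K by (force simp: S_def)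
  then have nth: "c * fls_nth (fps_to_fls (P \<mu>)) (k - m) = c' * fls_nth (fps_to_fls (P \<mu>')) (k - m')" for k
    unfolding fls_const_X_intpow_times_nth[symmetric] by (rule arg_cong)
  have "\<not> m < m'" using nth[of m] c P0 by auto
  moreover have "\<not> m' < m" using nth[of m'] c P0 by auto
  ultimately have mm: "m = m'" by simp
  then have cc: "c = c'" using nth[of m] P0 by simp
  have Peq: "P \<mu> = P \<mu>'"
  proof (rule fps_ext)
    fix n
    show "fps_nth (P \<mu>) n = fps_nth (P \<mu>') n" using nth[of "int n + m"] mm cc c by simp
  qed
  \<comment> \<open>Here the infinite products disappear: the telescoping quotient of
    \<open>P\<close> is a finite product of linear polynomials.\<close>
  have tele: "q_telescopes (qpow (2 * of_nat (dual_coxeter D))) (\<Prod>a\<in>S. linear_fps a ^ nat (\<nu> a + K)) (P \<nu>)" for \<nu>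
    unfolding P_def \<phi>_def by (intro q_telescopes_prod q_telescopes_power varphi_scaled_telescopes)
  have ne: "fps_scale (qpow (2 * of_nat (dual_coxeter D))) (P \<mu>') \<noteq> 0"
    by (metis P0 fps_scale_nth fps_zero_nth mult_1 power_0 zero_neq_one)
  have "(\<Prod>a\<in>S. linear_fps a ^ nat (\<mu> a + K)) = (\<Prod>a\<in>S. linear_fps a ^ nat (\<mu>' a + K))"
    using tele[of \<mu>] tele[of \<mu>'] ne unfolding Peq q_telescopes_def by (metis mult_right_cancel)
  from linear_fps_prod_unique[OF S this]
  have "nat (\<mu> a + K) = nat (\<mu>' a + K)" if "a \<in> S" for a using that by blast
  then have "\<mu> a = \<mu>' a" if "a \<in> S" for a using K[OF that] that by force
  moreover have "\<mu> a = \<mu>' a" if "a \<notin> S" for a using that by (simp add: S_def)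
  ultimately show ?thesis by blast
qed

lemma Deg_inf_eqI:
  assumes "Deg_rel D f n" shows "Deg_inf D f = n"
  unfolding Deg_inf_def
proof (rule the_equality)
  show "\<exists>c m \<mu>. factorization D f c m \<mu> \<and>
     n = (\<Sum>a | \<mu> a \<noteq> 0 \<and> (\<exists>k::int. a = qpow (2 * of_int k * of_nat (dual_coxeter D))). \<mu> a)"
    using assms unfolding Deg_rel_def in_coset_def .
  fix n' assume "\<exists>c m \<mu>. factorization D f c m \<mu> \<and>
     n' = (\<Sum>a | \<mu> a \<noteq> 0 \<and> (\<exists>k::int. a = qpow (2 * of_int k * of_nat (dual_coxeter D))). \<mu> a)"
  then show "n' = n"
    using assms factorization_unique unfolding Deg_rel_def in_coset_def by metis
qed

lemma Deg_rel_mult: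
  assumes "Deg_rel D f n" "Deg_rel D f' n'"
  shows "Deg_rel D (f * f') (n + n')"
proof -
  obtain c m \<mu> c' m' \<mu>' where f: "factorization D f c m \<mu>" "n = (\<Sum>a | \<mu> a \<noteq> 0 \<and> in_coset D a. \<mu> a)"
    and f': "factorization D f' c' m' \<mu>'" "n' = (\<Sum>a | \<mu>' a \<noteq> 0 \<and> in_coset D a. \<mu>' a)"
    using assms unfolding Deg_rel_def by blast
  define S where "S = {a. \<mu> a \<noteq> 0} \<union> {a. \<mu>' a \<noteq> 0}"
  have S: "finite S" using f f' by (simp add: S_def factorization_def)
  have sub: "{a. \<mu> a \<noteq> 0} \<subseteq> S" "{a. \<mu>' a \<noteq> 0} \<subseteq> S" "{a. \<mu> a + \<mu>' a \<noteq> 0} \<subseteq> S" by (auto simp: S_def)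
  have "factorization D (f * f') (c * c') (m + m') (\<lambda>a. \<mu> a + \<mu>' a)"
    unfolding factorization_def
  proof (intro conjI)
    show "finite {a. \<mu> a + \<mu>' a \<noteq> 0}" using finite_subset[OF sub(3) S] .
    have "f * f' = (fls_const c * fls_const c') * (fls_X_intpow m * fls_X_intpow m') *
        ((\<Prod>a\<in>S. varphi_scaled D a powi \<mu> a) * (\<Prod>a\<in>S. varphi_scaled D a powi \<mu>' a))"
      using f f' unfolding factorization_def prod_power_int_superset[OF S sub(1)] prod_power_int_superset[OF S sub(2)]
      by (simp add: mult_ac)
    also have "(\<Prod>a\<in>S. varphi_scaled D a powi \<mu> a) * (\<Prod>a\<in>S. varphi_scaled D a powi \<mu>' a) =
        (\<Prod>a\<in>S. varphi_scaled D a powi (\<mu> a + \<mu>' a))"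
      by (simp add: power_int_add prod.distrib)
    finally show "f * f' = fls_const (c * c') * fls_X_intpow (m + m') *
      (\<Prod>a | \<mu> a + \<mu>' a \<noteq> 0. varphi_scaled D a powi (\<mu> a + \<mu>' a))"
      unfolding prod_power_int_superset[OF S sub(3)] by (simp only: fls_const_mult_const fls_X_intpow_times_fls_X_intpow)
  qed (use f f' in \<open>auto simp: factorization_def\<close>)
  moreover have "n + n' = (\<Sum>a | \<mu> a + \<mu>' a \<noteq> 0 \<and> in_coset D a. \<mu> a + \<mu>' a)"
    unfolding f(2) f'(2) sum_in_coset_superset[OF S sub(1)] sum_in_coset_superset[OF S sub(2)]
      sum_in_coset_superset[OF S sub(3)] sum.distrib[symmetric] by (intro sum.cong) auto
  ultimately show ?thesis unfolding Deg_rel_def by blast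
qed

lemma Deg_rel_inverse:
  assumes "Deg_rel D f n" shows "Deg_rel D (inverse f) (- n)"
proof -
  obtain c m \<mu> where f: "factorization D f c m \<mu>" "n = (\<Sum>a | \<mu> a \<noteq> 0 \<and> in_coset D a. \<mu> a)"
    using assms unfolding Deg_rel_def by blast
  have "factorization D (inverse f) (inverse c) (- m) (\<lambda>a. - \<mu> a)"
    using f by (auto simp: factorization_def fls_inverse_const fls_inverse_X_intpow
        power_int_minus prod_inversef[symmetric] o_def)
  then show ?thesis unfolding Deg_rel_def f(2)
    by (intro exI[of _ "inverse c"] exI[of _ "- m"] exI[of _ "\<lambda>a. - \<mu> a"]) (simp add: sum_negf)
qed

lemma Deg_rel_const_X: "c \<noteq> 0 \<Longrightarrow> Deg_rel D (fls_const c * fls_X_intpow m) 0"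
  unfolding Deg_rel_def factorization_def by (intro exI[of _ c] exI[of _ m] exI[of _ "\<lambda>_. 0"]) simp

lemma Deg_rel_const: "c \<noteq> 0 \<Longrightarrow> Deg_rel D (fls_const c) 0"
  using Deg_rel_const_X[of c 0] by simp

lemma Deg_rel_1: "Deg_rel D 1 0"
  using Deg_rel_const[of 1] by simp

lemma Deg_rel_power: "Deg_rel D f n \<Longrightarrow> Deg_rel D (f ^ k) (int k * n)"
  by (induction k) (auto simp: Deg_rel_1 algebra_simps dest: Deg_rel_mult)

lemma Deg_rel_power_int: "Deg_rel D f n \<Longrightarrow> Deg_rel D (f powi k) (k * n)"
  using Deg_rel_power[of f n "nat k"] Deg_rel_power[of "inverse f" "- n" "nat (- k)"] Deg_rel_inverse[of f n]
  by (auto simp: power_int_def)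

lemma Deg_rel_prod:
  "(\<And>i. i \<in> A \<Longrightarrow> Deg_rel D (f i) (n i)) \<Longrightarrow> finite A \<Longrightarrow> Deg_rel D (\<Prod>i\<in>A. f i) (\<Sum>i\<in>A. n i)"
  by (induction A rule: infinite_finite_induct) (auto intro: Deg_rel_1 Deg_rel_mult)

lemma Deg_rel_varphi:
  assumes "a \<noteq> 0" shows "Deg_rel D (varphi_scaled D a) (if in_coset D a then 1 else 0)"
  unfolding Deg_rel_def factorization_def
proof (intro exI conjI)
  let ?\<mu> = "\<lambda>b. if b = a then 1 else 0 :: int"
  have [simp]: "{b. ?\<mu> b \<noteq> 0} = {a}" by auto
  have "{b. ?\<mu> b \<noteq> 0 \<and> in_coset D b} = (if in_coset D a then {a} else {})" by auto
  then show "(if in_coset D a then 1 else 0) = (\<Sum>b | ?\<mu> b \<noteq> 0 \<and> in_coset D b. ?\<mu> b)"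
    by (cases "in_coset D a") simp_all
  show "?\<mu> 0 = 0" using assms by simp
  show "finite {b. ?\<mu> b \<noteq> 0}" by simp
  show "varphi_scaled D a = fls_const 1 * fls_X_intpow 0 * (\<Prod>b | ?\<mu> b \<noteq> 0. varphi_scaled D b powi ?\<mu> b)"
    by simp
qed simp

lemma in_coset_shift: "in_coset D (a * qpow (2 * of_nat (dual_coxeter D))) \<longleftrightarrow> in_coset D a"
proof -
  let ?h = "of_nat (dual_coxeter D) :: rat"
  have 1: "a * qpow (2 * ?h) = qpow (2 * of_int (k + 1) * ?h)" if "a = qpow (2 * of_int k * ?h)" for k
    unfolding that qpow_add[symmetric] by (simp add: algebra_simps)
  have 2: "a = qpow (2 * of_int (k - 1) * ?h)" if "a * qpow (2 * ?h) = qpow (2 * of_int k * ?h)" for k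
  proof -
    have "a * qpow (2 * ?h) = qpow (2 * of_int (k - 1) * ?h) * qpow (2 * ?h)"
      unfolding that qpow_add[symmetric] by (simp add: algebra_simps)
    then show ?thesis by simp
  qed
  show ?thesis unfolding in_coset_def using 1 2 by blast
qed

text \<open>For nonzero \<open>a\<close>, \<open>1 - a z\<close> is the quotient of
  \<open>varphi(a z)\<close> by \<open>varphi(a Q z)\<close>. As \<open>a\<close> is a power of
  \<open>Q\<close> if and only if \<open>a Q\<close> is, the two contributions cancel.\<close>

lemma Deg_rel_linear: "Deg_rel D (fps_to_fls (linear_fps a)) 0"
proof (cases "a = 0")
  case True
  then show ?thesis using Deg_rel_1 by (simp add: linear_fps_def)
next
  case False
  let ?Q = "qpow (2 * of_nat (dual_coxeter D))"
  have "linear_fps a * fps_scale (a * ?Q) (varphi D) = fps_scale a (varphi D)"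
    using varphi_scaled_telescopes[of a] by (simp add: q_telescopes_def fps_scale_scale mult.commute)
  then have "fps_to_fls (linear_fps a) * varphi_scaled D (a * ?Q) = varphi_scaled D a"
    by (metis fls_times_fps_to_fls varphi_scaled_conv)
  then have "fps_to_fls (linear_fps a) = varphi_scaled D a * inverse (varphi_scaled D (a * ?Q))"
    by (metis divide_inverse nonzero_mult_div_cancel_right varphi_scaled_nonzero)
  moreover have "Deg_rel D (varphi_scaled D a * inverse (varphi_scaled D (a * ?Q)))
      ((if in_coset D a then 1 else 0) + - (if in_coset D (a * ?Q) then 1 else 0))"
    using False by (intro Deg_rel_mult Deg_rel_inverse Deg_rel_varphi) auto
  ultimately show ?thesis by (simp add: in_coset_shift)
qed

text \<open>Algebraic closedness splits the polynomial into linear factors. The factor with root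
  \<open>x\<close> is the monomial for \<open>x = 0\<close> and a constant times
  \<open>1 - z / x\<close> otherwise; all of these contribute 0.\<close>

lemma Deg_rel_poly:
  assumes "p \<noteq> 0" shows "Deg_rel D (fps_to_fls (fps_of_poly p)) 0"
  using assms
proof (induction "Polynomial.degree p" arbitrary: p)
  case 0
  then obtain c where "p = [:c:]" "c \<noteq> 0" by (metis degree_eq_zeroE pCons_0_0)
  then show ?case using Deg_rel_const[of c] by (simp add: fps_of_poly_pCons)
next
  case (Suc n)
  then obtain x where "poly p x = 0" using alg_closed_imp_poly_has_root[of p] by auto
  then obtain q where q: "p = [:- x, 1:] * q" by (auto simp: poly_eq_0_iff_dvd dvd_def)
  have q0: "q \<noteq> 0" using Suc.prems q by auto
  then have "Polynomial.degree q = n" using Suc.hyps(2) q by (simp add: degree_mult_eq del: mult_pCons_left)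
  then have "Deg_rel D (fps_to_fls (fps_of_poly q)) 0" using Suc.hyps(1) q0 by blast
  moreover have "Deg_rel D (fps_to_fls (fps_of_poly [:- x, 1:])) 0"
  proof (cases "x = 0")
    case True
    then show ?thesis using Deg_rel_const_X[of 1 1] by (simp add: fps_of_poly_pCons fls_X_conv_shift_1)
  next
    case False
    have "fps_of_poly [:- x, 1:] = fps_const (- x) * linear_fps (inverse x)"
      using False by (simp add: linear_fps_def algebra_simps fps_const_mult[symmetric] mult.assoc[symmetric])
    then show ?thesis
      using Deg_rel_mult[OF Deg_rel_const[of "- x"] Deg_rel_linear[of "inverse x"]] False
      by (simp only: fls_times_fps_to_fls fps_const_to_fls) simp
  qed
  ultimately show ?case
    using Deg_rel_mult[of "fps_to_fls (fps_of_poly [:- x, 1:])" 0 "fps_to_fls (fps_of_poly q)" 0] q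
    by (simp only: fps_of_poly_mult fls_times_fps_to_fls) simp
qed

end

section \<open>Foldings and parity functions\<close>

lemma ADE_adj_sym: "ADE_diagram a \<Longrightarrow> a x y \<Longrightarrow> a y x"
  unfolding ADE_diagram_def by blast

lemma ADE_adj_irrefl:
  assumes "ADE_diagram a" shows "\<not> a x x"
proof -
  obtain n edges f where "edges = edges_A n \<and> n \<ge> 1 \<or> edges = edges_D n \<and> n \<ge> 4 \<or> edges = edges_E n \<and> n \<in> {6, 7, 8}"
    and a: "\<forall>x y. a x y \<longleftrightarrow> (f x, f y) \<in> edges \<or> (f y, f x) \<in> edges"
    using assms unfolding ADE_diagram_def by blast
  then have "(c, c) \<notin> edges" for c
    by (auto simp: edges_A_def edges_D_def edges_E_def)
  then show ?thesis using a by blast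
qed

locale folding =
  fixes D :: "('v::finite) folding"
  assumes folding: "is_folding D"
begin

abbreviation "\<sigma> \<equiv> aut D"
abbreviation "r \<equiv> fold_order D"

lemma ADE: "ADE_diagram (adj D)" and bij_aut: "bij \<sigma>" and adj_aut: "adj D (\<sigma> x) (\<sigma> y) = adj D x y"
  and not_adj_aut: "\<not> adj D x (\<sigma> x)" and r_cases: "r = 1 \<or> r = 2 \<or> r = 3"
  using folding by (auto simp: is_folding_def)

lemma adj_sym: "adj D x y \<Longrightarrow> adj D y x" by (rule ADE_adj_sym[OF ADE])
lemma adj_irrefl [simp]: "\<not> adj D x x" by (rule ADE_adj_irrefl[OF ADE])
lemma inj_aut: "inj \<sigma>" using bij_aut by (rule bij_is_inj)

lemma r_pos: "r > 0" using r_cases by auto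

lemma aut_pow_r: "\<sigma> ^^ r = id" and aut_pow_less: "0 < n \<Longrightarrow> n < r \<Longrightarrow> \<sigma> ^^ n \<noteq> id"
proof -
  have "r \<in> {1, 2, 3}" using r_cases by blast
  moreover have "\<exists>n. n > 0 \<and> \<sigma> ^^ n = id"
  proof -
    have "permutation \<sigma>" using bij_aut by (simp add: permutation)
    then show ?thesis by (metis permutation_is_nilpotent)
  qed
  from LeastI_ex[OF this] show "\<sigma> ^^ r = id" by (simp add: fold_order_def)
  show "\<sigma> ^^ n \<noteq> id" if "0 < n" "n < r"
    using not_less_Least[of n "\<lambda>n. n > 0 \<and> \<sigma> ^^ n = id"] that by (auto simp: fold_order_def)
qed

lemma aut_pow_r_apply: "(\<sigma> ^^ r) x = x" by (simp add: aut_pow_r)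

lemma adj_aut_pow: "adj D ((\<sigma> ^^ n) x) ((\<sigma> ^^ n) y) = adj D x y"
  by (induction n) (simp_all add: adj_aut)

lemma orbit_image: "orbit D x = (\<lambda>n. (\<sigma> ^^ n) x) ` {..<r}"
proof -
  have "(\<sigma> ^^ n) x = (\<sigma> ^^ (n mod r)) x" for n
    using funpow_mod_eq[of r \<sigma> x n] aut_pow_r_apply by simp
  then have "(\<sigma> ^^ n) x \<in> (\<lambda>n. (\<sigma> ^^ n) x) ` {..<r}" for n
    using r_pos by (metis imageI lessThan_iff mod_less_divisor)
  then show ?thesis unfolding orbit_def by blast
qed

lemma finite_orbit [simp]: "finite (orbit D x)" by simp
lemma self_in_orbit [simp]: "x \<in> orbit D x" unfolding orbit_def by (metis funpow_0 rangeI)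

lemma orbit_fixed: "\<sigma> x = x \<Longrightarrow> orbit D x = {x}"
proof -
  assume "\<sigma> x = x"
  then have "(\<sigma> ^^ n) x = x" for n by (induction n) simp_all
  then show ?thesis by (auto simp: orbit_def)
qed

text \<open>The order \<open>r\<close> is 1 or a prime, so a point that is moved has trivial
  stabilizer. Beyond \<open>n = 1\<close> the only case is \<open>n = 2\<close>,
  \<open>r = 3\<close>, where the square and the cube both fixing \<open>x\<close> would force
  \<open>\<sigma> x = x\<close>.\<close>

lemma inj_on_orbit: "\<sigma> x \<noteq> x \<Longrightarrow> inj_on (\<lambda>n. (\<sigma> ^^ n) x) {..<r}"
proof -
  assume nf: "\<sigma> x \<noteq> x"
  have "(\<sigma> ^^ n) x \<noteq> x" if "0 < n" "n < r" for n
  proof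
    assume eq: "(\<sigma> ^^ n) x = x"
    have "n = 1 \<or> n = 2 \<and> r = 3" using that r_cases by auto
    then show False
    proof
      assume "n = 2 \<and> r = 3"
      then have "\<sigma> (\<sigma> x) = x" "\<sigma> (\<sigma> (\<sigma> x)) = x" using eq aut_pow_r_apply[of x]
        by (auto simp: numeral_2_eq_2 numeral_3_eq_3)
      then show False using nf by simp
    qed (use eq nf in simp)
  qed note ne = this
  show ?thesis
  proof (rule linorder_inj_onI)
    fix m n assume mn: "m < n" "m \<in> {..<r}" "n \<in> {..<r}"
    show "(\<sigma> ^^ m) x \<noteq> (\<sigma> ^^ n) x"
    proof
      assume "(\<sigma> ^^ m) x = (\<sigma> ^^ n) x"
      moreover have "(\<sigma> ^^ n) x = (\<sigma> ^^ m) ((\<sigma> ^^ (n - m)) x)"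
        using mn by (simp add: funpow_add[symmetric, unfolded o_def, THEN fun_cong])
      moreover have "inj (\<sigma> ^^ m)" using inj_aut by (rule inj_fn)
      ultimately have "x = (\<sigma> ^^ (n - m)) x" by (metis injD)
      then have "(\<sigma> ^^ (n - m)) x = x" by (rule sym)
      moreover have "0 < n - m" "n - m < r" using mn by auto
      ultimately show False using ne by blast
    qed
  qed auto
qed

lemma dn_cases: "\<sigma> x = x \<and> dn D x = 1 \<or> \<sigma> x \<noteq> x \<and> dn D x = int r"
proof (cases "\<sigma> x = x")
  case False
  then have "card (orbit D x) = r" unfolding orbit_image using inj_on_orbit by (simp add: card_image)
  then show ?thesis using False by (simp add: dn_def)
qed (simp add: dn_def orbit_fixed)

lemma dn_pos: "dn D x > 0" using dn_cases[of x] r_pos by auto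

lemma dn_1_or_r: "dn D x = 1 \<or> dn D x = int r" using dn_cases[of x] by auto

lemma dn_1_fixed: "dn D x = 1 \<Longrightarrow> \<sigma> x = x"
proof -
  assume "dn D x = 1"
  then have "card (orbit D x) = 1" by (simp add: dn_def)
  then obtain a where "orbit D x = {a}" by (rule card_1_singletonE)
  moreover have "(\<sigma> ^^ 1) x \<in> orbit D x" unfolding orbit_def by (rule rangeI)
  ultimately show ?thesis using self_in_orbit[of x] by auto
qed

lemma dn_fixed: "dn D x = 1 \<Longrightarrow> (\<sigma> ^^ n) x = x"
  using dn_1_fixed[of x] by (induction n) simp_all

lemma aut_pow_dn: "(\<sigma> ^^ nat (dn D x)) x = x"
  using dn_1_or_r[of x] dn_fixed[of x] aut_pow_r_apply[of x] by auto

lemma orbit_aut: "orbit D (\<sigma> x) = orbit D x"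
proof -
  have "(\<sigma> ^^ n) x \<in> orbit D (\<sigma> x)" for n
  proof -
    have "(\<sigma> ^^ n) x = (\<sigma> ^^ (n + r)) x" by (simp add: funpow_add aut_pow_r)
    also have "\<dots> = (\<sigma> ^^ (n + r - 1)) (\<sigma> x)"
      using r_pos by (metis Suc_diff_1 add_gr_0 funpow_Suc_right o_apply)
    finally show ?thesis by (auto simp: orbit_def)
  qed
  moreover have "(\<sigma> ^^ n) (\<sigma> x) \<in> orbit D x" for n
    unfolding orbit_def by (metis funpow_Suc_right o_apply rangeI)
  ultimately show ?thesis by (auto simp: orbit_def)
qed

lemma orbit_aut_pow: "orbit D ((\<sigma> ^^ n) x) = orbit D x"
  by (induction n) (simp_all add: orbit_aut)

lemma dn_aut: "dn D (\<sigma> x) = dn D x" by (simp add: dn_def orbit_aut)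
lemma dn_aut_pow: "dn D ((\<sigma> ^^ n) x) = dn D x" by (simp add: dn_def orbit_aut_pow)

lemma orbitE:
  assumes "y \<in> orbit D x"
  obtains l where "int l < dn D x" "y = (\<sigma> ^^ l) x"
proof -
  obtain l where l: "l < r" "y = (\<sigma> ^^ l) x" using assms by (auto simp: orbit_image)
  show ?thesis
  proof (cases "dn D x = 1")
    case True
    then show ?thesis using that[of 0] l dn_fixed[of x] by simp
  next
    case False
    then show ?thesis using that[of l] l dn_1_or_r[of x] by auto
  qed
qed

lemma orbit_eq: "y \<in> orbit D x \<Longrightarrow> orbit D y = orbit D x"
  by (metis orbitE orbit_aut_pow)

lemma orbit_mem_powE:
  assumes "orbit D z = orbit D y"
  obtains l where "l < r" "y = (\<sigma> ^^ l) z"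
proof -
  have "y \<in> orbit D z" unfolding assms by (rule self_in_orbit)
  then show ?thesis using that by (auto simp: orbit_image)
qed

lemma nodes_eq_orbit: "i \<in> nodes D \<Longrightarrow> x \<in> i \<Longrightarrow> i = orbit D x"
  unfolding nodes_def using orbit_eq by auto

lemma orbit_in_nodes [simp]: "orbit D x \<in> nodes D" by (simp add: nodes_def)

lemma nodes_nonempty: "i \<in> nodes D \<Longrightarrow> \<exists>x. x \<in> i" unfolding nodes_def using self_in_orbit by blast

lemma card_node: "i \<in> nodes D \<Longrightarrow> x \<in> i \<Longrightarrow> int (card i) = dn D x"
  using nodes_eq_orbit by (simp add: dn_def)

lemma finite_nodes [simp]: "finite (nodes D)" by (simp add: nodes_def)

text \<open>A folding excludes edges between \<open>x\<close> and \<open>\<sigma> x\<close>. The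
  remaining pair, \<open>x\<close> and its second image for \<open>r = 3\<close>, is of the same
  kind because one further step returns to \<open>x\<close>.\<close>

lemma not_adj_orbit: "y \<in> orbit D x \<Longrightarrow> \<not> adj D x y"
proof -
  assume "y \<in> orbit D x"
  then obtain l where l: "l < r" "y = (\<sigma> ^^ l) x" by (auto simp: orbit_image)
  then have "l = 0 \<or> l = 1 \<or> l = 2 \<and> r = 3" using r_cases by auto
  then show ?thesis
  proof (elim disjE conjE)
    assume "l = 2" "r = 3"
    then have "\<sigma> y = x" using l aut_pow_r_apply[of x] by (simp add: numeral_2_eq_2 numeral_3_eq_3)
    then show ?thesis using not_adj_aut[of y] adj_sym by blast
  qed (use l not_adj_aut in auto)
qed

lemma adj_nodes_orbit_iff: "adj_nodes D (orbit D x) (orbit D y) \<longleftrightarrow> (\<exists>l. adj D x ((\<sigma> ^^ l) y))"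
proof
  assume "adj_nodes D (orbit D x) (orbit D y)"
  then obtain a b where ab: "a < r" "b < r" "adj D ((\<sigma> ^^ a) x) ((\<sigma> ^^ b) y)"
    by (auto simp: adj_nodes_def orbit_image)
  then have "adj D ((\<sigma> ^^ (r - a)) ((\<sigma> ^^ a) x)) ((\<sigma> ^^ (r - a)) ((\<sigma> ^^ b) y))" by (simp add: adj_aut_pow)
  moreover have "(\<sigma> ^^ (r - a)) ((\<sigma> ^^ a) x) = x"
    using ab aut_pow_r_apply[of x] by (simp add: funpow_add[symmetric, unfolded o_def, THEN fun_cong])
  ultimately have "adj D x ((\<sigma> ^^ (r - a + b)) y)" by (simp add: funpow_add)
  then show "\<exists>l. adj D x ((\<sigma> ^^ l) y)" ..
next
  assume "\<exists>l. adj D x ((\<sigma> ^^ l) y)"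
  then show "adj_nodes D (orbit D x) (orbit D y)"
    unfolding adj_nodes_def by (metis orbit_aut_pow self_in_orbit)
qed

lemma adj_fixed_orbit: "dn D x = 1 \<Longrightarrow> adj D x y \<Longrightarrow> y' \<in> orbit D y \<Longrightarrow> adj D x y'"
  by (metis adj_aut_pow dn_fixed orbitE)

end

locale parity_folding = folding D for D :: "('v::finite) folding" +
  fixes \<epsilon> :: "'v \<Rightarrow> int"
  assumes parity: "parity_function D \<epsilon>"
begin

definition vertex :: "'v \<Rightarrow> int \<Rightarrow> bool" where
  "vertex x p \<longleftrightarrow> 2 * dn D x dvd p - \<epsilon> x"

lemma rep_vertices_iff: "(x, p) \<in> rep_vertices D \<epsilon> \<longleftrightarrow> vertex x p"
  by (simp add: rep_vertices_def vertex_def)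

lemma eps_aut_pow: "2 * dn D x dvd \<epsilon> ((\<sigma> ^^ l) x) - \<epsilon> x + 2 * int l"
  using parity unfolding parity_function_def cong_iff_dvd_diff by (simp add: algebra_simps)

lemma eps_orbit_parity: "orbit D x = orbit D y \<Longrightarrow> even (\<epsilon> x - \<epsilon> y)"
  using parity unfolding parity_function_def cong_iff_dvd_diff by blast

lemma vertex_shift: "vertex x (p + 2 * dn D x * n) \<longleftrightarrow> vertex x p"
proof -
  have "p + 2 * dn D x * n - \<epsilon> x = (p - \<epsilon> x) + 2 * dn D x * n" by simp
  moreover have "2 * dn D x dvd 2 * dn D x * n" by simp
  ultimately show ?thesis unfolding vertex_def by (simp only: dvd_add_left_iff)
qed

lemma vertex_minus: "vertex x (p - 2 * dn D x) \<longleftrightarrow> vertex x p"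
  using vertex_shift[of x p "-1"] by simp

lemma vertex_diff: "vertex x p \<Longrightarrow> vertex x p' \<Longrightarrow> 2 * dn D x dvd p' - p"
  unfolding vertex_def using dvd_diff[of "2 * dn D x" "p' - \<epsilon> x" "p - \<epsilon> x"] by simp

lemma vertex_close: "vertex x p \<Longrightarrow> vertex x p' \<Longrightarrow> \<bar>p' - p\<bar> < 2 * dn D x \<Longrightarrow> p' = p"
  using vertex_diff[of x p p'] dvd_imp_le_int[of "p' - p" "2 * dn D x"] dn_pos[of x] by fastforce

lemma vertex_aut: "vertex (\<sigma> x) (p - 2) \<longleftrightarrow> vertex x p"
proof -
  have "2 * dn D x dvd \<epsilon> (\<sigma> x) - \<epsilon> x + 2" using eps_aut_pow[of x 1] by simp
  moreover have "p - 2 - \<epsilon> (\<sigma> x) = (p - \<epsilon> x) - (\<epsilon> (\<sigma> x) - \<epsilon> x + 2)" by simp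
  ultimately show ?thesis unfolding vertex_def dn_aut by (simp only: dvd_diff_left_iff)
qed

lemma vertex_aut_pow: "vertex ((\<sigma> ^^ l) x) (p - 2 * int l) \<longleftrightarrow> vertex x p"
proof (induction l)
  case (Suc l)
  have "vertex ((\<sigma> ^^ Suc l) x) (p - 2 * int (Suc l)) \<longleftrightarrow> vertex (\<sigma> ((\<sigma> ^^ l) x)) ((p - 2 * int l) - 2)"
    by (simp add: algebra_simps)
  then show ?case using Suc vertex_aut by blast
qed simp

lemma vertex_orbit_unique: "vertex x p \<Longrightarrow> y \<in> orbit D x \<Longrightarrow> vertex y p \<Longrightarrow> y = x"
proof -
  assume x: "vertex x p" and y: "y \<in> orbit D x" "vertex y p"
  from y(1) obtain l where l: "int l < dn D x" "y = (\<sigma> ^^ l) x" by (rule orbitE)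
  have "vertex y (p - 2 * int l)" using x l vertex_aut_pow by simp
  then have "p - 2 * int l = p"
    using y(2) l dn_aut_pow[of l x] by (intro vertex_close[of y]) auto
  then show "y = x" using l by simp
qed

text \<open>Along the orbit the residue of \<open>\<epsilon>\<close> modulo \<open>2 d\<close> moves
  in steps of 2, so every residue of the right parity is attained. Together with
  \<open>vertex_orbit_unique\<close> this is the bijectivity of the projection from vertices to
  pairs of an orbit and a time.\<close>

lemma vertex_orbit_exists:
  assumes "even (p - \<epsilon> x)"
  obtains y where "y \<in> orbit D x" "vertex y p"
proof -
  obtain m where m: "p - \<epsilon> x = 2 * m" using assms by (elim evenE)
  define l where "l = nat ((- m) mod dn D x)"
  have l: "int l = (- m) mod dn D x" unfolding l_def using dn_pos[of x] by simp
  have "dn D x dvd int l + m" unfolding l minus_div_mult_eq_mod[symmetric] by simp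
  then have "2 * dn D x dvd 2 * (int l + m)" by (rule mult_dvd_mono[OF dvd_refl])
  moreover have "p + 2 * int l - \<epsilon> x = 2 * (int l + m)" using m by simp
  ultimately have "vertex x (p + 2 * int l)" by (simp only: vertex_def)
  then have "vertex ((\<sigma> ^^ l) x) p" using vertex_aut_pow[of l x "p + 2 * int l"] by simp
  moreover have "(\<sigma> ^^ l) x \<in> orbit D x" by (simp add: orbit_def)
  ultimately show ?thesis using that by blast
qed

lemma vertex_parity: "vertex x p \<Longrightarrow> even (p - \<epsilon> x)"
  unfolding vertex_def by (meson dvd_trans dvd_triv_left)

abbreviation mind :: "'v \<Rightarrow> 'v \<Rightarrow> int" where "mind x y \<equiv> min (dn D x) (dn D y)"

lemma vertex_adj:
  assumes "adj D x y" "vertex x p" "vertex y p'"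
  shows "2 * mind x y dvd p' - p - mind x y"
proof -
  have e: "2 * mind x y dvd \<epsilon> x - (\<epsilon> y + mind x y)"
    using parity assms(1) unfolding parity_function_def cong_iff_dvd_diff by blast
  have "mind x y = dn D x \<or> mind x y = dn D y" "mind x y = 1 \<or> dn D x = dn D y"
    using dn_1_or_r[of x] dn_1_or_r[of y] r_pos by (auto simp: min_def)
  then have "mind x y dvd dn D x" "mind x y dvd dn D y" by auto
  then have "2 * mind x y dvd p - \<epsilon> x" "2 * mind x y dvd p' - \<epsilon> y"
    using assms(2,3) unfolding vertex_def by (meson dvd_trans mult_dvd_mono dvd_refl)+
  then have "2 * mind x y dvd (p' - \<epsilon> y) - (p - \<epsilon> x) - (\<epsilon> x - (\<epsilon> y + mind x y)) - 2 * mind x y"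
    using e dvd_refl[of "2 * mind x y"] by (blast intro: dvd_diff)
  moreover have "(p' - \<epsilon> y) - (p - \<epsilon> x) - (\<epsilon> x - (\<epsilon> y + mind x y)) - 2 * mind x y = p' - p - mind x y"
    by simp
  ultimately show ?thesis by (simp only:)
qed

lemma mind_pos: "mind x y > 0" using dn_pos by simp

lemma vertex_adj_neq: "adj D x y \<Longrightarrow> vertex x p \<Longrightarrow> vertex y p' \<Longrightarrow> p' \<noteq> p"
proof
  assume a: "adj D x y" "vertex x p" "vertex y p'" "p' = p"
  then have "2 * mind x y dvd mind x y" using vertex_adj[OF a(1-3)] by simp
  then show False using mind_pos[of x y] zdvd_not_zless[of "mind x y" "2 * mind x y"] by auto
qed

end

section \<open>Periodicity of the mesh recursions\<close>

lemma antiperiodic_imp_periodic: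
  fixes b :: "int \<Rightarrow> rat"
  assumes "\<And>u. b (u + m) = - b (u - m)"
  shows "b (u + 4 * m) = b u"
  using assms[of "u + 3 * m"] assms[of "u + m"] by (simp add: algebra_simps)

text \<open>d'Alembert's formula for the discrete wave equation on a path with a boundary at 0.\<close>

lemma path_wave:
  fixes c :: "nat \<Rightarrow> int \<Rightarrow> rat"
  assumes "\<And>u. c 0 u = 0" and "\<And>a u. 1 \<le> a \<Longrightarrow> a < m \<Longrightarrow> c a (u + \<delta>) + c a (u - \<delta>) = c (a - 1) u + c (a + 1) u"
    and "a < m"
  shows "c (Suc a) u = c a (u - \<delta>) + c 1 (u + \<delta> * int a)" and "c (Suc a) u = c a (u + \<delta>) + c 1 (u - \<delta> * int a)"
proof -
  have "c (Suc a) u = c a (u - \<delta>) + c 1 (u + \<delta> * int a) \<and> c (Suc a) u = c a (u + \<delta>) + c 1 (u - \<delta> * int a)" for u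
    using assms(3)
  proof (induction a arbitrary: u)
    case (Suc a)
    have "c (Suc a) (u + \<delta>) = c a u + c 1 (u + \<delta> + \<delta> * int a)"
      "c (Suc a) (u - \<delta>) = c a u + c 1 (u - \<delta> - \<delta> * int a)"
      using Suc.IH[of "u + \<delta>"] Suc.IH[of "u - \<delta>"] Suc.prems by simp_all
    moreover have "c (Suc a) (u + \<delta>) + c (Suc a) (u - \<delta>) = c a u + c (Suc (Suc a)) u"
      using assms(2)[of "Suc a" u] Suc.prems by simp
    ultimately show ?case by (simp add: algebra_simps)
  qed (simp add: assms(1))
  then show "c (Suc a) u = c a (u - \<delta>) + c 1 (u + \<delta> * int a)" "c (Suc a) u = c a (u + \<delta>) + c 1 (u - \<delta> * int a)"
    by blast+
qed

text \<open>The wave formula expresses each \<open>c (Suc a)\<close> through \<open>c a\<close> and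
  \<open>c 1\<close>, so a period of \<open>c 1\<close> spreads along the path.\<close>

lemma path_periodic:
  fixes c :: "nat \<Rightarrow> int \<Rightarrow> rat"
  assumes c: "\<And>u. c 0 u = 0" "\<And>a u. 1 \<le> a \<Longrightarrow> a < m \<Longrightarrow> c a (u + \<delta>) + c a (u - \<delta>) = c (a - 1) u + c (a + 1) u"
    and P: "\<And>u. c 1 (u + P) = c 1 u" and "a \<le> m"
  shows "c a (u + P) = c a u"
  using assms(4)
proof (induction a arbitrary: u)
  case (Suc a)
  have "c (Suc a) v = c a (v - \<delta>) + c 1 (v + \<delta> * int a)" for v
    by (rule path_wave(1)[of c m \<delta>, OF c]) (use Suc.prems in simp_all)
  then show ?case using Suc.IH[of "u - \<delta>"] P[of "u + \<delta> * int a"] Suc.prems by (simp add: algebra_simps)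
qed (simp add: c)

text \<open>The boundary condition at the far end, read through the forward and the backward form of
  \<open>path_wave\<close>, expresses one and the same value of \<open>c n\<close> in two ways;
  comparing them gives the period of \<open>c 1\<close>.\<close>

lemma period_A:
  fixes c :: "nat \<Rightarrow> int \<Rightarrow> rat"
  assumes c: "\<And>u. c 0 u = 0" "\<And>u. c (Suc n) u = 0"
    "\<And>a u. 1 \<le> a \<Longrightarrow> a \<le> n \<Longrightarrow> c a (u + 1) + c a (u - 1) = c (a - 1) u + c (a + 1) u"
    and "a \<le> n"
  shows "c a (u + 2 * (int n + 1)) = c a u"
proof (rule path_periodic[of c "Suc n" 1])
  fix u
  have w: "c (Suc n) v = c n (v - 1) + c 1 (v + 1 * int n)" "c (Suc n) v = c n (v + 1) + c 1 (v - 1 * int n)" for v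
    by (rule path_wave[of c "Suc n" 1]; use c in simp)+
  show "c 1 (u + 2 * (int n + 1)) = c 1 u"
    using w(1)[of "u + int n + 2"] w(2)[of "u + int n"] c(2) by (simp add: algebra_simps)
qed (use assms in auto)

text \<open>Inserting both forms of \<open>path_wave\<close> into the relation of the last node
  cancels the values of \<open>c (n - 1)\<close> and leaves
  \<open>c 1 (u + m) = - c 1 (u - m)\<close> with \<open>m = 2 n - 1\<close>.\<close>

lemma period_B:
  fixes c :: "nat \<Rightarrow> int \<Rightarrow> rat"
  assumes c: "\<And>u. c 0 u = 0"
    "\<And>a u. 1 \<le> a \<Longrightarrow> a < n \<Longrightarrow> c a (u + 2) + c a (u - 2) = c (a - 1) u + c (a + 1) u"
    "\<And>u. c n (u + 1) + c n (u - 1) = c (n - 1) (u + 1) + c (n - 1) (u - 1)"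
    and n: "n \<ge> 2" "a \<le> n"
  shows "c a (u + 4 * (2 * int n - 1)) = c a u"
proof (rule path_periodic[of c n 2])
  fix u
  obtain k where k: "n = Suc k" using n by (cases n) auto
  have w: "c n v = c k (v - 2) + c 1 (v + 2 * int k)" "c n v = c k (v + 2) + c 1 (v - 2 * int k)" for v
    unfolding k by (rule path_wave[of c n 2]; use c k in simp)+
  have "c 1 (v + (2 * int n - 1)) = - c 1 (v - (2 * int n - 1))" for v
    using w(2)[of "v - 1"] w(1)[of "v + 1"] c(3)[of v] k by (simp add: algebra_simps)
  then show "c 1 (u + 4 * (2 * int n - 1)) = c 1 u" by (rule antiperiodic_imp_periodic)
qed (use assms in auto)

text \<open>The wave formula holds up to the node before the last. The relations there express
  \<open>c 1 (v + n)\<close> and \<open>c 1 (v - n)\<close> through \<open>c n\<close>; eliminating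
  \<open>c n\<close> gives antiperiodicity with \<open>m = n + 1\<close>.\<close>

lemma period_C:
  fixes c :: "nat \<Rightarrow> int \<Rightarrow> rat"
  assumes c: "\<And>u. c 0 u = 0"
    "\<And>a u. 1 \<le> a \<Longrightarrow> a < n - 1 \<Longrightarrow> c a (u + 1) + c a (u - 1) = c (a - 1) u + c (a + 1) u"
    "\<And>u. c (n - 1) (u + 1) + c (n - 1) (u - 1) = c (n - 2) u + c n (u + 1) + c n (u - 1)"
    "\<And>u. c n (u + 2) + c n (u - 2) = c (n - 1) u"
    and n: "n \<ge> 3" "a \<le> n"
  shows "c a (u + 4 * (int n + 1)) = c a u"
proof -
  define k where "k = n - 2"
  have k: "n = Suc (Suc k)" using n by (simp add: k_def)
  note simps = k diff_Suc_1
  have w: "c (Suc k) v = c k (v - 1) + c 1 (v + 1 * int k)" "c (Suc k) v = c k (v + 1) + c 1 (v - 1 * int k)" for v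
    by (rule path_wave[of c "Suc k" 1]; use c k in simp)+
  have m: "c (Suc k) (v + 1) + c (Suc k) (v - 1) = c k v + c n (v + 1) + c n (v - 1)"
    "c n (v + 2) + c n (v - 2) = c (Suc k) v" for v using c(3,4)[of v] k by simp_all
  have b1: "c 1 (v + int n) = c n v - c n (v - 2)" for v
    using w(1)[of "v + 2"] m(1)[of "v + 1"] m(2)[of v] k by (simp add: algebra_simps)
  have b2: "c 1 (v - int n) = c n v - c n (v + 2)" for v
    using w(2)[of "v - 2"] m(1)[of "v - 1"] m(2)[of v] k by (simp add: algebra_simps)
  have "c 1 (v + (int n + 1)) = - c 1 (v - (int n + 1))" for v
    using b1[of "v + 1"] b2[of "v - 1"] by (simp add: algebra_simps)
  then have P1: "c 1 (v + 4 * (int n + 1)) = c 1 v" for v by (rule antiperiodic_imp_periodic)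
  have P: "c a (v + 4 * (int n + 1)) = c a v" if "a \<le> n - 1" for a v
    by (rule path_periodic[of c "n - 1" 1]) (use c P1 that in auto)
  show ?thesis
  proof (cases "a = n")
    case True
    have Pk: "c (Suc k) (v + 4 * (int n + 1)) = c (Suc k) v" for v using P[of "Suc k"] k by simp
    \<comment> \<open>The wave formula does not reach the last node. The defect \<open>e\<close> of
      periodicity there has period 2 and satisfies \<open>e (v + 2) + e (v - 2) = 0\<close>, so
      \<open>2 * e = 0\<close>.\<close>
    define e where "e v = c n (v + 4 * (int n + 1)) - c n v" for v
    have e1: "e v = e (v - 2)" for v
      using b1[of v] b1[of "v + 4 * (int n + 1)"] P1[of "v + int n"] by (simp add: e_def algebra_simps)
    have e2: "e (v + 2) + e (v - 2) = 0" for v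
      using m(2)[of v] m(2)[of "v + 4 * (int n + 1)"] Pk[of v] by (simp add: e_def algebra_simps)
    have "e u = 0" using e1[of "u + 2"] e1[of u] e2[of u] by simp
    then show ?thesis using True by (simp add: e_def)
  next
    case False
    then show ?thesis using n(2) by (intro P) simp
  qed
qed

lemma period_D:
  fixes c :: "nat \<Rightarrow> int \<Rightarrow> rat"
  assumes c: "\<And>u. c 0 u = 0"
    "\<And>a u. 1 \<le> a \<Longrightarrow> a < n - 2 \<Longrightarrow> c a (u + 1) + c a (u - 1) = c (a - 1) u + c (a + 1) u"
    "\<And>u. c (n - 2) (u + 1) + c (n - 2) (u - 1) = c (n - 3) u + c (n - 1) u + c n u"
    "\<And>u. c (n - 1) (u + 1) + c (n - 1) (u - 1) = c (n - 2) u"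
    "\<And>u. c n (u + 1) + c n (u - 1) = c (n - 2) u"
    and n: "n \<ge> 4" "a \<le> n"
  shows "c a (u + 4 * (int n - 1)) = c a u"
proof -
  define k where "k = n - 3"
  have k: "n = Suc (Suc (Suc k))" using n by (simp add: k_def)
  define p q where "p = c (n - 1)" and "q = c n"
  have w: "c (Suc k) v = c k (v - 1) + c 1 (v + 1 * int k)" "c (Suc k) v = c k (v + 1) + c 1 (v - 1 * int k)" for v
    by (rule path_wave[of c "Suc k" 1]; use c k in simp)+
  have m: "c (Suc k) (v + 1) + c (Suc k) (v - 1) = c k v + p v + q v"
    "p (v + 1) + p (v - 1) = c (Suc k) v" "q (v + 1) + q (v - 1) = c (Suc k) v" for v
    using c(3,4,5)[of v] k by (simp_all add: p_def q_def)
  have b1: "c 1 (v + (int n - 1)) = p (v + 1) + q (v + 1) - c (Suc k) v" for v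
    using w(1)[of "v + 2"] m(1)[of "v + 1"] k by (simp add: algebra_simps)
  have b2: "c 1 (v - (int n - 1)) = p (v - 1) + q (v - 1) - c (Suc k) v" for v
    using w(2)[of "v - 2"] m(1)[of "v - 1"] k by (simp add: algebra_simps)
  have "c 1 (v + (int n - 1)) = - c 1 (v - (int n - 1))" for v
    using b1[of v] b2[of v] m(2,3)[of v] by linarith
  then have P1: "c 1 (v + 4 * (int n - 1)) = c 1 v" for v by (rule antiperiodic_imp_periodic)
  have P: "c a (v + 4 * (int n - 1)) = c a v" if "a \<le> n - 2" for a v
    by (rule path_periodic[of c "n - 2" 1]) (use c P1 that in auto)
  have Ps: "p (v + 4 * (int n - 1)) + q (v + 4 * (int n - 1)) = p v + q v" for v
    using b1[of "v - 1"] b1[of "v - 1 + 4 * (int n - 1)"] P1[of "v - 1 + (int n - 1)"] P[of "Suc k" "v - 1"] k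
    by (simp add: algebra_simps)
  \<comment> \<open>The difference of the two tips changes sign under a shift by 2, hence has period
    4, of which the claimed period is a multiple. Their sum is controlled by
    \<open>c 1\<close>.\<close>
  have d4: "p (v + 4) - q (v + 4) = p v - q v" for v
    using m(2,3)[of "v + 3"] m(2,3)[of "v + 1"] by (simp add: algebra_simps)
  have Pd: "p (v + 4 * int l) - q (v + 4 * int l) = p v - q v" for v l
  proof (induction l)
    case (Suc l)
    then show ?case using d4[of "v + 4 * int l"] by (simp add: algebra_simps)
  qed simp
  have "p (u + 4 * (int n - 1)) = p u \<and> q (u + 4 * (int n - 1)) = q u"
    using Ps[of u] Pd[of u "n - 1"] n by (simp add: of_nat_diff)
  moreover consider "a \<le> n - 2" | "a = n - 1" | "a = n" using n by linarith
  ultimately show ?thesis by (cases; use P p_def q_def in auto)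
qed

text \<open>All nodes are eliminated in favour of one sequence \<open>b\<close>: each
  \<open>c a\<close> is an integral Laurent polynomial in the shift, applied to \<open>b\<close>.
  The vanishing node beyond the end then becomes one linear recurrence for \<open>b\<close>.\<close>

lemma period_E:
  fixes c :: "nat \<Rightarrow> int \<Rightarrow> rat"
  assumes n: "n \<in> {6, 7, 8}" and a: "a \<in> {1..n}"
    and c1: "\<And>u. c 1 (u + 1) + c 1 (u - 1) = c 3 u" and c2: "\<And>u. c 2 (u + 1) + c 2 (u - 1) = c 4 u"
    and c3: "\<And>u. c 3 (u + 1) + c 3 (u - 1) = c 1 u + c 4 u"
    and c4: "\<And>u. c 4 (u + 1) + c 4 (u - 1) = c 2 u + c 3 u + c 5 u"
    and c5: "\<And>a u. 5 \<le> a \<Longrightarrow> a \<le> n \<Longrightarrow> c a (u + 1) + c a (u - 1) = c (a - 1) u + c (a + 1) u"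
    and last: "\<And>u. c (Suc n) u = 0"
  shows "c a (u + (if n = 6 then 24 else if n = 7 then 36 else 60)) = c a u"
proof -
  \<comment> \<open>This is \<open>c 3 - c 2\<close>. With this choice \<open>c 1\<close>, and by
    the mesh relations every other node, can be recovered from \<open>b\<close>.\<close>
  define b where "b u = c 1 (u + 1) + c 1 (u - 1) - c 2 u" for u
  have d1: "c 1 u = b (u + 1) + b (u - 1)" for u
    using c1[of "u + 1"] c1[of "u - 1"] c2[of u] c3[of u] by (simp add: b_def algebra_simps)
  have d2: "c 2 u = b (u + 2) + b u + b (u - 2)" for u
    using d1[of "u + 1"] d1[of "u - 1"] by (simp add: b_def algebra_simps)
  have d3: "c 3 u = b (u + 2) + 2 * b u + b (u - 2)" for u
    using d1[of "u + 1"] d1[of "u - 1"] c1[of u] by (simp add: algebra_simps)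
  have d4: "c 4 u = b (u + 3) + 2 * b (u + 1) + 2 * b (u - 1) + b (u - 3)" for u
    using d3[of "u + 1"] d3[of "u - 1"] d1[of u] c3[of u] by (simp add: algebra_simps)
  have d5: "c 5 u = b (u + 4) + b (u + 2) + b u + b (u - 2) + b (u - 4)" for u
    using d4[of "u + 1"] d4[of "u - 1"] d3[of u] d2[of u] c4[of u] by (simp add: algebra_simps)
  have d6: "c 6 u = b (u + 5) + b (u + 3) + b (u - 3) + b (u - 5)" for u
    using d5[of "u + 1"] d5[of "u - 1"] d4[of u] c5[of 5 u] n by (auto simp: algebra_simps)
  have d7: "c 7 u = b (u + 6) + b (u + 4) - b u + b (u - 4) + b (u - 6)" for u
    using d6[of "u + 1"] d6[of "u - 1"] d5[of u] c5[of 6 u] n by (auto simp: algebra_simps)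
  have d8: "c 8 u = b (u + 7) + b (u + 5) - b (u + 1) - b (u - 1) + b (u - 5) + b (u - 7)" if "n > 6" for u
    using d7[of "u + 1"] d7[of "u - 1"] d6[of u] c5[of 7 u] n that by (auto simp: algebra_simps)
  have d9: "c 9 u = b (u + 8) + b (u + 6) - b (u + 2) - b u - b (u - 2) + b (u - 6) + b (u - 8)" if "n = 8" for u
    using d8[of "u + 1"] d8[of "u - 1"] d7[of u] c5[of 8 u] that by (auto simp: algebra_simps)
  define P :: int where "P = (if n = 6 then 24 else if n = 7 then 36 else 60)"
  have b: "b (u + P) = b u" for u
  proof -
    consider "n = 6" | "n = 7" | "n = 8" using n by auto
    then show ?thesis
    proof cases
      case 1
      have R: "b (v + 6) + b (v + 4) - b v + b (v - 4) + b (v - 6) = 0" for v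
        using d7[of v] last[of v] 1 by (simp add: eval_nat_numeral)
      \<comment> \<open>Centred at \<open>u + 12\<close>, the instances of \<open>R\<close> are the
        terms of the cofactor that turns the polynomial of the recurrence, in the shift
        \<open>x\<close>, into \<open>x^12 - x^-12\<close>. The cofactors for \<open>E_7\<close> and
        \<open>E_8\<close> below lead to \<open>x^9 + x^-9\<close> and
        \<open>x^15 + x^-15\<close>.\<close>
      show ?thesis
        using R[of "u + 18"] R[of "u + 16"] R[of "u + 14"] R[of "u + 10"] R[of "u + 8"] R[of "u + 6"] 1
        by (simp add: P_def algebra_simps)
    next
      case 2
      have R: "b (v + 7) + b (v + 5) - b (v + 1) - b (v - 1) + b (v - 5) + b (v - 7) = 0" for v
        using d8[of v] last[of v] 2 by (simp add: eval_nat_numeral)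
      have "b (v + 9) = - b (v - 9)" for v
        using R[of "v + 2"] R[of v] R[of "v - 2"] by (simp add: algebra_simps)
      from antiperiodic_imp_periodic[of b 9, OF this] show ?thesis using 2 by (simp add: P_def)
    next
      case 3
      have R: "b (v + 8) + b (v + 6) - b (v + 2) - b v - b (v - 2) + b (v - 6) + b (v - 8) = 0" for v
        using d9[of v] last[of v] 3 by (simp add: eval_nat_numeral)
      have "b (v + 15) = - b (v - 15)" for v
        using R[of "v + 7"] R[of "v + 5"] R[of "v + 3"] R[of "v - 3"] R[of "v - 5"] R[of "v - 7"] by (simp add: algebra_simps)
      from antiperiodic_imp_periodic[of b 15, OF this] show ?thesis using 3 by (simp add: P_def)
    qed
  qed
  have bs: "b (u + P + k) = b (u + k)" "b (u + P - k) = b (u - k)" for u k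
    using b[of "u + k"] b[of "u - k"] by (simp_all add: algebra_simps)
  have "a = 1 \<or> a = 2 \<or> a = 3 \<or> a = 4 \<or> a = 5 \<or> a = 6 \<or> a = 7 \<or> a = 8 \<and> n = 8" using n a by auto
  moreover have "c 8 (u + P) = c 8 u" if "n = 8"
  proof -
    have "n > 6" using that by simp
    then show ?thesis by (simp only: d8 bs b)
  qed
  ultimately have "c a (u + P) = c a u"
    by (elim disjE conjE) (simp_all only: d1 d2 d3 d4 d5 d6 d7 bs b)
  then show ?thesis by (simp add: P_def)
qed

text \<open>Elimination towards \<open>c 1\<close> gives \<open>b (v + 6) = b v - b (v - 6)\<close>.
  A sequence with \<open>t (k + 1) = t k - t (k - 1)\<close> has period 6, hence the period
  36.\<close>

lemma period_F4:
  fixes c :: "nat \<Rightarrow> int \<Rightarrow> rat"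
  assumes a: "a \<in> {1..4}"
    and c1: "\<And>u. c 1 (u + 2) + c 1 (u - 2) = c 2 u" and c2: "\<And>u. c 2 (u + 2) + c 2 (u - 2) = c 1 u + c 3 u"
    and c3: "\<And>u. c 3 (u + 1) + c 3 (u - 1) = c 2 (u + 1) + c 2 (u - 1) + c 4 u"
    and c4: "\<And>u. c 4 (u + 1) + c 4 (u - 1) = c 3 u"
  shows "c a (u + 36) = c a u"
proof -
  define b where "b = c 1"
  have d2: "c 2 u = b (u + 2) + b (u - 2)" for u using c1[of u] by (simp add: b_def)
  have d3: "c 3 u = b (u + 4) + b u + b (u - 4)" for u
    using c2[of u] d2[of "u + 2"] d2[of "u - 2"] by (simp add: b_def algebra_simps)
  have d4: "c 4 u = b (u + 5) + b (u - 5)" for u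
    using c3[of u] d3[of "u + 1"] d3[of "u - 1"] d2[of "u + 1"] d2[of "u - 1"] by (simp add: algebra_simps)
  have R: "b (v + 6) = b v - b (v - 6)" for v
    using c4[of v] d4[of "v + 1"] d4[of "v - 1"] d3[of v] by (simp add: algebra_simps)
  have b: "b (v + 36) = b v" for v
    using R[of "v + 30"] R[of "v + 24"] R[of "v + 18"] R[of "v + 12"] R[of "v + 6"] by (simp add: algebra_simps)
  have bs: "b (u + 36 + k) = b (u + k)" "b (u + 36 - k) = b (u - k)" for u k
    using b[of "u + k"] b[of "u - k"] by (simp_all add: algebra_simps)
  have "a = 1 \<or> a = 2 \<or> a = 3 \<or> a = 4" using a by auto
  then show ?thesis
    by (elim disjE) (simp_all only: b_def[symmetric] d2 d3 d4 bs b)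
qed

text \<open>The same recurrence of period 6 as for \<open>period_F4\<close>, with step 4 in place of
  6.\<close>

lemma period_G2:
  fixes c :: "nat \<Rightarrow> int \<Rightarrow> rat"
  assumes a: "a \<in> {1..2}" and c1: "\<And>u. c 1 (u + 3) + c 1 (u - 3) = c 2 u"
    and c2: "\<And>u. c 2 (u + 1) + c 2 (u - 1) = c 1 (u + 2) + c 1 u + c 1 (u - 2)"
  shows "c a (u + 24) = c a u"
proof -
  have R: "c 1 (v + 4) = c 1 v - c 1 (v - 4)" for v
    using c2[of v] c1[of "v + 1"] c1[of "v - 1"] by (simp add: algebra_simps)
  have b: "c 1 (v + 24) = c 1 v" for v
    using R[of "v + 20"] R[of "v + 16"] R[of "v + 12"] R[of "v + 8"] R[of "v + 4"] by (simp add: algebra_simps)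
  have "a = 1 \<or> a = 2" using a by auto
  then show ?thesis
    using b[of u] b[of "u + 3"] b[of "u - 3"] c1[of u] c1[of "u + 24"] by (auto simp: algebra_simps)
qed

section \<open>Classification of foldings\<close>

definition nbr :: "(nat \<times> nat) set \<Rightarrow> nat \<Rightarrow> nat \<Rightarrow> bool" where
  "nbr e a b \<longleftrightarrow> (a, b) \<in> e \<or> (b, a) \<in> e"

lemma nbr_A: "nbr (edges_A n) a b \<longleftrightarrow> 1 \<le> a \<and> a \<le> n \<and> 1 \<le> b \<and> b \<le> n \<and> (b = Suc a \<or> a = Suc b)"
  by (auto simp: nbr_def edges_A_def)

lemma nbr_D:
  assumes "m \<ge> 2"
  shows "nbr (edges_D (m + 2)) a b \<longleftrightarrow> (b = Suc a \<and> 1 \<le> a \<and> a \<le> m) \<or> (a = Suc b \<and> 1 \<le> b \<and> b \<le> m) \<or>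
    (a = m \<and> b = m + 2) \<or> (a = m + 2 \<and> b = m)"
  using assms by (auto simp: nbr_def edges_D_def)

lemma nbr_E: "nbr (edges_E n) a b \<longleftrightarrow> (a = 1 \<and> b = 3) \<or> (a = 3 \<and> b = 1) \<or> (a = 2 \<and> b = 4) \<or> (a = 4 \<and> b = 2) \<or>
    (b = Suc a \<and> 3 \<le> a \<and> a < n) \<or> (a = Suc b \<and> 3 \<le> b \<and> b < n)"
  by (auto simp: nbr_def edges_E_def)

locale diagram_aut =
  fixes n :: nat and e :: "(nat \<times> nat) set" and s :: "nat \<Rightarrow> nat"
  assumes rng: "a \<in> {1..n} \<Longrightarrow> s a \<in> {1..n}"
    and inj: "a \<in> {1..n} \<Longrightarrow> b \<in> {1..n} \<Longrightarrow> s a = s b \<Longrightarrow> a = b"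
    and nbr: "a \<in> {1..n} \<Longrightarrow> b \<in> {1..n} \<Longrightarrow> nbr e (s a) (s b) = nbr e a b"
begin

lemma surj: assumes "c \<in> {1..n}" obtains a where "a \<in> {1..n}" "s a = c"
proof -
  have "s ` {1..n} = {1..n}"
  proof (rule endo_inj_surj)
    show "s ` {1..n} \<subseteq> {1..n}" using rng by blast
    show "inj_on s {1..n}" using inj by (rule inj_onI)
  qed simp
  then show ?thesis using that assms by (metis imageE)
qed

text \<open>If the end 1 went to an interior vertex, the preimages of the two neighbours of its
  image would be distinct neighbours of 1. So it goes to an end, and the rest of the path follows
  step by step.\<close>

lemma aut_A:
  assumes e: "e = edges_A n"
  shows "(\<forall>a\<in>{1..n}. s a = a) \<or> (\<forall>a\<in>{1..n}. s a = n + 1 - a)"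
proof (cases "n \<le> 1")
  case True
  then have "s a = a" if "a \<in> {1..n}" for a using rng[OF that] that by auto
  then show ?thesis by blast
next
  case False
  have e2: "1 \<in> {1..n}" "2 \<in> {1..n}" using False by auto
  have "s 1 = 1 \<or> s 1 = n"
  proof (rule ccontr)
    assume not: "\<not> ?thesis"
    then have c: "1 < s 1" "s 1 < n" using rng[OF e2(1)] by auto
    have c': "s 1 - 1 \<in> {1..n}" "s 1 + 1 \<in> {1..n}" using c by auto
    obtain p where p: "p \<in> {1..n}" "s p = s 1 - 1" using surj[OF c'(1)] .
    obtain q where q: "q \<in> {1..n}" "s q = s 1 + 1" using surj[OF c'(2)] .
    have "nbr e 1 p" "nbr e 1 q" using nbr[OF e2(1) p(1)] nbr[OF e2(1) q(1)] p q c by (auto simp: e nbr_A)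
    then have "p = 2" "q = 2" by (auto simp: e nbr_A)
    then show False using p q by simp
  qed
  then show ?thesis
  proof
    assume s1: "s 1 = 1"
    have "s a = a \<and> s (Suc a) = Suc a" if "1 \<le> a" "a < n" for a
      using that
    proof (induction a rule: nat_induct_at_least)
      case base
      have "nbr e (s 1) (s 2)" using nbr[OF e2] False by (simp add: e nbr_A)
      then show ?case using s1 by (auto simp: e nbr_A numeral_2_eq_2)
    next
      case (Suc a)
      have i: "a \<in> {1..n}" "Suc a \<in> {1..n}" "Suc (Suc a) \<in> {1..n}" using Suc by auto
      have IH: "s a = a" "s (Suc a) = Suc a" using Suc by auto
      have "nbr e (s (Suc a)) (s (Suc (Suc a)))" using nbr[OF i(2,3)] Suc by (simp add: e nbr_A)
      then have "s (Suc (Suc a)) = Suc (Suc a) \<or> s (Suc (Suc a)) = a" using IH by (auto simp: e nbr_A)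
      then show ?case using inj[OF i(3,1)] IH by auto
    qed note st = this
    have "s a = a" if "a \<in> {1..n}" for a
      using st[of a] st[of "a - 1"] that s1 by (cases "a = 1"; cases "a = n") auto
    then show ?thesis by blast
  next
    assume s1: "s 1 = n"
    have "s a = n + 1 - a \<and> s (Suc a) = n - a" if "1 \<le> a" "a < n" for a
      using that
    proof (induction a rule: nat_induct_at_least)
      case base
      have "nbr e (s 1) (s 2)" using nbr[OF e2] False by (simp add: e nbr_A)
      then show ?case using s1 by (auto simp: e nbr_A numeral_2_eq_2)
    next
      case (Suc a)
      have i: "a \<in> {1..n}" "Suc a \<in> {1..n}" "Suc (Suc a) \<in> {1..n}" using Suc by auto
      have IH: "s a = n + 1 - a" "s (Suc a) = n - a" using Suc by auto
      have "nbr e (s (Suc a)) (s (Suc (Suc a)))" using nbr[OF i(2,3)] Suc by (simp add: e nbr_A)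
      then have "s (Suc (Suc a)) = n - Suc a \<or> s (Suc (Suc a)) = n + 1 - a" using IH by (auto simp: e nbr_A)
      then show ?case using inj[OF i(3,1)] IH by auto
    qed note st = this
    have "s a = n + 1 - a" if "a \<in> {1..n}" for a
      using st[of a] st[of "a - 1"] that s1 by (cases "a = 1"; cases "a = n") auto
    then show ?thesis by blast
  qed
qed

text \<open>The branch vertex is the only one with three neighbours.\<close>

lemma aut_D_branch:
  assumes e: "e = edges_D n" and n: "n = m + 2" "m \<ge> 2"
  shows "s m = m"
proof (rule ccontr)
  assume ne: "s m \<noteq> m"
  have i: "m \<in> {1..n}" "m - 1 \<in> {1..n}" "m + 1 \<in> {1..n}" "m + 2 \<in> {1..n}" using n by auto
  have "nbr e m (m - 1)" "nbr e m (m + 1)" "nbr e m (m + 2)" unfolding e n(1) nbr_D[OF n(2)] using n by auto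
  then have "nbr e (s m) (s (m - 1))" "nbr e (s m) (s (m + 1))" "nbr e (s m) (s (m + 2))" using nbr i by blast+
  moreover have "s (m - 1) \<noteq> s (m + 1)" "s (m - 1) \<noteq> s (m + 2)" "s (m + 1) \<noteq> s (m + 2)"
    using inj[OF i(2,3)] inj[OF i(2,4)] inj[OF i(3,4)] by auto
  ultimately show False unfolding e n(1) nbr_D[OF n(2)] using ne by linarith
qed

text \<open>For \<open>m >= 3\<close> the vertex \<open>m - 1\<close> is the only neighbour of the
  branch vertex with a further neighbour, so the long leg is fixed pointwise and only the two tips
  can be exchanged. In \<open>D_4\<close> all three legs look alike, hence its separate
  treatment.\<close>

lemma aut_D:
  assumes e: "e = edges_D n" and n: "n = m + 2" "m \<ge> 3"
  shows "(\<forall>a\<in>{1..m}. s a = a) \<and> (s (m + 1) = m + 1 \<and> s (m + 2) = m + 2 \<or> s (m + 1) = m + 2 \<and> s (m + 2) = m + 1)"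
proof -
  have m2: "m \<ge> 2" using n by simp
  have nb: "nbr e a b \<longleftrightarrow> (b = Suc a \<and> 1 \<le> a \<and> a \<le> m) \<or> (a = Suc b \<and> 1 \<le> b \<and> b \<le> m) \<or>
    (a = m \<and> b = m + 2) \<or> (a = m + 2 \<and> b = m)" for a b unfolding e n(1) by (rule nbr_D[OF m2])
  have sm: "s m = m" by (rule aut_D_branch[OF e n(1) m2])
  have i: "m \<in> {1..n}" "m - 1 \<in> {1..n}" "m - 2 \<in> {1..n}" "m + 1 \<in> {1..n}" "m + 2 \<in> {1..n}" using n by auto
  have sm1: "s (m - 1) = m - 1"
  proof -
    have "nbr e m (m - 1)" "nbr e (m - 1) (m - 2)" unfolding nb using n by linarith+
    then have "nbr e (s m) (s (m - 1))" "nbr e (s (m - 1)) (s (m - 2))" using nbr i by blast+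
    moreover have "s (m - 2) \<noteq> m" using inj[OF i(3,1)] sm n by auto
    ultimately show ?thesis unfolding nb sm by linarith
  qed
  have "s (m - k) = m - k \<and> s (m - Suc k) = m - Suc k" if "Suc k < m" for k
    using that
  proof (induction k)
    case (Suc k)
    define c where "c = m - Suc (Suc k)"
    have c: "1 \<le> c" "m - Suc k = Suc c" "m - k = Suc (Suc c)" using Suc.prems by (auto simp: c_def)
    have j: "Suc (Suc c) \<in> {1..n}" "Suc c \<in> {1..n}" "c \<in> {1..n}" using Suc.prems n c by auto
    have IH: "s (Suc (Suc c)) = Suc (Suc c)" "s (Suc c) = Suc c" using Suc c by auto
    have "nbr e (Suc c) c" unfolding nb using c Suc.prems by linarith
    then have "nbr e (Suc c) (s c)" using nbr[OF j(2,3)] IH by simp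
    moreover have "s c \<noteq> Suc (Suc c)" using inj[OF j(3,1)] IH by auto
    moreover have "Suc c \<noteq> m" "Suc c \<le> m" using c Suc.prems by linarith+
    ultimately have "s c = c" unfolding nb by linarith
    then show ?case using IH c by (simp add: c_def)
  qed (use sm sm1 in simp)
  note st = this
  have "s a = a" if "a \<in> {1..m}" for a
  proof (cases "a = m")
    case False
    then show ?thesis using st[of "m - Suc a"] that by (auto simp: Suc_diff_Suc)
  qed (simp add: sm)
  moreover have "s (m + 1) = m + 1 \<or> s (m + 1) = m + 2" "s (m + 2) = m + 1 \<or> s (m + 2) = m + 2"
  proof -
    have "nbr e m (m + 1)" "nbr e m (m + 2)" unfolding nb using n by linarith+
    then have "nbr e (s m) (s (m + 1))" "nbr e (s m) (s (m + 2))" using nbr i by blast+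
    moreover have "s (m + 1) \<noteq> m - 1" "s (m + 2) \<noteq> m - 1" using inj[OF i(4,2)] inj[OF i(5,2)] sm1 by auto
    ultimately show "s (m + 1) = m + 1 \<or> s (m + 1) = m + 2" "s (m + 2) = m + 1 \<or> s (m + 2) = m + 2"
      unfolding nb sm by linarith+
  qed
  ultimately show ?thesis using inj[OF i(4,5)] by auto
qed

text \<open>The legs at the branch vertex 4 have lengths 1, 2 and \<open>n - 4\<close>. The shortest
  is fixed, and the other two can be exchanged only if \<open>n = 6\<close>.\<close>

lemma aut_E:
  assumes e: "e = edges_E n" and n: "n \<in> {6, 7, 8}"
  shows "(\<forall>a\<in>{1..n}. s a = a) \<or> n = 6 \<and> s 1 = 6 \<and> s 2 = 2 \<and> s 3 = 5 \<and> s 4 = 4 \<and> s 5 = 3 \<and> s 6 = 1"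
proof -
  note nb = nbr_E[of n, folded e]
  have i: "1 \<in> {1..n}" "2 \<in> {1..n}" "3 \<in> {1..n}" "4 \<in> {1..n}" "5 \<in> {1..n}" "6 \<in> {1..n}" using n by auto
  have ne: "s a \<noteq> s b" if "a \<in> {1..n}" "b \<in> {1..n}" "a \<noteq> b" for a b using inj that by blast
  have ed: "nbr e 4 2" "nbr e 4 3" "nbr e 4 5" "nbr e 3 1" "nbr e 5 6" unfolding nb using n by auto
  have sd: "nbr e (s 4) (s 2)" "nbr e (s 4) (s 3)" "nbr e (s 4) (s 5)" "nbr e (s 3) (s 1)" "nbr e (s 5) (s 6)"
    using nbr i ed by blast+
  have s4: "s 4 = 4"
  proof (rule ccontr)
    assume "s 4 \<noteq> 4"
    with sd(1-3) ne[OF i(2,3)] ne[OF i(2,5)] ne[OF i(3,5)] show False unfolding nb by linarith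
  qed
  have b4: "nbr e 4 b \<Longrightarrow> b = 2 \<or> b = 3 \<or> b = 5" for b by (auto simp: nb)
  have n4: "s 2 = 2 \<or> s 2 = 3 \<or> s 2 = 5" "s 3 = 2 \<or> s 3 = 3 \<or> s 3 = 5" "s 5 = 2 \<or> s 5 = 3 \<or> s 5 = 5"
    using sd(1-3) b4 unfolding s4 by blast+
  have b2: "nbr e 2 b \<Longrightarrow> b = 4" for b by (auto simp: nb)
  have s3: "s 3 \<noteq> 2"
  proof
    assume "s 3 = 2"
    then have "s 1 = 4" using sd(4) b2 by simp
    then show False using s4 ne[OF i(1) i(4)] by simp
  qed
  have s5: "s 5 \<noteq> 2"
  proof
    assume "s 5 = 2"
    then have "s 6 = 4" using sd(5) b2 by simp
    then show False using s4 ne[OF i(6) i(4)] by simp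
  qed
  have s2: "s 2 = 2" using n4 s3 s5 ne[OF i(2) i(3)] ne[OF i(2) i(5)] ne[OF i(3) i(5)] by auto
  have b3: "nbr e 3 b \<Longrightarrow> b = 1 \<or> b = 4" for b by (auto simp: nb)
  have b5: "nbr e 5 b \<Longrightarrow> b = 4 \<or> b = 6" for b by (auto simp: nb)
  have b6: "nbr e 6 b \<Longrightarrow> b = 5 \<or> b = 7" for b by (auto simp: nb)
  have b1: "nbr e 1 b \<Longrightarrow> b = 3" for b by (auto simp: nb)
  have n14: "s 1 \<noteq> 4" "s 6 \<noteq> 4" using ne[OF i(1) i(4)] ne[OF i(6) i(4)] s4 by simp_all
  consider "s 3 = 3" "s 5 = 5" | "s 3 = 5" "s 5 = 3"
    using n4 s3 s5 ne[OF i(3) i(5)] by auto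
  then show ?thesis
  proof cases
    case 1
    then have s16: "s 1 = 1" "s 6 = 6" using sd(4,5) b3[of "s 1"] b5[of "s 6"] n14 by simp_all
    have s7: "s 7 = 7" if "n \<ge> 7"
    proof -
      have i7: "7 \<in> {1..n}" using that by simp
      have "nbr e 6 7" unfolding nb using that by simp
      then have "nbr e 6 (s 7)" using nbr[OF i(6) i7] s16 by simp
      then show ?thesis using b6 ne[OF i7 i(5)] 1 by auto
    qed
    have s8: "s 8 = 8" if "n = 8"
    proof -
      have i78: "7 \<in> {1..n}" "8 \<in> {1..n}" using that by simp_all
      have "nbr e 7 8" unfolding nb using that by simp
      then have "nbr e 7 (s 8)" using nbr[OF i78] s7 that by simp
      moreover have "s 8 \<noteq> 6" using ne[OF i78(2) i(6)] s16 by simp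
      ultimately show ?thesis unfolding nb by linarith
    qed
    moreover have "a = 1 \<or> a = 2 \<or> a = 3 \<or> a = 4 \<or> a = 5 \<or> a = 6 \<or> a = 7 \<and> n \<ge> 7 \<or> a = 8 \<and> n = 8" if "a \<in> {1..n}" for a
      using n that by auto
    ultimately have "s a = a" if "a \<in> {1..n}" for a
      using that s2 s4 1 s16 s7 s8 by (elim meta_allE[of _ a]) auto
    then show ?thesis by blast
  next
    case 2
    then have s16: "s 1 = 6" "s 6 = 1" using sd(4,5) b3[of "s 6"] b5[of "s 1"] n14 by simp_all
    have "n = 6"
    proof (rule ccontr)
      assume "n \<noteq> 6"
      then have "7 \<in> {1..n}" using n by auto
      moreover have "nbr e 6 7" unfolding nb using \<open>n \<noteq> 6\<close> n by auto
      then have "nbr e 1 (s 7)" using nbr[OF i(6) \<open>7 \<in> {1..n}\<close>] s16 by simp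
      then have "s 7 = 3" by (rule b1)
      ultimately show False using ne[of 7 5] 2 i by auto
    qed
    then show ?thesis using 2 s16 s2 s4 by simp
  qed
qed

end

text \<open>The edge set records mere adjacency of orbits; the multiplicities of bonds are encoded
  in the orbit sizes \<open>d\<close>. This is why all nontrivial foldings can share the edges of a
  path and differ in \<open>d\<close>.\<close>

definition node_labelling :: "'v folding \<Rightarrow> nat \<Rightarrow> (nat \<Rightarrow> nat) \<Rightarrow> (nat \<times> nat) set \<Rightarrow> (nat \<Rightarrow> 'v set) \<Rightarrow> bool" where
  "node_labelling D N d E node \<longleftrightarrow> bij_betw node {1..N} (nodes D) \<and> (\<forall>a\<in>{1..N}. card (node a) = d a) \<and>
     (\<forall>a\<in>{1..N}. \<forall>b\<in>{1..N}. adj_nodes D (node a) (node b) \<longleftrightarrow> nbr E a b)"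

text \<open>In this order: the unfolded types A, D, E, then B, C, F, G; \<open>d\<close> is the size of the orbits.\<close>

definition folding_type :: "nat \<Rightarrow> nat \<Rightarrow> (nat \<Rightarrow> nat) \<Rightarrow> (nat \<times> nat) set \<Rightarrow> bool" where
  "folding_type r N d E \<longleftrightarrow>
     r = 1 \<and> d = (\<lambda>_. 1) \<and> (E = edges_A N \<and> N \<ge> 1 \<or> E = edges_D N \<and> N \<ge> 4 \<or> E = edges_E N \<and> N \<in> {6, 7, 8}) \<or>
     r = 2 \<and> E = edges_A N \<and> N \<ge> 2 \<and> d = (\<lambda>a. if a < N then 2 else 1) \<or>
     r = 2 \<and> E = edges_A N \<and> N \<ge> 3 \<and> d = (\<lambda>a. if a < N then 1 else 2) \<or>
     r = 2 \<and> E = edges_A N \<and> N = 4 \<and> d = (\<lambda>a. if a \<le> 2 then 2 else 1) \<or>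
     r = 3 \<and> E = edges_A N \<and> N = 2 \<and> d = (\<lambda>a. if a = 1 then 3 else 1)"

locale labelled_folding = folding D for D :: "('v::finite) folding" +
  fixes n e f
  assumes ade: "e = edges_A n \<and> n \<ge> 1 \<or> e = edges_D n \<and> n \<ge> 4 \<or> e = edges_E n \<and> n \<in> {6, 7, 8}"
    and f: "bij_betw f UNIV {1..n}" and adj: "adj D x y \<longleftrightarrow> nbr e (f x) (f y)"
begin

definition g :: "nat \<Rightarrow> 'v" where "g = inv_into UNIV f"
definition s :: "nat \<Rightarrow> nat" where "s a = f (\<sigma> (g a))"

lemma gf [simp]: "g (f x) = x" unfolding g_def using f by (simp add: bij_betw_def inv_into_f_f)
lemma fg [simp]: "a \<in> {1..n} \<Longrightarrow> f (g a) = a" unfolding g_def using f by (simp add: bij_betw_def f_inv_into_f)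
lemma f_rng: "f x \<in> {1..n}" using f bij_betwE by blast
lemma sf: "s (f x) = f (\<sigma> x)" by (simp add: s_def)
lemma f_inj: "f x = f y \<Longrightarrow> x = y" by (metis gf)

sublocale diagram_aut n e s
proof
  fix a b assume a: "a \<in> {1..n}"
  show "s a \<in> {1..n}" unfolding s_def by (rule f_rng)
  assume b: "b \<in> {1..n}"
  show "s a = s b \<Longrightarrow> a = b" unfolding s_def using inj_aut a b by (metis f_inj fg injD)
  have "nbr e (s a) (s b) \<longleftrightarrow> adj D (g a) (g b)" unfolding s_def adj[symmetric] by (rule adj_aut)
  then show "nbr e (s a) (s b) = nbr e a b" using a b by (simp add: adj)
qed

lemma s_not_nbr: "a \<in> {1..n} \<Longrightarrow> \<not> nbr e a (s a)"
  using not_adj_aut[of "g a"] by (simp add: adj s_def)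

lemma s_nontrivial: "r \<noteq> 1 \<Longrightarrow> \<exists>a\<in>{1..n}. s a \<noteq> a"
proof (rule ccontr)
  assume r: "r \<noteq> 1" and "\<not> ?thesis"
  then have "s (f x) = f x" for x using f_rng by blast
  then have "\<sigma> x = x" for x using f_inj by (simp add: sf)
  then have "\<sigma> ^^ 1 = id" by auto
  moreover have "1 < r" using r r_pos by simp
  ultimately show False using aut_pow_less[of 1] by simp
qed

lemma s_pow: "(s ^^ l) (f x) = f ((\<sigma> ^^ l) x)"
  by (induction l) (simp_all add: sf)

lemma s_pow_r: "a \<in> {1..n} \<Longrightarrow> (s ^^ r) a = a"
  using s_pow[of r "g a"] by (simp add: aut_pow_r)

text \<open>A labelling is read off from a transversal \<open>t\<close> of the orbits:
  \<open>cover\<close> and \<open>disj\<close> together say that each orbit is met exactly once.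
  Orbits are traversed by powers of \<open>s\<close>, the automorphism transported to the
  labels.\<close>

lemma labelling_r:
  assumes t: "\<And>a. a \<in> {1..N} \<Longrightarrow> t a \<in> {1..n}"
    and cover: "\<And>c. c \<in> {1..n} \<Longrightarrow> \<exists>a\<in>{1..N}. \<exists>l<r. c = (s ^^ l) (t a)"
    and disj: "\<And>a b l. a \<in> {1..N} \<Longrightarrow> b \<in> {1..N} \<Longrightarrow> a \<noteq> b \<Longrightarrow> l < r \<Longrightarrow> t a \<noteq> (s ^^ l) (t b)"
    and d: "\<And>a. a \<in> {1..N} \<Longrightarrow> d a = (if s (t a) = t a then 1 else r)"
    and E: "\<And>a b. a \<in> {1..N} \<Longrightarrow> b \<in> {1..N} \<Longrightarrow> nbr E a b \<longleftrightarrow> (\<exists>l<r. nbr e (t a) ((s ^^ l) (t b)))"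
  shows "node_labelling D N d E (\<lambda>a. orbit D (g (t a)))"
proof -
  have st: "(s ^^ l) (t a) = f ((\<sigma> ^^ l) (g (t a)))" if "a \<in> {1..N}" for a l
    using s_pow[of l "g (t a)"] t[OF that] by simp
  have "bij_betw (\<lambda>a. orbit D (g (t a))) {1..N} (nodes D)"
    unfolding bij_betw_def
  proof
    show "inj_on (\<lambda>a. orbit D (g (t a))) {1..N}"
    proof (rule inj_onI, rule ccontr)
      fix a b assume ab: "a \<in> {1..N}" "b \<in> {1..N}" "orbit D (g (t a)) = orbit D (g (t b))" "a \<noteq> b"
      then have "g (t a) \<in> orbit D (g (t b))" using self_in_orbit[of "g (t a)"] by simp
      then obtain l where "l < r" "g (t a) = (\<sigma> ^^ l) (g (t b))" by (auto simp: orbit_image)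
      then have "t a = (s ^^ l) (t b)" using st[OF ab(2)] t[OF ab(1)] by (metis fg)
      then show False using disj[OF ab(1,2,4) \<open>l < r\<close>] by simp
    qed
    show "(\<lambda>a. orbit D (g (t a))) ` {1..N} = nodes D"
    proof (intro equalityI subsetI)
      fix i assume "i \<in> nodes D"
      then obtain x where x: "i = orbit D x" by (auto simp: nodes_def)
      obtain a l where a: "a \<in> {1..N}" "l < r" "f x = (s ^^ l) (t a)" using cover[OF f_rng[of x]] by blast
      then have "x = (\<sigma> ^^ l) (g (t a))" using st[OF a(1)] f_inj by simp
      then show "i \<in> (\<lambda>a. orbit D (g (t a))) ` {1..N}" using x a by (auto simp: orbit_aut_pow)
    qed auto
  qed
  moreover have "card (orbit D (g (t a))) = d a" if "a \<in> {1..N}" for a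
  proof -
    have "s (t a) = t a \<longleftrightarrow> \<sigma> (g (t a)) = g (t a)"
      using t[OF that] f_inj unfolding s_def by (metis fg)
    then show ?thesis using dn_cases[of "g (t a)"] d[OF that] by (auto simp: dn_def)
  qed
  moreover have "adj_nodes D (orbit D (g (t a))) (orbit D (g (t b))) \<longleftrightarrow> nbr E a b" if ab: "a \<in> {1..N}" "b \<in> {1..N}" for a b
  proof -
    have "adj_nodes D (orbit D (g (t a))) (orbit D (g (t b))) \<longleftrightarrow> (\<exists>l. adj D (g (t a)) ((\<sigma> ^^ l) (g (t b))))"
      by (rule adj_nodes_orbit_iff)
    also have "\<dots> \<longleftrightarrow> (\<exists>l<r. adj D (g (t a)) ((\<sigma> ^^ l) (g (t b))))"
    proof
      assume "\<exists>l. adj D (g (t a)) ((\<sigma> ^^ l) (g (t b)))"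
      then obtain l where l: "adj D (g (t a)) ((\<sigma> ^^ l) (g (t b)))" ..
      have "(\<sigma> ^^ l) (g (t b)) \<in> orbit D (g (t b))" by (simp add: orbit_def)
      then obtain l' where "l' < r" "(\<sigma> ^^ l) (g (t b)) = (\<sigma> ^^ l') (g (t b))" by (auto simp: orbit_image)
      then show "\<exists>l<r. adj D (g (t a)) ((\<sigma> ^^ l) (g (t b)))" using l by auto
    qed blast
    also have "\<dots> \<longleftrightarrow> nbr E a b" using E[OF ab] t[OF ab(1)] by (simp add: adj st[OF ab(2)])
    finally show ?thesis .
  qed
  ultimately show ?thesis by (simp add: node_labelling_def)
qed

lemma labelling_2:
  assumes r2: "r = 2" and t: "\<And>a. a \<in> {1..N} \<Longrightarrow> t a \<in> {1..n}"
    and "\<And>c. c \<in> {1..n} \<Longrightarrow> \<exists>a\<in>{1..N}. c = t a \<or> c = s (t a)"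
    and "\<And>a b. a \<in> {1..N} \<Longrightarrow> b \<in> {1..N} \<Longrightarrow> a \<noteq> b \<Longrightarrow> t a \<noteq> t b \<and> t a \<noteq> s (t b)"
    and "\<And>a. a \<in> {1..N} \<Longrightarrow> d a = (if s (t a) = t a then 1 else 2)"
    and "\<And>a b. a \<in> {1..N} \<Longrightarrow> b \<in> {1..N} \<Longrightarrow> nbr E a b \<longleftrightarrow> nbr e (t a) (t b) \<or> nbr e (t a) (s (t b))"
  shows "node_labelling D N d E (\<lambda>a. orbit D (g (t a)))"
proof (rule labelling_r[OF t])
  have l2: "(\<exists>l<r. P ((s ^^ l) c)) \<longleftrightarrow> P c \<or> P (s c)" for P c
    by (auto simp: r2 less_2_cases_iff)
  show "\<exists>a\<in>{1..N}. \<exists>l<r. c = (s ^^ l) (t a)" if "c \<in> {1..n}" for c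
    using assms(3)[OF that] l2[of "\<lambda>x. c = x"] by blast
  show "t a \<noteq> (s ^^ l) (t b)" if "a \<in> {1..N}" "b \<in> {1..N}" "a \<noteq> b" "l < r" for a b l
    using assms(4)[OF that(1-3)] that(4) by (auto simp: r2 less_2_cases_iff)
  show "d a = (if s (t a) = t a then 1 else r)" if "a \<in> {1..N}" for a using assms(5)[OF that] by (simp add: r2)
  show "nbr E a b \<longleftrightarrow> (\<exists>l<r. nbr e (t a) ((s ^^ l) (t b)))" if "a \<in> {1..N}" "b \<in> {1..N}" for a b
    using assms(6)[OF that] l2[of "nbr e (t a)"] by blast
qed

lemma classification_1:
  assumes "r = 1" shows "folding_type r n (\<lambda>_. 1) e" "node_labelling D n (\<lambda>_. 1) e (\<lambda>a. orbit D (g a))"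
proof -
  show "folding_type r n (\<lambda>_. 1) e" using ade assms by (simp add: folding_type_def)
  show "node_labelling D n (\<lambda>_. 1) e (\<lambda>a. orbit D (g a))"
    by (rule labelling_r) (use assms in auto)
qed

lemma classification_A:
  assumes "r \<noteq> 1" "e = edges_A n"
  shows "\<exists>N d E node. folding_type r N d E \<and> node_labelling D N d E node"
proof -
  have sa: "s a = n + 1 - a" if "a \<in> {1..n}" for a
    using aut_A[OF assms(2)] s_nontrivial[OF assms(1)] that by blast
  have r2: "r = 2"
  proof -
    obtain a where a: "a \<in> {1..n}" "s a \<noteq> a" using s_nontrivial[OF assms(1)] by blast
    have "n + 1 - a \<in> {1..n}" using a(1) by auto
    from sa[OF this] have "s (s a) = a" using sa[OF a(1)] a(1) by simp
    then have "r \<noteq> 3" using s_pow_r[OF a(1)] a(2) by (auto simp: numeral_3_eq_3)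
    then show ?thesis using r_cases assms(1) by blast
  qed
  define N where "N = (n + 1) div 2"
  \<comment> \<open>For \<open>n = 2 k\<close> the reversal maps \<open>k\<close> to its neighbour
    \<open>k + 1\<close>, which a folding forbids. In the odd case the middle vertex is fixed and
    becomes the short end of type B.\<close>
  have "odd n"
  proof
    assume "even n"
    then obtain k where k: "n = 2 * k" by (elim evenE)
    have "n \<ge> 1" using s_nontrivial[OF assms(1)] by auto
    then have "k \<in> {1..n}" "nbr e k (s k)" using k sa[of k] by (auto simp: assms(2) nbr_A)
    then show False using s_not_nbr by blast
  qed
  then have nN: "n = 2 * N - 1" "N \<ge> 1" unfolding N_def by (auto elim!: oddE)
  have N2: "N \<ge> 2"
  proof (rule ccontr)
    assume "\<not> ?thesis"
    then have "n = 1" using nN by simp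
    then show False using s_nontrivial[OF assms(1)] sa by auto
  qed
  have "node_labelling D N (\<lambda>a. if a < N then 2 else 1) (edges_A N) (\<lambda>a. orbit D (g a))"
  proof (rule labelling_2[OF r2])
    fix c assume c: "c \<in> {1..n}"
    show "\<exists>a\<in>{1..N}. c = a \<or> c = s a"
    proof (cases "c \<le> N")
      case False
      have m: "2 * N - c \<in> {1..N}" "2 * N - c \<in> {1..n}" using False c nN by auto
      then have "c = s (2 * N - c)" using sa[OF m(2)] nN c by auto
      then show ?thesis using m(1) by blast
    qed (use c in auto)
  next
    have sN: "s b = 2 * N - b" if "b \<in> {1..N}" for b
    proof -
      have "b \<in> {1..n}" using that nN by auto
      from sa[OF this] show ?thesis using nN by simp
    qed
    show "a \<in> {1..n}" if "a \<in> {1..N}" for a using that nN by auto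
    show "a \<noteq> b \<and> a \<noteq> s b" if "a \<in> {1..N}" "b \<in> {1..N}" "a \<noteq> b" for a b
      using that sN[OF that(2)] by auto
    show "(if a < N then 2 else 1) = (if s a = a then 1 else 2::nat)" if "a \<in> {1..N}" for a
      using that sN[OF that] by auto
    show "nbr (edges_A N) a b \<longleftrightarrow> nbr e a b \<or> nbr e a (s b)" if "a \<in> {1..N}" "b \<in> {1..N}" for a b
    proof -
      have ab: "1 \<le> a" "a \<le> N" "1 \<le> b" "b \<le> N" using that by auto
      have "nbr e a (s b) \<longleftrightarrow> a + b + 1 = 2 * N"
        using ab nN(2) unfolding assms(2) nbr_A sN[OF that(2)] nN(1) by auto
      moreover have "b = Suc a \<or> a = Suc b" if "a + b + 1 = 2 * N" using ab that by arith
      ultimately show ?thesis using ab nN unfolding assms(2) nbr_A by auto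
    qed
  qed
  moreover have "folding_type r N (\<lambda>a. if a < N then 2 else 1) (edges_A N)" using r2 N2 by (simp add: folding_type_def)
  ultimately show ?thesis by blast
qed

lemma r_2I: "r \<noteq> 1 \<Longrightarrow> a \<in> {1..n} \<Longrightarrow> s a \<noteq> a \<Longrightarrow> s (s a) = a \<Longrightarrow> r = 2"
  using r_cases s_pow_r[of a] by (auto simp: numeral_3_eq_3)

lemma classification_D:
  assumes "r \<noteq> 1" "e = edges_D n" "n \<ge> 5"
  shows "\<exists>N d E node. folding_type r N d E \<and> node_labelling D N d E node"
proof -
  define m where "m = n - 2"
  have m: "n = m + 2" "m \<ge> 3" using assms(3) by (simp_all add: m_def)
  then have m2: "m \<ge> 2" by simp
  have nb: "nbr e a b \<longleftrightarrow> (b = Suc a \<and> 1 \<le> a \<and> a \<le> m) \<or> (a = Suc b \<and> 1 \<le> b \<and> b \<le> m) \<or>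
    (a = m \<and> b = m + 2) \<or> (a = m + 2 \<and> b = m)" for a b unfolding assms(2) m(1) by (rule nbr_D[OF m2])
  have fixed: "s a = a" if "a \<in> {1..m}" for a using aut_D[OF assms(2) m] that by blast
  have swap: "s (m + 1) = m + 2" "s (m + 2) = m + 1"
  proof -
    have "\<not> (s (m + 1) = m + 1 \<and> s (m + 2) = m + 2)"
    proof
      assume f: "s (m + 1) = m + 1 \<and> s (m + 2) = m + 2"
      obtain a where a: "a \<in> {1..n}" "s a \<noteq> a" using s_nontrivial[OF assms(1)] by blast
      then have "a \<in> {1..m} \<or> a = m + 1 \<or> a = m + 2" using m by auto
      then show False using a f fixed by blast
    qed
    then show "s (m + 1) = m + 2" "s (m + 2) = m + 1" using aut_D[OF assms(2) m] by blast+
  qed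
  have r2: "r = 2" using r_2I[OF assms(1), of "m + 1"] swap m by simp
  have "node_labelling D (m + 1) (\<lambda>a. if a < m + 1 then 1 else 2) (edges_A (m + 1)) (\<lambda>a. orbit D (g a))"
  proof (rule labelling_2[OF r2])
    show "\<exists>a\<in>{1..m + 1}. c = a \<or> c = s a" if "c \<in> {1..n}" for c
    proof (cases "c = m + 2")
      case True
      then show ?thesis using swap by (intro bexI[of _ "m + 1"]) auto
    qed (use that m in auto)
    have sv: "s b = (if b = m + 1 then m + 2 else b)" if "b \<in> {1..m + 1}" for b
      using that fixed[of b] swap by (cases "b = m + 1") auto
    show "a \<noteq> b \<and> a \<noteq> s b" if "a \<in> {1..m + 1}" "b \<in> {1..m + 1}" "a \<noteq> b" for a b
      using that sv[OF that(2)] by auto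
    show "(if a < m + 1 then 1 else 2) = (if s a = a then 1 else 2::nat)" if "a \<in> {1..m + 1}" for a
      using that sv[OF that] by auto
    show "nbr (edges_A (m + 1)) a b \<longleftrightarrow> nbr e a b \<or> nbr e a (s b)" if "a \<in> {1..m + 1}" "b \<in> {1..m + 1}" for a b
      using that unfolding nb nbr_A sv[OF that(2)] by auto
  qed (use m in auto)
  moreover have "folding_type r (m + 1) (\<lambda>a. if a < m + 1 then 1 else 2) (edges_A (m + 1))"
    using r2 m by (simp add: folding_type_def)
  ultimately show ?thesis by blast
qed

lemma D4_leaves:
  assumes "e = edges_D n" "n = 4"
  shows "s 2 = 2" "s 1 = 1 \<or> s 1 = 3 \<or> s 1 = 4" "s 3 = 1 \<or> s 3 = 3 \<or> s 3 = 4" "s 4 = 1 \<or> s 4 = 3 \<or> s 4 = 4"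
    "s 1 \<noteq> s 3" "s 1 \<noteq> s 4" "s 3 \<noteq> s 4"
proof -
  have i: "1 \<in> {1..n}" "2 \<in> {1..n}" "3 \<in> {1..n}" "4 \<in> {1..n}" using assms(2) by auto
  show s2: "s 2 = 2" using aut_D_branch[OF assms(1), of 2] assms(2) by simp
  have four: "c = 1 \<or> c = 2 \<or> c = 3 \<or> c = 4" if "c \<in> {1..n}" for c using that assms(2) by auto
  show "s 1 = 1 \<or> s 1 = 3 \<or> s 1 = 4" "s 3 = 1 \<or> s 3 = 3 \<or> s 3 = 4" "s 4 = 1 \<or> s 4 = 3 \<or> s 4 = 4"
    using four[OF rng[OF i(1)]] four[OF rng[OF i(3)]] four[OF rng[OF i(4)]]
      inj[OF i(1,2)] inj[OF i(3,2)] inj[OF i(4,2)] s2 by auto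
  show "s 1 \<noteq> s 3" "s 1 \<noteq> s 4" "s 3 \<noteq> s 4" using inj[OF i(1,3)] inj[OF i(1,4)] inj[OF i(3,4)] by auto
qed

lemma nbr_D4: "nbr (edges_D 4) a b \<longleftrightarrow> (a = 2 \<and> b \<in> {1, 3, 4}) \<or> (b = 2 \<and> a \<in> {1, 3, 4})"
proof -
  have "nbr (edges_D 4) a b \<longleftrightarrow> (b = Suc a \<and> 1 \<le> a \<and> a \<le> 2) \<or> (a = Suc b \<and> 1 \<le> b \<and> b \<le> 2) \<or>
    (a = 2 \<and> b = 4) \<or> (a = 4 \<and> b = 2)"
    using nbr_D[of 2 a b] by simp
  also have "\<dots> \<longleftrightarrow> (a = 2 \<and> (b = 1 \<or> b = 3 \<or> b = 4)) \<or> (b = 2 \<and> (a = 1 \<or> a = 3 \<or> a = 4))" by presburger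
  finally show ?thesis by simp
qed

text \<open>Stated for an arbitrary fixed leaf \<open>u\<close> and exchanged leaves
  \<open>v\<close>, \<open>w\<close>, so that the three involutions of \<open>D_4\<close> are
  covered at once. The quotient is the path \<open>u\<close>, 2, \<open>v\<close>, with an orbit of
  size 2 at its end.\<close>

lemma classification_D4_2:
  assumes e: "e = edges_D n" "n = 4" and r2: "r = 2"
    and t: "s u = u" "s v = w" "s w = v" "{u, v, w} = {1, 3, 4}" "u \<noteq> v" "u \<noteq> w" "v \<noteq> w"
  shows "\<exists>N d E node. folding_type r N d E \<and> node_labelling D N d E node"
proof -
  define t where "t a = (if a = 1 then u else if a = 2 then 2 else v)" for a :: nat
  have ne2: "u \<noteq> 2" "v \<noteq> 2" "w \<noteq> 2" using t(4) by (metis insert_iff empty_iff numeral_eq_iff numeral_eq_one_iff semiring_norm(83,85,86,87,88,89))+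
  have three: "a = 1 \<or> a = 2 \<or> a = 3" if "a \<in> {1..3}" for a :: nat using that by auto
  have tv: "t 1 = u" "t 2 = 2" "t 3 = v" by (simp_all add: t_def)
  have in4: "u \<in> {1, 3, 4}" "v \<in> {1, 3, 4}" "w \<in> {1, 3, 4}" using t(4) by blast+
  note s2 = D4_leaves(1)[OF e]
  have "node_labelling D 3 (\<lambda>a. if a < 3 then 1 else 2) (edges_A 3) (\<lambda>a. orbit D (g (t a)))"
  proof (rule labelling_2[OF r2])
    show "t a \<in> {1..n}" if "a \<in> {1..3}" for a using in4 e(2) by (auto simp: t_def)
    show "\<exists>a\<in>{1..3}. c = t a \<or> c = s (t a)" if c: "c \<in> {1..n}" for c
    proof -
      have "c = 2 \<or> c \<in> {1, 3, 4}" using c e(2) by auto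
      then have "c = 2 \<or> c = u \<or> c = v \<or> c = w" unfolding t(4)[symmetric] by blast
      moreover have m: "1 \<in> {1..3::nat}" "2 \<in> {1..3::nat}" "3 \<in> {1..3::nat}" by auto
      ultimately show ?thesis using tv t(2) by metis
    qed
    show "t a \<noteq> t b \<and> t a \<noteq> s (t b)" if "a \<in> {1..3}" "b \<in> {1..3}" "a \<noteq> b" for a b
      using three[OF that(1)] three[OF that(2)] that(3) t(1-3,5-7) ne2 s2 by (elim disjE) (simp_all add: tv tv[unfolded One_nat_def])
    show "(if a < 3 then 1 else 2) = (if s (t a) = t a then 1 else 2::nat)" if "a \<in> {1..3}" for a
      using three[OF that] t(1-3,5-7) s2 by (elim disjE) (simp_all add: tv tv[unfolded One_nat_def])
    show "nbr (edges_A 3) a b \<longleftrightarrow> nbr e (t a) (t b) \<or> nbr e (t a) (s (t b))" if "a \<in> {1..3}" "b \<in> {1..3}" for a b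
      unfolding e nbr_D4 nbr_A using three[OF that(1)] three[OF that(2)] t(1-3,5-7) s2 ne2 in4 by (elim disjE) (simp_all add: tv tv[unfolded One_nat_def])
  qed
  moreover have "folding_type r 3 (\<lambda>a. if a < 3 then 1 else 2) (edges_A 3)" using r2 by (simp add: folding_type_def)
  ultimately show ?thesis by blast
qed

lemma classification_D4_3:
  assumes e: "e = edges_D n" "n = 4" and r3: "r = 3"
    and t: "s 1 = v" "s v = w" "s w = 1" "{1, v, w} = {1, 3, 4}" "1 \<noteq> v" "1 \<noteq> w" "v \<noteq> w"
  shows "\<exists>N d E node. folding_type r N d E \<and> node_labelling D N d E node"
proof -
  have two: "a = 1 \<or> a = 2" if "a \<in> {1..2}" for a :: nat using that by auto
  have in4: "v \<in> {1, 3, 4}" "w \<in> {1, 3, 4}" using t(4) by blast+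
  then have ne2: "v \<noteq> 2" "w \<noteq> 2" by auto
  note s2 = D4_leaves(1)[OF e]
  have l3: "(\<exists>l<r. P ((s ^^ l) c)) \<longleftrightarrow> P c \<or> P (s c) \<or> P (s (s c))" for P c
    by (auto simp: r3 numeral_3_eq_3 less_Suc_eq)
  have "node_labelling D 2 (\<lambda>a. if a = 1 then 3 else 1) (edges_A 2) (\<lambda>a. orbit D (g a))"
  proof (rule labelling_r)
    show "a \<in> {1..n}" if "a \<in> {1..2}" for a using that e(2) by auto
    show "\<exists>a\<in>{1..2}. \<exists>l<r. c = (s ^^ l) a" if c: "c \<in> {1..n}" for c
    proof -
      have "c = 2 \<or> c \<in> {1, 3, 4}" using c e(2) by auto
      then have "c = 2 \<or> c = 1 \<or> c = s 1 \<or> c = s (s 1)" unfolding t(4)[symmetric] using t(1,2) by blast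
      moreover have m: "1 \<in> {1..2::nat}" "2 \<in> {1..2::nat}" by auto
      ultimately show ?thesis using l3[of "\<lambda>x. c = x"] by blast
    qed
    show "a \<noteq> (s ^^ l) b" if "a \<in> {1..2}" "b \<in> {1..2}" "a \<noteq> b" "l < r" for a b l
    proof
      assume "a = (s ^^ l) b"
      then have "a = b \<or> a = s b \<or> a = s (s b)" using l3[of "\<lambda>x. a = x" b] that(4) by blast
      then show False using two[OF that(1)] two[OF that(2)] that(3) t(1-3,5-7) s2 ne2 by (elim disjE) simp_all
    qed
    show "(if a = 1 then 3 else 1) = (if s a = a then 1 else r)" if "a \<in> {1..2}" for a
      using two[OF that] t(1-3,5-7) s2 r3 by (elim disjE) simp_all
    show "nbr (edges_A 2) a b \<longleftrightarrow> (\<exists>l<r. nbr e a ((s ^^ l) b))" if "a \<in> {1..2}" "b \<in> {1..2}" for a b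
      unfolding l3[of "nbr e a"] unfolding e nbr_D4 nbr_A using two[OF that(1)] two[OF that(2)] t(1-3,5-7) s2 ne2 in4
      by (elim disjE) simp_all
  qed
  moreover have "folding_type r 2 (\<lambda>a. if a = 1 then 3 else 1) (edges_A 2)" using r3 by (simp add: folding_type_def)
  ultimately show ?thesis by blast
qed

lemma classification_D4:
  assumes "r \<noteq> 1" "e = edges_D n" "n = 4"
  shows "\<exists>N d E node. folding_type r N d E \<and> node_labelling D N d E node"
proof -
  note l = D4_leaves[OF assms(2,3)]
  have i: "1 \<in> {1..n}" "3 \<in> {1..n}" using assms(3) by auto
  have "\<not> (s 1 = 1 \<and> s 3 = 3)"
  proof
    assume f: "s 1 = 1 \<and> s 3 = 3"
    obtain a where a: "a \<in> {1..n}" "s a \<noteq> a" using s_nontrivial[OF assms(1)] by blast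
    then have "a = 1 \<or> a = 2 \<or> a = 3 \<or> a = 4" using assms(3) by auto
    then show False using a(2) f l by auto
  qed
  then have "s 1 = 1 \<and> s 3 = 4 \<and> s 4 = 3 \<or> s 1 = 4 \<and> s 3 = 3 \<and> s 4 = 1 \<or> s 1 = 3 \<and> s 3 = 1 \<and> s 4 = 4 \<or>
      s 1 = 3 \<and> s 3 = 4 \<and> s 4 = 1 \<or> s 1 = 4 \<and> s 4 = 3 \<and> s 3 = 1"
    using l(2-7) by (elim disjE) simp_all
  then consider "s 1 = 1" "s 3 = 4" "s 4 = 3" | "s 1 = 4" "s 3 = 3" "s 4 = 1" | "s 1 = 3" "s 3 = 1" "s 4 = 4"
    | "s 1 = 3" "s 3 = 4" "s 4 = 1" | "s 1 = 4" "s 4 = 3" "s 3 = 1" by blast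
  then show ?thesis
  proof cases
    case 1
    then have "r = 2" using r_2I[OF assms(1) i(2)] by simp
    then show ?thesis by (rule classification_D4_2[OF assms(2,3), of 1 3 4]) (use 1 in auto)
  next
    case 2
    then have "r = 2" using r_2I[OF assms(1) i(1)] by simp
    then show ?thesis by (rule classification_D4_2[OF assms(2,3), of 3 1 4]) (use 2 in auto)
  next
    case 3
    then have "r = 2" using r_2I[OF assms(1) i(1)] by simp
    then show ?thesis by (rule classification_D4_2[OF assms(2,3), of 4 1 3]) (use 3 in auto)
  next
    case 4
    then have "r \<noteq> 2" using s_pow_r[OF i(1)] by (auto simp: numeral_2_eq_2)
    then have "r = 3" using r_cases assms(1) by blast
    then show ?thesis by (rule classification_D4_3[OF assms(2,3), of 3 4]) (use 4 in auto)
  next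
    case 5
    then have "r \<noteq> 2" using s_pow_r[OF i(1)] by (auto simp: numeral_2_eq_2)
    then have "r = 3" using r_cases assms(1) by blast
    then show ?thesis by (rule classification_D4_3[OF assms(2,3), of 4 3]) (use 5 in auto)
  qed
qed

lemma classification_E:
  assumes "r \<noteq> 1" "e = edges_E n" "n \<in> {6, 7, 8}"
  shows "\<exists>N d E node. folding_type r N d E \<and> node_labelling D N d E node"
proof -
  have s: "n = 6" "s 1 = 6" "s 2 = 2" "s 3 = 5" "s 4 = 4" "s 5 = 3" "s 6 = 1"
    using aut_E[OF assms(2,3)] s_nontrivial[OF assms(1)] by blast+
  have r2: "r = 2" using r_2I[OF assms(1), of 1] s by simp
  \<comment> \<open>Representatives in the order of the folded path: the orbits of 1 and 3 have two
    elements, 4 and 2 are fixed.\<close>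
  define t :: "nat \<Rightarrow> nat" where "t a = (if a = 1 then 1 else if a = 2 then 3 else if a = 3 then 4 else 2)" for a
  have tv: "t 1 = 1" "t 2 = 3" "t 3 = 4" "t 4 = 2" by (simp_all add: t_def)
  have four: "a = 1 \<or> a = 2 \<or> a = 3 \<or> a = 4" if "a \<in> {1..4}" for a :: nat using that by auto
  have "node_labelling D 4 (\<lambda>a. if a \<le> 2 then 2 else 1) (edges_A 4) (\<lambda>a. orbit D (g (t a)))"
  proof (rule labelling_2[OF r2])
    show "t a \<in> {1..n}" if "a \<in> {1..4}" for a using s(1) by (auto simp: t_def)
    show "\<exists>a\<in>{1..4}. c = t a \<or> c = s (t a)" if c: "c \<in> {1..n}" for c
    proof -
      have "c = 1 \<or> c = 2 \<or> c = 3 \<or> c = 4 \<or> c = 5 \<or> c = 6" using c s(1) by auto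
      moreover have m: "1 \<in> {1..4::nat}" "2 \<in> {1..4::nat}" "3 \<in> {1..4::nat}" "4 \<in> {1..4::nat}" by auto
      ultimately show ?thesis using tv s by metis
    qed
    show "t a \<noteq> t b \<and> t a \<noteq> s (t b)" if "a \<in> {1..4}" "b \<in> {1..4}" "a \<noteq> b" for a b
      using four[OF that(1)] four[OF that(2)] that(3) by (elim disjE) (simp_all add: tv s tv[unfolded One_nat_def] s[unfolded One_nat_def])
    show "(if a \<le> 2 then 2 else 1) = (if s (t a) = t a then 1 else 2::nat)" if "a \<in> {1..4}" for a
      using four[OF that] by (elim disjE) (simp_all add: tv s tv[unfolded One_nat_def] s[unfolded One_nat_def])
    show "nbr (edges_A 4) a b \<longleftrightarrow> nbr e (t a) (t b) \<or> nbr e (t a) (s (t b))" if "a \<in> {1..4}" "b \<in> {1..4}" for a b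
      unfolding assms(2) nbr_E nbr_A using four[OF that(1)] four[OF that(2)]
      by (elim disjE) (simp_all add: tv s tv[unfolded One_nat_def] s[unfolded One_nat_def])
  qed
  moreover have "folding_type r 4 (\<lambda>a. if a \<le> 2 then 2 else 1) (edges_A 4)" using r2 by (simp add: folding_type_def)
  ultimately show ?thesis by blast
qed

end

theorem (in folding) folding_classification:
  "\<exists>N d E node. folding_type r N d E \<and> node_labelling D N d E node"
proof -
  obtain n e f where ade: "e = edges_A n \<and> n \<ge> 1 \<or> e = edges_D n \<and> n \<ge> 4 \<or> e = edges_E n \<and> n \<in> {6, 7, 8}"
    and f: "bij_betw f UNIV {1..n}" "\<forall>x y. adj D x y \<longleftrightarrow> (f x, f y) \<in> e \<or> (f y, f x) \<in> e"
    using ADE unfolding ADE_diagram_def by blast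
  interpret labelled_folding D n e f by unfold_locales (use ade f in \<open>auto simp: nbr_def\<close>)
  show ?thesis
  proof (cases "r = 1")
    case True
    then show ?thesis using classification_1 by blast
  next
    case False
    consider "e = edges_A n" | "e = edges_D n" "n \<ge> 5" | "e = edges_D n" "n = 4" | "e = edges_E n" "n \<in> {6, 7, 8}"
      using ade by fastforce
    then show ?thesis
      by cases (use False classification_A classification_D classification_D4 classification_E in blast)+
  qed
qed

section \<open>The highest root\<close>

context folding
begin

text \<open>Off the diagonal this is \<open>- c_ik\<close>, on the diagonal 0. It is a natural
  number because it also counts the time shifts with which \<open>k\<close> enters the mesh relation
  at \<open>i\<close>.\<close>

definition link :: "'v set \<Rightarrow> 'v set \<Rightarrow> nat" where
  "link i k = (if adj_nodes D i k then if card i = 1 then card k else 1 else 0)"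

lemma card_node_cases: "i \<in> nodes D \<Longrightarrow> card i = 1 \<or> card i = r"
  using card_node nodes_nonempty dn_1_or_r by (metis of_nat_1_eq_iff of_nat_eq_iff)

lemma card_node_pos: "i \<in> nodes D \<Longrightarrow> card i > 0"
  using card_node_cases[of i] r_pos by auto

lemma not_adj_nodes_self: "i \<in> nodes D \<Longrightarrow> \<not> adj_nodes D i i"
  unfolding adj_nodes_def using nodes_eq_orbit not_adj_orbit by metis

lemma adj_nodes_sym: "adj_nodes D i k \<longleftrightarrow> adj_nodes D k i"
  unfolding adj_nodes_def using adj_sym by blast

lemma link_self [simp]: "i \<in> nodes D \<Longrightarrow> link i i = 0" by (simp add: link_def not_adj_nodes_self)

lemma ceiling_inverse: "m > 0 \<Longrightarrow> \<lceil>1 / of_nat m :: rat\<rceil> = 1"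
  by (rule ceiling_unique) (simp_all add: divide_simps)

lemma cartan_link:
  assumes "i \<in> nodes D" "k \<in> nodes D" "i \<noteq> k" shows "cartan D i k = - int (link i k)"
  using card_node_cases[OF assms(1)] card_node_cases[OF assms(2)] assms(3) r_pos
  by (auto simp: cartan_def link_def ceiling_inverse)

lemma link_sym: "i \<in> nodes D \<Longrightarrow> k \<in> nodes D \<Longrightarrow> card i * link i k = card k * link k i"
  using card_node_cases[of i] card_node_cases[of k] adj_nodes_sym[of i k] by (auto simp: link_def)

definition row :: "('v set \<Rightarrow> int) \<Rightarrow> 'v set \<Rightarrow> int" where
  "row x i = 2 * x i - (\<Sum>k\<in>nodes D. int (link i k) * x k)"

text \<open>The symmetrized Cartan form, in which the simple root of \<open>i\<close> has squared
  length \<open>2 d_i\<close>.\<close>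

definition nform :: "('v set \<Rightarrow> int) \<Rightarrow> ('v set \<Rightarrow> int) \<Rightarrow> int" where
  "nform x y = (\<Sum>i\<in>nodes D. int (card i) * x i * row y i)"

lemma cartan_row: "i \<in> nodes D \<Longrightarrow> (\<Sum>k\<in>nodes D. cartan D i k * x k) = row x i"
proof -
  assume i: "i \<in> nodes D"
  have "(\<Sum>k\<in>nodes D. cartan D i k * x k) = 2 * x i + (\<Sum>k\<in>nodes D - {i}. cartan D i k * x k)"
    using i by (simp add: sum.remove cartan_def)
  also have "(\<Sum>k\<in>nodes D - {i}. cartan D i k * x k) = (\<Sum>k\<in>nodes D - {i}. - (int (link i k) * x k))"
  proof (rule sum.cong)
    fix k assume "k \<in> nodes D - {i}"
    then have "cartan D i k = - int (link i k)" by (intro cartan_link[OF i]) blast+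
    then show "cartan D i k * x k = - (int (link i k) * x k)" by simp
  qed simp
  also have "\<dots> = - (\<Sum>k\<in>nodes D. int (link i k) * x k)"
    using i by (simp add: sum_negf sum.remove[of "nodes D" i])
  finally show ?thesis by (simp add: row_def)
qed

definition simple :: "'v set \<Rightarrow> 'v set \<Rightarrow> int" where "simple i = (\<lambda>j. if j = i then 1 else 0)"

lemma row_lin: "row (\<lambda>j. a * x j + b * y j) i = a * row x i + b * row y i"
proof -
  have "(\<Sum>k\<in>nodes D. int (link i k) * (a * x k + b * y k)) =
      a * (\<Sum>k\<in>nodes D. int (link i k) * x k) + b * (\<Sum>k\<in>nodes D. int (link i k) * y k)"
    by (simp add: sum_distrib_left sum.distrib[symmetric] algebra_simps)
  then show ?thesis by (simp add: row_def algebra_simps)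
qed

lemma nform_lin_right: "nform z (\<lambda>j. a * x j + b * y j) = a * nform z x + b * nform z y"
  by (simp add: nform_def row_lin sum_distrib_left sum.distrib[symmetric] algebra_simps)

lemma nform_lin_left: "nform (\<lambda>j. a * x j + b * y j) z = a * nform x z + b * nform y z"
  by (simp add: nform_def sum_distrib_left sum.distrib[symmetric] algebra_simps)

lemma nform_simple_left: "i \<in> nodes D \<Longrightarrow> nform (simple i) y = int (card i) * row y i"
  unfolding nform_def simple_def by (subst sum.remove[of _ i]) (auto intro!: sum.neutral)

lemma nform_sym: "nform x y = nform y x"
proof -
  have e: "nform x y = 2 * (\<Sum>i\<in>nodes D. int (card i) * x i * y i) -
      (\<Sum>i\<in>nodes D. \<Sum>k\<in>nodes D. int (card i * link i k) * (x i * y k))" for x y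
    by (simp add: nform_def row_def algebra_simps sum_subtractf sum_distrib_left)
  have "(\<Sum>i\<in>nodes D. \<Sum>k\<in>nodes D. int (card i * link i k) * (x i * y k)) =
      (\<Sum>i\<in>nodes D. \<Sum>k\<in>nodes D. int (card k * link k i) * (x i * y k))"
    by (intro sum.cong) (simp_all only: link_sym)
  also have "\<dots> = (\<Sum>i\<in>nodes D. \<Sum>k\<in>nodes D. int (card i * link i k) * (y i * x k))"
    by (subst sum.swap) (simp add: mult.commute)
  finally show ?thesis unfolding e by (simp add: mult.commute mult.left_commute)
qed

lemma row_simple: "i \<in> nodes D \<Longrightarrow> row (simple i) i = 2"
proof -
  assume i: "i \<in> nodes D"
  have "(\<Sum>k\<in>nodes D. int (link i k) * simple i k) = 0"
    by (intro sum.neutral) (use i in \<open>auto simp: simple_def\<close>)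
  moreover have "simple i i = 1" by (simp add: simple_def)
  ultimately show ?thesis by (simp add: row_def)
qed

lemma nform_simple: "i \<in> nodes D \<Longrightarrow> nform (simple i) (simple i) = 2 * int (card i)"
  by (simp add: nform_simple_left row_simple)

lemma nform_plus: "i \<in> nodes D \<Longrightarrow> nform (\<lambda>j. a * x j + b * simple i j) (\<lambda>j. a * x j + b * simple i j) =
    a\<^sup>2 * nform x x + 2 * a * b * (int (card i) * row x i) + 2 * b\<^sup>2 * int (card i)"
  by (simp add: nform_lin_left nform_lin_right row_simple nform_sym[of x "simple i"] nform_simple_left
      power2_eq_square algebra_simps)

definition reflect :: "'v set \<Rightarrow> ('v set \<Rightarrow> int) \<Rightarrow> 'v set \<Rightarrow> int" where
  "reflect i \<beta> = (\<lambda>j. \<beta> j - row \<beta> i * simple i j)"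

lemma nform_reflect: "i \<in> nodes D \<Longrightarrow> nform (reflect i \<beta>) (reflect i \<beta>) = nform \<beta> \<beta>"
proof -
  assume i: "i \<in> nodes D"
  have "reflect i \<beta> = (\<lambda>j. 1 * \<beta> j + (- row \<beta> i) * simple i j)" by (simp add: reflect_def)
  then show ?thesis using nform_plus[OF i, of 1 \<beta> "- row \<beta> i"] by (simp add: power2_eq_square)
qed

lemma folded_roots_reflect: "\<beta> \<in> folded_roots D \<Longrightarrow> i \<in> nodes D \<Longrightarrow> reflect i \<beta> \<in> folded_roots D"
proof -
  assume \<beta>: "\<beta> \<in> folded_roots D" and i: "i \<in> nodes D"
  have "reflect i \<beta> = (\<lambda>j. \<beta> j - (if j = i then \<Sum>k\<in>nodes D. cartan D i k * \<beta> k else 0))"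
    by (auto simp: reflect_def simple_def cartan_row[OF i])
  then show ?thesis using folded_refl[OF \<beta> i] by simp
qed

lemma folded_roots_simple: "i \<in> nodes D \<Longrightarrow> simple i \<in> folded_roots D"
  unfolding simple_def by (rule folded_simple)

lemma folded_roots_inductive [consumes 1, case_names simple reflect]:
  assumes "\<beta> \<in> folded_roots D" and "\<And>i. i \<in> nodes D \<Longrightarrow> P (simple i)"
    and "\<And>\<beta> i. i \<in> nodes D \<Longrightarrow> P \<beta> \<Longrightarrow> P (reflect i \<beta>)"
  shows "P \<beta>"
  using assms(1)
proof induction
  case (folded_simple i)
  then show ?case using assms(2) by (simp add: simple_def)
next
  case (folded_refl \<beta> i)
  have "reflect i \<beta> = (\<lambda>j. \<beta> j - (if j = i then \<Sum>k\<in>nodes D. cartan D i k * \<beta> k else 0))"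
    by (auto simp: reflect_def simple_def cartan_row[OF folded_refl(2)])
  then show ?case using assms(3)[OF folded_refl(2,3)] by simp
qed

text \<open>An invariant that recognizes long roots: squared length \<open>2 r\<close>, and
  coordinates at short nodes divisible by \<open>r\<close>. Reflections preserve both; the
  divisibility is used in \<open>reflect_le\<close>, where a long vector is reflected at a short
  node.\<close>

definition long_vec :: "('v set \<Rightarrow> int) \<Rightarrow> bool" where
  "long_vec \<beta> \<longleftrightarrow> nform \<beta> \<beta> = 2 * int r \<and> (\<forall>i\<in>nodes D. card i = 1 \<longrightarrow> int r dvd \<beta> i)"

lemma long_vec_row:
  assumes "long_vec \<beta>" "i \<in> nodes D" "card i = 1" shows "int r dvd row \<beta> i"
proof -
  have "int r dvd int (link i k) * \<beta> k" if "k \<in> nodes D" for k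
    using card_node_cases[OF that] assms that by (auto simp: link_def long_vec_def)
  then have "int r dvd (\<Sum>k\<in>nodes D. int (link i k) * \<beta> k)" by (rule dvd_sum)
  moreover have "int r dvd \<beta> i" using assms by (simp add: long_vec_def)
  ultimately show ?thesis unfolding row_def by (simp add: dvd_diff)
qed

lemma long_vec_reflect: "long_vec \<beta> \<Longrightarrow> i \<in> nodes D \<Longrightarrow> long_vec (reflect i \<beta>)"
  using long_vec_row[of \<beta> i] nform_reflect[of i \<beta>] unfolding long_vec_def by (simp add: reflect_def simple_def)

lemma long_vec_simple: "i \<in> nodes D \<Longrightarrow> card i = r \<Longrightarrow> long_vec (simple i)"
  unfolding long_vec_def using nform_simple[of i] by (auto simp: simple_def)

end

text \<open>
  Positivity of the symmetrized Cartan matrix comes from the sum of squares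
  $\sum_i (B\theta)_i x_i^2/\theta_i - \frac12\sum_{i \ne j} b_{ij}\theta_i\theta_j(x_i/\theta_i - x_j/\theta_j)^2$.
\<close>

locale dominant_vec = folding D for D :: "('v::finite) folding" +
  fixes \<theta> :: "'v set \<Rightarrow> int"
  assumes theta_long: "long_vec \<theta>" and theta_pos: "i \<in> nodes D \<Longrightarrow> \<theta> i > 0"
    and theta_dominant: "i \<in> nodes D \<Longrightarrow> row \<theta> i \<ge> 0" and theta_support: "i \<notin> nodes D \<Longrightarrow> \<theta> i = 0"
    and nonsingular: "(\<And>i. i \<in> nodes D \<Longrightarrow> row x i = 0) \<Longrightarrow> i \<in> nodes D \<Longrightarrow> x i = 0"
begin

lemma nform_nonneg: "nform x x \<ge> 0"
proof -
  define U T :: "'v set \<Rightarrow> rat" where "U i = of_int (x i)" and "T i = of_int (\<theta> i)" for i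
  define b :: "'v set \<Rightarrow> 'v set \<Rightarrow> rat" where "b i k = of_nat (card i * link i k)" for i k
  have T: "T i > 0" if "i \<in> nodes D" for i using theta_pos[OF that] by (simp add: T_def)
  have sym: "b i k = b k i" if "i \<in> nodes D" "k \<in> nodes D" for i k
    unfolding b_def using link_sym[OF that] by (simp only:)
  have e: "of_int (nform x x) = (\<Sum>i\<in>nodes D. 2 * of_nat (card i) * (U i)\<^sup>2) - (\<Sum>i\<in>nodes D. \<Sum>k\<in>nodes D. b i k * (U i * U k))"
    by (simp add: nform_def row_def U_def b_def algebra_simps sum_subtractf sum_distrib_left power2_eq_square)
  have dom: "(\<Sum>k\<in>nodes D. b i k * T k) \<le> 2 * of_nat (card i) * T i" if i: "i \<in> nodes D" for i
  proof -
    have "(\<Sum>k\<in>nodes D. b i k * T k) = of_nat (card i) * of_int (\<Sum>k\<in>nodes D. int (link i k) * \<theta> k)"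
      by (simp add: b_def T_def sum_distrib_left algebra_simps)
    also have "\<dots> \<le> of_nat (card i) * of_int (2 * \<theta> i)"
      using theta_dominant[OF i] by (intro mult_left_mono) (simp_all only: row_def of_int_le_iff of_nat_0_le_iff)
    finally show ?thesis by (simp add: T_def)
  qed
  \<comment> \<open>The sum of squares, term by term: with \<open>u = x_i / \<theta>_i\<close> and
    \<open>v = x_k / \<theta>_k\<close> this is \<open>2 u v <= u^2 + v^2\<close>.\<close>
  have am: "U i * U k \<le> (T k * (U i)\<^sup>2 / T i + T i * (U k)\<^sup>2 / T k) / 2" if "i \<in> nodes D" "k \<in> nodes D" for i k
  proof -
    define u v where "u = U i / T i" and "v = U k / T k"
    have U: "U i = T i * u" "U k = T k * v" using T[OF that(1)] T[OF that(2)] by (simp_all add: u_def v_def)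
    have "T k * (U i)\<^sup>2 / T i = (T i * T k) * u\<^sup>2" "T i * (U k)\<^sup>2 / T k = (T i * T k) * v\<^sup>2"
      using T[OF that(1)] T[OF that(2)] unfolding U by (simp_all add: power2_eq_square)
    moreover have "0 \<le> (T i * T k) * (u - v)\<^sup>2" using T[OF that(1)] T[OF that(2)] by simp
    then have "2 * (U i * U k) \<le> (T i * T k) * u\<^sup>2 + (T i * T k) * v\<^sup>2"
      unfolding U by (simp add: power2_eq_square algebra_simps)
    ultimately show ?thesis by simp
  qed
  have "(\<Sum>i\<in>nodes D. \<Sum>k\<in>nodes D. b i k * (U i * U k)) \<le>
      (\<Sum>i\<in>nodes D. \<Sum>k\<in>nodes D. b i k * ((T k * (U i)\<^sup>2 / T i + T i * (U k)\<^sup>2 / T k) / 2))"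
    by (intro sum_mono mult_left_mono am) (simp_all add: b_def)
  also have "\<dots> = (\<Sum>i\<in>nodes D. \<Sum>k\<in>nodes D. b i k * (T k * (U i)\<^sup>2 / T i)) / 2 +
      (\<Sum>i\<in>nodes D. \<Sum>k\<in>nodes D. b i k * (T i * (U k)\<^sup>2 / T k)) / 2"
    by (simp add: sum.distrib sum_divide_distrib add_divide_distrib distrib_left)
  also have "(\<Sum>i\<in>nodes D. \<Sum>k\<in>nodes D. b i k * (T i * (U k)\<^sup>2 / T k)) =
      (\<Sum>i\<in>nodes D. \<Sum>k\<in>nodes D. b i k * (T k * (U i)\<^sup>2 / T i))"
    by (subst sum.swap) (intro sum.cong, simp_all add: sym)
  also have "(\<Sum>i\<in>nodes D. \<Sum>k\<in>nodes D. b i k * (T k * (U i)\<^sup>2 / T i)) =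
      (\<Sum>i\<in>nodes D. (\<Sum>k\<in>nodes D. b i k * T k) * ((U i)\<^sup>2 / T i))"
    by (simp only: sum_distrib_right) (simp add: mult.assoc)
  also have "\<dots> / 2 + \<dots> / 2 = \<dots>" by simp
  also have "\<dots> \<le> (\<Sum>i\<in>nodes D. (2 * of_nat (card i) * T i) * ((U i)\<^sup>2 / T i))"
    by (intro sum_mono mult_right_mono dom) (use T in \<open>simp_all add: less_imp_le\<close>)
  also have "\<dots> = (\<Sum>i\<in>nodes D. 2 * of_nat (card i) * (U i)\<^sup>2)"
    by (intro sum.cong refl) (use T in force)
  finally have "(0::rat) \<le> of_int (nform x x)" unfolding e by simp
  then show ?thesis by simp
qed

text \<open>A null vector of a semidefinite form lies in its radical, so all rows vanish and
  \<open>nonsingular\<close> applies. Over the integers it suffices to test \<open>2 x\<close> plus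
  or minus one simple root, which bounds \<open>2 |row x i|\<close> by 1.\<close>

lemma nform_zero:
  assumes "nform x x = 0" "i \<in> nodes D" shows "x i = 0"
proof (rule nonsingular[OF _ assms(2)])
  fix i assume i: "i \<in> nodes D"
  have "0 \<le> 4 * s * (int (card i) * row x i) + 2 * s\<^sup>2 * int (card i)" for s
    using nform_nonneg[of "\<lambda>j. 2 * x j + s * simple i j"] nform_plus[OF i, of 2 x s] assms(1) by simp
  from this[of 1] this[of "-1"] have "2 * \<bar>int (card i) * row x i\<bar> \<le> int (card i)" by (simp add: abs_if)
  then have "int (card i) * (2 * \<bar>row x i\<bar>) \<le> int (card i) * 1" by (simp add: abs_mult)
  then have "2 * \<bar>row x i\<bar> \<le> 1" using card_node_pos[OF i] by (simp only: mult_le_cancel_left_pos of_nat_0_less_iff)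
  then show "row x i = 0" by presburger
qed

text \<open>With \<open>k = row \<beta> i\<close> and \<open>m = \<theta> i - \<beta> i\<close>,
  dominance of \<open>\<theta>\<close> yields \<open>- k <= 2 m\<close>, half of the claim. The rest
  compares lengths. For equal lengths \<open>k >= - 2\<close>, with equality for the negative simple
  root alone; a long vector at a short node has \<open>k\<close> and \<open>m\<close> divisible by
  \<open>r\<close>; a short vector at a long node has \<open>k >= - 1\<close>.\<close>

lemma reflect_le:
  assumes le: "\<And>j. \<beta> j \<le> \<theta> j" and norm: "long_vec \<beta> \<or> nform \<beta> \<beta> = 2" and i: "i \<in> nodes D"
  shows "- row \<beta> i \<le> \<theta> i - \<beta> i"
proof (cases "row \<beta> i < 0")
  case True
  define k m where "k = row \<beta> i" and "m = \<theta> i - \<beta> i"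
  have "row \<theta> i - k = row (\<lambda>j. 1 * \<theta> j + (- 1) * \<beta> j) i" unfolding row_lin k_def by simp
  also have "\<dots> \<le> 2 * m"
    unfolding row_def m_def using le by (simp add: sum_nonneg)
  finally have km: "- k \<le> 2 * m" using theta_dominant[OF i] by simp
  \<comment> \<open>Positivity of the form on \<open>\<beta>\<close> plus \<open>s\<close> times the
    simple root. The choices \<open>s = 1\<close> and, for a long vector at a short node,
    \<open>s = 2\<close> give the lower bounds for \<open>k\<close>.\<close>
  have q: "0 \<le> nform \<beta> \<beta> + 2 * s * (int (card i) * k) + 2 * s\<^sup>2 * int (card i)" for s
    using nform_nonneg[of "\<lambda>j. 1 * \<beta> j + s * simple i j"] nform_plus[OF i, of 1 \<beta> s] by (simp add: k_def)
  have same: "- k \<le> m" if "nform \<beta> \<beta> = 2 * int (card i)"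
  proof -
    have "0 \<le> int (card i) * (4 + 2 * k)" using q[of 1] that by (simp add: algebra_simps)
    then have "k \<ge> - 2" using card_node_pos[OF i] mult_pos_neg[of "int (card i)" "4 + 2 * k"] by linarith
    moreover have "m \<ge> 2" if "k = - 2"
    proof -
      have "nform (\<lambda>j. 1 * \<beta> j + 1 * simple i j) (\<lambda>j. 1 * \<beta> j + 1 * simple i j) = 0"
        unfolding nform_plus[OF i] using that \<open>nform \<beta> \<beta> = 2 * int (card i)\<close> by (simp add: k_def)
      from nform_zero[OF this i] have "\<beta> i = - 1" by (simp add: simple_def)
      then show ?thesis using theta_pos[OF i] by (simp add: m_def)
    qed
    ultimately show ?thesis using km True by (cases "k = - 2") (auto simp: k_def)
  qed
  have "- k \<le> m"
  proof (cases "nform \<beta> \<beta> = 2 * int (card i)")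
    case False
    consider "long_vec \<beta>" "card i = 1" "r \<noteq> 1" | "nform \<beta> \<beta> = 2" "card i = r" "r \<noteq> 1"
      using norm False card_node_cases[OF i] by (auto simp: long_vec_def)
    then show ?thesis
    proof cases
      case 1
      have d: "int r dvd k" unfolding k_def by (rule long_vec_row[OF 1(1) i 1(2)])
      have "int r dvd \<theta> i - \<beta> i" using 1 theta_long i unfolding long_vec_def by (blast intro: dvd_diff)
      then have d': "int r dvd m" by (simp add: m_def)
      have "0 \<le> int r + 2 * k + 4" using q[of 2] 1 by (simp add: long_vec_def)
      moreover have "r = 2 \<or> r = 3" using 1 r_cases by auto
      ultimately show ?thesis using d d' km by (elim disjE) (simp, presburger)+
    next
      case 2
      have "int r \<ge> 2" using 2 r_cases by auto
      have "0 \<le> 2 + 2 * (int r * k) + 2 * int r" using q[of 1] 2 by simp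
      then have "int r * (- 1 - k) \<le> 1" by (simp add: algebra_simps)
      then have "\<not> 1 \<le> - 1 - k" using mult_mono[of 2 "int r" 1 "- 1 - k"] \<open>int r \<ge> 2\<close> by auto
      then show ?thesis using km by simp
    qed
  qed (rule same)
  then show ?thesis by (simp add: k_def m_def)
qed (use le[of i] in simp)

lemma folded_root_le: "\<beta> \<in> folded_roots D \<Longrightarrow> \<beta> j \<le> \<theta> j"
proof -
  assume "\<beta> \<in> folded_roots D"
  then have "(\<forall>j. \<beta> j \<le> \<theta> j) \<and> (long_vec \<beta> \<or> nform \<beta> \<beta> = 2)"
  proof (induction rule: folded_roots_inductive)
    case (simple i)
    have "simple i j \<le> \<theta> j" for j
      using theta_pos[of j] theta_support[of j] simple by (cases "j \<in> nodes D") (auto simp: simple_def)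
    then show ?case using card_node_cases[OF simple] long_vec_simple[OF simple] nform_simple[OF simple] by auto
  next
    case (reflect \<beta> i)
    then have "- row \<beta> i \<le> \<theta> i - \<beta> i" by (intro reflect_le) auto
    then have "reflect i \<beta> j \<le> \<theta> j" for j using reflect(2) by (auto simp: reflect_def simple_def)
    then show ?case using reflect long_vec_reflect nform_reflect by auto
  qed
  then show ?thesis by blast
qed

theorem highest_root_eq:
  assumes "\<theta> \<in> folded_roots D" shows "highest_root D = \<theta>"
  unfolding highest_root_def
proof (rule the_equality)
  show "\<theta> \<in> folded_roots D \<and> (\<forall>\<beta>\<in>folded_roots D. \<forall>i. \<beta> i \<le> \<theta> i)" using assms folded_root_le by blast
  show "\<theta>' = \<theta>" if "\<theta>' \<in> folded_roots D \<and> (\<forall>\<beta>\<in>folded_roots D. \<forall>i. \<beta> i \<le> \<theta>' i)" for \<theta>'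
    using that assms folded_root_le by (intro ext order_antisym) auto
qed

end

section \<open>Highest roots and periods by type\<close>

definition lk :: "(nat \<Rightarrow> nat) \<Rightarrow> (nat \<times> nat) set \<Rightarrow> nat \<Rightarrow> nat \<Rightarrow> nat" where
  "lk d E a b = (if nbr E a b then if d a = 1 then d b else 1 else 0)"

definition lmesh :: "nat \<Rightarrow> (nat \<Rightarrow> nat) \<Rightarrow> (nat \<times> nat) set \<Rightarrow> (nat \<Rightarrow> int \<Rightarrow> rat) \<Rightarrow> bool" where
  "lmesh N d E c \<longleftrightarrow> (\<forall>a\<in>{1..N}. \<forall>u. c a (u + int (d a)) + c a (u - int (d a)) =
     (\<Sum>b\<in>{1..N}. \<Sum>j<lk d E a b. c b (u + 2 * int j + 1 - int (lk d E a b))))"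

inductive_set long_roots :: "nat \<Rightarrow> (nat \<Rightarrow> nat) \<Rightarrow> (nat \<times> nat) set \<Rightarrow> nat \<Rightarrow> (nat \<Rightarrow> int) set"
  for N d E r where
  base: "a \<in> {1..N} \<Longrightarrow> d a = r \<Longrightarrow> (\<lambda>b. if b = a then 1 else 0) \<in> long_roots N d E r"
| step: "x \<in> long_roots N d E r \<Longrightarrow> a \<in> {1..N} \<Longrightarrow>
    x(a := (\<Sum>b\<in>{1..N}. int (lk d E a b) * x b) - x a) \<in> long_roots N d E r"

text \<open>The facts to be checked type by type, on labels instead of orbits. Reachability from a
  long simple root, positivity and dominance make \<open>\<theta>\<close> the highest root, so that
  \<open>h\<close> is the dual Coxeter number and the last condition the period.\<close>

definition type_data :: "nat \<Rightarrow> (nat \<Rightarrow> nat) \<Rightarrow> (nat \<times> nat) set \<Rightarrow> nat \<Rightarrow> (nat \<Rightarrow> int) \<Rightarrow> nat \<Rightarrow> bool" where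
  "type_data N d E r \<theta> h \<longleftrightarrow> \<theta> \<in> long_roots N d E r \<and>
     (\<forall>a\<in>{1..N}. \<theta> a > 0 \<and> (\<Sum>b\<in>{1..N}. int (lk d E a b) * \<theta> b) \<le> 2 * \<theta> a) \<and>
     1 + (\<Sum>a\<in>{1..N}. \<theta> a * int (d a)) div int r = int h \<and>
     (\<forall>c. lmesh N d E c \<longrightarrow> (\<forall>a\<in>{1..N}. \<forall>u. c a (u + 2 * int r * int h) = c a u))"

text \<open>The values 0 at both outer positions let the ends of the path be treated like interior
  vertices, so one formula covers every \<open>a\<close>.\<close>

lemma nbr_sum_A:
  fixes F :: "nat \<Rightarrow> 'a::comm_monoid_add"
  assumes "a \<in> {1..N}" "F 0 = 0" "F (Suc N) = 0"
  shows "(\<Sum>b\<in>{1..N}. if nbr (edges_A N) a b then F b else 0) = F (a - 1) + F (a + 1)"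
proof -
  have "(\<Sum>b\<in>{1..N}. if nbr (edges_A N) a b then F b else 0) = sum F {b \<in> {1..N}. nbr (edges_A N) a b}"
    by (rule sum.inter_filter[symmetric]) simp
  also have "\<dots> = sum F {a - 1, a + 1}"
  proof (rule sum.mono_neutral_left)
    show "\<forall>b\<in>{a - 1, a + 1} - {b \<in> {1..N}. nbr (edges_A N) a b}. F b = 0"
    proof
      fix b assume b: "b \<in> {a - 1, a + 1} - {b \<in> {1..N}. nbr (edges_A N) a b}"
      then have "b = 0 \<or> b = Suc N" using assms(1) by (auto simp: nbr_A)
      then show "F b = 0" using assms by blast
    qed
  qed (auto simp: nbr_A)
  also have "\<dots> = F (a - 1) + F (a + 1)" by simp
  finally show ?thesis .
qed

lemma nbr_sum_D:
  fixes F :: "nat \<Rightarrow> 'a::comm_monoid_add"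
  assumes "m \<ge> 2" "a \<in> {1..m + 2}" "F 0 = 0"
  shows "(\<Sum>b\<in>{1..m + 2}. if nbr (edges_D (m + 2)) a b then F b else 0) =
    (if a < m then F (a - 1) + F (a + 1) else if a = m then F (m - 1) + F (m + 1) + F (m + 2) else F m)"
proof -
  define T where "T = (if a < m then {a - 1, a + 1} else if a = m then {m - 1, m + 1, m + 2} else {m})"
  have "(\<Sum>b\<in>{1..m + 2}. if nbr (edges_D (m + 2)) a b then F b else 0) = sum F {b \<in> {1..m + 2}. nbr (edges_D (m + 2)) a b}"
    by (rule sum.inter_filter[symmetric]) simp
  also have "\<dots> = sum F T"
  proof (rule sum.mono_neutral_left)
    show "finite T" by (simp add: T_def)
    show "{b \<in> {1..m + 2}. nbr (edges_D (m + 2)) a b} \<subseteq> T"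
      unfolding nbr_D[OF assms(1)] T_def using assms(2) by auto
    show "\<forall>b\<in>T - {b \<in> {1..m + 2}. nbr (edges_D (m + 2)) a b}. F b = 0"
    proof
      fix b assume b: "b \<in> T - {b \<in> {1..m + 2}. nbr (edges_D (m + 2)) a b}"
      then have "b = 0" unfolding nbr_D[OF assms(1)] T_def using assms(1,2) by (auto split: if_splits)
      then show "F b = 0" using assms by blast
    qed
  qed
  also have "\<dots> = (if a < m then F (a - 1) + F (a + 1) else if a = m then F (m - 1) + F (m + 1) + F (m + 2) else F m)"
  proof -
    have "m - 1 \<notin> {m + 1, m + 2}" "a - 1 \<noteq> a + 1" using assms(1) by auto
    then show ?thesis by (simp add: T_def add.assoc)
  qed
  finally show ?thesis .
qed

lemma nbr_sum_E:
  fixes F :: "nat \<Rightarrow> 'a::comm_monoid_add"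
  assumes "N \<ge> 6" "a \<in> {1..N}" "F (Suc N) = 0"
  shows "(\<Sum>b\<in>{1..N}. if nbr (edges_E N) a b then F b else 0) =
    (if a = 1 then F 3 else if a = 2 then F 4 else if a = 3 then F 1 + F 4 else if a = 4 then F 2 + F 3 + F 5
     else F (a - 1) + F (a + 1))"
proof -
  define T where "T = (if a = 1 then {3} else if a = 2 then {4} else if a = 3 then {1, 4} else if a = 4 then {2, 3, 5}
    else {a - 1, a + 1})"
  have "(\<Sum>b\<in>{1..N}. if nbr (edges_E N) a b then F b else 0) = sum F {b \<in> {1..N}. nbr (edges_E N) a b}"
    by (rule sum.inter_filter[symmetric]) simp
  also have "\<dots> = sum F T"
  proof (rule sum.mono_neutral_left)
    show "finite T" by (simp add: T_def)
    show "{b \<in> {1..N}. nbr (edges_E N) a b} \<subseteq> T"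
      unfolding nbr_E T_def using assms(2) by (auto split: if_splits)
    show "\<forall>b\<in>T - {b \<in> {1..N}. nbr (edges_E N) a b}. F b = 0"
    proof
      fix b assume b: "b \<in> T - {b \<in> {1..N}. nbr (edges_E N) a b}"
      then have "b = Suc N" unfolding nbr_E T_def using assms(1,2) by (auto split: if_splits)
      then show "F b = 0" using assms by blast
    qed
  qed
  also have "\<dots> = (if a = 1 then F 3 else if a = 2 then F 4 else if a = 3 then F 1 + F 4 else if a = 4 then F 2 + F 3 + F 5
     else F (a - 1) + F (a + 1))"
    by (auto simp: T_def add.assoc)
  finally show ?thesis .
qed

definition wt :: "(nat \<Rightarrow> nat) \<Rightarrow> nat \<Rightarrow> nat \<Rightarrow> nat" where "wt d a b = (if d a = 1 then d b else 1)"

lemma wt_const: "wt (\<lambda>_. 1) a b = 1" by (simp add: wt_def)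

lemma lk_mult: "int (lk d E a b) * t = (if nbr E a b then int (wt d a b) * t else 0)"
  by (simp add: lk_def wt_def)

lemma step_A:
  assumes "x \<in> long_roots N d (edges_A N) r" "a \<in> {1..N}" "x 0 = 0" "x (Suc N) = 0"
    and "y = x(a := int (wt d a (a - 1)) * x (a - 1) + int (wt d a (a + 1)) * x (a + 1) - x a)"
  shows "y \<in> long_roots N d (edges_A N) r"
  using step[OF assms(1,2)] nbr_sum_A[OF assms(2), of "\<lambda>b. int (wt d a b) * x b"] assms(3-5) by (simp add: lk_mult)

definition zero_ext :: "nat \<Rightarrow> (nat \<Rightarrow> int \<Rightarrow> rat) \<Rightarrow> nat \<Rightarrow> int \<Rightarrow> rat" where
  "zero_ext N c a u = (if a \<in> {1..N} then c a u else 0)"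

lemma lmesh_zero_ext:
  assumes "lmesh N d E c" "a \<in> {1..N}"
  shows "zero_ext N c a (u + int (d a)) + zero_ext N c a (u - int (d a)) =
    (\<Sum>b\<in>{1..N}. if nbr E a b then \<Sum>j<wt d a b. zero_ext N c b (u + 2 * int j + 1 - int (wt d a b)) else 0)"
proof -
  have "(\<Sum>b\<in>{1..N}. if nbr E a b then \<Sum>j<wt d a b. zero_ext N c b (u + 2 * int j + 1 - int (wt d a b)) else 0) =
    (\<Sum>b\<in>{1..N}. \<Sum>j<lk d E a b. c b (u + 2 * int j + 1 - int (lk d E a b)))"
    by (intro sum.cong) (simp_all add: zero_ext_def lk_def wt_def)
  then show ?thesis using assms by (simp add: lmesh_def zero_ext_def)
qed

lemma lmesh_1:
  assumes "lmesh N (\<lambda>_. 1) E c" "a \<in> {1..N}"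
  shows "zero_ext N c a (u + 1) + zero_ext N c a (u - 1) = (\<Sum>b\<in>{1..N}. if nbr E a b then zero_ext N c b u else 0)"
proof -
  have "(\<Sum>j<wt (\<lambda>_. 1) a b. zero_ext N c b (u + 2 * int j + 1 - int (wt (\<lambda>_. 1) a b))) = zero_ext N c b u" for b
    unfolding wt_const by simp
  then show ?thesis using lmesh_zero_ext[OF assms, of u] by (simp only:) simp
qed

lemma zero_ext_0 [simp]: "zero_ext N c 0 u = 0" "zero_ext N c (Suc N) u = 0"
  by (simp_all add: zero_ext_def)

lemma lmesh_A:
  assumes "lmesh N d (edges_A N) c" "a \<in> {1..N}"
  shows "zero_ext N c a (u + int (d a)) + zero_ext N c a (u - int (d a)) =
    (\<Sum>j<wt d a (a - 1). zero_ext N c (a - 1) (u + 2 * int j + 1 - int (wt d a (a - 1)))) +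
    (\<Sum>j<wt d a (a + 1). zero_ext N c (a + 1) (u + 2 * int j + 1 - int (wt d a (a + 1))))"
  unfolding lmesh_zero_ext[OF assms] by (subst nbr_sum_A[OF assms(2)]) simp_all

lemma dominant_A:
  fixes x :: "nat \<Rightarrow> int"
  assumes "a \<in> {1..N}" "x 0 = 0" "x (Suc N) = 0"
  shows "(\<Sum>b\<in>{1..N}. int (lk d (edges_A N) a b) * x b) = int (wt d a (a - 1)) * x (a - 1) + int (wt d a (a + 1)) * x (a + 1)"
  using nbr_sum_A[OF assms(1), of "\<lambda>b. int (wt d a b) * x b"] assms(2,3) by (simp add: lk_mult)

lemma periodI:
  assumes "\<And>a u. a \<in> {1..N} \<Longrightarrow> zero_ext N c a (u + P) = zero_ext N c a u"
  shows "\<forall>a\<in>{1..N}. \<forall>u. c a (u + P) = c a u"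
  using assms by (simp add: zero_ext_def)

lemma path_root:
  assumes "1 \<le> m" "m \<le> n" "n \<le> N" "d 1 = r" "\<And>a. 1 \<le> a \<Longrightarrow> a < n \<Longrightarrow> d a = d (Suc a)" "r = 1 \<or> r = 2"
  shows "(\<lambda>b. if b \<in> {1..m} then 1 else 0) \<in> long_roots N d (edges_A N) r"
  using assms(1,2)
proof (induction m rule: nat_induct_at_least)
  case base
  have "(\<lambda>b::nat. if b \<in> {1..1} then 1 else 0) = (\<lambda>b. if b = 1 then 1 else 0::int)" by (auto simp: fun_eq_iff)
  then show ?case using long_roots.base[of 1 N d r "edges_A N"] assms by simp
next
  case (Suc m)
  have "wt d (Suc m) m = 1" using assms(5)[of m] Suc by (auto simp: wt_def)
  then show ?case
    by (intro step_A[OF Suc.IH, of "Suc m"]) (use Suc assms(3) in \<open>auto simp: fun_eq_iff\<close>)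
qed

lemma type_data_A:
  assumes "N \<ge> 1"
  shows "type_data N (\<lambda>_. 1) (edges_A N) 1 (\<lambda>b. if b \<in> {1..N} then 1 else 0) (N + 1)"
  unfolding type_data_def
proof (intro conjI ballI allI impI)
  show "(\<lambda>b. if b \<in> {1..N} then 1 else 0) \<in> long_roots N (\<lambda>_. 1) (edges_A N) 1"
    by (rule path_root[of N N]) (use assms in auto)
  show "(\<Sum>b\<in>{1..N}. int (lk (\<lambda>_. 1) (edges_A N) a b) * (if b \<in> {1..N} then 1 else 0)) \<le> 2 * (if a \<in> {1..N} then 1 else 0)"
    if "a \<in> {1..N}" for a
    by (subst dominant_A[OF that]) (use that in \<open>auto simp: wt_def\<close>)
  fix c a u assume c: "lmesh N (\<lambda>_. 1) (edges_A N) c" and a: "a \<in> {1..N}"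
  have "zero_ext N c a (u + 2 * (int N + 1)) = zero_ext N c a u" if "a \<in> {1..N}" for a u
    by (rule period_A) (use lmesh_A[OF c] that in \<open>auto simp: wt_def\<close>)
  from periodI[OF this] show "c a (u + 2 * int 1 * int (N + 1)) = c a u" using a by (simp add: add.commute)
qed auto

lemma type_data_B:
  assumes "N \<ge> 2"
  shows "type_data N (\<lambda>a. if a < N then 2 else 1) (edges_A N) 2 (\<lambda>b. if b \<in> {1..N} then if b < 2 then 1 else 2 else 0) (2 * N - 1)"
  (is "type_data N ?d _ _ _ _")
  unfolding type_data_def
proof (intro conjI ballI allI impI)
  \<comment> \<open>Reflections descend from the right end. The vector of ones up to
    \<open>N - 1\<close> becomes 1, ..., 1, 2 by reflecting at \<open>N\<close>, and each reflection
    at a smaller \<open>m\<close> turns one more 1 into a 2.\<close>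
  have "(\<lambda>b. if b \<in> {1..N} then if b < m then 1 else 2 else 0) \<in> long_roots N ?d (edges_A N) 2" if "m \<in> {2..N}" for m
  proof -
    have "m \<le> N" using that by simp
    then have "m \<ge> 2 \<longrightarrow> (\<lambda>b. if b \<in> {1..N} then if b < m then 1 else 2 else 0) \<in> long_roots N ?d (edges_A N) 2"
    proof (induction m rule: inc_induct)
      case base
      have p: "(\<lambda>b. if b \<in> {1..N-1} then 1 else 0) \<in> long_roots N ?d (edges_A N) 2"
        by (rule path_root[of _ "N - 1"]) (use assms in auto)
      show ?case
        by (intro impI step_A[OF p, of N]) (use assms in \<open>auto simp: fun_eq_iff wt_def\<close>)
    next
      case (step m)
      show ?case
      proof
        assume m: "2 \<le> m"
        then have p: "(\<lambda>b. if b \<in> {1..N} then if b < Suc m then 1 else 2 else 0) \<in> long_roots N ?d (edges_A N) 2" using step by simp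
        show "(\<lambda>b. if b \<in> {1..N} then if b < m then 1 else 2 else 0) \<in> long_roots N ?d (edges_A N) 2"
          by (intro step_A[OF p, of m]) (use assms m step in \<open>auto simp: fun_eq_iff wt_def\<close>)
      qed
    qed
    then show ?thesis using that by simp
  qed
  then show "(\<lambda>b. if b \<in> {1..N} then if b < 2 then 1 else 2 else 0) \<in> long_roots N ?d (edges_A N) 2" using assms by auto
  show "(\<Sum>b\<in>{1..N}. int (lk ?d (edges_A N) a b) * (if b \<in> {1..N} then if b < 2 then 1 else 2 else 0)) \<le>
      2 * (if a \<in> {1..N} then if a < 2 then 1 else 2 else 0)"
    if "a \<in> {1..N}" for a
    by (subst dominant_A[OF that]) (use that assms in \<open>auto simp: wt_def\<close>)
  obtain k where k: "N = Suc (Suc k)" using assms by (metis One_nat_def Suc_1 Suc_le_D Suc_le_mono)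
  have "(\<Sum>a\<in>{1..N}. (if a \<in> {1..N} then if a < 2 then 1 else 2 else 0) * int (?d a)) = (\<Sum>a\<in>{1..N}. if a = 1 \<or> a = N then 2 else 4)"
    by (intro sum.cong) (use assms in auto)
  also have "\<dots> = 4 * (int N - 1)"
  proof -
    have "{1..N} = insert 1 (insert N {2..N-1})" using assms by auto
    moreover have "(\<Sum>a\<in>{2..N-1}. if a = 1 \<or> a = N then 2 else 4::int) = (\<Sum>a\<in>{2..N-1}. 4)"
      by (intro sum.cong) auto
    ultimately show ?thesis using assms by simp
  qed
  finally show "1 + (\<Sum>a\<in>{1..N}. (if a \<in> {1..N} then if a < 2 then 1 else 2 else 0) * int (?d a)) div int 2 = int (2 * N - 1)"
    using k by simp
  fix c a u assume c: "lmesh N ?d (edges_A N) c" and a: "a \<in> {1..N}"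
  have m: "zero_ext N c N (u + 1) + zero_ext N c N (u - 1) = zero_ext N c (N - 1) (u + 1) + zero_ext N c (N - 1) (u - 1)" for u
    using lmesh_A[OF c, of N u] assms by (simp add: wt_def numeral_2_eq_2 algebra_simps)
  have m': "zero_ext N c a (u + 2) + zero_ext N c a (u - 2) = zero_ext N c (a - 1) u + zero_ext N c (a + 1) u"
    if "1 \<le> a" "a < N" for a u
    using lmesh_A[OF c, of a u] that by (simp add: wt_def)
  have "zero_ext N c a (u + 4 * (2 * int N - 1)) = zero_ext N c a u" if "a \<in> {1..N}" for a u
    by (rule period_B[of _ N, OF _ m' m]) (use that assms in auto)
  from periodI[OF this] show "c a (u + 2 * int 2 * int (2 * N - 1)) = c a u" using a k by (simp add: algebra_simps)
qed auto

lemma type_data_C: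
  assumes "N \<ge> 3"
  shows "type_data N (\<lambda>a. if a < N then 1 else 2) (edges_A N) 2 (\<lambda>b. if b \<in> {1..N} then if b = N then 1 else 2 else 0) (N + 1)"
  (is "type_data N ?d _ _ _ _")
  unfolding type_data_def
proof (intro conjI ballI allI impI)
  \<comment> \<open>Starting from the long simple root at \<open>N\<close>, the reflections at
    \<open>N - 1\<close>, ..., 1 append the entries 2 one after the other.\<close>
  have "(\<lambda>b. if b \<in> {m..N} then if b = N then 1 else 2 else 0) \<in> long_roots N ?d (edges_A N) 2" if "m \<in> {1..N}" for m
  proof -
    have "m \<le> N" using that by simp
    then have "m \<ge> 1 \<longrightarrow> (\<lambda>b. if b \<in> {m..N} then if b = N then 1 else 2 else 0) \<in> long_roots N ?d (edges_A N) 2"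
    proof (induction m rule: inc_induct)
      case base
      have "(\<lambda>b::nat. if b \<in> {N..N} then if b = N then 1 else 2 else 0) = (\<lambda>b. if b = N then 1 else 0::int)" by (auto simp: fun_eq_iff)
      then show ?case using long_roots.base[of N N ?d 2 "edges_A N"] assms by simp
    next
      case (step m)
      show ?case
      proof
        assume m: "1 \<le> m"
        then have p: "(\<lambda>b. if b \<in> {Suc m..N} then if b = N then 1 else 2 else 0) \<in> long_roots N ?d (edges_A N) 2" using step by simp
        show "(\<lambda>b. if b \<in> {m..N} then if b = N then 1 else 2 else 0) \<in> long_roots N ?d (edges_A N) 2"
          by (intro step_A[OF p, of m]) (use assms m step in \<open>auto simp: fun_eq_iff wt_def\<close>)
      qed
    qed
    then show ?thesis using that by simp
  qed
  then show "(\<lambda>b. if b \<in> {1..N} then if b = N then 1 else 2 else 0) \<in> long_roots N ?d (edges_A N) 2" using assms by auto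
  show "(\<Sum>b\<in>{1..N}. int (lk ?d (edges_A N) a b) * (if b \<in> {1..N} then if b = N then 1 else 2 else 0)) \<le>
      2 * (if a \<in> {1..N} then if a = N then 1 else 2 else 0)"
    if "a \<in> {1..N}" for a
    by (subst dominant_A[OF that]) (use that assms in \<open>auto simp: wt_def\<close>)
  have "(\<Sum>a\<in>{1..N}. (if a \<in> {1..N} then if a = N then 1 else 2 else 0) * int (?d a)) = (\<Sum>a\<in>{1..N}. 2)"
    by (intro sum.cong) (use assms in auto)
  then show "1 + (\<Sum>a\<in>{1..N}. (if a \<in> {1..N} then if a = N then 1 else 2 else 0) * int (?d a)) div int 2 = int (N + 1)" by simp
  fix c a u assume c: "lmesh N ?d (edges_A N) c" and a: "a \<in> {1..N}"
  have m: "zero_ext N c (N - 1) (u + 1) + zero_ext N c (N - 1) (u - 1) = zero_ext N c (N - 2) u + zero_ext N c N (u + 1) + zero_ext N c N (u - 1)" for u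
    using lmesh_A[OF c, of "N - 1" u] assms by (simp add: wt_def numeral_2_eq_2 algebra_simps)
  have m': "zero_ext N c a (u + 1) + zero_ext N c a (u - 1) = zero_ext N c (a - 1) u + zero_ext N c (a + 1) u"
    if "1 \<le> a" "a < N - 1" for a u
  proof -
    have "a \<in> {1..N}" "a < N" "a - 1 < N" "a + 1 < N" using that by auto
    then show ?thesis using lmesh_A[OF c, of a u] by (simp add: wt_def)
  qed
  have m'': "zero_ext N c N (u + 2) + zero_ext N c N (u - 2) = zero_ext N c (N - 1) u" for u
    using lmesh_A[OF c, of N u] assms by (simp add: wt_def)
  have "zero_ext N c a (u + 4 * (int N + 1)) = zero_ext N c a u" if "a \<in> {1..N}" for a u
    by (rule period_C[of _ N, OF _ m' m m'']) (use that assms in auto)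
  from periodI[OF this] show "c a (u + 2 * int 2 * int (N + 1)) = c a u" using a by (simp add: algebra_simps)
qed auto

lemma type_data_D:
  assumes "N \<ge> 4"
  shows "type_data N (\<lambda>_. 1) (edges_D N) 1 (\<lambda>b. if b \<in> {1..N} then if b < 2 \<or> b > N - 2 then 1 else 2 else 0) (2 * N - 2)"
  unfolding type_data_def
proof (intro conjI ballI allI impI)
  let ?L = "long_roots N (\<lambda>_. 1) (edges_D N) 1"
  define m where "m = N - 2"
  have m: "N = m + 2" "m \<ge> 2" using assms by (simp_all add: m_def)
  have sum: "(\<Sum>b\<in>{1..N}. int (lk (\<lambda>_. 1) (edges_D N) a b) * x b) =
    (if a < m then x (a - 1) + x (a + 1) else if a = m then x (m - 1) + x (m + 1) + x (m + 2) else x m)"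
    if "a \<in> {1..N}" "x 0 = 0" for a and x :: "nat \<Rightarrow> int"
    using nbr_sum_D[OF m(2), of a "\<lambda>b. int 1 * x b"] that m(1) unfolding lk_mult wt_const by simp
  have st: "y \<in> ?L" if "x \<in> ?L" "a \<in> {1..N}" "x 0 = 0"
    "y = x(a := (if a < m then x (a - 1) + x (a + 1) else if a = m then x (m - 1) + x (m + 1) + x (m + 2) else x m) - x a)" for x y a
    using step[OF that(1,2)] sum[of a x, OF that(2,3)] that(4) by simp
  have "(\<lambda>b. if b \<in> {1..k} then 1 else 0) \<in> ?L" if "1 \<le> k" "k \<le> m + 1" for k
    using that
  proof (induction k rule: nat_induct_at_least)
    case base
    have "(\<lambda>b::nat. if b \<in> {1..1} then 1 else 0) = (\<lambda>b. if b = 1 then 1 else 0::int)" by (auto simp: fun_eq_iff)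
    then show ?case using long_roots.base[of 1 N "\<lambda>_. 1" 1 "edges_D N"] assms by simp
  next
    case (Suc k)
    show ?case by (rule st[OF Suc.IH, of "Suc k"]) (use Suc m in \<open>auto simp: fun_eq_iff\<close>)
  qed
  then have p: "(\<lambda>b. if b \<in> {1..m + 1} then 1 else 0) \<in> ?L" by simp
  have q: "(\<lambda>b. if b \<in> {1..N} then if b < m + 1 \<or> b > m then 1 else 2 else 0) \<in> ?L"
    by (rule st[OF p, of "m + 2"]) (use m in \<open>auto simp: fun_eq_iff\<close>)
  \<comment> \<open>The vector of all ones is the case \<open>k = m + 1\<close>; the reflections at
    \<open>m\<close>, ..., 2 descend along the long leg and turn ones into twos.\<close>
  have "(\<lambda>b. if b \<in> {1..N} then if b < k \<or> b > m then 1 else 2 else 0) \<in> ?L" if "k \<in> {2..m + 1}" for k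
  proof -
    have "k \<le> m + 1" using that by simp
    then have "k \<ge> 2 \<longrightarrow> (\<lambda>b. if b \<in> {1..N} then if b < k \<or> b > m then 1 else 2 else 0) \<in> ?L"
    proof (induction k rule: inc_induct)
      case (step k)
      show ?case
      proof
        assume k: "2 \<le> k"
        then have p: "(\<lambda>b. if b \<in> {1..N} then if b < Suc k \<or> b > m then 1 else 2 else 0) \<in> ?L" using step by simp
        show "(\<lambda>b. if b \<in> {1..N} then if b < k \<or> b > m then 1 else 2 else 0) \<in> ?L"
          by (rule st[OF p, of k]) (use m k step in \<open>auto simp: fun_eq_iff\<close>)
      qed
    qed (use q in simp)
    then show ?thesis using that by simp
  qed
  then show "(\<lambda>b. if b \<in> {1..N} then if b < 2 \<or> b > N - 2 then 1 else 2 else 0) \<in> ?L"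
    unfolding m_def[symmetric] using m(2) by simp
  show "(\<Sum>b\<in>{1..N}. int (lk (\<lambda>_. 1) (edges_D N) a b) * (if b \<in> {1..N} then if b < 2 \<or> b > N - 2 then 1 else 2 else 0)) \<le>
      2 * (if a \<in> {1..N} then if a < 2 \<or> a > N - 2 then 1 else 2 else 0)"
    if "a \<in> {1..N}" for a
    by (subst sum[OF that]) (use that m in auto)
  have "(\<Sum>a\<in>{1..N}. (if a \<in> {1..N} then if a < 2 \<or> a > N - 2 then 1 else 2 else 0) * int 1) =
      (\<Sum>a\<in>{1..N}. if a = 1 \<or> a = N - 1 \<or> a = N then 1 else 2)"
    by (intro sum.cong) (use m in auto)
  also have "\<dots> = 2 * int N - 3"
  proof -
    have "{1..N} = insert 1 (insert N (insert (N - 1) {2..N-2}))" using assms by auto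
    moreover have "(\<Sum>a\<in>{2..N-2}. if a = 1 \<or> a = N - 1 \<or> a = N then 1 else 2::int) = (\<Sum>a\<in>{2..N-2}. 2)"
      by (intro sum.cong) auto
    ultimately show ?thesis using m by simp
  qed
  finally show "1 + (\<Sum>a\<in>{1..N}. (if a \<in> {1..N} then if a < 2 \<or> a > N - 2 then 1 else 2 else 0) * int 1) div int 1 = int (2 * N - 2)"
    using m by simp
  fix c a u assume c: "lmesh N (\<lambda>_. 1) (edges_D N) c" and a: "a \<in> {1..N}"
  have mesh: "zero_ext N c a (u + 1) + zero_ext N c a (u - 1) = (if a < m then zero_ext N c (a - 1) u + zero_ext N c (a + 1) u
    else if a = m then zero_ext N c (m - 1) u + zero_ext N c (m + 1) u + zero_ext N c (m + 2) u else zero_ext N c m u)" if "a \<in> {1..N}" for a u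
    unfolding lmesh_1[OF c that] using nbr_sum_D[OF m(2), of a "\<lambda>b. zero_ext N c b u"] that m by simp
  have "zero_ext N c a (u + 4 * (int N - 1)) = zero_ext N c a u" if "a \<in> {1..N}" for a u
    by (rule period_D[of _ N]) (use mesh[of "N - 2"] mesh[of "N - 1"] mesh[of N] mesh m that in \<open>auto simp: Suc_diff_Suc numeral_2_eq_2 numeral_3_eq_3\<close>)
  from periodI[OF this] show "c a (u + 2 * int 1 * int (2 * N - 2)) = c a u" using a m by (simp add: algebra_simps)
qed auto

section \<open>The exceptional types, by evaluation of reflection words\<close>

definition vec_of :: "int list \<Rightarrow> nat \<Rightarrow> int" where
  "vec_of xs b = (if b \<in> {1..length xs} then xs ! (b - 1) else 0)"

text \<open>The simple reflection at \<open>a\<close> on coordinate lists, with \<open>nb a\<close>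
  listing the neighbours and their multiplicities. On lists the reflection words below can be
  evaluated.\<close>

definition list_step :: "(nat \<Rightarrow> (nat \<times> int) list) \<Rightarrow> nat \<Rightarrow> int list \<Rightarrow> int list" where
  "list_step nb a xs = xs[a - 1 := (\<Sum>(b, k)\<leftarrow>nb a. k * vec_of xs b) - vec_of xs a]"

lemma long_roots_word:
  assumes nb: "\<And>a xs. a \<in> {1..N} \<Longrightarrow> length xs = N \<Longrightarrow>
      (\<Sum>b\<in>{1..N}. int (lk d E a b) * vec_of xs b) = (\<Sum>(b, k)\<leftarrow>nb a. k * vec_of xs b)"
    and "vec_of xs \<in> long_roots N d E r" "length xs = N" "set w \<subseteq> {1..N}"
  shows "vec_of (fold (list_step nb) w xs) \<in> long_roots N d E r"
  using assms(2-4)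
proof (induction w arbitrary: xs)
  case (Cons a w)
  have a: "a \<in> {1..N}" using Cons.prems by simp
  have "vec_of (list_step nb a xs) = (vec_of xs)(a := (\<Sum>b\<in>{1..N}. int (lk d E a b) * vec_of xs b) - vec_of xs a)"
    unfolding nb[OF a Cons.prems(2)] using a Cons.prems(2)
    by (auto simp: list_step_def vec_of_def fun_eq_iff nth_list_update)
  then have "vec_of (list_step nb a xs) \<in> long_roots N d E r" using step[OF Cons.prems(1) a] by simp
  then show ?case using Cons.IH[of "list_step nb a xs"] Cons.prems by (simp add: list_step_def)
qed simp

lemma vec_of_simple: "vec_of (1 # replicate n 0) = (\<lambda>b. if b = 1 then 1 else 0)"
  by (auto simp: vec_of_def fun_eq_iff nth_Cons')

definition nbs_E :: "nat \<Rightarrow> nat \<Rightarrow> (nat \<times> int) list" where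
  "nbs_E N a = (if a = 1 then [(3, 1)] else if a = 2 then [(4, 1)] else if a = 3 then [(1, 1), (4, 1)]
     else if a = 4 then [(2, 1), (3, 1), (5, 1)] else [(a - 1, 1), (a + 1, 1)])"

lemma nbs_E:
  assumes "N \<ge> 6" "a \<in> {1..N}" "length xs = N"
  shows "(\<Sum>b\<in>{1..N}. int (lk (\<lambda>_. 1) (edges_E N) a b) * vec_of xs b) = (\<Sum>(b, k)\<leftarrow>nbs_E N a. k * vec_of xs b)"
proof -
  have "vec_of xs (Suc N) = 0" using assms by (simp add: vec_of_def)
  from nbr_sum_E[OF assms(1,2), of "\<lambda>b. int 1 * vec_of xs b"] this
  show ?thesis unfolding lk_mult wt_const by (simp add: nbs_E_def)
qed

lemma type_data_E_aux:
  assumes N: "N \<in> {6, 7, 8}" and th: "th = fold (list_step (nbs_E N)) w (1 # replicate (N - 1) 0)" "length th = N"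
    and w: "set w \<subseteq> {1..N}" and pos: "\<forall>a\<in>{1..N}. vec_of th a > 0 \<and> (\<Sum>(b, k)\<leftarrow>nbs_E N a. k * vec_of th b) \<le> 2 * vec_of th a"
    and h: "1 + sum_list th = int h" "h = (if N = 6 then 12 else if N = 7 then 18 else 30)"
  shows "type_data N (\<lambda>_. 1) (edges_E N) 1 (vec_of th) h"
  unfolding type_data_def
proof (intro conjI ballI allI impI)
  have N6: "N \<ge> 6" using N by auto
  show "vec_of th \<in> long_roots N (\<lambda>_. 1) (edges_E N) 1" unfolding th(1)
    by (rule long_roots_word[OF nbs_E[OF N6]]; (simp only: vec_of_simple)?) (use N6 w in \<open>auto intro: long_roots.base\<close>)
  show "vec_of th a > 0" if "a \<in> {1..N}" for a using pos that by blast
  show "(\<Sum>b\<in>{1..N}. int (lk (\<lambda>_. 1) (edges_E N) a b) * vec_of th b) \<le> 2 * vec_of th a" if "a \<in> {1..N}" for a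
    unfolding nbs_E[OF N6 that th(2)] using pos that by blast
  have "(\<Sum>a\<in>{1..N}. vec_of th a) = (\<Sum>a<N. th ! a)"
    by (rule sum.reindex_bij_witness[of _ Suc "\<lambda>a. a - 1"]) (use th(2) in \<open>auto simp: vec_of_def\<close>)
  then show "1 + (\<Sum>a\<in>{1..N}. vec_of th a * int 1) div int 1 = int h"
    using h(1) th(2) by (simp add: sum_list_sum_nth atLeast0LessThan)
  fix c a u assume c: "lmesh N (\<lambda>_. 1) (edges_E N) c" and a: "a \<in> {1..N}"
  have m: "zero_ext N c a (u + 1) + zero_ext N c a (u - 1) = (if a = 1 then zero_ext N c 3 u else if a = 2 then zero_ext N c 4 u
      else if a = 3 then zero_ext N c 1 u + zero_ext N c 4 u else if a = 4 then zero_ext N c 2 u + zero_ext N c 3 u + zero_ext N c 5 u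
      else zero_ext N c (a - 1) u + zero_ext N c (a + 1) u)" if "a \<in> {1..N}" for a u
    unfolding lmesh_1[OF c that] by (rule nbr_sum_E[OF N6 that]) simp
  have "zero_ext N c a (u + (if N = 6 then 24 else if N = 7 then 36 else 60)) = zero_ext N c a u" if "a \<in> {1..N}" for a u
    by (rule period_E[OF N that]) (use m N6 in auto)
  from periodI[OF this] show "c a (u + 2 * int 1 * int h) = c a u" using a N by (auto simp: h(2))
qed

lemma type_data_E:
  assumes "N \<in> {6, 7, 8}"
  shows "\<exists>\<theta> h. type_data N (\<lambda>_. 1) (edges_E N) 1 \<theta> h"
proof -
  consider "N = 6" | "N = 7" | "N = 8" using assms by blast
  then show ?thesis
  proof cases
    case 1
    \<comment> \<open>A word of simple reflections leading from the simple root at 1 to the highest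
      root. Its length is the height of that root minus 1, each reflection adding one simple root;
      the words for \<open>E_7\<close> and \<open>E_8\<close> are of the same kind.\<close>
    have e: "[1, 2, 2, 3, 2, 1] = fold (list_step (nbs_E 6)) [3, 4, 5, 6, 2, 4, 5, 3, 4, 2] (1 # replicate (6 - 1) 0)"
      by code_simp
    have p: "\<forall>a\<in>{1..6}. vec_of [1, 2, 2, 3, 2, 1] a > 0 \<and>
       (\<Sum>(b, k)\<leftarrow>nbs_E 6 a. k * vec_of [1, 2, 2, 3, 2, 1] b) \<le> 2 * vec_of [1, 2, 2, 3, 2, 1] a" by code_simp
    show ?thesis using type_data_E_aux[OF assms[unfolded 1] e _ _ p, of 12] unfolding 1 by auto
  next
    case 2
    have e: "[2, 2, 3, 4, 3, 2, 1] = fold (list_step (nbs_E 7)) [3, 4, 5, 6, 7, 2, 4, 5, 6, 3, 4, 5, 2, 4, 3, 1] (1 # replicate (7 - 1) 0)"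
      by code_simp
    have p: "\<forall>a\<in>{1..7}. vec_of [2, 2, 3, 4, 3, 2, 1] a > 0 \<and>
       (\<Sum>(b, k)\<leftarrow>nbs_E 7 a. k * vec_of [2, 2, 3, 4, 3, 2, 1] b) \<le> 2 * vec_of [2, 2, 3, 4, 3, 2, 1] a" by code_simp
    show ?thesis using type_data_E_aux[OF assms[unfolded 2] e _ _ p, of 18] unfolding 2 by auto
  next
    case 3
    have e: "[2, 3, 4, 6, 5, 4, 3, 2] = fold (list_step (nbs_E 8)) [3, 4, 5, 6, 7, 8, 2, 4, 5, 6, 7, 3, 4, 5, 6, 2, 4, 5, 3, 4, 1,
        2, 3, 4, 5, 6, 7, 8] (1 # replicate (8 - 1) 0)"
      by code_simp
    have p: "\<forall>a\<in>{1..8}. vec_of [2, 3, 4, 6, 5, 4, 3, 2] a > 0 \<and>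
       (\<Sum>(b, k)\<leftarrow>nbs_E 8 a. k * vec_of [2, 3, 4, 6, 5, 4, 3, 2] b) \<le> 2 * vec_of [2, 3, 4, 6, 5, 4, 3, 2] a" by code_simp
    show ?thesis using type_data_E_aux[OF assms[unfolded 3] e _ _ p, of 30] unfolding 3 by auto
  qed
qed

definition nbs_A :: "(nat \<Rightarrow> nat) \<Rightarrow> nat \<Rightarrow> (nat \<times> int) list" where
  "nbs_A d a = [(a - 1, int (wt d a (a - 1))), (a + 1, int (wt d a (a + 1)))]"

lemma nbs_A:
  assumes "a \<in> {1..N}" "length xs = N"
  shows "(\<Sum>b\<in>{1..N}. int (lk d (edges_A N) a b) * vec_of xs b) = (\<Sum>(b, k)\<leftarrow>nbs_A d a. k * vec_of xs b)"
  using dominant_A[OF assms(1), of "vec_of xs"] assms by (simp add: nbs_A_def vec_of_def)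

lemma type_data_F4: "type_data 4 (\<lambda>a. if a \<le> 2 then 2 else 1) (edges_A 4) 2 (vec_of [2, 3, 4, 2]) 9"
  (is "type_data 4 ?d _ _ ?th _")
  unfolding type_data_def
proof (intro conjI ballI allI impI)
  \<comment> \<open>Fewer letters than the height of the root would suggest: each reflection at the
    short nodes 3 and 4 adds the simple root twice.\<close>
  have e: "fold (list_step (nbs_A ?d)) [2, 3, 4, 2, 3, 2, 1] (1 # replicate (4 - 1) 0) = [2, 3, 4, 2]"
    by code_simp
  have p: "\<forall>a\<in>{1..4}. ?th a > 0 \<and> (\<Sum>(b, k)\<leftarrow>nbs_A ?d a. k * ?th b) \<le> 2 * ?th a" by code_simp
  show "?th \<in> long_roots 4 ?d (edges_A 4) 2" unfolding e[symmetric]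
    by (rule long_roots_word[OF nbs_A]; (simp only: vec_of_simple)?) (auto intro: long_roots.base)
  show "?th a > 0" if "a \<in> {1..4}" for a using p that by blast
  show "(\<Sum>b\<in>{1..4}. int (lk ?d (edges_A 4) a b) * ?th b) \<le> 2 * ?th a" if "a \<in> {1..4}" for a
    using nbs_A[OF that, of "[2, 3, 4, 2]" ?d] p that by simp
  show "1 + (\<Sum>a\<in>{1..4}. ?th a * int (?d a)) div int 2 = int 9" by code_simp
  fix c a u assume c: "lmesh 4 ?d (edges_A 4) c" and a: "a \<in> {1..4::nat}"
  have m: "zero_ext 4 c 1 (u + 2) + zero_ext 4 c 1 (u - 2) = zero_ext 4 c 2 u"
    "zero_ext 4 c 2 (u + 2) + zero_ext 4 c 2 (u - 2) = zero_ext 4 c 1 u + zero_ext 4 c 3 u"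
    "zero_ext 4 c 3 (u + 1) + zero_ext 4 c 3 (u - 1) = zero_ext 4 c 2 (u + 1) + zero_ext 4 c 2 (u - 1) + zero_ext 4 c 4 u"
    "zero_ext 4 c 4 (u + 1) + zero_ext 4 c 4 (u - 1) = zero_ext 4 c 3 u" for u
    using lmesh_A[OF c, of 1 u] lmesh_A[OF c, of 2 u] lmesh_A[OF c, of 3 u] lmesh_A[OF c, of 4 u] zero_ext_0(2)[of 4 c]
    by (simp_all add: wt_def eval_nat_numeral algebra_simps)
  have "zero_ext 4 c a (u + 36) = zero_ext 4 c a u" if "a \<in> {1..4}" for a u
    by (rule period_F4[OF that m])
  from periodI[OF this] show "c a (u + 2 * int 2 * int 9) = c a u" using a by simp
qed

lemma type_data_G2: "type_data 2 (\<lambda>a. if a = 1 then 3 else 1) (edges_A 2) 3 (vec_of [2, 3]) 4"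
  (is "type_data 2 ?d _ _ ?th _")
  unfolding type_data_def
proof (intro conjI ballI allI impI)
  have e: "fold (list_step (nbs_A ?d)) [2, 1] (1 # replicate (2 - 1) 0) = [2, 3]"
    by code_simp
  have p: "\<forall>a\<in>{1..2}. ?th a > 0 \<and> (\<Sum>(b, k)\<leftarrow>nbs_A ?d a. k * ?th b) \<le> 2 * ?th a" by code_simp
  show "?th \<in> long_roots 2 ?d (edges_A 2) 3" unfolding e[symmetric]
    by (rule long_roots_word[OF nbs_A]; (simp only: vec_of_simple)?) (auto intro: long_roots.base)
  show "?th a > 0" if "a \<in> {1..2}" for a using p that by blast
  show "(\<Sum>b\<in>{1..2}. int (lk ?d (edges_A 2) a b) * ?th b) \<le> 2 * ?th a" if "a \<in> {1..2}" for a
    using nbs_A[OF that, of "[2, 3]" ?d] p that by simp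
  show "1 + (\<Sum>a\<in>{1..2}. ?th a * int (?d a)) div int 3 = int 4" by code_simp
  fix c a u assume c: "lmesh 2 ?d (edges_A 2) c" and a: "a \<in> {1..2::nat}"
  have m: "zero_ext 2 c 1 (u + 3) + zero_ext 2 c 1 (u - 3) = zero_ext 2 c 2 u"
    "zero_ext 2 c 2 (u + 1) + zero_ext 2 c 2 (u - 1) = zero_ext 2 c 1 (u + 2) + zero_ext 2 c 1 u + zero_ext 2 c 1 (u - 2)" for u
    using lmesh_A[OF c, of 1 u] lmesh_A[OF c, of 2 u] zero_ext_0(2)[of 2 c]
    by (simp_all add: wt_def numeral_2_eq_2 numeral_3_eq_3 algebra_simps)
  have "zero_ext 2 c a (u + 24) = zero_ext 2 c a u" if "a \<in> {1..2}" for a u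
    by (rule period_G2[OF that m])
  from periodI[OF this] show "c a (u + 2 * int 3 * int 4) = c a u" using a by simp
qed

theorem type_data_exists:
  assumes "folding_type r N d E"
  shows "\<exists>\<theta> h. type_data N d E r \<theta> h"
  using assms type_data_A[of N] type_data_B[of N] type_data_C[of N] type_data_D[of N] type_data_E[of N] type_data_F4 type_data_G2
  unfolding folding_type_def by (elim disjE conjE) (simp_all only:, blast+)

section \<open>The mesh recursion of the folded diagram and the dual Coxeter number\<close>

context folding
begin

text \<open>The kernel equation of the quantum Cartan matrix, with \<open>z\<close> acting as the
  unit shift. The entry at \<open>i\<close> and \<open>k\<close> is minus a quantum integer, whose
  terms become \<open>link i k\<close> shifts symmetric about 0.\<close>

definition folded_mesh :: "('v set \<Rightarrow> int \<Rightarrow> rat) \<Rightarrow> bool" where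
  "folded_mesh f \<longleftrightarrow> (\<forall>i\<in>nodes D. \<forall>u. f i (u + int (card i)) + f i (u - int (card i)) =
     (\<Sum>k\<in>nodes D. \<Sum>j<link i k. f k (u + 2 * int j + 1 - int (link i k))))"

lemma sum_symmetric_offsets: "(\<Sum>j<n. 2 * int j + 1 - int n) = 0"
proof -
  have "(\<Sum>j<n. 2 * int j + 1) = int n * int n" by (induction n) (simp_all add: algebra_simps)
  then show ?thesis by (simp add: sum_subtractf)
qed

text \<open>A vector in the kernel of the Cartan matrix gives a linearly growing, hence nonperiodic, solution of the mesh relations.\<close>

lemma nonsingular_if_periodic:
  assumes per: "\<forall>f i u. folded_mesh f \<longrightarrow> i \<in> nodes D \<longrightarrow> f i (u + P) = f i u" and "P \<noteq> 0"
    and row: "\<And>i. i \<in> nodes D \<Longrightarrow> 2 * x i = (\<Sum>k\<in>nodes D. of_nat (link i k) * x k)" and i: "i \<in> nodes D"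
  shows "x i = (0::rat)"
proof -
  define f where "f k u = of_int u * x k" for k :: "'v set" and u :: int
  have "folded_mesh f" unfolding folded_mesh_def
  proof (intro ballI allI)
    fix i u assume i: "i \<in> nodes D"
    have "(\<Sum>j<n. f k (u + 2 * int j + 1 - int n)) = of_int u * (of_nat n * x k)" for k n
    proof -
      have "(\<Sum>j<n. f k (u + 2 * int j + 1 - int n)) = (\<Sum>j<n. of_int u * x k + of_int (2 * int j + 1 - int n) * x k)"
        by (intro sum.cong) (simp_all add: f_def algebra_simps)
      also have "\<dots> = of_nat n * (of_int u * x k) + of_int (\<Sum>j<n. 2 * int j + 1 - int n) * x k"
        unfolding of_int_sum sum_distrib_right by (simp add: sum.distrib)
      finally show ?thesis unfolding sum_symmetric_offsets by (simp add: algebra_simps)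
    qed
    then have "(\<Sum>k\<in>nodes D. \<Sum>j<link i k. f k (u + 2 * int j + 1 - int (link i k))) = of_int u * (2 * x i)"
      unfolding row[OF i] by (simp add: sum_distrib_left)
    then show "f i (u + int (card i)) + f i (u - int (card i)) = (\<Sum>k\<in>nodes D. \<Sum>j<link i k. f k (u + 2 * int j + 1 - int (link i k)))"
      by (simp add: f_def algebra_simps)
  qed
  then have "f i (0 + P) = f i 0" using per i by blast
  then show ?thesis using \<open>P \<noteq> 0\<close> by (simp add: f_def)
qed

lemma labelled_link:
  assumes "node_labelling D N d E node" "a \<in> {1..N}" "b \<in> {1..N}"
  shows "link (node a) (node b) = lk d E a b"
  using assms by (simp add: node_labelling_def link_def lk_def)

lemma labelled_sum:
  assumes "node_labelling D N d E node" shows "(\<Sum>k\<in>nodes D. F k) = (\<Sum>b\<in>{1..N}. F (node b))"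
  using assms unfolding node_labelling_def by (metis sum.reindex_bij_betw)

lemma labelled_nodeE:
  assumes "node_labelling D N d E node" "i \<in> nodes D" obtains a where "a \<in> {1..N}" "i = node a"
  using assms unfolding node_labelling_def bij_betw_def by blast

lemma labelled_mesh:
  assumes L: "node_labelling D N d E node" and "folded_mesh f"
  shows "lmesh N d E (\<lambda>a. f (node a))"
  unfolding lmesh_def
proof (intro ballI allI)
  fix a u assume a: "a \<in> {1..N}"
  then have na: "node a \<in> nodes D" "card (node a) = d a" using L by (auto simp: node_labelling_def bij_betw_def)
  have "f (node a) (u + int (d a)) + f (node a) (u - int (d a)) =
      (\<Sum>b\<in>{1..N}. \<Sum>j<link (node a) (node b). f (node b) (u + 2 * int j + 1 - int (link (node a) (node b))))"
    using assms(2)[unfolded folded_mesh_def labelled_sum[OF L], rule_format, OF na(1), of u] unfolding na(2) .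
  also have "\<dots> = (\<Sum>b\<in>{1..N}. \<Sum>j<lk d E a b. f (node b) (u + 2 * int j + 1 - int (lk d E a b)))"
    by (intro sum.cong refl) (simp_all only: labelled_link[OF L a])
  finally show "f (node a) (u + int (d a)) + f (node a) (u - int (d a)) =
      (\<Sum>b\<in>{1..N}. \<Sum>j<lk d E a b. f (node b) (u + 2 * int j + 1 - int (lk d E a b)))" .
qed

lemma labelled_long_roots:
  assumes L: "node_labelling D N d E node" and "x \<in> long_roots N d E r"
  shows "(\<lambda>i. if i \<in> nodes D then x (the_inv_into {1..N} node i) else 0) \<in> folded_roots D \<and>
    long_vec (\<lambda>i. if i \<in> nodes D then x (the_inv_into {1..N} node i) else 0)"
  using assms(2)
proof induction
  let ?l = "the_inv_into {1..N} node"
  have inj: "inj_on node {1..N}" and im: "\<And>a. a \<in> {1..N} \<Longrightarrow> node a \<in> nodes D"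
    using L by (auto simp: node_labelling_def bij_betw_def)
  have l: "?l (node a) = a" if "a \<in> {1..N}" for a using the_inv_into_f_f[OF inj that] .
  have l_iff: "?l i = a \<longleftrightarrow> i = node a" if "a \<in> {1..N}" "i \<in> nodes D" for a i
    using labelled_nodeE[OF L that(2)] l that(1) by metis
  {
    case (base a)
    have "(\<lambda>i. if i \<in> nodes D then if ?l i = a then 1 else 0 else 0) = simple (node a)"
      using l_iff[OF base(1)] im[OF base(1)] by (auto simp: simple_def fun_eq_iff)
    then show ?case using folded_roots_simple long_vec_simple im[OF base(1)] L base by (simp add: node_labelling_def)
  next
    case (step x a)
    let ?\<beta> = "\<lambda>i. if i \<in> nodes D then x (?l i) else 0"
    have a: "a \<in> {1..N}" using step by blast
    have r: "row ?\<beta> (node a) = 2 * x a - (\<Sum>b\<in>{1..N}. int (lk d E a b) * x b)"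
      unfolding row_def labelled_sum[OF L] using im l a labelled_link[OF L a] by simp
    have "(\<lambda>i. if i \<in> nodes D then (x(a := (\<Sum>b\<in>{1..N}. int (lk d E a b) * x b) - x a)) (?l i) else 0) = reflect (node a) ?\<beta>"
    proof
      fix i
      show "(if i \<in> nodes D then (x(a := (\<Sum>b\<in>{1..N}. int (lk d E a b) * x b) - x a)) (?l i) else 0) = reflect (node a) ?\<beta> i"
        unfolding reflect_def r simple_def using l_iff[OF a, of i] im[OF a] by auto
    qed
    then show ?case using folded_roots_reflect long_vec_reflect im[OF a] step.IH by simp
  }
qed

text \<open>The order of deduction matters. The period is available with the number \<open>h\<close>
  of the type; it makes the Cartan matrix nonsingular and thereby the form definite; this identifies
  \<open>\<Theta>\<close> as the highest root, so that \<open>h\<close> is the dual Coxeter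
  number.\<close>

lemma dual_coxeter_period:
  "dual_coxeter D > 0 \<and> (\<forall>f i u. folded_mesh f \<longrightarrow> i \<in> nodes D \<longrightarrow> f i (u + 2 * int r * int (dual_coxeter D)) = f i u)"
proof -
  obtain N d E node where T: "folding_type r N d E" and L: "node_labelling D N d E node"
    using folding_classification by blast
  obtain \<theta> h where t: "type_data N d E r \<theta> h" using type_data_exists[OF T] by blast
  note t = t[unfolded type_data_def]
  let ?l = "the_inv_into {1..N} node"
  define \<Theta> where "\<Theta> i = (if i \<in> nodes D then \<theta> (?l i) else 0)" for i
  have inj: "inj_on node {1..N}" and im: "\<And>a. a \<in> {1..N} \<Longrightarrow> node a \<in> nodes D" and d: "\<And>a. a \<in> {1..N} \<Longrightarrow> card (node a) = d a"
    using L by (auto simp: node_labelling_def bij_betw_def)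
  have \<Theta>: "\<Theta> (node a) = \<theta> a" if "a \<in> {1..N}" for a
    using im[OF that] the_inv_into_f_f[OF inj that] by (simp add: \<Theta>_def)
  have "0 \<le> (\<Sum>a\<in>{1..N}. \<theta> a * int (d a))" using t by (intro sum_nonneg mult_nonneg_nonneg) (auto simp: less_imp_le)
  then have "0 \<le> (\<Sum>a\<in>{1..N}. \<theta> a * int (d a)) div int r" using r_pos by (simp add: pos_imp_zdiv_nonneg_iff)
  then have h: "h > 0" using t by linarith
  have t4: "c a (u + 2 * int r * int h) = c a u" if "lmesh N d E c" "a \<in> {1..N}" for c a u using t that by blast
  have per: "f i (u + 2 * int r * int h) = f i u" if f: "folded_mesh f" and i: "i \<in> nodes D" for f i u
  proof -
    obtain a where a: "a \<in> {1..N}" "i = node a" using labelled_nodeE[OF L i] .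
    show ?thesis unfolding a(2) by (rule t4[OF labelled_mesh[OF L f] a(1)])
  qed
  have R: "\<Theta> \<in> folded_roots D" "long_vec \<Theta>"
    using labelled_long_roots[OF L, of \<theta>] t unfolding \<Theta>_def by blast+
  interpret dominant_vec D \<Theta>
  proof
    show "long_vec \<Theta>" by (rule R)
    show "\<Theta> i > 0" if i: "i \<in> nodes D" for i
    proof -
      obtain a where a: "a \<in> {1..N}" "i = node a" using labelled_nodeE[OF L i] .
      then show ?thesis using \<Theta> t by simp
    qed
    show "row \<Theta> i \<ge> 0" if i: "i \<in> nodes D" for i
    proof -
      obtain a where a: "a \<in> {1..N}" "i = node a" using labelled_nodeE[OF L i] .
      have "row \<Theta> i = 2 * \<theta> a - (\<Sum>b\<in>{1..N}. int (lk d E a b) * \<theta> b)"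
        unfolding row_def labelled_sum[OF L] a(2) using \<Theta> a(1) labelled_link[OF L a(1)] by simp
      then show ?thesis using t a by simp
    qed
    show "\<Theta> i = 0" if "i \<notin> nodes D" for i using that by (simp add: \<Theta>_def)
    show "x i = 0" if x: "\<And>i. i \<in> nodes D \<Longrightarrow> row x i = 0" and i: "i \<in> nodes D" for x i
    proof -
      have "(of_int (x i) :: rat) = 0"
      proof (rule nonsingular_if_periodic[of "2 * int r * int h" "\<lambda>i. of_int (x i)"])
        show "\<forall>f i u. folded_mesh f \<longrightarrow> i \<in> nodes D \<longrightarrow> f i (u + 2 * int r * int h) = f i u" using per by blast
      next
        fix i assume i: "i \<in> nodes D"
        have "2 * x i = (\<Sum>k\<in>nodes D. int (link i k) * x k)" using x[OF i] by (simp add: row_def)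
        from arg_cong[OF this, of of_int]
        show "2 * (of_int (x i) :: rat) = (\<Sum>k\<in>nodes D. of_nat (link i k) * of_int (x k))" by simp
      qed (use h r_pos i in auto)
      then show ?thesis by simp
    qed
  qed
  have "(\<Sum>i\<in>nodes D. \<Theta> i * int (card i)) = (\<Sum>a\<in>{1..N}. \<theta> a * int (d a))"
    unfolding labelled_sum[OF L] using \<Theta> d by simp
  then have "dual_coxeter D = h" unfolding dual_coxeter_def highest_root_eq[OF R(1)] using t by simp
  then show ?thesis using per h by simp
qed

lemma dual_coxeter_pos: "dual_coxeter D > 0" using dual_coxeter_period by blast

lemma folded_mesh_periodic: "folded_mesh f \<Longrightarrow> i \<in> nodes D \<Longrightarrow> f i (u + 2 * int r * int (dual_coxeter D)) = f i u"
  using dual_coxeter_period by blast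

text \<open>For \<open>r = 3\<close> the diagram of orbits is that of \<open>G_2\<close>, so every
  moved vertex is adjacent to the fixed one. This brings the staircase condition of height functions
  to bear on every nontrivial orbit.\<close>

lemma triality:
  assumes "r = 3" "\<sigma> x \<noteq> x" shows "\<exists>y. adj D x y \<and> \<sigma> y = y"
proof -
  obtain N d E node where T: "folding_type r N d E" and L: "node_labelling D N d E node"
    using folding_classification by blast
  have N: "N = 2" "E = edges_A N" "d = (\<lambda>a. if a = 1 then 3 else 1)" using T assms(1) by (auto simp: folding_type_def)
  obtain a where a: "a \<in> {1..N}" "orbit D x = node a" using labelled_nodeE[OF L orbit_in_nodes] .
  have "card (orbit D x) = 3" using dn_cases[of x] assms by (simp add: dn_def)
  then have "a = 1" using L a N(3) by (auto simp: node_labelling_def split: if_splits)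
  have m: "1 \<in> {1..N}" "2 \<in> {1..N}" using N(1) by auto
  have n2: "node 2 \<in> nodes D" "card (node 2) = 1" "adj_nodes D (orbit D x) (node 2)"
    using L m N a(2) \<open>a = 1\<close> by (auto simp: node_labelling_def bij_betw_def nbr_A)
  obtain y where y: "node 2 = orbit D y" using n2(1) by (auto simp: nodes_def)
  have f: "\<sigma> y = y" using n2(2) y dn_1_fixed[of y] by (simp add: dn_def)
  have "node 2 = {y}" unfolding y by (rule orbit_fixed[OF f])
  then obtain x' where "x' \<in> orbit D x" "adj D x' y" using n2(3) by (auto simp: adj_nodes_def)
  then have "adj D y x'" "x \<in> orbit D x'" using adj_sym orbit_eq by (blast, metis self_in_orbit)
  then have "adj D y x" using adj_fixed_orbit[of y x' x] f dn_cases[of y] assms(1) by auto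
  then show ?thesis using f adj_sym by blast
qed

end

text \<open>The Cartan matrix of the diagram is that of its folding by the identity, whose orbits
  are singletons, so the argument by linear growth applies to it too.\<close>

lemma ADE_nonsingular:
  fixes D :: "('v::finite) folding" and c :: "'v \<Rightarrow> rat"
  assumes "ADE_diagram (adj D)" and c: "\<And>y. (\<Sum>x\<in>UNIV. c x * of_int (simple_root D x y)) = 0"
  shows "c x = 0"
proof -
  define D' where "D' = D\<lparr>aut := id\<rparr>"
  have D': "adj D' = adj D" "aut D' = id" by (simp_all add: D'_def)
  have "fold_order D' = 1" unfolding fold_order_def D' by (rule Least_equality) (auto simp: id_def)
  then have "is_folding D'" using ADE_adj_irrefl[OF assms(1)] assms(1) by (simp add: is_folding_def D')
  then interpret folding D' by unfold_locales
  have orb: "orbit D' y = {y}" for y by (rule orbit_fixed) (simp add: D')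
  have nodes: "nodes D' = (\<lambda>y. {y}) ` UNIV" unfolding nodes_def orb by simp
  have link: "link {y} {z} = (if adj D y z then 1 else 0)" for y z
    by (simp add: link_def adj_nodes_def D')
  have "c (the_elem {x}) = 0"
  proof (rule nonsingular_if_periodic[of "2 * int r * int (dual_coxeter D')" "\<lambda>i. c (the_elem i)"])
    show "\<forall>f i u. folded_mesh f \<longrightarrow> i \<in> nodes D' \<longrightarrow> f i (u + 2 * int r * int (dual_coxeter D')) = f i u"
      using dual_coxeter_period by blast
  next
    fix i assume "i \<in> nodes D'"
    then obtain y where y: "i = {y}" by (auto simp: nodes)
    have "(\<Sum>k\<in>nodes D'. of_nat (link i k) * c (the_elem k)) = (\<Sum>z\<in>UNIV. (if adj D z y then 1 else 0) * c z)"
      unfolding nodes y by (subst sum.reindex) (auto simp: link adj_sym[unfolded D'(1)] intro!: sum.cong inj_onI)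
    moreover have "(\<Sum>x\<in>UNIV. c x * of_int (simple_root D x y)) = 2 * c y - (\<Sum>z\<in>UNIV. (if adj D z y then 1 else 0) * c z)"
    proof -
      have "c x * of_int (simple_root D x y) = (if x = y then 2 * c y else 0) - (if adj D x y then 1 else 0) * c x" for x
        using ADE_adj_irrefl[OF assms(1)] by (auto simp: simple_root_def)
      then show ?thesis by (simp add: sum_subtractf)
    qed
    ultimately show "2 * c (the_elem i) = (\<Sum>k\<in>nodes D'. of_nat (link i k) * c (the_elem k))"
      using c[of y] y by simp
  qed (use dual_coxeter_pos r_pos in \<open>auto simp: nodes\<close>)
  then show ?thesis by simp
qed

section \<open>Weyl group actions\<close>

definition additive_map :: "(('v \<Rightarrow> int) \<Rightarrow> ('v \<Rightarrow> int)) \<Rightarrow> bool" where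
  "additive_map w \<longleftrightarrow> (\<forall>a b \<kappa> \<mu>. w (\<lambda>y. a * \<kappa> y + b * \<mu> y) = (\<lambda>y. a * w \<kappa> y + b * w \<mu> y))"

lemma additive_mapD: "additive_map w \<Longrightarrow> w (\<lambda>y. a * \<kappa> y + b * \<mu> y) = (\<lambda>y. a * w \<kappa> y + b * w \<mu> y)"
  by (simp add: additive_map_def)

lemma additive_map_scale: "additive_map w \<Longrightarrow> w (\<lambda>y. a * \<kappa> y) = (\<lambda>y. a * w \<kappa> y)"
  using additive_mapD[of w a \<kappa> 0 \<kappa>] by simp

lemma additive_map_diff: "additive_map w \<Longrightarrow> w (\<lambda>y. \<kappa> y - \<mu> y) = (\<lambda>y. w \<kappa> y - w \<mu> y)"
  using additive_mapD[of w 1 \<kappa> "-1" \<mu>] by simp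

lemma additive_map_sum:
  assumes "additive_map w"
  shows "w (\<lambda>y. \<Sum>i\<in>A. c i * f i y) = (\<lambda>y. \<Sum>i\<in>A. c i * w (f i) y)"
proof -
  have 0: "w (\<lambda>y. 0) = (\<lambda>y. 0)" using additive_map_scale[OF assms, of 0 "\<lambda>_. 0"] by simp
  show ?thesis
  proof (induction A rule: infinite_finite_induct)
    case (insert i A)
    have "w (\<lambda>y. \<Sum>i\<in>insert i A. c i * f i y) = w (\<lambda>y. c i * f i y + 1 * (\<Sum>i\<in>A. c i * f i y))"
      using insert.hyps by simp
    also have "\<dots> = (\<lambda>y. c i * w (f i) y + 1 * w (\<lambda>y. \<Sum>i\<in>A. c i * f i y) y)"
      by (rule additive_mapD[OF assms])
    also have "\<dots> = (\<lambda>y. \<Sum>i\<in>insert i A. c i * w (f i) y)"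
      unfolding insert.IH using insert.hyps by simp
    finally show ?case .
  qed (simp_all add: 0)
qed

lemma additive_map_id: "additive_map id" by (simp add: additive_map_def)
lemma additive_map_comp: "additive_map u \<Longrightarrow> additive_map w \<Longrightarrow> additive_map (u \<circ> w)"
  by (simp add: additive_map_def)

lemma additive_map_inverse:
  assumes "additive_map w" "u \<circ> w = id" "w \<circ> u = id" shows "additive_map u"
  unfolding additive_map_def
proof (intro allI)
  fix a b \<kappa> \<mu>
  have uw: "u (w f) = f" "w (u f) = f" for f using assms(2,3) by (metis comp_apply id_apply)+
  have "u (\<lambda>y. a * \<kappa> y + b * \<mu> y) = u (\<lambda>y. a * w (u \<kappa>) y + b * w (u \<mu>) y)" by (simp add: uw)
  also have "\<dots> = u (w (\<lambda>y. a * u \<kappa> y + b * u \<mu> y))" by (simp add: additive_mapD[OF assms(1)])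
  finally show "u (\<lambda>y. a * \<kappa> y + b * \<mu> y) = (\<lambda>y. a * u \<kappa> y + b * u \<mu> y)" by (simp add: uw)
qed

lemma weight_expansion: "\<kappa> = (\<lambda>y::'v::finite. \<Sum>x\<in>UNIV. \<kappa> x * fund_weight x y)"
  by (rule ext) (simp add: fund_weight_def if_distrib cong: if_cong)

lemma additive_map_eqI:
  fixes u w :: "('v::finite \<Rightarrow> int) \<Rightarrow> ('v \<Rightarrow> int)"
  assumes "additive_map u" "additive_map w" and "\<And>x. u (fund_weight x) = w (fund_weight x)"
  shows "u = w"
proof
  fix \<kappa>
  have "u (\<lambda>y. \<Sum>x\<in>UNIV. \<kappa> x * fund_weight x y) = w (\<lambda>y. \<Sum>x\<in>UNIV. \<kappa> x * fund_weight x y)"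
    by (simp only: additive_map_sum[OF assms(1)] additive_map_sum[OF assms(2)] assms(3))
  then show "u \<kappa> = w \<kappa>" by (simp only: weight_expansion[symmetric])
qed

context folding begin

lemma simple_root_sym: "simple_root D x y = simple_root D y x"
  using adj_sym by (auto simp: simple_root_def)

lemma additive_map_reflection: "additive_map (reflection D x)"
  unfolding additive_map_def reflection_def by (simp add: fun_eq_iff algebra_simps)

lemma reflection_involution: "reflection D x \<circ> reflection D x = id"
  by (rule ext, rule ext) (simp add: reflection_def simple_root_def algebra_simps)

lemma weyl_additive: "w \<in> weyl_group D \<Longrightarrow> additive_map w"
proof (induction rule: weyl_group.induct)
  case (weyl_refl w x)
  show ?case by (rule additive_map_comp[OF additive_map_reflection weyl_refl.IH])
qed (rule additive_map_id)

lemma weyl_comp: "u \<in> weyl_group D \<Longrightarrow> w \<in> weyl_group D \<Longrightarrow> u \<circ> w \<in> weyl_group D"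
proof (induction rule: weyl_group.induct)
  case (weyl_refl u x)
  from weyl_group.weyl_refl[OF weyl_refl.IH[OF weyl_refl.prems]] show ?case by (simp only: comp_assoc)
qed (simp only: id_comp)

lemma reflection_weyl: "reflection D x \<in> weyl_group D"
  using weyl_refl[OF weyl_id, of D x] by simp

lemma weyl_inverse:
  assumes "w \<in> weyl_group D"
  shows "\<exists>u\<in>weyl_group D. u \<circ> w = id \<and> w \<circ> u = id"
  using assms
proof (induction rule: weyl_group.induct)
  case weyl_id
  show ?case by (rule bexI[of _ id]) (auto intro: weyl_group.weyl_id)
next
  case (weyl_refl w x)
  then obtain u where u: "u \<in> weyl_group D" "u \<circ> w = id" "w \<circ> u = id" by blast
  show ?case
  proof (intro bexI[of _ "u \<circ> reflection D x"] conjI)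
    show "u \<circ> reflection D x \<circ> (reflection D x \<circ> w) = id"
      using u(2) reflection_involution[of x] by (metis comp_assoc comp_id)
    show "reflection D x \<circ> w \<circ> (u \<circ> reflection D x) = id"
      using u(3) reflection_involution[of x] by (metis comp_assoc comp_id)
  qed (use u reflection_weyl weyl_comp in auto)
qed

lemma weyl_bij: "w \<in> weyl_group D \<Longrightarrow> bij w"
  using weyl_inverse[of w] o_bij by blast

lemma weyl_inv_into:
  assumes "w \<in> weyl_group D" shows "inv_into UNIV w \<in> weyl_group D"
proof -
  obtain u where u: "u \<in> weyl_group D" "u \<circ> w = id" "w \<circ> u = id" using weyl_inverse[OF assms] by blast
  have "inv_into UNIV w = u" using u(2,3) by (metis inv_unique_comp)
  then show ?thesis using u by simp
qed

text \<open>For pairwise nonadjacent points of \<open>S\<close> this is the product of the commuting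
  reflections at \<open>S\<close>; as a sum it needs no order of the factors.\<close>

definition refl_set :: "'v set \<Rightarrow> ('v \<Rightarrow> int) \<Rightarrow> ('v \<Rightarrow> int)" where
  "refl_set S \<kappa> = (\<lambda>y. \<kappa> y - (\<Sum>x\<in>S. \<kappa> x * simple_root D x y))"

lemma refl_set_at:
  assumes "\<And>x y. x \<in> S \<Longrightarrow> y \<in> S \<Longrightarrow> \<not> adj D x y"
  shows "x \<in> S \<Longrightarrow> refl_set S \<kappa> x = - \<kappa> x"
proof -
  assume x: "x \<in> S"
  have "(\<Sum>z\<in>S. \<kappa> z * simple_root D z x) = (\<Sum>z\<in>S. if z = x then 2 * \<kappa> x else 0)"
    using assms x by (intro sum.cong) (auto simp: simple_root_def)
  then show ?thesis using x by (simp add: refl_set_def)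
qed

lemma refl_set_involution:
  assumes "\<And>x y. x \<in> S \<Longrightarrow> y \<in> S \<Longrightarrow> \<not> adj D x y"
  shows "refl_set S (refl_set S \<kappa>) = \<kappa>"
proof
  fix y
  have "(\<Sum>x\<in>S. refl_set S \<kappa> x * simple_root D x y) = - (\<Sum>x\<in>S. \<kappa> x * simple_root D x y)"
    unfolding sum_negf[symmetric] using refl_set_at[OF assms] by (intro sum.cong) simp_all
  then show "refl_set S (refl_set S \<kappa>) y = \<kappa> y"
    unfolding refl_set_def[of S "refl_set S \<kappa>"] by (simp add: refl_set_def)
qed

lemma refl_set_weyl:
  assumes "\<And>x y. x \<in> S \<Longrightarrow> y \<in> S \<Longrightarrow> \<not> adj D x y"
  shows "refl_set S \<in> weyl_group D"
proof -
  have "finite S" by simp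
  then show ?thesis using assms
  proof (induction S)
    case empty
    have "refl_set {} = id" by (rule ext) (simp add: refl_set_def)
    then show ?case by (simp only: weyl_id)
  next
    case (insert x S)
    have "refl_set S \<kappa> x = \<kappa> x" for \<kappa>
    proof -
      have "\<kappa> z * simple_root D z x = 0" if "z \<in> S" for z
        using insert.prems[of z x] insert.hyps that by (auto simp: simple_root_def)
      then have "(\<Sum>z\<in>S. \<kappa> z * simple_root D z x) = 0" by (rule sum.neutral[rule_format])
      then show ?thesis by (simp add: refl_set_def)
    qed
    then have "refl_set (insert x S) = reflection D x \<circ> refl_set S"
      by (intro ext) (simp add: reflection_def insert.hyps refl_set_def[of "insert x S"], simp add: refl_set_def)
    then show ?case using weyl_refl[OF insert.IH, of x] insert.prems by (simp only: insert_iff simp_thms)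
  qed
qed

lemma aut_weight_fund: "aut_weight D (fund_weight x) = fund_weight (\<sigma> x)"
  using bij_aut by (auto simp: aut_weight_def fund_weight_def fun_eq_iff bij_inv_eq_iff inv_f_eq inj_aut)

lemma additive_map_aut_weight: "additive_map (aut_weight D)"
  by (simp add: additive_map_def aut_weight_def)

lemma simple_root_aut: "simple_root D (\<sigma> x) (\<sigma> y) = simple_root D x y"
  using inj_aut by (simp add: simple_root_def adj_aut inj_eq)

lemma aut_inv: "\<sigma> (inv_into UNIV \<sigma> y) = y"
  using bij_aut by (simp add: bij_is_surj surj_f_inv_f)

lemma aut_weight_refl_set: "aut_weight D (refl_set S \<kappa>) = refl_set (\<sigma> ` S) (aut_weight D \<kappa>)"
proof
  fix y
  have "(\<Sum>x\<in>\<sigma> ` S. aut_weight D \<kappa> x * simple_root D x y) = (\<Sum>x\<in>S. aut_weight D \<kappa> (\<sigma> x) * simple_root D (\<sigma> x) (\<sigma> (inv_into UNIV \<sigma> y)))"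
    using inj_aut by (subst sum.reindex) (auto intro: inj_on_subset simp: aut_inv)
  also have "\<dots> = (\<Sum>x\<in>S. \<kappa> x * simple_root D x (inv_into UNIV \<sigma> y))"
    unfolding simple_root_aut by (simp add: aut_weight_def inj_aut)
  finally show "aut_weight D (refl_set S \<kappa>) y = refl_set (\<sigma> ` S) (aut_weight D \<kappa>) y"
    by (simp add: aut_weight_def refl_set_def)
qed

end

section \<open>Compatible families on the repetition quiver\<close>

text \<open>
  \<open>state\<close> is determined by its value at time 0 and \<open>state (t - 1) = state t \<circ> tick t\<close>, where \<open>tick t\<close>
  reflects at all vertices of time \<open>t\<close>.
\<close>

context parity_folding begin

definition tick :: "int \<Rightarrow> ('v \<Rightarrow> int) \<Rightarrow> ('v \<Rightarrow> int)" where
  "tick t = refl_set {x. vertex x t}"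

lemma tick_indep: "x \<in> {x. vertex x t} \<Longrightarrow> y \<in> {x. vertex x t} \<Longrightarrow> \<not> adj D x y"
  using vertex_adj_neq by blast

lemma tick_tick [simp]: "tick t (tick t \<kappa>) = \<kappa>"
  unfolding tick_def by (rule refl_set_involution[OF tick_indep])

lemma tick_weyl: "tick t \<in> weyl_group D"
  unfolding tick_def by (rule refl_set_weyl[OF tick_indep])

lemma tick_fund: "tick t (fund_weight x) = (if vertex x t then (\<lambda>y. fund_weight x y - simple_root D x y) else fund_weight x)"
proof
  fix y
  have "(\<Sum>z | vertex z t. fund_weight x z * simple_root D z y) = (\<Sum>z | vertex z t. if z = x then simple_root D x y else 0)"
    by (intro sum.cong) (auto simp: fund_weight_def)
  then show "tick t (fund_weight x) y = (if vertex x t then (\<lambda>y. fund_weight x y - simple_root D x y) else fund_weight x) y"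
    by (simp add: tick_def refl_set_def)
qed

primrec state_down :: "nat \<Rightarrow> ('v \<Rightarrow> int) \<Rightarrow> ('v \<Rightarrow> int)" where
  "state_down 0 = id" | "state_down (Suc n) = state_down n \<circ> tick (- int n)"

primrec state_up :: "nat \<Rightarrow> ('v \<Rightarrow> int) \<Rightarrow> ('v \<Rightarrow> int)" where
  "state_up 0 = id" | "state_up (Suc n) = state_up n \<circ> tick (int n + 1)"

definition state :: "int \<Rightarrow> ('v \<Rightarrow> int) \<Rightarrow> ('v \<Rightarrow> int)" where
  "state t = (if t \<ge> 0 then state_up (nat t) else state_down (nat (- t)))"

lemma state_step: "state (t - 1) = state t \<circ> tick t"
proof (cases "t \<ge> 1")
  case True
  then have "nat t = Suc (nat (t - 1))" "int (nat (t - 1)) + 1 = t" by auto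
  then have "state t = state (t - 1) \<circ> tick t" using True by (simp add: state_def)
  then show ?thesis by (intro ext) simp
next
  case False
  then have "nat (- (t - 1)) = Suc (nat (- t))" "- int (nat (- t)) = t" by auto
  then have "state (t - 1) = state_down (nat (- t)) \<circ> tick t" using False by (simp add: state_def)
  moreover have "state t = state_down (nat (- t))" using False by (cases "t = 0") (simp_all add: state_def)
  ultimately show ?thesis by simp
qed

lemma state_step': "state t = state (t - 1) \<circ> tick t"
  by (intro ext) (simp add: state_step)

lemma state_weyl: "state t \<in> weyl_group D"
proof -
  have "state_up n \<in> weyl_group D" "state_down n \<in> weyl_group D" for n
    by (induction n) (simp_all only: state_up.simps state_down.simps weyl_id weyl_comp[OF _ tick_weyl])
  then show ?thesis by (simp add: state_def)
qed

lemma state_additive: "additive_map (state t)" by (rule weyl_additive[OF state_weyl])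

definition E0 :: "'v \<Rightarrow> int \<Rightarrow> ('v \<Rightarrow> int)" where
  "E0 x p = state p (fund_weight x)"

text \<open>Between \<open>p\<close> and the next vertex over \<open>x\<close>, at
  \<open>p + 2 d\<close>, no \<open>tick\<close> touches the fundamental weight of \<open>x\<close>.
  Weights at different vertices can thus be compared at a common time.\<close>

lemma E0_window:
  assumes x: "vertex x p" and "p \<le> t" "t < p + 2 * dn D x"
  shows "state t (fund_weight x) = E0 x p"
  using assms(2,3)
proof (induction t rule: int_ge_induct)
  case (step t)
  have "\<not> vertex x (t + 1)"
  proof
    assume "vertex x (t + 1)"
    then have "t + 1 = p" using x step by (intro vertex_close[of x]) auto
    then show False using step by simp
  qed
  moreover have "state (t + 1) = state t \<circ> tick (t + 1)" using state_step'[of "t + 1"] by simp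
  ultimately show ?case using step by (simp add: tick_fund)
qed (simp add: E0_def)

lemma E0_drop:
  assumes "vertex x p"
  shows "E0 x (p - 2 * dn D x) = state p (\<lambda>y. fund_weight x y - simple_root D x y)"
proof -
  have "state (p - 1) (fund_weight x) = E0 x (p - 2 * dn D x)"
    using assms dn_pos[of x] by (intro E0_window) (auto simp: vertex_minus)
  then show ?thesis using assms by (simp add: state_step tick_fund)
qed

lemma fund_simple: "(\<lambda>y. fund_weight x y - simple_root D x y) = (\<lambda>y. (\<Sum>z | adj D x z. fund_weight z y) - fund_weight x y)"
proof
  fix y
  have "(\<Sum>z | adj D x z. fund_weight z y) = (if adj D x y then 1 else 0)"
  proof -
    have "(\<Sum>z | adj D x z. fund_weight z y) = (\<Sum>z | adj D x z. if z = y then 1 else 0)"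
      by (intro sum.cong) (auto simp: fund_weight_def)
    then show ?thesis by simp
  qed
  then show "fund_weight x y - simple_root D x y = (\<Sum>z | adj D x z. fund_weight z y) - fund_weight x y"
    using adj_irrefl[of x] by (auto simp: fund_weight_def simple_root_def)
qed

text \<open>\<open>q z\<close> is the last vertex over the neighbour \<open>z\<close> not after
  \<open>p\<close>. By \<open>E0_window\<close> its weight may be evaluated at time
  \<open>p\<close>, where the relation is the formula for a reflected fundamental weight.\<close>

lemma E0_mesh:
  assumes x: "vertex x p" and q: "\<And>z. adj D x z \<Longrightarrow> vertex z (q z) \<and> q z \<le> p \<and> p < q z + 2 * dn D z"
  shows "E0 x (p - 2 * dn D x) y = (\<Sum>z | adj D x z. E0 z (q z) y) - E0 x p y"
proof -
  have "E0 x (p - 2 * dn D x) = state p (\<lambda>y. (\<Sum>z | adj D x z. 1 * fund_weight z y) - fund_weight x y)"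
    using E0_drop[OF x] by (simp add: fund_simple)
  also have "\<dots> = (\<lambda>y. state p (\<lambda>y. \<Sum>z | adj D x z. 1 * fund_weight z y) y - state p (fund_weight x) y)"
    by (rule additive_map_diff[OF state_additive])
  also have "\<dots> = (\<lambda>y. (\<Sum>z | adj D x z. 1 * state p (fund_weight z) y) - state p (fund_weight x) y)"
    by (simp only: additive_map_sum[OF state_additive])
  also have "\<dots> = (\<lambda>y. (\<Sum>z | adj D x z. E0 z (q z) y) - E0 x p y)"
  proof -
    have "state p (fund_weight z) = E0 z (q z)" if "adj D x z" for z
      using q[OF that] by (intro E0_window) auto
    then show ?thesis by (simp add: E0_def[of x p])
  qed
  finally show ?thesis by simp
qed

text \<open>\<open>\<sigma>\<close> carries the vertices of time \<open>t\<close> to those of time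
  \<open>t - 2\<close> and so intertwines the ticks. Hence \<open>state (t - 2)\<close> times
  \<open>\<sigma>\<close> times the inverse of \<open>state t\<close> does not depend on
  \<open>t\<close>.\<close>

lemma state_shift: "\<exists>T. additive_map T \<and> bij T \<and> (\<forall>t. state (t - 2) \<circ> aut_weight D = T \<circ> state t)"
proof -
  have img: "\<sigma> ` {x. vertex x t} = {x. vertex x (t - 2)}" for t
    using vertex_aut aut_inv by (auto simp: image_iff) metis
  have tick: "aut_weight D (tick t \<kappa>) = tick (t - 2) (aut_weight D \<kappa>)" for t \<kappa>
    unfolding tick_def img[symmetric] by (rule aut_weight_refl_set)
  define u where "u t = inv_into UNIV (state t)" for t
  have inv: "u t (state t \<kappa>) = \<kappa>" "state t (u t \<kappa>) = \<kappa>" for t \<kappa>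
    unfolding u_def using weyl_bij[OF state_weyl[of t]]
    by (simp_all add: bij_is_inj bij_is_surj surj_f_inv_f)
  define T where "T t = state (t - 2) \<circ> aut_weight D \<circ> u t" for t
  have eq: "state (t - 2) \<circ> aut_weight D = T t \<circ> state t" for t
    unfolding T_def by (intro ext) (simp add: inv)
  have T1: "T (t - 1) = T t" for t
  proof
    fix \<kappa>
    have "u (t - 1) \<kappa> = tick t (u t \<kappa>)"
    proof -
      have "state (t - 1) (tick t (u t \<kappa>)) = \<kappa>" by (simp add: state_step inv)
      then show ?thesis using inv(1)[of "t - 1" "tick t (u t \<kappa>)"] by simp
    qed
    moreover have "state (t - 1 - 2) \<mu> = state (t - 2) (tick (t - 2) \<mu>)" for \<mu>
      using fun_cong[OF state_step[of "t - 2"], of \<mu>] by (simp add: algebra_simps)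
    ultimately show "T (t - 1) \<kappa> = T t \<kappa>" by (simp add: T_def tick)
  qed
  have T0: "T t = T 0" for t
  proof (cases "t \<ge> 0")
    case True
    then show ?thesis
    proof (induction t rule: int_ge_induct)
      case (step i) then show ?case using T1[of "i + 1"] by simp
    qed simp
  next
    case False
    then have "t \<le> 0" by simp
    then show ?thesis
    proof (induction t rule: int_le_induct)
      case (step i) then show ?case using T1[of i] by simp
    qed simp
  qed
  have "additive_map (T 0)"
    unfolding T_def u_def
    by (intro additive_map_comp additive_map_aut_weight state_additive weyl_additive[OF weyl_inv_into[OF state_weyl]])
  moreover have "bij (aut_weight D)"
  proof (rule o_bij)
    show "(\<lambda>\<kappa> y. \<kappa> (\<sigma> y)) \<circ> aut_weight D = id"
      by (rule ext) (simp add: aut_weight_def inj_aut)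
    show "aut_weight D \<circ> (\<lambda>\<kappa> y. \<kappa> (\<sigma> y)) = id"
      by (rule ext) (simp add: aut_weight_def aut_inv)
  qed
  then have "bij (T 0)" unfolding T_def u_def
    by (intro bij_comp weyl_bij[OF state_weyl] weyl_bij[OF weyl_inv_into[OF state_weyl]])
  ultimately show ?thesis using eq T0 by metis
qed

lemma E0_shift: "\<exists>T. additive_map T \<and> bij T \<and> (\<forall>x p. E0 (\<sigma> x) (p - 2) = T (E0 x p))"
proof -
  obtain T where T: "additive_map T" "bij T" "\<And>t. state (t - 2) \<circ> aut_weight D = T \<circ> state t"
    using state_shift by blast
  have "E0 (\<sigma> x) (p - 2) = T (E0 x p)" for x p
    using fun_cong[OF T(3)[of p], of "fund_weight x"] by (simp add: E0_def aut_weight_fund)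
  then show ?thesis using T by blast
qed

end

text \<open>An isolated vertex occurs only in \<open>A_1\<close>. Over such a vertex no arrows order
  the successive vertices, which is why \<open>framed_region\<close> limits how far it may be
  lowered.\<close>

lemma ADE_isolated:
  assumes "ADE_diagram a" and "\<And>y. \<not> a x y" shows "z = x"
proof -
  obtain n edges f where e: "edges = edges_A n \<and> n \<ge> 1 \<or> edges = edges_D n \<and> n \<ge> 4 \<or> edges = edges_E n \<and> n \<in> {6, 7, 8}"
    and f: "bij_betw f UNIV {1..n}" and a: "\<And>x y. a x y \<longleftrightarrow> (f x, f y) \<in> edges \<or> (f y, f x) \<in> edges"
    using assms(1) unfolding ADE_diagram_def by blast
  have rng: "f y \<in> {1..n}" for y using f bij_betwE by blast
  have no: "(f x, c) \<notin> edges \<and> (c, f x) \<notin> edges" if "c \<in> {1..n}" for c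
  proof -
    obtain y where "f y = c" using f \<open>c \<in> {1..n}\<close> by (metis bij_betw_imp_surj_on imageE)
    then show ?thesis using assms(2)[of y] a by blast
  qed
  obtain b where b: "f x = Suc b" "b < n" using rng[of x] by (cases "f x") auto
  have "n = 1"
  proof (rule ccontr)
    assume "n \<noteq> 1"
    then have n: "n \<ge> 2" using rng[of x] by auto
    consider "edges = edges_A n" | "edges = edges_D n" "n \<ge> 4" | "edges = edges_E n" "n \<in> {6, 7, 8}" using e by blast
    then show False
    proof cases
      case 1
      have "(c, Suc c) \<in> edges" if "1 \<le> c" "c < n" for c using that 1 by (auto simp: edges_A_def)
      from this[of b] this[of 1] show False using no[of 2] no[of b] b n by (cases "b = 0") (auto simp: numeral_2_eq_2)
    next
      case 2
      have m: "(c, Suc c) \<in> edges" if "1 \<le> c" "c < n - 1" for c using that 2 by (auto simp: edges_D_def)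
      have m': "(n - 2, n) \<in> edges" using 2 by (auto simp: edges_D_def)
      consider "b = 0" | "b > 0" "b < n - 1" | "Suc b = n" using b by linarith
      then show False
      proof cases
        case 1 then show False using m[of 1] no[of 2] b n 2 by (auto simp: numeral_2_eq_2)
      next
        case 2 then show False using m[of b] no[of b] b by auto
      next
        case 3
        have "n - 2 \<in> {1..n}" using \<open>n \<ge> 4\<close> by auto
        from no[OF this] m' b(1) 3 show False by simp
      qed
    next
      case 3
      have m: "(1, 3) \<in> edges" "(2, 4) \<in> edges" "3 \<le> c \<Longrightarrow> c < n \<Longrightarrow> (c, Suc c) \<in> edges" for c
        using 3 by (auto simp: edges_E_def)
      consider "f x = 1" | "f x = 2" | "f x = 3" | "b \<ge> 3" using b by fastforce
      then show False
      proof cases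
        assume "f x = 1" then show False using m(1) no[of 3] 3 by auto
      next
        assume "f x = 2" then show False using m(2) no[of 4] 3 by auto
      next
        assume "f x = 3" then show False using m(1) no[of 1] 3 by auto
      next
        assume "b \<ge> 3" then show False using m(3)[of b] no[of b] b by auto
      qed
    qed
  qed
  then have "f z = f x" using rng[of z] rng[of x] by auto
  then show ?thesis using f by (metis UNIV_I bij_betw_imp_inj_on inj_onD)
qed

section \<open>Slices of the repetition quiver and their Weyl group elements\<close>

context parity_folding begin

text \<open>One vertex over each point, such that the next vertex over a neighbour is always later.
  Height functions, their lifts and their translates are of this kind, and so are all intermediate
  stages when one slice is lowered to another.\<close>

definition slice :: "('v \<Rightarrow> int) \<Rightarrow> bool" where
  "slice \<zeta> \<longleftrightarrow> (\<forall>x. vertex x (\<zeta> x)) \<and> (\<forall>x y. adj D x y \<longrightarrow> \<zeta> x < \<zeta> y + 2 * dn D y)"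

text \<open>The map \<open>w\<close> represents the slice: it carries the fundamental weights to the
  weights \<open>E0\<close> along it.\<close>

definition framed :: "('v \<Rightarrow> int) \<Rightarrow> (('v \<Rightarrow> int) \<Rightarrow> ('v \<Rightarrow> int)) \<Rightarrow> bool" where
  "framed \<zeta> w \<longleftrightarrow> (\<forall>x. E0 x (\<zeta> x) = w (fund_weight x))"

lemma sliceD: "slice \<zeta> \<Longrightarrow> vertex x (\<zeta> x)" "slice \<zeta> \<Longrightarrow> adj D x y \<Longrightarrow> \<zeta> x < \<zeta> y + 2 * dn D y"
  by (auto simp: slice_def)

lemma slice_max: "slice \<zeta> \<Longrightarrow> slice \<eta> \<Longrightarrow> slice (\<lambda>x. max (\<zeta> x) (\<eta> x))"
proof -
  assume s: "slice \<zeta>" "slice \<eta>"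
  have "max (\<zeta> x) (\<eta> x) < max (\<zeta> y) (\<eta> y) + 2 * dn D y" if "adj D x y" for x y
    using sliceD(2)[OF s(1) that] sliceD(2)[OF s(2) that] by linarith
  moreover have "vertex x (max (\<zeta> x) (\<eta> x))" for x
    using sliceD(1)[OF s(1)] sliceD(1)[OF s(2)] by (simp add: max_def)
  ultimately show ?thesis by (simp add: slice_def)
qed

lemma reflection_fund: "reflection D x (fund_weight z) = (if z = x then (\<lambda>y. fund_weight x y - simple_root D x y) else fund_weight z)"
  by (rule ext) (simp add: reflection_def fund_weight_def)

lemma additive_reflection_fund:
  assumes "additive_map w"
  shows "w (reflection D x (fund_weight x)) y = (\<Sum>z | adj D x z. w (fund_weight z) y) - w (fund_weight x) y"
proof -
  have "w (reflection D x (fund_weight x)) = w (\<lambda>y. (\<Sum>z | adj D x z. 1 * fund_weight z y) - fund_weight x y)"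
    by (simp add: reflection_fund fund_simple)
  also have "\<dots> = (\<lambda>y. w (\<lambda>y. \<Sum>z | adj D x z. 1 * fund_weight z y) y - w (fund_weight x) y)"
    by (rule additive_map_diff[OF assms])
  also have "\<dots> = (\<lambda>y. (\<Sum>z | adj D x z. 1 * w (fund_weight z) y) - w (fund_weight x) y)"
    by (simp only: additive_map_sum[OF assms])
  finally show ?thesis by simp
qed

context
  fixes \<zeta> x \<zeta>'
  assumes slice: "slice \<zeta>" and max: "\<And>y. adj D x y \<Longrightarrow> \<zeta> y < \<zeta> x"
  defines "\<zeta>' \<equiv> \<zeta>(x := \<zeta> x - 2 * dn D x)"
begin

lemma slice_flip: "slice \<zeta>'"
  unfolding slice_def
proof (intro conjI allI impI)
  fix y show "vertex y (\<zeta>' y)" using sliceD(1)[OF slice, of y] by (auto simp: \<zeta>'_def vertex_minus)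
next
  fix y z assume yz: "adj D y z"
  then have "\<zeta> y < \<zeta> z + 2 * dn D z" by (rule sliceD(2)[OF slice])
  then show "\<zeta>' y < \<zeta>' z + 2 * dn D z" using max[of y] adj_sym[OF yz] dn_pos[of x] by (auto simp: \<zeta>'_def)
qed

lemma flip_mesh: "E0 x (\<zeta>' x) y = (\<Sum>z | adj D x z. E0 z (\<zeta> z) y) - E0 x (\<zeta> x) y"
  unfolding \<zeta>'_def fun_upd_same
  using sliceD[OF slice] max by (intro E0_mesh) (auto intro: less_imp_le)

text \<open>The mesh relation at a local maximum is the formula for the reflected fundamental
  weight, so lowering the slice there multiplies its element on the right by the reflection.\<close>

lemma framed_flip: "additive_map w \<Longrightarrow> framed \<zeta> w \<Longrightarrow> framed \<zeta>' (w \<circ> reflection D x)"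
  unfolding framed_def
proof
  fix z assume w: "additive_map w" "\<forall>x. E0 x (\<zeta> x) = w (fund_weight x)"
  show "E0 z (\<zeta>' z) = (w \<circ> reflection D x) (fund_weight z)"
  proof (cases "z = x")
    case True
    show ?thesis unfolding True
      by (rule ext) (simp add: flip_mesh w additive_reflection_fund)
  next
    case False
    then show ?thesis using w by (simp add: reflection_fund \<zeta>'_def)
  qed
qed

lemma framed_unflip: "additive_map w \<Longrightarrow> framed \<zeta>' w \<Longrightarrow> framed \<zeta> (w \<circ> reflection D x)"
  unfolding framed_def
proof
  fix z assume w: "additive_map w" "\<forall>x. E0 x (\<zeta>' x) = w (fund_weight x)"
  have z: "E0 z (\<zeta> z) = w (fund_weight z)" if "z \<noteq> x" for z
    using w(2)[rule_format, of z] that by (simp add: \<zeta>'_def)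
  show "E0 z (\<zeta> z) = (w \<circ> reflection D x) (fund_weight z)"
  proof (cases "z = x")
    case True
    have "(\<Sum>z | adj D x z. E0 z (\<zeta> z) y) = (\<Sum>z | adj D x z. w (fund_weight z) y)" for y
    proof (rule sum.cong)
      fix u assume "u \<in> {u. adj D x u}"
      then have "u \<noteq> x" using adj_irrefl[of x] by auto
      then show "E0 u (\<zeta> u) y = w (fund_weight u) y" by (simp add: z)
    qed simp
    then have "E0 x (\<zeta> x) y = (\<Sum>z | adj D x z. w (fund_weight z) y) - w (fund_weight x) y" for y
      using flip_mesh[of y] w(2)[rule_format, of x] by simp
    then show ?thesis unfolding True by (intro ext) (simp add: additive_reflection_fund w)
  qed (simp add: z reflection_fund)
qed

end

text \<open>Lowering a global maximum above \<open>t\<close> decreases the total excess over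
  \<open>t\<close>. When no excess is left, the slice lies in the window \<open>(t - 2 d, t]\<close>
  and is framed by \<open>state t\<close>; the flips are undone by
  \<open>framed_unflip\<close>.\<close>

lemma slice_framed_above:
  assumes "slice \<zeta>" "\<And>x. t - 2 * dn D x < \<zeta> x"
  shows "\<exists>w\<in>weyl_group D. framed \<zeta> w"
  using assms
proof (induction "\<Sum>x\<in>UNIV. nat (\<zeta> x - t)" arbitrary: \<zeta> rule: less_induct)
  case less
  show ?case
  proof (cases "\<forall>x. \<zeta> x \<le> t")
    case True
    have "E0 x (\<zeta> x) = state t (fund_weight x)" for x
      using True less.prems(2)[of x] sliceD(1)[OF less.prems(1)] by (intro E0_window[symmetric]) auto
    then have "framed \<zeta> (state t)" by (simp add: framed_def)
    then show ?thesis using state_weyl by blast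
  next
    case False
    have "Max (range \<zeta>) \<in> range \<zeta>" by (intro Max_in) auto
    then obtain x where x: "\<zeta> x = Max (range \<zeta>)" by (metis imageE)
    have le: "\<zeta> y \<le> \<zeta> x" for y unfolding x by (intro Max_ge) auto
    have xt: "\<zeta> x > t" using False le by (meson less_le_trans not_le)
    have lt: "\<zeta> y < \<zeta> x" if "adj D x y" for y
      using le[of y] vertex_adj_neq[OF that sliceD(1)[OF less.prems(1)] sliceD(1)[OF less.prems(1)]] by simp
    define \<zeta>' where "\<zeta>' = \<zeta>(x := \<zeta> x - 2 * dn D x)"
    have "(\<Sum>x\<in>UNIV. nat (\<zeta>' x - t)) < (\<Sum>x\<in>UNIV. nat (\<zeta> x - t))"
    proof (rule sum_strict_mono_ex1)
      show "\<forall>y\<in>UNIV. nat (\<zeta>' y - t) \<le> nat (\<zeta> y - t)" using dn_pos[of x] by (simp add: \<zeta>'_def)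
      show "\<exists>y\<in>UNIV. nat (\<zeta>' y - t) < nat (\<zeta> y - t)" using dn_pos[of x] xt by (intro bexI[of _ x]) (auto simp: \<zeta>'_def)
    qed simp
    moreover have "slice \<zeta>'" unfolding \<zeta>'_def by (rule slice_flip[OF less.prems(1) lt])
    moreover have "t - 2 * dn D y < \<zeta>' y" for y using less.prems(2)[of y] xt by (simp add: \<zeta>'_def)
    ultimately obtain w where w: "w \<in> weyl_group D" "framed \<zeta>' w" using less.hyps by blast
    then have "framed \<zeta> (w \<circ> reflection D x)"
      using framed_unflip[OF less.prems(1) lt weyl_additive[OF w(1)]] by (simp only: \<zeta>'_def)
    moreover have "w \<circ> reflection D x \<in> weyl_group D" by (rule weyl_comp[OF w(1) reflection_weyl])
    ultimately show ?thesis by blast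
  qed
qed

lemma slice_framed:
  assumes "slice \<zeta>" shows "\<exists>w\<in>weyl_group D. framed \<zeta> w"
proof -
  have "Min (range \<zeta>) - 2 * dn D x < \<zeta> x" for x
  proof -
    have "Min (range \<zeta>) \<le> \<zeta> x" by (intro Min_le) auto
    then show ?thesis using dn_pos[of x] by linarith
  qed
  then show ?thesis by (rule slice_framed_above[OF assms])
qed

lemma vertex_adj_smaller:
  assumes "adj D x y" "vertex x p" "dn D y \<le> dn D x"
  shows "vertex y (p + dn D y)"
proof -
  have m: "mind x y = dn D y" using assms(3) by simp
  have "dn D y dvd dn D x" using dn_1_or_r[of x] dn_1_or_r[of y] assms(3) r_pos by auto
  then have "2 * dn D y dvd 2 * dn D x" by (rule mult_dvd_mono[OF dvd_refl])
  then have 1: "2 * dn D y dvd p - \<epsilon> x" using assms(2) unfolding vertex_def by (rule dvd_trans)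
  have 2: "2 * dn D y dvd \<epsilon> x - (\<epsilon> y + dn D y)"
    using parity assms(1) m unfolding parity_function_def cong_iff_dvd_diff by metis
  have "p + dn D y - \<epsilon> y = (p - \<epsilon> x) + (\<epsilon> x - (\<epsilon> y + dn D y)) + 2 * dn D y" by simp
  then show ?thesis unfolding vertex_def using 1 2 by (metis dvd_add dvd_refl)
qed

text \<open>If \<open>x\<close> is fixed and \<open>z\<close> is moved, the time
  \<open>p + 1\<close> may belong to another point of the orbit of \<open>z\<close>; all of these
  are neighbours of \<open>x\<close>. Hence an arrow starts at every vertex over a point that has a
  neighbour.\<close>

lemma next_vertex:
  assumes "adj D x z" "vertex x p"
  obtains y where "adj D x y" "vertex y (p + mind x y)"
proof (cases "dn D z \<le> dn D x")
  case True
  then show ?thesis using vertex_adj_smaller[OF assms] that[OF assms(1)] by simp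
next
  case False
  then have dx: "dn D x = 1" and dz: "dn D z = int r" using dn_1_or_r[of x] dn_1_or_r[of z] r_pos by auto
  have "2 * 1 dvd \<epsilon> x - (\<epsilon> z + 1)"
    using parity assms(1) False dx unfolding parity_function_def cong_iff_dvd_diff by (metis min.absorb1 nle_le)
  moreover have "even (p - \<epsilon> x)" by (rule vertex_parity[OF assms(2)])
  ultimately have "even (p + 1 - \<epsilon> z)" by presburger
  then obtain y where y: "y \<in> orbit D z" "vertex y (p + 1)" by (rule vertex_orbit_exists)
  have "mind x y = 1" using dx dn_pos[of y] by simp
  then show ?thesis using that[of y] y adj_fixed_orbit[OF dx assms(1) y(1)] by simp
qed

definition region :: "('v \<Rightarrow> int) \<Rightarrow> ('v \<Rightarrow> int) \<Rightarrow> ('v \<times> int) set" where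
  "region \<zeta> \<zeta>' = {(x, p). vertex x p \<and> \<zeta>' x < p \<and> p \<le> \<zeta> x}"

lemma vertex_step: "vertex x p \<Longrightarrow> vertex x p' \<Longrightarrow> p < p' \<Longrightarrow> p + 2 * dn D x \<le> p'"
  using vertex_diff[of x p p'] zdvd_imp_le[of "2 * dn D x" "p' - p"] by simp

text \<open>
  In a compatible reading of the region between two slices, the first vertex is a local maximum of the
  upper slice, so the reading lowers the upper slice to the lower one by flips.
\<close>

lemma framed_region:
  assumes "slice \<zeta>" "slice \<zeta>'" "\<And>x. \<zeta>' x \<le> \<zeta> x" "compatible_reading D (region \<zeta> \<zeta>') xs"
    "\<And>x. (\<exists>y. adj D x y) \<or> \<zeta> x \<le> \<zeta>' x + 2 * dn D x" "additive_map w" "framed \<zeta> w"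
  shows "framed \<zeta>' (w \<circ> foldr (\<lambda>a w. reflection D (fst a) \<circ> w) xs id)"
  using assms(1,3-)
proof (induction xs arbitrary: \<zeta> w)
  case Nil
  have "\<zeta> x = \<zeta>' x" for x
  proof (rule ccontr)
    assume "\<zeta> x \<noteq> \<zeta>' x"
    then have "(x, \<zeta> x) \<in> region \<zeta> \<zeta>'" using Nil(2)[of x] sliceD(1)[OF Nil(1)] by (simp add: region_def)
    then show False using Nil(3) by (simp add: compatible_reading_def)
  qed
  then show ?case using Nil(6) by (simp add: framed_def)
next
  case (Cons a xs)
  obtain x p where a: "a = (x, p)" by (cases a)
  note sl = Cons.prems(1) and comp = Cons.prems(3)[unfolded compatible_reading_def]
  have "a \<in> region \<zeta> \<zeta>'" using comp by auto
  then have x: "vertex x p" "\<zeta>' x < p" "p \<le> \<zeta> x" by (auto simp: a region_def)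
  have x': "\<zeta>' x + 2 * dn D x \<le> p" using vertex_step[OF sliceD(1)[OF assms(2)] x(1,2)] .
  \<comment> \<open>Arrows point to earlier letters of a reading, so none can lead from its initial
    letter into the region.\<close>
  have noarrow: False if "adj D x y" "vertex y (p + mind x y)" "\<zeta>' y < p + mind x y" "p + mind x y \<le> \<zeta> y" for y
  proof -
    have "(y, p + mind x y) \<in> set (a # xs)" using that comp by (simp add: region_def)
    then obtain k where k: "k < length (a # xs)" "(a # xs) ! k = (y, p + mind x y)" by (metis in_set_conv_nth)
    have "rep_arrow D ((a # xs) ! 0) ((a # xs) ! k)" using k that(1) by (simp add: a rep_arrow_def)
    then have "k < 0" using comp k(1) by blast
    then show False by simp
  qed
  have below: "\<zeta>' y < p" if "adj D x y" for y
    using sliceD(2)[OF assms(2) adj_sym[OF that]] x' by linarith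
  \<comment> \<open>The initial letter is the topmost vertex over \<open>x\<close>. Otherwise the
    slice is at least \<open>2 d\<close> higher over \<open>x\<close>, so over a neighbour it cannot
    stay below the end of an arrow starting at the letter.\<close>
  have p: "p = \<zeta> x"
  proof (rule ccontr)
    assume "p \<noteq> \<zeta> x"
    then have px: "p + 2 * dn D x \<le> \<zeta> x" using x sliceD(1)[OF sl] by (intro vertex_step) auto
    then have "\<not> \<zeta> x \<le> \<zeta>' x + 2 * dn D x" using x by linarith
    then obtain z where "adj D x z" using Cons.prems(4)[of x] by blast
    then obtain y where y: "adj D x y" "vertex y (p + mind x y)" using x(1) by (rule next_vertex)
    have "\<zeta>' y < p + mind x y" using below[OF y(1)] mind_pos[of x y] by linarith
    moreover have "p + mind x y \<le> \<zeta> y"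
    proof (rule ccontr)
      assume "\<not> ?thesis"
      then have "\<zeta> y + 2 * dn D y \<le> p + mind x y" using y sliceD(1)[OF sl] by (intro vertex_step) auto
      moreover have "\<zeta> x < \<zeta> y + 2 * dn D y" by (rule sliceD(2)[OF sl y(1)])
      ultimately show False using px dn_pos[of x] by (simp add: min_def split: if_splits)
    qed
    ultimately show False using noarrow y by blast
  qed
  \<comment> \<open>Over a higher neighbour the vertex at \<open>p + mind x y\<close> would lie in
    the region and be the end of an arrow.\<close>
  have max: "\<zeta> y < \<zeta> x" if y: "adj D x y" for y
  proof (rule ccontr)
    assume "\<not> ?thesis"
    then have gt: "\<zeta> y > \<zeta> x" using vertex_adj_neq[OF y sliceD(1)[OF sl] sliceD(1)[OF sl]] by simp
    have lt: "\<zeta> y < \<zeta> x + 2 * dn D x" by (rule sliceD(2)[OF sl adj_sym[OF y]])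
    have dv: "2 * mind x y dvd \<zeta> y - \<zeta> x - mind x y" by (rule vertex_adj[OF y sliceD(1)[OF sl] sliceD(1)[OF sl]])
    have "vertex y (p + mind x y) \<and> p + mind x y \<le> \<zeta> y"
    proof (cases "dn D y \<le> dn D x")
      case True
      then have v: "vertex y (p + mind x y)" using vertex_adj_smaller[OF y x(1)] by simp
      have "p + mind x y \<le> \<zeta> y"
      proof (rule ccontr)
        assume "\<not> ?thesis"
        then have "\<zeta> y + 2 * dn D y \<le> p + mind x y" using v sliceD(1)[OF sl] by (intro vertex_step) auto
        then show False using gt p True dn_pos[of y] by simp
      qed
      then show ?thesis using v by simp
    next
      case False
      then have m: "mind x y = dn D x" by simp
      have "\<zeta> y - \<zeta> x - dn D x = 0"
      proof (rule ccontr)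
        assume "\<zeta> y - \<zeta> x - dn D x \<noteq> 0"
        then have "2 * dn D x \<le> \<bar>\<zeta> y - \<zeta> x - dn D x\<bar>"
          using dv m dvd_imp_le_int[of "\<zeta> y - \<zeta> x - dn D x" "2 * dn D x"] dn_pos[of x] by simp
        then show False using gt lt by linarith
      qed
      then have "p + mind x y = \<zeta> y" using p m by simp
      then show ?thesis using sliceD(1)[OF sl, of y] by simp
    qed
    moreover have "\<zeta>' y < p + mind x y" using below[OF y] mind_pos[of x y] by linarith
    ultimately show False using noarrow y by blast
  qed
  define \<eta> where "\<eta> = \<zeta>(x := \<zeta> x - 2 * dn D x)"
  have "framed \<zeta>' ((w \<circ> reflection D x) \<circ> foldr (\<lambda>a w. reflection D (fst a) \<circ> w) xs id)"
  proof (rule Cons.IH)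
    show "slice \<eta>" unfolding \<eta>_def by (rule slice_flip[OF sl max])
    show "\<zeta>' y \<le> \<eta> y" for y using Cons.prems(2)[of y] x' p by (simp add: \<eta>_def)
    have "region \<eta> \<zeta>' = region \<zeta> \<zeta>' - {a}"
    proof -
      have "q \<le> \<zeta> x - 2 * dn D x \<longleftrightarrow> q \<le> \<zeta> x \<and> q \<noteq> \<zeta> x" if "vertex x q" for q
        using vertex_step[OF that sliceD(1)[OF sl, of x]] dn_pos[of x] by auto
      then show ?thesis by (auto simp: region_def \<eta>_def a p split: if_splits)
    qed
    moreover have "set xs = region \<zeta> \<zeta>' - {a}" "distinct xs" using comp by auto
    moreover have "k < k'" if "k < length xs" "k' < length xs" "rep_arrow D (xs ! k') (xs ! k)" for k k'
      using comp that by (metis Suc_less_eq length_Cons nth_Cons_Suc)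
    ultimately show "compatible_reading D (region \<eta> \<zeta>') xs" unfolding compatible_reading_def by blast
    show "(\<exists>z. adj D y z) \<or> \<eta> y \<le> \<zeta>' y + 2 * dn D y" for y
      using Cons.prems(4)[of y] dn_pos[of x] by (auto simp: \<eta>_def)
    show "additive_map (w \<circ> reflection D x)" by (rule additive_map_comp[OF Cons.prems(5) additive_map_reflection])
    show "framed \<eta> (w \<circ> reflection D x)" unfolding \<eta>_def by (rule framed_flip[OF sl max Cons.prems(5,6)])
  qed
  moreover have "foldr (\<lambda>a w. reflection D (fst a) \<circ> w) (a # xs) id =
      reflection D x \<circ> foldr (\<lambda>a w. reflection D (fst a) \<circ> w) xs id" by (simp add: a)
  ultimately show ?case by (simp only: comp_assoc)
qed

lemma finite_region: "finite (region \<zeta> \<zeta>')"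
proof (rule finite_subset)
  show "region \<zeta> \<zeta>' \<subseteq> (SIGMA x:UNIV. {\<zeta>' x..\<zeta> x})" by (auto simp: region_def)
qed simp

text \<open>Arrows increase the time, so listing by decreasing time is compatible.\<close>

lemma compatible_reading_exists:
  assumes "finite Z" shows "\<exists>xs. compatible_reading D Z xs"
proof -
  obtain ys where ys: "set ys = Z" "distinct ys" using finite_distinct_list[OF assms] by blast
  define xs where "xs = sort_key (\<lambda>a. - snd a) ys"
  have s: "sorted (map (\<lambda>a. - snd a) xs)" by (simp add: xs_def)
  have "k < k'" if "k < length xs" "k' < length xs" "rep_arrow D (xs ! k') (xs ! k)" for k k'
  proof (rule ccontr)
    assume "\<not> k < k'"
    then have "- snd (xs ! k') \<le> - snd (xs ! k)" using that sorted_nth_mono[OF s, of k' k] by simp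
    moreover have "snd (xs ! k) > snd (xs ! k')" using that(3) mind_pos[of "fst (xs ! k')" "fst (xs ! k)"] unfolding rep_arrow_def by linarith
    ultimately show False by simp
  qed
  then have "compatible_reading D Z xs" using ys by (simp add: compatible_reading_def xs_def)
  then show ?thesis ..
qed

lemma reading_word_weyl: "reading_word D Z \<in> weyl_group D"
proof -
  have "foldr (\<lambda>a w. reflection D (fst a) \<circ> w) xs id \<in> weyl_group D" for xs
  proof (induction xs)
    case (Cons a xs)
    have "foldr (\<lambda>a w. reflection D (fst a) \<circ> w) (a # xs) id =
        reflection D (fst a) \<circ> foldr (\<lambda>a w. reflection D (fst a) \<circ> w) xs id" by simp
    then show ?case using weyl_refl[OF Cons.IH, of "fst a"] by (simp only:)
  next
    case Nil
    show ?case unfolding foldr.simps id_apply[of id] by (rule weyl_id)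
  qed
  then show ?thesis by (simp only: reading_word_def)
qed

text \<open>Every compatible reading has the stated effect on frames, in particular the one picked
  by \<open>SOME\<close>; this takes the place of showing that the word is well defined.\<close>

lemma framed_reading_word:
  assumes "slice \<zeta>" "slice \<zeta>'" "\<And>x. \<zeta>' x \<le> \<zeta> x"
    "\<And>x. (\<exists>y. adj D x y) \<or> \<zeta> x \<le> \<zeta>' x + 2 * dn D x" "additive_map w" "framed \<zeta> w"
  shows "framed \<zeta>' (w \<circ> reading_word D (region \<zeta> \<zeta>'))"
  unfolding reading_word_def
  using framed_region[OF assms(1-3) someI_ex[OF compatible_reading_exists[OF finite_region]] assms(4-6)] .

end

section \<open>Q-data\<close>

locale q_datum = parity_folding D \<epsilon> for D :: "('v::finite) folding" and \<epsilon> +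
  fixes \<xi> :: "'v \<Rightarrow> int"
  assumes height: "height_function D \<epsilon> \<xi>"
begin

lemma height_vertex: "vertex x (\<xi> x)"
  using height by (simp add: height_function_def vertex_def)

lemma height_staircase:
  assumes "adj D x y" "dn D x < dn D y"
  obtains z where "orbit D z = orbit D y" "\<bar>\<xi> x - \<xi> z\<bar> = 1" "\<And>l. l < r \<Longrightarrow> \<xi> ((\<sigma> ^^ l) z) = \<xi> z - 2 * int l"
proof -
  have "adj_nodes D (orbit D x) (orbit D y)" using assms(1) unfolding adj_nodes_def by (metis self_in_orbit)
  moreover have "card (orbit D x) < card (orbit D y)" using assms(2) by (simp add: dn_def)
  ultimately have "\<exists>!z. z \<in> orbit D y \<and> \<bar>\<xi> x - \<xi> z\<bar> = 1 \<and> (\<forall>l<r. \<xi> ((\<sigma> ^^ l) z) = \<xi> z - 2 * int l)"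
    using height orbit_in_nodes[of y] unfolding height_function_def by blast
  then show ?thesis using that orbit_eq by blast
qed

text \<open>For equal orbit sizes the heights of neighbours differ by \<open>d < 2 d\<close>.
  Otherwise one of them is fixed and the other lies on a staircase of \<open>r\<close> points, in
  steps of 2, that starts at distance 1 from it.\<close>

lemma slice_height: "slice \<xi>"
  unfolding slice_def
proof (intro conjI allI impI height_vertex)
  fix x y assume xy: "adj D x y"
  consider "dn D x = dn D y" | "dn D x < dn D y" | "dn D y < dn D x" by linarith
  then show "\<xi> x < \<xi> y + 2 * dn D y"
  proof cases
    case 1
    then have "\<bar>\<xi> x - \<xi> y\<bar> = dn D x" using height xy by (simp add: height_function_def)
    then show ?thesis using 1 dn_pos[of x] by linarith
  next
    case 2
    then have d: "dn D y = int r" using dn_1_or_r[of x] dn_1_or_r[of y] r_pos by auto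
    obtain z where z: "orbit D z = orbit D y" "\<bar>\<xi> x - \<xi> z\<bar> = 1" "\<And>l. l < r \<Longrightarrow> \<xi> ((\<sigma> ^^ l) z) = \<xi> z - 2 * int l"
      using height_staircase[OF xy 2] by blast
    obtain l where l: "l < r" "y = (\<sigma> ^^ l) z" using orbit_mem_powE[OF z(1)] by blast
    then show ?thesis using z(2) z(3)[OF l(1)] d by auto
  next
    case 3
    then have d: "dn D y = 1" using dn_1_or_r[of x] dn_1_or_r[of y] r_pos by auto
    obtain z where z: "orbit D z = orbit D x" "\<bar>\<xi> y - \<xi> z\<bar> = 1" "\<And>l. l < r \<Longrightarrow> \<xi> ((\<sigma> ^^ l) z) = \<xi> z - 2 * int l"
      using height_staircase[OF adj_sym[OF xy] 3] by blast
    obtain l where l: "l < r" "x = (\<sigma> ^^ l) z" using orbit_mem_powE[OF z(1)] by blast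
    then show ?thesis using z(2) z(3)[OF l(1)] d by auto
  qed
qed

lemma height_orbit_inj: "y \<in> orbit D x \<Longrightarrow> \<xi> y = \<xi> x \<Longrightarrow> y = x"
  using vertex_orbit_unique[of x "\<xi> x" y] height_vertex[of x] height_vertex[of y] by simp

definition top_of :: "'v \<Rightarrow> 'v" where "top_of x = top_vertex \<xi> (orbit D x)"

lemma top_of: "top_of x \<in> orbit D x" and top_of_less: "y \<in> orbit D x \<Longrightarrow> y \<noteq> top_of x \<Longrightarrow> \<xi> y < \<xi> (top_of x)"
proof -
  have "Max (\<xi> ` orbit D x) \<in> \<xi> ` orbit D x" using self_in_orbit[of x] by (intro Max_in finite_imageI finite_orbit) blast
  then obtain t where t: "t \<in> orbit D x" "\<xi> t = Max (\<xi> ` orbit D x)" by (metis imageE)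
  have less: "\<xi> y < \<xi> t" if "y \<in> orbit D x" "y \<noteq> t" for y
  proof -
    have "\<xi> y \<le> \<xi> t" unfolding t(2) using that by (intro Max_ge) auto
    moreover have "\<xi> y \<noteq> \<xi> t" using height_orbit_inj[of y t] that orbit_eq[OF t(1)] by auto
    ultimately show ?thesis by simp
  qed
  have "top_of x = t"
    unfolding top_of_def top_vertex_def
  proof (rule the_equality)
    fix u assume u: "u \<in> orbit D x \<and> (\<forall>y\<in>orbit D x. y \<noteq> u \<longrightarrow> \<xi> y < \<xi> u)"
    show "u = t"
    proof (rule ccontr)
      assume "u \<noteq> t"
      then have "\<xi> t < \<xi> u" "\<xi> u < \<xi> t" using u t(1) less by auto
      then show False by simp
    qed
  qed (use t less in auto)
  then show "top_of x \<in> orbit D x" "y \<in> orbit D x \<Longrightarrow> y \<noteq> top_of x \<Longrightarrow> \<xi> y < \<xi> (top_of x)"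
    using t less by auto
qed

lemma orbit_top_of [simp]: "orbit D (top_of x) = orbit D x" by (rule orbit_eq[OF top_of])
lemma dn_top_of [simp]: "dn D (top_of x) = dn D x" by (simp add: dn_def)

text \<open>By \<open>triality\<close> the orbit is adjacent to a fixed vertex, so the staircase
  condition applies, and the start of the staircase is its highest point. For \<open>r = 2\<close>
  the heights in an orbit may differ by more than 2.\<close>

lemma triality_staircase:
  assumes "r = 3" "dn D x = 3" "l < 3"
  shows "\<xi> ((\<sigma> ^^ l) (top_of x)) = \<xi> (top_of x) - 2 * int l"
proof -
  let ?t = "top_of x"
  have "\<sigma> ?t \<noteq> ?t" using dn_cases[of ?t] assms by auto
  then obtain y where y: "adj D ?t y" "\<sigma> y = y" using triality assms(1) by blast
  then have dy: "dn D y < dn D ?t" using dn_cases[of y] assms by auto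
  obtain z where z: "orbit D z = orbit D ?t" "\<bar>\<xi> y - \<xi> z\<bar> = 1" "\<And>l. l < r \<Longrightarrow> \<xi> ((\<sigma> ^^ l) z) = \<xi> z - 2 * int l"
    using height_staircase[OF adj_sym[OF y(1)] dy] by blast
  obtain m where m: "m < r" "?t = (\<sigma> ^^ m) z" using orbit_mem_powE[OF z(1)] by blast
  have "z = ?t"
  proof (rule ccontr)
    assume "z \<noteq> ?t"
    then have "\<xi> z < \<xi> ?t" using top_of_less[of z x] z(1) self_in_orbit[of z] by simp
    then show False using z(3)[OF m(1)] m(2) by simp
  qed
  then show ?thesis using z(3)[of l] assms by simp
qed

text \<open>
  On each orbit \<open>lift\<close> is a staircase descending from the top vertex. The set $X'$ of the paper lies between
  the slices \<open>lift\<close> and \<open>\<xi>\<close>, and $X^\circ$ between \<open>lift\<close> and its translate \<open>lowered\<close>.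
\<close>

definition lift :: "'v \<Rightarrow> int" where "lift x = max (\<xi> x) (\<xi> (inv_into UNIV \<sigma> x) - 2)"

lemma slice_translate: "slice \<zeta> \<Longrightarrow> slice (\<lambda>x. \<zeta> (inv_into UNIV \<sigma> x) - 2)"
proof -
  assume s: "slice \<zeta>"
  have d: "dn D (inv_into UNIV \<sigma> x) = dn D x" for x using dn_aut[of "inv_into UNIV \<sigma> x"] by (simp add: aut_inv)
  show ?thesis unfolding slice_def
  proof (intro conjI allI impI)
    fix x show "vertex x (\<zeta> (inv_into UNIV \<sigma> x) - 2)"
      using vertex_aut[of "inv_into UNIV \<sigma> x" "\<zeta> (inv_into UNIV \<sigma> x)"] sliceD(1)[OF s] by (simp add: aut_inv)
  next
    fix x y assume "adj D x y"
    then have "adj D (inv_into UNIV \<sigma> x) (inv_into UNIV \<sigma> y)" by (metis adj_aut aut_inv)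
    from sliceD(2)[OF s this] show "\<zeta> (inv_into UNIV \<sigma> x) - 2 < \<zeta> (inv_into UNIV \<sigma> y) - 2 + 2 * dn D y"
      by (simp add: d)
  qed
qed

lemma slice_lift: "slice lift"
  unfolding lift_def by (rule slice_max[OF slice_height slice_translate[OF slice_height]])

text \<open>In an orbit of size 2 the lower height is congruent modulo 4 to that of the top minus 2,
  hence at most that, and the maximum in \<open>lift\<close> picks the staircase value. For
  \<open>r = 3\<close> the heights form a staircase already.\<close>

lemma lift_staircase:
  assumes "int l < dn D x" shows "lift ((\<sigma> ^^ l) (top_of x)) = \<xi> (top_of x) - 2 * int l"
proof -
  let ?t = "top_of x"
  have inv_top: "inv_into UNIV \<sigma> u \<in> orbit D x" if "u \<in> orbit D x" for u
    using that orbit_aut[of "inv_into UNIV \<sigma> u"] orbit_eq[OF that] self_in_orbit[of "inv_into UNIV \<sigma> u"] by (simp add: aut_inv)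
  have le: "\<xi> u \<le> \<xi> ?t" if "u \<in> orbit D x" for u
    using top_of_less[OF that] by (cases "u = ?t") auto
  have 0: "lift ?t = \<xi> ?t" unfolding lift_def using le[OF inv_top[OF top_of]] by simp
  have inv_aut: "inv_into UNIV \<sigma> (\<sigma> u) = u" for u using inj_aut by simp
  show ?thesis
  proof (cases "l = 0")
    case False
    then have l: "dn D x = int r" "0 < l" "l < r" using assms dn_1_or_r[of x] by auto
    then have "r = 2 \<or> r = 3" using r_cases by auto
    then show ?thesis
    proof
      assume "r = 2"
      then have l1: "l = 1" and d: "dn D x = 2" using l by auto
      have ne: "\<sigma> ?t \<noteq> ?t" using dn_cases[of ?t] d by auto
      have "\<sigma> ?t \<in> orbit D x" using orbit_aut[of ?t] self_in_orbit[of "\<sigma> ?t"] by simp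
      from top_of_less[OF this ne] have "\<xi> (\<sigma> ?t) < \<xi> ?t" .
      moreover have "vertex (\<sigma> ?t) (\<xi> ?t - 2)" using vertex_aut height_vertex by blast
      then have "2 * dn D (\<sigma> ?t) dvd \<xi> (\<sigma> ?t) - (\<xi> ?t - 2)" using vertex_diff height_vertex by blast
      then have "4 dvd \<xi> (\<sigma> ?t) - (\<xi> ?t - 2)" using d by (simp add: dn_aut)
      ultimately have "\<xi> (\<sigma> ?t) \<le> \<xi> ?t - 2" by presburger
      then show ?thesis using l1 by (simp add: lift_def inv_aut)
    next
      assume r3: "r = 3"
      obtain l' where l': "l = Suc l'" using l by (cases l) auto
      have "(\<sigma> ^^ l) ?t = \<sigma> ((\<sigma> ^^ l') ?t)" by (simp add: l')
      then have "lift ((\<sigma> ^^ l) ?t) = max (\<xi> ((\<sigma> ^^ l) ?t)) (\<xi> ((\<sigma> ^^ l') ?t) - 2)" by (simp add: lift_def inv_aut)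
      then show ?thesis
        using triality_staircase[OF r3, of x l] triality_staircase[OF r3, of x l'] l l' r3 by simp
    qed
  qed (simp add: 0)
qed

lemma height_le_lift: "\<xi> x \<le> lift x" by (simp add: lift_def)

lemma X_prime_eq: "X_prime D \<epsilon> \<xi> = region lift \<xi>"
proof -
  have "X_prime D \<epsilon> \<xi> = {(\<sigma> (top_of x), p) | x p. vertex (\<sigma> (top_of x)) p \<and> \<xi> (\<sigma> (top_of x)) < p \<and> p \<le> \<xi> (top_of x) - 2}"
    by (force simp: X_prime_def nodes_def top_of_def rep_vertices_iff)
  also have "\<dots> = region lift \<xi>"
  proof (intro equalityI subsetI)
    fix a assume "a \<in> {(\<sigma> (top_of x), p) | x p. vertex (\<sigma> (top_of x)) p \<and> \<xi> (\<sigma> (top_of x)) < p \<and> p \<le> \<xi> (top_of x) - 2}"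
    then obtain x p where a: "a = (\<sigma> (top_of x), p)" "vertex (\<sigma> (top_of x)) p" "\<xi> (\<sigma> (top_of x)) < p" "p \<le> \<xi> (top_of x) - 2" by blast
    have "\<xi> (top_of x) - 2 \<le> lift (\<sigma> (top_of x))" using inj_aut by (simp add: lift_def)
    then show "a \<in> region lift \<xi>" using a by (simp add: region_def)
  next
    fix a assume "a \<in> region lift \<xi>"
    then obtain y p where a: "a = (y, p)" "vertex y p" "\<xi> y < p" "p \<le> lift y" by (auto simp: region_def)
    obtain l where l: "int l < dn D y" "y = (\<sigma> ^^ l) (top_of y)"
      using orbitE[of y "top_of y"] self_in_orbit[of y] by auto
    have ly: "lift y = \<xi> (top_of y) - 2 * int l" using lift_staircase[OF l(1)] l(2) by simp
    \<comment> \<open>Only the point next to the top can be raised by \<open>lift\<close>: the top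
      itself stays, and two steps occur only for \<open>r = 3\<close>, where the heights already
      form the staircase.\<close>
    have "l = 1"
    proof (rule ccontr)
      assume "l \<noteq> 1"
      moreover have "l \<noteq> 0" using l(2) ly a by (metis funpow_0 diff_zero mult_zero_right of_nat_0 not_le less_le_trans)
      ultimately have "l = 2" "r = 3" "dn D y = 3" using l(1) dn_1_or_r[of y] r_cases by auto
      then have "\<xi> y = \<xi> (top_of y) - 4" using triality_staircase[of y 2] l(2) by simp
      then show False using ly a \<open>l = 2\<close> by simp
    qed
    then have "y = \<sigma> (top_of y)" "lift y = \<xi> (top_of y) - 2" using l(2) ly by simp_all
    then show "a \<in> {(\<sigma> (top_of x), p) | x p. vertex (\<sigma> (top_of x)) p \<and> \<xi> (\<sigma> (top_of x)) < p \<and> p \<le> \<xi> (top_of x) - 2}"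
      using a by (intro CollectI exI[of _ y] exI[of _ p]) auto
  qed
  finally show ?thesis .
qed

definition lowered :: "'v \<Rightarrow> int" where "lowered x = lift (inv_into UNIV \<sigma> x) - 2"

text \<open>Translation by \<open>\<sigma>\<close> and \<open>- 2\<close> reproduces the staircase
  except that its top is replaced by the vertex \<open>2 d\<close> below; hence exactly the top
  vertices lie between \<open>lift\<close> and \<open>lowered\<close>.\<close>

lemma lowered_eq:
  assumes "int l < dn D x"
  shows "lowered ((\<sigma> ^^ l) (top_of x)) = (if l = 0 then \<xi> (top_of x) - 2 * dn D x else \<xi> (top_of x) - 2 * int l)"
proof (cases l)
  case 0
  define m where "m = nat (dn D x) - 1"
  have m: "int m < dn D x" "int m + 1 = dn D x" using dn_pos[of x] by (auto simp: m_def)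
  then have "\<sigma> ((\<sigma> ^^ m) (top_of x)) = (\<sigma> ^^ nat (dn D x)) (top_of x)"
    by (metis Suc_eq_plus1 funpow.simps(2) nat_int o_apply of_nat_1 of_nat_add)
  also have "\<dots> = top_of x" using aut_pow_dn[of "top_of x"] by simp
  finally have "inv_into UNIV \<sigma> (top_of x) = (\<sigma> ^^ m) (top_of x)" using inj_aut by (metis inv_f_f)
  then show ?thesis using lift_staircase[OF m(1)] m(2) 0 by (simp add: lowered_def)
next
  case (Suc m)
  then show ?thesis using lift_staircase[of m x] assms inj_aut by (simp add: lowered_def)
qed

lemma lowered_le_lift: "lowered x \<le> lift x" and lift_drop: "lift x \<le> lowered x + 2 * dn D x"
proof -
  obtain l where l: "int l < dn D x" "x = (\<sigma> ^^ l) (top_of x)"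
    using orbitE[of x "top_of x"] self_in_orbit[of x] by auto
  show "lowered x \<le> lift x" "lift x \<le> lowered x + 2 * dn D x"
    using lowered_eq[OF l(1)] lift_staircase[OF l(1)] l(2) dn_pos[of x] by (auto split: if_splits)
qed

lemma X_top_eq: "X_top D \<xi> = region lift lowered"
proof -
  have "X_top D \<xi> = {(top_of x, \<xi> (top_of x)) | x. True}"
    by (force simp: X_top_def nodes_def top_of_def)
  also have "\<dots> = region lift lowered"
  proof (intro equalityI subsetI)
    fix a assume "a \<in> {(top_of x, \<xi> (top_of x)) | x. True}"
    then obtain x where a: "a = (top_of x, \<xi> (top_of x))" by blast
    have "lift (top_of x) = \<xi> (top_of x)" "lowered (top_of x) < \<xi> (top_of x)"
      using lift_staircase[of 0 x] lowered_eq[of 0 x] dn_pos[of x] by auto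
    then show "a \<in> region lift lowered" using height_vertex by (simp add: a region_def)
  next
    fix a assume "a \<in> region lift lowered"
    then obtain x p where a: "a = (x, p)" "vertex x p" "lowered x < p" "p \<le> lift x" by (auto simp: region_def)
    obtain l where l: "int l < dn D x" "x = (\<sigma> ^^ l) (top_of x)"
      using orbitE[of x "top_of x"] self_in_orbit[of x] by auto
    have "l = 0" using a lowered_eq[OF l(1)] lift_staircase[OF l(1)] l(2) by (auto split: if_splits)
    then have x: "x = top_of x" and b: "\<xi> x - 2 * dn D x < p" "p \<le> \<xi> x"
      using a lowered_eq[OF l(1)] lift_staircase[OF l(1)] l(2) by auto
    have "p = \<xi> x" using b by (intro vertex_close[OF height_vertex a(2), symmetric, THEN sym]) auto
    then show "a \<in> {(top_of x, \<xi> (top_of x)) | x. True}" using a(1) x by auto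
  qed
  finally show ?thesis .
qed

lemma lift_has_neighbour: "(\<exists>y. adj D x y) \<or> lift x \<le> \<xi> x + 2 * dn D x"
proof (cases "\<exists>y. adj D x y")
  case False
  then have "\<sigma> x = x" using ADE_isolated[OF ADE, of x] by blast
  then have "lift x = \<xi> x" unfolding lift_def using inj_aut by (metis inv_f_f diff_le_self max.absorb1 zero_le_numeral diff_ge_0_iff_ge add_diff_cancel_left' diff_le_eq le_add_same_cancel1)
  then show ?thesis using dn_pos[of x] by simp
qed simp

text \<open>Let \<open>u\<close> frame \<open>lift\<close>. The words \<open>a\<close> and
  \<open>b\<close> of \<open>X_prime\<close> and \<open>X_top\<close> lead to frames
  \<open>u a\<close> of \<open>\<xi>\<close> and \<open>u b\<close> of \<open>lowered\<close>. The
  shift \<open>T\<close> takes \<open>lift\<close> to \<open>lowered\<close>, so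
  \<open>T u = u b \<sigma>\<close>; conjugation by \<open>a\<close> turns this into
  \<open>T v = v \<tau>\<close> for \<open>v = u a\<close>.\<close>

theorem coxeter_frame:
  "\<exists>v T. v \<in> weyl_group D \<and> framed \<xi> v \<and> additive_map T \<and> inj T \<and>
     (\<forall>x p. E0 (\<sigma> x) (p - 2) = T (E0 x p)) \<and> (\<forall>\<kappa>. v (coxeter_tau D \<epsilon> \<xi> \<kappa>) = T (v \<kappa>)) \<and> bij (coxeter_tau D \<epsilon> \<xi>)"
proof -
  obtain u where u: "u \<in> weyl_group D" "framed lift u" using slice_framed[OF slice_lift] by blast
  obtain T where T: "additive_map T" "bij T" "\<And>x p. E0 (\<sigma> x) (p - 2) = T (E0 x p)" using E0_shift by blast
  note ua = weyl_additive[OF u(1)]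
  have slow: "slice lowered" unfolding lowered_def by (rule slice_translate[OF slice_lift])
  define a where "a = reading_word D (X_prime D \<epsilon> \<xi>)"
  define b where "b = reading_word D (X_top D \<xi>)"
  have aw: "a \<in> weyl_group D" and bw: "b \<in> weyl_group D" unfolding a_def b_def by (rule reading_word_weyl)+
  have fa: "framed \<xi> (u \<circ> a)"
    unfolding a_def X_prime_eq
    by (rule framed_reading_word[OF slice_lift slice_height height_le_lift lift_has_neighbour ua u(2)])
  have fb: "framed lowered (u \<circ> b)"
    unfolding b_def X_top_eq using lift_drop
    by (intro framed_reading_word[OF slice_lift slow lowered_le_lift _ ua u(2)]) auto
  have bij: "bij a" "bij u" "bij b" using weyl_bij aw bw u(1) by blast+
  have "T \<circ> u = u \<circ> (b \<circ> aut_weight D)"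
  proof (rule additive_map_eqI)
    fix x
    have "T (u (fund_weight x)) = T (E0 x (lift x))" using u(2) by (simp add: framed_def)
    also have "\<dots> = E0 (\<sigma> x) (lift x - 2)" by (simp add: T)
    also have "lift x - 2 = lowered (\<sigma> x)" using inj_aut by (simp add: lowered_def)
    also have "E0 (\<sigma> x) (lowered (\<sigma> x)) = u (b (fund_weight (\<sigma> x)))" using fb by (simp add: framed_def)
    finally show "(T \<circ> u) (fund_weight x) = (u \<circ> (b \<circ> aut_weight D)) (fund_weight x)"
      by (simp add: aut_weight_fund)
  qed (intro additive_map_comp T ua weyl_additive[OF bw] additive_map_aut_weight)+
  then have Tu: "T (u \<kappa>) = u (b (aut_weight D \<kappa>))" for \<kappa> by (metis o_apply)
  have tau: "coxeter_tau D \<epsilon> \<xi> = inv_into UNIV a \<circ> (b \<circ> aut_weight D) \<circ> a"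
    by (simp only: coxeter_tau_def tau_top_def a_def b_def)
  have aia: "a (inv_into UNIV a \<kappa>) = \<kappa>" for \<kappa> using bij(1) by (simp add: bij_is_surj surj_f_inv_f)
  have vT: "(u \<circ> a) (coxeter_tau D \<epsilon> \<xi> \<kappa>) = T ((u \<circ> a) \<kappa>)" for \<kappa>
    by (simp add: tau aia Tu)
  have "bij (coxeter_tau D \<epsilon> \<xi>)"
  proof -
    have "coxeter_tau D \<epsilon> \<xi> = inv_into UNIV (u \<circ> a) \<circ> T \<circ> (u \<circ> a)"
    proof
      fix \<kappa>
      have "inj (u \<circ> a)" using bij by (intro inj_compose) (auto simp: bij_is_inj)
      then have "coxeter_tau D \<epsilon> \<xi> \<kappa> = inv_into UNIV (u \<circ> a) ((u \<circ> a) (coxeter_tau D \<epsilon> \<xi> \<kappa>))"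
        by (simp only: inv_f_f)
      then show "coxeter_tau D \<epsilon> \<xi> \<kappa> = (inv_into UNIV (u \<circ> a) \<circ> T \<circ> (u \<circ> a)) \<kappa>"
        unfolding o_apply using vT[of \<kappa>] by (simp only: o_apply)
    qed
    moreover have "bij (u \<circ> a)" using bij by (intro bij_comp)
    ultimately show ?thesis using T(2) by (metis bij_comp bij_imp_bij_inv)
  qed
  moreover have "u \<circ> a \<in> weyl_group D" by (rule weyl_comp[OF u(1) aw])
  ultimately show ?thesis using fa T vT bij_is_inj by blast
qed

end

section \<open>The form on the root lattice\<close>

context folding begin

definition root_comb :: "('v \<Rightarrow> int) \<Rightarrow> 'v \<Rightarrow> int" where
  "root_comb n = (\<lambda>y. \<Sum>x\<in>UNIV. n x * simple_root D x y)"

lemma root_coords_comb: "root_coords D (root_comb n) x = of_int (n x)"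
proof -
  have "root_coords D (root_comb n) = (\<lambda>x. of_int (n x))"
    unfolding root_coords_def
  proof (rule the_equality)
    show "\<forall>y. of_int (root_comb n y) = (\<Sum>x\<in>UNIV. of_int (n x) * of_int (simple_root D x y))"
      by (simp add: root_comb_def)
    fix c :: "'v \<Rightarrow> rat" assume c: "\<forall>y. of_int (root_comb n y) = (\<Sum>x\<in>UNIV. c x * of_int (simple_root D x y))"
    show "c = (\<lambda>x. of_int (n x))"
    proof
      fix x
      have "(\<Sum>x\<in>UNIV. (c x - of_int (n x)) * of_int (simple_root D x y)) = 0" for y
        using c[rule_format, of y] by (simp add: root_comb_def left_diff_distrib sum_subtractf)
      from ADE_nonsingular[OF ADE this, of x] show "c x = of_int (n x)" by simp
    qed
  qed
  then show ?thesis by simp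
qed

lemma form_comb: "form D \<kappa> (root_comb n) = of_int (\<Sum>x\<in>UNIV. \<kappa> x * n x)"
  by (simp add: form_def root_coords_comb)

lemma root_comb_lin: "root_comb (\<lambda>x. a * m x + b * n x) = (\<lambda>y. a * root_comb m y + b * root_comb n y)"
  by (simp add: root_comb_def fun_eq_iff sum_distrib_left sum.distrib[symmetric] algebra_simps)

lemma root_comb_simple: "root_comb (\<lambda>y. if y = x then 1 else 0) = simple_root D x"
  by (simp add: root_comb_def fun_eq_iff if_distrib[of "\<lambda>t. t * _"] cong: if_cong)

definition in_root_lattice :: "('v \<Rightarrow> int) \<Rightarrow> bool" where
  "in_root_lattice \<mu> \<longleftrightarrow> (\<exists>n. \<mu> = root_comb n)"

lemma in_root_lattice_lin:
  assumes "in_root_lattice \<mu>" "in_root_lattice \<nu>" shows "in_root_lattice (\<lambda>y. a * \<mu> y + b * \<nu> y)"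
proof -
  obtain m n where "\<mu> = root_comb m" "\<nu> = root_comb n" using assms by (auto simp: in_root_lattice_def)
  then show ?thesis unfolding in_root_lattice_def using root_comb_lin[of a m b n, symmetric] by blast
qed

lemma in_root_lattice_simple: "in_root_lattice (simple_root D x)"
  unfolding in_root_lattice_def using root_comb_simple[of x, symmetric] by blast

lemma form_simple_root: "form D \<kappa> (simple_root D x) = of_int (\<kappa> x)"
  using form_comb[of \<kappa> "\<lambda>y. if y = x then 1 else 0"]
  by (simp add: root_comb_simple if_distrib[of "\<lambda>t. _ * t"] cong: if_cong)

lemma form_lin_right:
  assumes "in_root_lattice \<mu>" "in_root_lattice \<nu>"
  shows "form D \<kappa> (\<lambda>y. a * \<mu> y + b * \<nu> y) = of_int a * form D \<kappa> \<mu> + of_int b * form D \<kappa> \<nu>"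
proof -
  obtain m n where mn: "\<mu> = root_comb m" "\<nu> = root_comb n" using assms by (auto simp: in_root_lattice_def)
  show ?thesis unfolding mn root_comb_lin[symmetric] form_comb
    by (simp add: sum_distrib_left sum.distrib[symmetric] algebra_simps)
qed

lemma form_lin_left: "form D (\<lambda>y. a * \<kappa> y + b * \<kappa>' y) \<mu> = of_int a * form D \<kappa> \<mu> + of_int b * form D \<kappa>' \<mu>"
  by (simp add: form_def sum_distrib_left sum.distrib[symmetric] algebra_simps)

text \<open>The definition of \<open>form\<close> is not symmetric: its second argument is expanded
  in simple roots. So \<open>\<kappa>\<close> may be any weight, while \<open>\<mu>\<close> lies in
  the root lattice, which reflections preserve.\<close>

lemma form_weyl:
  assumes "w \<in> weyl_group D" "in_root_lattice \<mu>"
  shows "in_root_lattice (w \<mu>) \<and> form D (w \<kappa>) (w \<mu>) = form D \<kappa> \<mu>"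
  using assms
proof (induction arbitrary: \<kappa> rule: weyl_group.induct)
  case (weyl_refl w x)
  have IH: "in_root_lattice (w \<mu>)" "form D (w \<kappa>) (w \<mu>) = form D \<kappa> \<mu>" using weyl_refl by blast+
  obtain n where n: "w \<mu> = root_comb n" using IH(1) by (auto simp: in_root_lattice_def)
  define m where "m y = 1 * n y + (- root_comb n x) * (if y = x then 1 else 0)" for y
  have "(reflection D x \<circ> w) \<mu> = (\<lambda>y. 1 * root_comb n y + (- root_comb n x) * simple_root D x y)"
    by (simp add: n reflection_def)
  also have "\<dots> = root_comb m"
    unfolding m_def root_comb_lin root_comb_simple ..
  finally have m: "(reflection D x \<circ> w) \<mu> = root_comb m" .
  have s: "(\<Sum>y\<in>UNIV. simple_root D x y * n y) = root_comb n x"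
    unfolding root_comb_def by (intro sum.cong) (simp_all add: simple_root_sym)
  have m': "m y = n y - (if y = x then root_comb n x else 0)" for y by (simp add: m_def)
  have "(\<Sum>y\<in>UNIV. (w \<kappa> y - w \<kappa> x * simple_root D x y) * m y) = (\<Sum>y\<in>UNIV. w \<kappa> y * m y) - w \<kappa> x * (\<Sum>y\<in>UNIV. simple_root D x y * m y)"
    by (simp add: sum_subtractf sum_distrib_left algebra_simps)
  also have "(\<Sum>y\<in>UNIV. simple_root D x y * m y) = root_comb n x - 2 * root_comb n x"
    unfolding m' right_diff_distrib sum_subtractf s by (simp add: simple_root_def if_distrib[of "\<lambda>t. _ * t"] cong: if_cong)
  also have "(\<Sum>y\<in>UNIV. w \<kappa> y * m y) = (\<Sum>y\<in>UNIV. w \<kappa> y * n y) - w \<kappa> x * root_comb n x"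
    unfolding m' right_diff_distrib sum_subtractf by (simp add: if_distrib[of "\<lambda>t. _ * t"] cong: if_cong)
  finally have "form D ((reflection D x \<circ> w) \<kappa>) ((reflection D x \<circ> w) \<mu>) = form D (w \<kappa>) (w \<mu>)"
    unfolding m n form_comb by (simp add: reflection_def algebra_simps)
  then show ?case using IH m by (auto simp: in_root_lattice_def)
qed simp

end

section \<open>The inverse of the quantum Cartan matrix\<close>

context folding begin

lemma qcartan_self: "qcartan D i i = fls_X_intpow (int (card i)) + fls_X_intpow (- int (card i))"
  by (simp add: qcartan_def)

text \<open>The quotient is the quantum integer \<open>[m]\<close> with \<open>m = link i k\<close>;
  multiplied by \<open>X - X^-1\<close>, the symmetric sum telescopes.\<close>

lemma qcartan_link:
  assumes "i \<in> nodes D" "k \<in> nodes D" "i \<noteq> k"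
  shows "qcartan D i k = - (\<Sum>j<link i k. fls_X_intpow (2 * int j + 1 - int (link i k)))"
proof -
  define m where "m = link i k"
  have nz: "fls_X - fls_X_inv \<noteq> (0 :: rat fls)"
  proof
    assume "fls_X - fls_X_inv = (0 :: rat fls)"
    then have "fls_nth (fls_X - fls_X_inv :: rat fls) 1 = 0" by simp
    then show False by simp
  qed
  have X: "fls_X = (fls_X_intpow 1 :: rat fls)" "fls_X_inv = (fls_X_intpow (-1) :: rat fls)"
    by (rule fls_eqI, simp)+
  have tel: "(\<Sum>j<n. fls_X_intpow (a + 2 * int j)) * (fls_X - fls_X_inv) = fls_X_intpow (a + 2 * int n - 1) - (fls_X_intpow (a - 1) :: rat fls)" for n a
  proof (induction n)
    case (Suc n)
    have st: "fls_X_intpow (a + 2 * int n) * (fls_X - fls_X_inv) = fls_X_intpow (a + 2 * int n + 1) - (fls_X_intpow (a + 2 * int n - 1) :: rat fls)"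
      unfolding X right_diff_distrib fls_X_intpow_times_fls_X_intpow by simp
    have e: "a + 2 * int (Suc n) - 1 = a + 2 * int n + 1" by simp
    show ?case unfolding sum.lessThan_Suc distrib_right Suc.IH st e by simp
  qed simp
  have "(\<Sum>j<m. fls_X_intpow (2 * int j + 1 - int m)) * (fls_X - fls_X_inv) = fls_X_intpow (int m) - (fls_X_intpow (- int m) :: rat fls)"
    using tel[of "1 - int m" m] by (simp add: algebra_simps)
  then have "(\<Sum>j<m. fls_X_intpow (2 * int j + 1 - int m)) = (fls_X_intpow (int m) - (fls_X_intpow (- int m) :: rat fls)) / (fls_X - fls_X_inv)"
    using nz by (simp add: nonzero_eq_divide_eq)
  moreover have "qcartan D i k = - ((fls_X_intpow (int m) - fls_X_intpow (- int m)) / (fls_X - fls_X_inv))"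
    using assms by (simp add: qcartan_def cartan_link m_def minus_divide_left)
  ultimately show ?thesis by (simp add: m_def)
qed

lemma fls_nth_intpow_mult: "fls_nth (fls_X_intpow a * F) n = fls_nth (F :: rat fls) (n - a)"
  by (simp add: fls_X_intpow_times_conv_shift)

lemma qcartan_row_nth:
  assumes i: "i \<in> nodes D"
  shows "fls_nth (\<Sum>k\<in>nodes D. qcartan D i k * M k) u = fls_nth (M i) (u - int (card i)) + fls_nth (M i) (u + int (card i)) -
     (\<Sum>k\<in>nodes D. \<Sum>j<link i k. fls_nth (M k) (u + 2 * int j + 1 - int (link i k)))"
proof -
  have off: "fls_nth (qcartan D i k * M k) u = - (\<Sum>j<link i k. fls_nth (M k) (u + 2 * int j + 1 - int (link i k)))"
    if k: "k \<in> nodes D" "k \<noteq> i" for k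
  proof -
    have "fls_nth (qcartan D i k * M k) u = - (\<Sum>j<link i k. fls_nth (M k) (u - (2 * int j + 1 - int (link i k))))"
      unfolding qcartan_link[OF i k(1) k(2)[symmetric]]
      by (simp only: mult_minus_left fls_uminus_nth sum_distrib_right fls_nth_sum fls_nth_intpow_mult)
    \<comment> \<open>Reversing the order of summation changes the sign of the offsets, so forward
      and backward shifts agree.\<close>
    also have "(\<Sum>j<link i k. fls_nth (M k) (u - (2 * int j + 1 - int (link i k)))) =
        (\<Sum>j<link i k. fls_nth (M k) (u + 2 * int j + 1 - int (link i k)))"
      by (rule sum.reindex_bij_witness[of _ "\<lambda>j. link i k - 1 - j" "\<lambda>j. link i k - 1 - j"]) (auto simp: algebra_simps of_nat_diff)
    finally show ?thesis .
  qed
  have "fls_nth (\<Sum>k\<in>nodes D. qcartan D i k * M k) u = fls_nth (qcartan D i i * M i) u + (\<Sum>k\<in>nodes D - {i}. fls_nth (qcartan D i k * M k) u)"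
    using i by (simp add: fls_nth_sum sum.remove)
  also have "fls_nth (qcartan D i i * M i) u = fls_nth (M i) (u - int (card i)) + fls_nth (M i) (u + int (card i))"
    by (simp only: qcartan_self distrib_right fls_plus_nth fls_nth_intpow_mult) simp
  also have "(\<Sum>k\<in>nodes D - {i}. fls_nth (qcartan D i k * M k) u) =
      (\<Sum>k\<in>nodes D - {i}. - (\<Sum>j<link i k. fls_nth (M k) (u + 2 * int j + 1 - int (link i k))))"
    by (intro sum.cong) (auto intro: off)
  also have "\<dots> = - (\<Sum>k\<in>nodes D. \<Sum>j<link i k. fls_nth (M k) (u + 2 * int j + 1 - int (link i k)))"
    using i by (simp add: sum_negf sum.remove[of "nodes D" i])
  finally show ?thesis by simp
qed

lemma link_le: "i \<in> nodes D \<Longrightarrow> k \<in> nodes D \<Longrightarrow> link i k \<le> card k"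
  using card_node_pos[of k] by (simp add: link_def)

text \<open>Measure indices of \<open>M k\<close> relative to \<open>d_k\<close>. In row
  \<open>i\<close> the coefficient of \<open>M i\<close> at \<open>u + d_i\<close> is then
  determined by strictly earlier ones, as the shifts at the other nodes \<open>k\<close> stay below
  \<open>d_k\<close>. All coefficients vanish far to the left, hence everywhere.\<close>

lemma qcartan_kernel:
  assumes Z: "\<And>i. i \<in> nodes D \<Longrightarrow> (\<Sum>k\<in>nodes D. qcartan D i k * M k) = 0" and "i \<in> nodes D"
  shows "M i = 0"
proof -
  have "\<exists>N. \<forall>k\<in>nodes D. \<forall>n<N. fls_nth (M k) n = 0"
  proof (intro exI ballI allI impI)
    fix k n assume k: "k \<in> nodes D" "n < Min (insert 0 ((\<lambda>k. fls_subdegree (M k)) ` nodes D))"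
    then have "n < fls_subdegree (M k)" by simp
    then show "fls_nth (M k) n = 0" by simp
  qed
  then obtain N where N: "\<And>k n. k \<in> nodes D \<Longrightarrow> n < N \<Longrightarrow> fls_nth (M k) n = 0" by blast
  \<comment> \<open>Orbit sizes are at most \<open>r\<close>, so starting at
    \<open>N - r - 1\<close> places all coefficients concerned below the common bound
    \<open>N\<close>.\<close>
  have low: "\<forall>n'\<le>n. \<forall>i\<in>nodes D. fls_nth (M i) (n' + int (card i)) = 0" if "n \<ge> N - int r - 1" for n
    using that
  proof (induction n rule: int_ge_induct)
    case base
    show ?case
    proof (intro allI ballI impI)
      fix n' i assume i: "n' \<le> N - int r - 1" "i \<in> nodes D"
      have "int (card i) \<le> int r" using card_node_cases[OF i(2)] r_pos by auto
      then show "fls_nth (M i) (n' + int (card i)) = 0" using i by (intro N) auto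
    qed
  next
    case (step n)
    show ?case
    proof (intro allI ballI impI)
      fix n' i assume n': "n' \<le> n + 1" and i: "i \<in> nodes D"
      show "fls_nth (M i) (n' + int (card i)) = 0"
      proof (cases "n' = n + 1")
        case True
        have IH: "fls_nth (M k) m = 0" if "k \<in> nodes D" "m - int (card k) \<le> n" for k m
          using step.IH[rule_format, of "m - int (card k)" k] that by simp
        have "fls_nth (M k) (n' + 2 * int j + 1 - int (link i k)) = 0" if "k \<in> nodes D" "j < link i k" for k j
          using link_le[OF i that(1)] that True by (intro IH) auto
        moreover have "fls_nth (M i) (n' - int (card i)) = 0" using i card_node_pos[OF i] True by (intro IH) auto
        ultimately show ?thesis using qcartan_row_nth[OF i, of M n'] Z[OF i] by simp
      qed (use step n' i in auto)
    qed
  qed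
  show ?thesis
  proof (rule fls_eqI)
    fix n
    show "fls_nth (M i) n = fls_nth 0 n"
    proof (cases "n - int (card i) \<ge> N - int r - 1")
      case True
      from low[OF this, rule_format, of "n - int (card i)" i] assms(2) show ?thesis by simp
    next
      case False
      have "int (card i) \<le> int r" using card_node_cases[OF assms(2)] r_pos by auto
      then show ?thesis using False N[OF assms(2), of n] by simp
    qed
  qed
qed

lemma qcartan_inv_eqI:
  assumes M: "\<And>j i. j \<in> nodes D \<Longrightarrow> i \<in> nodes D \<Longrightarrow> (\<Sum>k\<in>nodes D. qcartan D i k * M k j) = (if i = j then 1 else 0)"
    and "i \<in> nodes D" "j \<in> nodes D"
  shows "qcartan_inv D i j = M i j"
proof -
  have "qcartan_inv D = (\<lambda>i j. if i \<in> nodes D \<and> j \<in> nodes D then M i j else 0)" (is "_ = ?M")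
    unfolding qcartan_inv_def
  proof (rule the_equality)
    show "(\<forall>i j. i \<notin> nodes D \<or> j \<notin> nodes D \<longrightarrow> ?M i j = 0) \<and>
       (\<forall>i\<in>nodes D. \<forall>j\<in>nodes D. (\<Sum>k\<in>nodes D. qcartan D i k * ?M k j) = (if i = j then 1 else 0))"
      using M by auto
    fix M' assume M': "(\<forall>i j. i \<notin> nodes D \<or> j \<notin> nodes D \<longrightarrow> M' i j = 0) \<and>
       (\<forall>i\<in>nodes D. \<forall>j\<in>nodes D. (\<Sum>k\<in>nodes D. qcartan D i k * M' k j) = (if i = j then 1 else 0))"
    have "M' i j = M i j" if ij: "i \<in> nodes D" "j \<in> nodes D" for i j
    proof -
      have "M' i j - M i j = 0"
      proof (rule qcartan_kernel[of "\<lambda>k. M' k j - M k j", OF _ ij(1)])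
        fix i assume i: "i \<in> nodes D"
        then show "(\<Sum>k\<in>nodes D. qcartan D i k * (M' k j - M k j)) = 0"
          using M[OF ij(2) i] M' ij(2) by (simp add: right_diff_distrib sum_subtractf)
      qed
      then show ?thesis by simp
    qed
    then show "M' = ?M" using M' by (auto simp: fun_eq_iff)
  qed
  then show ?thesis using assms(2,3) by simp
qed

end

section \<open>The coefficients of the inverse matrix as values of weights on the repetition
  quiver\<close>

context parity_folding begin

lemma vertex_eps: "vertex x (\<epsilon> x)" by (simp add: vertex_def)

lemma sum_indicator_unique:
  assumes "finite A" "\<And>a b. a \<in> A \<Longrightarrow> b \<in> A \<Longrightarrow> P a \<Longrightarrow> P b \<Longrightarrow> a = b"
  shows "(\<Sum>a\<in>A. if P a then 1 else 0) = (if \<exists>a\<in>A. P a then 1 else (0::int))"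
proof (cases "\<exists>a\<in>A. P a")
  case True
  then obtain a where a: "a \<in> A" "P a" by blast
  have "(\<Sum>b\<in>A. if P b then 1 else 0) = (\<Sum>b\<in>A. if b = a then 1 else (0::int))"
    by (intro sum.cong) (use a assms(2) in auto)
  then show ?thesis using a assms(1) by auto
qed auto

text \<open>Here the multiplicities of the folded mesh become neighbours of actual vertices. It
  rests on the parity congruences, by cases on the two orbit sizes; several shifts occur only when
  \<open>i\<close> is a single fixed point and \<open>k\<close> is not, and then all points of
  \<open>k\<close> are neighbours.\<close>

lemma link_vertex_iff:
  assumes i: "i \<in> nodes D" and k: "k \<in> nodes D" and z: "z \<in> k" and adj: "adj_nodes D i k"
  shows "(\<exists>j<link i k. vertex z (q + 2 * int j + 1 - int (link i k) - int (card k))) \<longleftrightarrow> (\<exists>x\<in>i. vertex x q \<and> adj D x z)"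
proof -
  have dk: "int (card k) = dn D z" by (rule card_node[OF k z])
  obtain x0 where x0: "x0 \<in> i" "adj D x0 z"
  proof -
    obtain x where x: "i = orbit D x" using i by (auto simp: nodes_def)
    have "adj_nodes D (orbit D z) (orbit D x)" using adj adj_nodes_sym nodes_eq_orbit[OF k z] x by simp
    then obtain l where "adj D z ((\<sigma> ^^ l) x)" unfolding adj_nodes_orbit_iff ..
    then show ?thesis using that[of "(\<sigma> ^^ l) x"] adj_sym x by (simp add: orbit_def)
  qed
  have di: "int (card i) = dn D x" if "x \<in> i" for x by (rule card_node[OF i that])
  have link: "link i k = (if card i = 1 then card k else 1)" using adj by (simp add: link_def)
  show ?thesis
  proof
    assume "\<exists>j<link i k. vertex z (q + 2 * int j + 1 - int (link i k) - int (card k))"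
    then obtain j where j: "j < link i k" "vertex z (q + 2 * int j + 1 - int (link i k) - int (card k))" by blast
    have d: "2 * mind x0 z dvd q + 2 * int j + 1 - int (link i k) - int (card k) - \<epsilon> x0 - mind x0 z"
      by (rule vertex_adj[OF x0(2) vertex_eps j(2)])
    show "\<exists>x\<in>i. vertex x q \<and> adj D x z"
    proof (cases "card k = 1")
      case True
      then have "link i k = 1" "mind x0 z = 1" using dk dn_pos[of x0] by (auto simp: link)
      with d j(1) True have "even (q - 2 - \<epsilon> x0)" by (simp add: algebra_simps)
      then have "even (q - \<epsilon> x0)" by simp
      then obtain y where y: "y \<in> orbit D x0" "vertex y q" by (rule vertex_orbit_exists)
      have "adj D z y" by (rule adj_fixed_orbit[OF _ _ y(1)]) (use True dk x0 adj_sym in auto)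
      then show ?thesis using y nodes_eq_orbit[OF i x0(1)] adj_sym by blast
    next
      case False
      then have kr: "card k = r" using card_node_cases[OF k] by blast
      show ?thesis
      proof (cases "card i = 1")
        case True
        then have "mind x0 z = 1" "link i k = r" using di[OF x0(1)] dn_pos[of z] kr by (auto simp: link)
        with d kr have "even (q + 2 * int j - 2 * int r - \<epsilon> x0)" by (simp add: algebra_simps)
        then have "even (q - \<epsilon> x0)" by simp
        then have "vertex x0 q" using di[OF x0(1)] True by (simp add: vertex_def)
        then show ?thesis using x0 by blast
      next
        case F: False
        then have "mind x0 z = int r" "link i k = 1" "dn D x0 = int r"
          using di[OF x0(1)] card_node_cases[OF i] dk kr by (auto simp: link)
        with d kr j(1) have "2 * int r dvd q - \<epsilon> x0 - 2 * int r" by (simp add: algebra_simps)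
        then have "vertex x0 q" using \<open>dn D x0 = int r\<close> by (simp add: vertex_def dvd_diff_left_iff)
        then show ?thesis using x0 by blast
      qed
    qed
  next
    assume "\<exists>x\<in>i. vertex x q \<and> adj D x z"
    then obtain x where x: "x \<in> i" "vertex x q" "adj D x z" by blast
    have d: "2 * mind x z dvd \<epsilon> z - q - mind x z" by (rule vertex_adj[OF x(3,2) vertex_eps])
    show "\<exists>j<link i k. vertex z (q + 2 * int j + 1 - int (link i k) - int (card k))"
    proof (cases "card i = 1 \<and> card k \<noteq> 1")
      case False
      then have m: "mind x z = dn D z" "link i k = 1"
        using card_node_cases[OF i] card_node_cases[OF k] di[OF x(1)] dk r_pos by (auto simp: link)
      have "2 * dn D z dvd \<epsilon> z - q - dn D z" using d m by simp
      then have "2 * dn D z dvd - (\<epsilon> z - q - dn D z) - 2 * dn D z"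
        by (intro dvd_diff) (simp_all only: dvd_minus_iff dvd_refl)
      moreover have "- (\<epsilon> z - q - dn D z) - 2 * dn D z = q - dn D z - \<epsilon> z" by simp
      ultimately have "vertex z (q - dn D z)" unfolding vertex_def by (simp only:)
      then show ?thesis using m dk by (intro exI[of _ 0]) simp
    next
      case True
      then have m: "mind x z = 1" "link i k = r" "card k = r" "dn D z = int r"
        using card_node_cases[OF k] di[OF x(1)] dk dn_pos[of z] by (auto simp: link)
      then have "2 dvd \<epsilon> z - q - 1" using d by (simp only: mult_1_right)
      then obtain t where t: "\<epsilon> z - q - 1 = 2 * t" ..
      define j where "j = nat (t mod int r)"
      have j: "int j = t mod int r" unfolding j_def using r_pos by simp
      have "int j < int r" unfolding j using r_pos by simp
      moreover have "int r dvd int j - t" unfolding j by (metis dvd_minus_mod dvd_diff_commute)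
      then have "2 * int r dvd 2 * (int j - t)" by (rule mult_dvd_mono[OF dvd_refl])
      have e: "q + 2 * int j + 1 - int r - int r - \<epsilon> z = 2 * (int j - t) - 2 * int r" using t by simp
      have "2 * int r dvd q + 2 * int j + 1 - int r - int r - \<epsilon> z"
        unfolding e using \<open>2 * int r dvd 2 * (int j - t)\<close> by (rule dvd_diff) simp
      ultimately show ?thesis using m by (intro exI[of _ j]) (simp add: vertex_def)
    qed
  qed
qed

text \<open>Both sums have at most one nonzero term: the offsets span less than the spacing
  \<open>2 d\<close> of the vertices over \<open>z\<close>, and an orbit has at most one vertex at a
  given time.\<close>

lemma link_count:
  assumes i: "i \<in> nodes D" and k: "k \<in> nodes D" and z: "z \<in> k"
  shows "(\<Sum>j<link i k. if vertex z (q + 2 * int j + 1 - int (link i k) - int (card k)) then 1 else 0) =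
    (\<Sum>x\<in>i. if vertex x q \<and> adj D x z then 1 else (0::int))"
proof (cases "adj_nodes D i k")
  case False
  then have "\<not> adj D x z" if "x \<in> i" for x using that z by (auto simp: adj_nodes_def)
  then show ?thesis using False by (simp add: link_def)
next
  case True
  have dk: "int (card k) = dn D z" by (rule card_node[OF k z])
  have "(\<Sum>j<link i k. if vertex z (q + 2 * int j + 1 - int (link i k) - int (card k)) then 1 else 0) =
      (if \<exists>j\<in>{..<link i k}. vertex z (q + 2 * int j + 1 - int (link i k) - int (card k)) then 1 else (0::int))"
  proof (rule sum_indicator_unique)
    fix j j' assume j: "j \<in> {..<link i k}" "j' \<in> {..<link i k}"
      and v: "vertex z (q + 2 * int j + 1 - int (link i k) - int (card k))" "vertex z (q + 2 * int j' + 1 - int (link i k) - int (card k))"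
    have "link i k \<le> card k" by (rule link_le[OF i k])
    then have "int j < dn D z" "int j' < dn D z" using j dk by auto
    then have "\<bar>2 * int j' - 2 * int j\<bar> < 2 * dn D z" by linarith
    then show "j = j'" using vertex_close[OF v] by simp
  qed simp
  also have "\<dots> = (if \<exists>x\<in>i. vertex x q \<and> adj D x z then 1 else 0)"
    using link_vertex_iff[OF i k z True, of q] by auto
  also have "\<dots> = (\<Sum>x\<in>i. if vertex x q \<and> adj D x z then 1 else 0)"
    by (rule sum_indicator_unique[symmetric]) (use nodes_eq_orbit[OF i] vertex_orbit_unique in auto)
  finally show ?thesis .
qed

lemma sum_nodes: "(\<Sum>k\<in>nodes D. \<Sum>z\<in>k. F z) = (\<Sum>z\<in>UNIV. (F z :: 'b::comm_monoid_add))"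
proof -
  have "{z \<in> UNIV. orbit D z = k} = k" if "k \<in> nodes D" for k
  proof -
    obtain x where k: "k = orbit D x" using \<open>k \<in> nodes D\<close> by (auto simp: nodes_def)
    show ?thesis unfolding k
    proof (intro equalityI subsetI)
      fix z assume "z \<in> {z \<in> UNIV. orbit D z = orbit D x}"
      then show "z \<in> orbit D x" using self_in_orbit[of z] by simp
    qed (simp add: orbit_eq)
  qed
  then have "(\<Sum>k\<in>nodes D. \<Sum>z\<in>k. F z) = (\<Sum>k\<in>nodes D. \<Sum>z\<in>{z \<in> UNIV. orbit D z = k}. F z)" by (intro sum.cong) auto
  also have "\<dots> = (\<Sum>z\<in>UNIV. F z)" by (rule sum.group) auto
  finally show ?thesis .
qed

text \<open>
  \<open>pulled y s x p\<close> is the coefficient at \<open>y\<close> of \<open>E0 x p\<close>, transported to time \<open>s\<close>; summing it over the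
  unique vertex of a node at each time gives the entries of the inverse quantum Cartan matrix.
\<close>

definition pulled :: "'v \<Rightarrow> int \<Rightarrow> 'v \<Rightarrow> int \<Rightarrow> int" where
  "pulled y s x p = inv_into UNIV (state s) (E0 x p) y"

text \<open>The offset by \<open>card i\<close> places the initial value 1 at
  \<open>u = d_i\<close>, where the expansion of the diagonal entry of the inverse begins.\<close>

definition node_coeff :: "'v \<Rightarrow> int \<Rightarrow> 'v set \<Rightarrow> int \<Rightarrow> int" where
  "node_coeff y s i u = (\<Sum>x\<in>i. if vertex x (s + u - int (card i)) then pulled y s x (s + u - int (card i)) else 0)"

lemma inv_state: "inv_into UNIV (state s) \<in> weyl_group D" "inv_into UNIV (state s) (state s \<kappa>) = \<kappa>"
  using weyl_inv_into[OF state_weyl] weyl_bij[OF state_weyl[of s]] by (simp_all add: bij_is_inj)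

lemma E0_mesh_state:
  assumes "vertex x q"
  shows "E0 x (q - 2 * dn D x) = (\<lambda>y. (\<Sum>z | adj D x z. 1 * state q (fund_weight z) y) - state q (fund_weight x) y)"
proof -
  have "E0 x (q - 2 * dn D x) = state q (\<lambda>y. (\<Sum>z | adj D x z. 1 * fund_weight z y) - fund_weight x y)"
    using E0_drop[OF assms] by (simp add: fund_simple)
  also have "\<dots> = (\<lambda>y. state q (\<lambda>y. \<Sum>z | adj D x z. 1 * fund_weight z y) y - state q (fund_weight x) y)"
    by (rule additive_map_diff[OF state_additive])
  finally show ?thesis by (simp only: additive_map_sum[OF state_additive])
qed

lemma pulled_mesh:
  assumes "vertex x q"
  shows "pulled y s x q + pulled y s x (q - 2 * dn D x) = (\<Sum>z | adj D x z. inv_into UNIV (state s) (state q (fund_weight z)) y)"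
proof -
  note a = weyl_additive[OF inv_state(1)[of s]]
  have "inv_into UNIV (state s) (E0 x (q - 2 * dn D x)) =
      (\<lambda>y. (\<Sum>z | adj D x z. 1 * inv_into UNIV (state s) (state q (fund_weight z)) y) - inv_into UNIV (state s) (state q (fund_weight x)) y)"
    unfolding E0_mesh_state[OF assms] by (simp only: additive_map_diff[OF a] additive_map_sum[OF a])
  then show ?thesis by (simp add: pulled_def E0_def[of x q])
qed

text \<open>The mesh relation at the vertex of \<open>i\<close> of time \<open>s + u\<close>, if
  there is one. Its neighbours are regrouped by orbits with \<open>link_count\<close>, and
  \<open>E0_window\<close> identifies the value of each neighbour at time \<open>q\<close> with that
  at its own vertex.\<close>

lemma node_coeff_mesh: "folded_mesh (\<lambda>i u. of_int (node_coeff y s i u))"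
  unfolding folded_mesh_def
proof (intro ballI allI)
  fix i u assume i: "i \<in> nodes D"
  define q where "q = s + u"
  define G where "G z = inv_into UNIV (state s) (state q (fund_weight z)) y" for z
  have di: "int (card i) = dn D x" if "x \<in> i" for x by (rule card_node[OF i that])
  have "node_coeff y s i (u + int (card i)) + node_coeff y s i (u - int (card i)) =
      (\<Sum>x\<in>i. if vertex x q then pulled y s x q else 0) + (\<Sum>x\<in>i. if vertex x (q - 2 * int (card i)) then pulled y s x (q - 2 * int (card i)) else 0)"
  proof -
    have "s + (u + int (card i)) - int (card i) = q" "s + (u - int (card i)) - int (card i) = q - 2 * int (card i)"
      by (simp_all add: q_def)
    then show ?thesis by (simp only: node_coeff_def)
  qed
  also have "\<dots> = (\<Sum>x\<in>i. if vertex x q then pulled y s x q + pulled y s x (q - 2 * dn D x) else 0)"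
    unfolding sum.distrib[symmetric] by (intro sum.cong) (auto simp: di vertex_minus)
  also have "\<dots> = (\<Sum>x\<in>i. \<Sum>z\<in>UNIV. (if vertex x q \<and> adj D x z then 1 else 0) * G z)"
  proof (intro sum.cong refl)
    fix x
    have "(\<Sum>z | adj D x z. G z) = (\<Sum>z\<in>UNIV. if adj D x z then G z else 0)" by (simp add: sum.If_cases)
    then show "(if vertex x q then pulled y s x q + pulled y s x (q - 2 * dn D x) else 0) =
        (\<Sum>z\<in>UNIV. (if vertex x q \<and> adj D x z then 1 else 0) * G z)"
      using pulled_mesh[of x q y s] by (simp add: G_def[symmetric] if_distrib[of "\<lambda>t. t * _"] cong: if_cong)
  qed
  also have "\<dots> = (\<Sum>z\<in>UNIV. (\<Sum>x\<in>i. if vertex x q \<and> adj D x z then 1 else 0) * G z)"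
    by (subst sum.swap) (simp only: sum_distrib_right)
  also have "\<dots> = (\<Sum>k\<in>nodes D. \<Sum>z\<in>k. (\<Sum>x\<in>i. if vertex x q \<and> adj D x z then 1 else 0) * G z)"
    by (rule sum_nodes[symmetric])
  also have "\<dots> = (\<Sum>k\<in>nodes D. \<Sum>j<link i k. node_coeff y s k (u + 2 * int j + 1 - int (link i k)))"
  proof (intro sum.cong refl)
    fix k assume k: "k \<in> nodes D"
    have dk: "int (card k) = dn D z" if "z \<in> k" for z by (rule card_node[OF k that])
    define p where "p j = q + 2 * int j + 1 - int (link i k) - int (card k)" for j
    have G: "pulled y s z (p j) = G z" if "z \<in> k" "j < link i k" "vertex z (p j)" for z j
    proof -
      have "p j \<le> q" "q < p j + 2 * dn D z" unfolding p_def dk[OF that(1), symmetric]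
        using link_le[OF i k] that(2) by auto
      from E0_window[OF that(3) this] show ?thesis by (simp add: pulled_def G_def)
    qed
    have "(\<Sum>z\<in>k. (\<Sum>x\<in>i. if vertex x q \<and> adj D x z then 1 else 0) * G z) =
        (\<Sum>z\<in>k. (\<Sum>j<link i k. if vertex z (p j) then 1 else 0) * G z)"
      unfolding p_def by (intro sum.cong refl) (simp only: link_count[OF i k])
    also have "\<dots> = (\<Sum>z\<in>k. \<Sum>j<link i k. if vertex z (p j) then pulled y s z (p j) else 0)"
      unfolding sum_distrib_right by (intro sum.cong refl) (auto simp: G)
    also have "\<dots> = (\<Sum>j<link i k. node_coeff y s k (u + 2 * int j + 1 - int (link i k)))"
    proof -
      have e: "s + (u + 2 * int j + 1 - int (link i k)) - int (card k) = p j" for j by (simp add: p_def q_def)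
      show ?thesis unfolding node_coeff_def e by (rule sum.swap)
    qed
    finally show "(\<Sum>z\<in>k. (\<Sum>x\<in>i. if vertex x q \<and> adj D x z then 1 else 0) * G z) =
        (\<Sum>j<link i k. node_coeff y s k (u + 2 * int j + 1 - int (link i k)))" .
  qed
  finally have "node_coeff y s i (u + int (card i)) + node_coeff y s i (u - int (card i)) =
     (\<Sum>k\<in>nodes D. \<Sum>j<link i k. node_coeff y s k (u + 2 * int j + 1 - int (link i k)))" .
  from arg_cong[OF this, of of_int]
  show "of_int (node_coeff y s i (u + int (card i))) + of_int (node_coeff y s i (u - int (card i))) =
     (\<Sum>k\<in>nodes D. \<Sum>j<link i k. of_int (node_coeff y s k (u + 2 * int j + 1 - int (link i k))) :: rat)"
    by simp
qed

lemma node_coeff_periodic: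
  assumes "i \<in> nodes D" shows "node_coeff y s i (u + 2 * int r * int (dual_coxeter D)) = node_coeff y s i u"
  using folded_mesh_periodic[OF node_coeff_mesh[of y s] assms, of u] by simp

text \<open>For these \<open>u\<close> the vertices lie in the window \<open>(s - 2 d_i, s]\<close>,
  so transport to time \<open>s\<close> returns the fundamental weight of \<open>x\<close>; its
  coefficient at \<open>y\<close> is nonzero for \<open>x = y\<close> only.\<close>

lemma node_coeff_initial:
  assumes i: "i \<in> nodes D" and y: "vertex y s" and u: "- int (card i) < u" "u \<le> int (card i)"
  shows "node_coeff y s i u = (if i = orbit D y \<and> u = int (card i) then 1 else 0)"
proof -
  define p where "p = s + u - int (card i)"
  have di: "int (card i) = dn D x" if "x \<in> i" for x by (rule card_node[OF i that])
  have "(if vertex x p then pulled y s x p else 0) = (if x = y \<and> u = int (card i) then 1 else 0)" if x: "x \<in> i" for x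
  proof (cases "vertex x p")
    case True
    have "E0 x p = state s (fund_weight x)"
      using E0_window[OF True, of s] u di[OF x] by (simp add: p_def)
    then have "pulled y s x p = (if x = y then 1 else 0)" by (simp add: pulled_def inv_state fund_weight_def)
    moreover have "u = int (card i)" if "x = y"
      using vertex_close[OF y True[unfolded that]] u di[OF x] that by (simp add: p_def)
    ultimately show ?thesis using True by auto
  next
    case False
    then show ?thesis using y by (auto simp: p_def)
  qed
  then have "node_coeff y s i u = (\<Sum>x\<in>i. if x = y \<and> u = int (card i) then 1 else 0)"
    unfolding node_coeff_def p_def by (intro sum.cong) auto
  moreover have "finite i" by simp
  moreover have "y \<in> i \<longleftrightarrow> i = orbit D y" using nodes_eq_orbit[OF i] self_in_orbit by blast
  ultimately show ?thesis by (cases "u = int (card i)") auto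
qed

text \<open>Cutting off the two-sided solution below 0 leaves the homogeneous relation intact for
  \<open>u > 0\<close>, since the values just below 0 vanish anyway. At \<open>u = 0\<close> the
  initial value 1 is left over, which is the entry of the identity matrix.\<close>

lemma node_coeff_inverse:
  assumes i: "i \<in> nodes D" and y: "vertex y s"
  shows "(\<Sum>k\<in>nodes D. qcartan D i k * fps_to_fls (Abs_fps (\<lambda>n. of_int (node_coeff y s k (int n))))) = (if i = orbit D y then 1 else 0)"
proof (rule fls_eqI)
  fix u
  define M where "M k = fps_to_fls (Abs_fps (\<lambda>n. of_int (node_coeff y s k (int n)) :: rat))" for k
  have M: "fls_nth (M k) u = (if u > - int (card k) then of_int (node_coeff y s k u) else 0)" if k: "k \<in> nodes D" for k u
  proof (cases "u \<ge> 0")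
    case False
    have "node_coeff y s k u = 0" if "u > - int (card k)"
      using node_coeff_initial[OF k y that] False by simp
    then show ?thesis using False by (simp add: M_def)
  qed (use card_node_pos[OF k] in \<open>simp add: M_def\<close>)
  have t: "- int (card k) < 2 * int j + 1 - int (link i k)" "2 * int j + 1 - int (link i k) < int (card k)"
    if "k \<in> nodes D" "j < link i k" for k j
    using link_le[OF i that(1)] that(2) by auto
  have nt: "fls_nth (M k) (u + 2 * int j + 1 - int (link i k)) = of_int (node_coeff y s k (u + 2 * int j + 1 - int (link i k)))"
    if "k \<in> nodes D" "j < link i k" "u \<ge> 0" for k j
    unfolding M[OF that(1)] using t[OF that(1,2)] that(3) by simp
  have nz: "fls_nth (M k) (u + 2 * int j + 1 - int (link i k)) = 0"
    if "k \<in> nodes D" "j < link i k" "u \<le> 0" for k j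
    unfolding M[OF that(1)] using t[OF that(1,2)] that(3)
      node_coeff_initial[OF that(1) y, of "u + 2 * int j + 1 - int (link i k)"] by auto
  note ci = card_node_pos[OF i]
  have "fls_nth (M i) (u - int (card i)) + fls_nth (M i) (u + int (card i)) -
     (\<Sum>k\<in>nodes D. \<Sum>j<link i k. fls_nth (M k) (u + 2 * int j + 1 - int (link i k))) = (if i = orbit D y \<and> u = 0 then 1 else 0)"
  proof (cases "u > 0")
    case True
    have "(\<Sum>k\<in>nodes D. \<Sum>j<link i k. fls_nth (M k) (u + 2 * int j + 1 - int (link i k))) =
        (\<Sum>k\<in>nodes D. \<Sum>j<link i k. of_int (node_coeff y s k (u + 2 * int j + 1 - int (link i k))))"
      by (intro sum.cong refl nt) (use True in auto)
    also have "\<dots> = of_int (node_coeff y s i (u + int (card i))) + of_int (node_coeff y s i (u - int (card i)))"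
      by (rule node_coeff_mesh[unfolded folded_mesh_def, rule_format, OF i, symmetric])
    finally show ?thesis using True ci by (simp add: M[OF i])
  next
    case False
    have "(\<Sum>k\<in>nodes D. \<Sum>j<link i k. fls_nth (M k) (u + 2 * int j + 1 - int (link i k))) = 0"
      by (intro sum.neutral ballI nz) (use False in auto)
    moreover have "fls_nth (M i) (u - int (card i)) = 0" using False by (simp add: M[OF i])
    moreover have "fls_nth (M i) (u + int (card i)) = (if i = orbit D y \<and> u = 0 then 1 else 0)"
      unfolding M[OF i] using False ci node_coeff_initial[OF i y, of "u + int (card i)"] by auto
    ultimately show ?thesis by simp
  qed
  then show "fls_nth (\<Sum>k\<in>nodes D. qcartan D i k * M k) u = fls_nth (if i = orbit D y then 1 else 0) u"
    unfolding qcartan_row_nth[OF i] by simp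
qed

theorem qcartan_inv_coeff_eq:
  assumes i: "i \<in> nodes D" and y: "vertex y s"
  shows "qcartan_inv_coeff D i (orbit D y) (int n) = node_coeff y s i (int n)"
proof -
  \<comment> \<open>A complete inverse matrix has to be exhibited. The column of the orbit of
    \<open>y\<close> uses the given \<open>y\<close> and \<open>s\<close>; the other columns are
    filled from arbitrary points of their orbits.\<close>
  define pt where "pt j = (SOME x. x \<in> j)" for j :: "'v set"
  define M where "M k j = (if j = orbit D y then fps_to_fls (Abs_fps (\<lambda>n. of_int (node_coeff y s k (int n)) :: rat))
    else fps_to_fls (Abs_fps (\<lambda>n. of_int (node_coeff (pt j) (\<epsilon> (pt j)) k (int n)) :: rat)))" for k j
  have pt: "orbit D (pt j) = j" if "j \<in> nodes D" for j
    using nodes_nonempty[OF that] nodes_eq_orbit[OF that] unfolding pt_def by (metis someI_ex)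
  have "(\<Sum>k\<in>nodes D. qcartan D i k * M k j) = (if i = j then 1 else 0)" if "j \<in> nodes D" "i \<in> nodes D" for i j
  proof (cases "j = orbit D y")
    case True
    then show ?thesis using node_coeff_inverse[OF that(2) y] by (simp add: M_def)
  next
    case False
    then show ?thesis using node_coeff_inverse[OF that(2) vertex_eps[of "pt j"]] pt[OF that(1)] by (simp add: M_def)
  qed
  then have "qcartan_inv D i (orbit D y) = M i (orbit D y)" by (rule qcartan_inv_eqI) (use i in auto)
  then show ?thesis by (simp add: qcartan_inv_coeff_def M_def)
qed

lemma node_coeff_vertex:
  assumes i: "i \<in> nodes D" and x: "x \<in> i" "vertex x p"
  shows "node_coeff y s i (p - s + int (card i)) = pulled y s x p"
    "node_coeff y s i (p - s - int (card i)) = pulled y s x (p - 2 * dn D x)"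
proof -
  have di: "int (card i) = dn D x" by (rule card_node[OF i x(1)])
  have u: "vertex x' q \<longleftrightarrow> x' = x" if "vertex x q" "x' \<in> i" for x' q
    using that vertex_orbit_unique[of x q x'] nodes_eq_orbit[OF i x(1)] by auto
  have "node_coeff y s i (q - s + int (card i)) = pulled y s x q" if "vertex x q" for q
  proof -
    have "node_coeff y s i (q - s + int (card i)) = (\<Sum>x'\<in>i. if x' = x then pulled y s x q else 0)"
      unfolding node_coeff_def by (intro sum.cong) (auto simp: u[OF that])
    then show ?thesis using x(1) by simp
  qed
  from this[OF x(2)] this[of "p - 2 * dn D x"]
  show "node_coeff y s i (p - s + int (card i)) = pulled y s x p"
    "node_coeff y s i (p - s - int (card i)) = pulled y s x (p - 2 * dn D x)"
    using x(2) di vertex_minus by (simp_all add: algebra_simps)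
qed

end

section \<open>The coordinate bijection\<close>

abbreviation sg :: "int \<Rightarrow> int" where "sg k \<equiv> (if even k then 1 else - 1)"

context parity_folding begin

definition root_at :: "'v \<Rightarrow> int \<Rightarrow> 'v \<Rightarrow> int" where
  "root_at x p = (\<lambda>y. E0 x p y - E0 x (p - 2 * dn D x) y)"

lemma root_at_state: "vertex x p \<Longrightarrow> root_at x p = state p (simple_root D x)"
proof -
  assume v: "vertex x p"
  have "simple_root D x = (\<lambda>y. fund_weight x y - (fund_weight x y - simple_root D x y))" by simp
  then have "state p (simple_root D x) = (\<lambda>y. state p (fund_weight x) y - state p (\<lambda>y. fund_weight x y - simple_root D x y) y)"
    using additive_map_diff[OF state_additive, of p "fund_weight x" "\<lambda>y. fund_weight x y - simple_root D x y"] by simp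
  then show ?thesis using E0_drop[OF v] by (simp add: root_at_def E0_def[of x p])
qed

text \<open>Both arguments are transported to time \<open>s\<close> by a Weyl group element. The
  second becomes the simple root of \<open>y\<close>, and pairing with it reads off the coefficient
  at \<open>y\<close>.\<close>

lemma form_root_at:
  assumes "vertex x p" "vertex y s"
  shows "form D (root_at x p) (root_at y s) = of_int (pulled y s x p - pulled y s x (p - 2 * dn D x))"
proof -
  note a = weyl_additive[OF inv_state(1)[of s]]
  have "form D (root_at x p) (root_at y s) =
      form D (inv_into UNIV (state s) (root_at x p)) (inv_into UNIV (state s) (state s (simple_root D y)))"
    unfolding root_at_state[OF assms(2)]
    using form_weyl[OF inv_state(1)] form_weyl[OF state_weyl in_root_lattice_simple] by metis
  also have "\<dots> = of_int (inv_into UNIV (state s) (root_at x p) y)"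
    unfolding inv_state(2) by (rule form_simple_root)
  finally show ?thesis unfolding root_at_def additive_map_diff[OF a] by (simp add: pulled_def)
qed

end

context q_datum begin

lemma framed_height: "framed \<xi> v \<Longrightarrow> v (fund_weight x) = E0 x (\<xi> x)" by (simp add: framed_def)

text \<open>In either branch the signed root \<open>(-1)^k \<beta>\<close> is transformed linearly
  by \<open>t\<close>: the change of sign of the root is compensated by the change of parity of
  \<open>k\<close>.\<close>

lemma phi_step_signed:
  assumes "additive_map t" "phi_step D t s (\<beta>, k) = (\<beta>', k')" "s = 1 \<or> s = - 1"
  shows "(\<lambda>y. sg k' * \<beta>' y) = t (\<lambda>y. sg k * \<beta> y)"
proof (cases "t \<beta> \<in> pos_roots D")
  case True
  then show ?thesis using assms(2) additive_map_scale[OF assms(1), of "sg k" \<beta>] by (simp add: phi_step_def)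
next
  case False
  then have e: "\<beta>' = (\<lambda>y. - t \<beta> y)" "k' = k + s" using assms(2) by (simp_all add: phi_step_def)
  have "sg k' = - sg k" using assms(3) e(2) by auto
  then show ?thesis using additive_map_scale[OF assms(1), of "sg k" \<beta>] e(1) by simp
qed

text \<open>At height \<open>\<xi> x\<close> the difference defining \<open>gamma_root\<close> is
  carried by \<open>v\<close> to a difference of consecutive weights over \<open>x\<close>. A step
  of the recursion amounts to \<open>d\<close> shifts or their inverse, and since the
  \<open>d\<close>-th power of \<open>\<sigma>\<close> fixes \<open>x\<close>, it stays over
  \<open>x\<close>.\<close>

lemma phi_formula:
  "\<exists>v\<in>weyl_group D. \<forall>x p \<beta> k. vertex x p \<longrightarrow> phi D \<epsilon> \<xi> (x, p) = (\<beta>, k) \<longrightarrow> v (\<lambda>y. sg k * \<beta> y) = root_at x p"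
proof -
  obtain v T where v: "v \<in> weyl_group D" "framed \<xi> v" and T: "additive_map T" "inj T"
    "\<And>x p. E0 (\<sigma> x) (p - 2) = T (E0 x p)" and vT: "\<And>\<kappa>. v (coxeter_tau D \<epsilon> \<xi> \<kappa>) = T (v \<kappa>)"
    and bij: "bij (coxeter_tau D \<epsilon> \<xi>)"
    using coxeter_frame by blast
  let ?\<tau> = "coxeter_tau D \<epsilon> \<xi>"
  note va = weyl_additive[OF v(1)]
  have vinj: "inj v" using weyl_bij[OF v(1)] by (rule bij_is_inj)
  have Tn: "additive_map (T ^^ n)" for n
    by (induction n) (simp_all only: funpow.simps additive_map_id additive_map_comp[OF T(1)])
  have vTn: "v ((?\<tau> ^^ n) \<kappa>) = (T ^^ n) (v \<kappa>)" for n \<kappa>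
    by (induction n) (simp_all add: vT)
  have E0n: "E0 ((\<sigma> ^^ n) x) (p - 2 * int n) = (T ^^ n) (E0 x p)" for n x p
  proof (induction n)
    case (Suc n)
    have "E0 ((\<sigma> ^^ Suc n) x) (p - 2 * int (Suc n)) = E0 (\<sigma> ((\<sigma> ^^ n) x)) (p - 2 * int n - 2)"
      by (simp add: algebra_simps)
    then show ?case using Suc T(3) by simp
  qed simp
  have tau_add: "additive_map ?\<tau>"
    unfolding additive_map_def
  proof (intro allI)
    fix a b \<kappa> \<mu>
    have "v (?\<tau> (\<lambda>y. a * \<kappa> y + b * \<mu> y)) = v (\<lambda>y. a * ?\<tau> \<kappa> y + b * ?\<tau> \<mu> y)"
      by (simp add: vT additive_mapD[OF va] additive_mapD[OF T(1)])
    then show "?\<tau> (\<lambda>y. a * \<kappa> y + b * \<mu> y) = (\<lambda>y. a * ?\<tau> \<kappa> y + b * ?\<tau> \<mu> y)" by (rule injD[OF vinj])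
  qed
  have "v (\<lambda>y. sg k * \<beta> y) = root_at x p" if x: "vertex x p" and phi: "phi D \<epsilon> \<xi> (x, p) = (\<beta>, k)" for x p \<beta> k
  proof -
    define d where "d = card (orbit D x)"
    have d: "int d = dn D x" by (simp add: d_def dn_def)
    define t where "t = ?\<tau> ^^ d"
    have t_add: "additive_map t" unfolding t_def
      by (induction d) (simp_all only: funpow.simps additive_map_id additive_map_comp[OF tau_add])
    have bij_t: "bij t" unfolding t_def using bij by (rule bij_betw_funpow)
    have t_inv: "t (inv_into UNIV t \<kappa>) = \<kappa>" "inv_into UNIV t (t \<kappa>) = \<kappa>" for \<kappa>
      using bij_t by (simp_all add: bij_is_surj bij_is_inj surj_f_inv_f)
    have inv_add: "additive_map (inv_into UNIV t)"
      by (rule additive_map_inverse[OF t_add]) (simp_all add: fun_eq_iff t_inv del: id_apply, simp_all add: t_inv)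
    have sx: "(\<sigma> ^^ d) x = x" using aut_pow_dn[of x] d by (metis nat_int)
    have drop: "root_at x (q - 2 * dn D x) = (T ^^ d) (root_at x q)" for q
    proof -
      have "E0 x (q - 2 * dn D x) = (T ^^ d) (E0 x q)" for q using E0n[of d x q] sx d by simp
      then show ?thesis unfolding root_at_def by (simp only: additive_map_diff[OF Tn])
    qed
    have gamma: "v (\<lambda>y. sg 0 * gamma_root D \<epsilon> \<xi> x y) = root_at x (\<xi> x)"
    proof -
      have "v (\<lambda>y. fund_weight x y - t (fund_weight x) y) = (\<lambda>y. v (fund_weight x) y - v (t (fund_weight x)) y)"
        by (rule additive_map_diff[OF va])
      also have "v (t (fund_weight x)) = (T ^^ d) (E0 x (\<xi> x))" unfolding t_def vTn framed_height[OF v(2)] ..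
      also have "\<dots> = E0 x (\<xi> x - 2 * dn D x)" using E0n[of d x "\<xi> x"] sx d by simp
      finally show ?thesis by (simp add: gamma_root_def root_at_def t_def d_def framed_height[OF v(2)])
    qed
    have down: "v (\<lambda>y. sg (snd a) * fst a y) = root_at x (\<xi> x - 2 * dn D x * int n)"
      if "a = (phi_step D t (- 1) ^^ n) (gamma_root D \<epsilon> \<xi> x, 0)" for n a
      using that
    proof (induction n arbitrary: a)
      case (Suc n)
      define b where "b = (phi_step D t (- 1) ^^ n) (gamma_root D \<epsilon> \<xi> x, 0)"
      have "phi_step D t (- 1) (fst b, snd b) = (fst a, snd a)" using Suc.prems by (simp add: b_def)
      from phi_step_signed[OF t_add this]
      have "v (\<lambda>y. sg (snd a) * fst a y) = (T ^^ d) (v (\<lambda>y. sg (snd b) * fst b y))" by (simp add: t_def vTn)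
      also have "\<dots> = root_at x (\<xi> x - 2 * dn D x * int n - 2 * dn D x)" by (simp only: Suc.IH[OF b_def] drop)
      finally show ?case by (simp add: algebra_simps)
    qed (use gamma in simp)
    \<comment> \<open>For ascending steps both sides are compared after applying the injective map
      \<open>T ^^ d\<close>, which undoes the inverse of \<open>t\<close>.\<close>
    have up: "v (\<lambda>y. sg (snd a) * fst a y) = root_at x (\<xi> x + 2 * dn D x * int n)"
      if "a = (phi_step D (inv_into UNIV t) 1 ^^ n) (gamma_root D \<epsilon> \<xi> x, 0)" for n a
      using that
    proof (induction n arbitrary: a)
      case (Suc n)
      define b where "b = (phi_step D (inv_into UNIV t) 1 ^^ n) (gamma_root D \<epsilon> \<xi> x, 0)"
      have "phi_step D (inv_into UNIV t) 1 (fst b, snd b) = (fst a, snd a)" using Suc.prems by (simp add: b_def)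
      from phi_step_signed[OF inv_add this]
      have "t (\<lambda>y. sg (snd a) * fst a y) = (\<lambda>y. sg (snd b) * fst b y)" by (simp add: t_inv)
      then have "(T ^^ d) (v (\<lambda>y. sg (snd a) * fst a y)) = v (\<lambda>y. sg (snd b) * fst b y)" unfolding t_def vTn[symmetric] by simp
      also have "\<dots> = (T ^^ d) (root_at x (\<xi> x + 2 * dn D x * int (Suc n)))"
        unfolding Suc.IH[OF b_def] drop[symmetric] by (simp add: algebra_simps)
      finally show ?case using inj_fn[OF T(2), of d] by (rule injD[rotated])
    qed (use gamma in simp)
    define n where "n = (p - \<xi> x) div (2 * dn D x)"
    have "2 * dn D x dvd p - \<xi> x" by (rule vertex_diff[OF height_vertex x])
    then have n: "p = \<xi> x + 2 * dn D x * n" by (simp add: n_def)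
    show ?thesis
    proof (cases "n \<ge> 0")
      case True
      then have "(\<beta>, k) = (phi_step D (inv_into UNIV t) 1 ^^ nat n) (gamma_root D \<epsilon> \<xi> x, 0)"
        using phi by (simp add: phi_def Let_def t_def d_def n_def)
      from up[OF this] show ?thesis using True n by simp
    next
      case False
      then have "(\<beta>, k) = (phi_step D t (- 1) ^^ nat (- n)) (gamma_root D \<epsilon> \<xi> x, 0)"
        using phi by (simp add: phi_def Let_def t_def d_def n_def)
      from down[OF this] show ?thesis using False n by simp
    qed
  qed
  then show ?thesis using v(1) by blast
qed

lemma node_parity_eq:
  assumes i: "i \<in> nodes D" and z: "z \<in> i" shows "node_parity D \<epsilon> i = \<epsilon> z mod 2"
  unfolding node_parity_def
proof (rule the_equality)
  have "[\<epsilon> z mod 2 = \<epsilon> x] (mod 2)" if "x \<in> i" for x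
  proof -
    have "even (\<epsilon> z - \<epsilon> x)"
      by (rule eps_orbit_parity) (use nodes_eq_orbit[OF i z] nodes_eq_orbit[OF i that] in simp)
    then show ?thesis by (simp add: cong_def mod_eq_dvd_iff)
  qed
  then show "\<epsilon> z mod 2 \<in> {0, 1} \<and> (\<forall>x\<in>i. [\<epsilon> z mod 2 = \<epsilon> x] (mod 2))" by auto
  show "e = \<epsilon> z mod 2" if "e \<in> {0, 1} \<and> (\<forall>x\<in>i. [e = \<epsilon> x] (mod 2))" for e
    using that z by (auto simp: cong_def)
qed

lemma vertex_I_hat: "vertex x p \<Longrightarrow> (orbit D x, p) \<in> I_hat D \<epsilon>"
  using vertex_parity[of x p] node_parity_eq[of "orbit D x" x] by (simp add: I_hat_def)

lemma I_hat_vertex: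
  assumes "(i, p) \<in> I_hat D \<epsilon>"
  obtains x where "i \<in> nodes D" "x \<in> i" "vertex x p" "phi_bar D \<epsilon> \<xi> (i, p) = phi D \<epsilon> \<xi> (x, p)"
proof -
  have i: "i \<in> nodes D" and ev: "even (p - node_parity D \<epsilon> i)" using assms by (auto simp: I_hat_def)
  obtain z where z: "z \<in> i" using nodes_nonempty[OF i] by blast
  have orb: "i = orbit D z" by (rule nodes_eq_orbit[OF i z])
  have "even (p - \<epsilon> z)" using ev by (simp add: node_parity_eq[OF i z])
  then obtain x0 where x0: "x0 \<in> orbit D z" "vertex x0 p" by (rule vertex_orbit_exists)
  let ?f = "\<lambda>(x, p). (orbit D x, p)"
  define a where "a = inv_into (rep_vertices D \<epsilon>) ?f (i, p)"
  have im: "(i, p) \<in> ?f ` rep_vertices D \<epsilon>"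
    using x0 orb orbit_eq[OF x0(1)] by (intro image_eqI[of _ _ "(x0, p)"]) (simp_all add: rep_vertices_iff)
  have "a \<in> rep_vertices D \<epsilon>" "?f a = (i, p)" unfolding a_def by (rule inv_into_into[OF im], rule f_inv_into_f[OF im])
  then obtain x where x: "a = (x, p)" "vertex x p" "orbit D x = i" by (cases a) (auto simp: rep_vertices_iff)
  have "phi_bar D \<epsilon> \<xi> (i, p) = phi D \<epsilon> \<xi> (x, p)" by (simp add: phi_bar_def a_def[symmetric] x(1))
  moreover have "x \<in> i" using x(3) self_in_orbit by blast
  ultimately show ?thesis using that i x(2) by blast
qed

definition signed_root :: "'v set \<times> int \<Rightarrow> 'v \<Rightarrow> int" where
  "signed_root a = (case phi_bar D \<epsilon> \<xi> a of (\<alpha>, k) \<Rightarrow> (\<lambda>y. sg k * \<alpha> y))"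

theorem signed_root_form:
  assumes "(i, p) \<in> I_hat D \<epsilon>" "(j, s) \<in> I_hat D \<epsilon>"
  shows "in_root_lattice (signed_root (i, p))"
    "\<exists>c :: int \<Rightarrow> int. (\<forall>n. qcartan_inv_coeff D i j (int n) = c (int n)) \<and>
      (\<forall>u. c (u + 2 * int r * int (dual_coxeter D)) = c u) \<and>
      form D (signed_root (i, p)) (signed_root (j, s)) = of_int (c (p - s + int (card i)) - c (p - s - int (card i)))"
proof -
  obtain x where x: "i \<in> nodes D" "x \<in> i" "vertex x p" "phi_bar D \<epsilon> \<xi> (i, p) = phi D \<epsilon> \<xi> (x, p)"
    using I_hat_vertex[OF assms(1)] .
  obtain y where y: "j \<in> nodes D" "y \<in> j" "vertex y s" "phi_bar D \<epsilon> \<xi> (j, s) = phi D \<epsilon> \<xi> (y, s)"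
    using I_hat_vertex[OF assms(2)] .
  obtain v where v: "v \<in> weyl_group D"
    "\<And>x p \<beta> k. vertex x p \<Longrightarrow> phi D \<epsilon> \<xi> (x, p) = (\<beta>, k) \<Longrightarrow> v (\<lambda>y. sg k * \<beta> y) = root_at x p"
    using phi_formula by blast
  have vr: "v (signed_root (i, p)) = root_at x p" "v (signed_root (j, s)) = root_at y s"
    using v(2)[OF x(3)] v(2)[OF y(3)] x(4) y(4) by (simp_all add: signed_root_def split: prod.splits)
  define u where "u = inv_into UNIV v"
  have u: "u \<in> weyl_group D" "u (v \<kappa>) = \<kappa>" for \<kappa>
    unfolding u_def using weyl_inv_into[OF v(1)] weyl_bij[OF v(1)] by (simp_all add: bij_is_inj)
  have L: "in_root_lattice (root_at x p)" if "vertex x p" for x p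
    unfolding root_at_state[OF that] using form_weyl[OF state_weyl in_root_lattice_simple] by blast
  have e: "signed_root (i, p) = u (root_at x p)" "signed_root (j, s) = u (root_at y s)"
    using vr u(2) by metis+
  show "in_root_lattice (signed_root (i, p))" unfolding e using form_weyl[OF u(1) L[OF x(3)]] by blast
  have "form D (signed_root (i, p)) (signed_root (j, s)) = form D (root_at x p) (root_at y s)"
    unfolding e using form_weyl[OF u(1) L[OF y(3)]] by blast
  also have "\<dots> = of_int (node_coeff y s i (p - s + int (card i)) - node_coeff y s i (p - s - int (card i)))"
    unfolding node_coeff_vertex[OF x(1-3)] by (rule form_root_at[OF x(3) y(3)])
  finally have "form D (signed_root (i, p)) (signed_root (j, s)) =
      of_int (node_coeff y s i (p - s + int (card i)) - node_coeff y s i (p - s - int (card i)))" .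
  moreover have "j = orbit D y" by (rule nodes_eq_orbit[OF y(1,2)])
  ultimately show "\<exists>c :: int \<Rightarrow> int. (\<forall>n. qcartan_inv_coeff D i j (int n) = c (int n)) \<and>
      (\<forall>u. c (u + 2 * int r * int (dual_coxeter D)) = c u) \<and>
      form D (signed_root (i, p)) (signed_root (j, s)) = of_int (c (p - s + int (card i)) - c (p - s - int (card i)))"
    using qcartan_inv_coeff_eq[OF x(1) y(3)] node_coeff_periodic[OF x(1), of y s]
    by (intro exI[of _ "node_coeff y s i"]) simp
qed

end

section \<open>Degrees of the universal coefficients\<close>

lemma funpow_periodic: "(\<And>u::int. c (u + T) = c u) \<Longrightarrow> c (u + T * int n) = c u"
proof (induction n)
  case (Suc n)
  have "c (u + T * int (Suc n)) = c ((u + T * int n) + T)" by (simp add: algebra_simps)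
  then show ?case using Suc by simp
qed simp

lemma periodic_int:
  assumes "\<And>u::int. c (u + T) = c u" shows "c (u + T * n) = c u"
proof (cases "n \<ge> 0")
  case True
  then show ?thesis using funpow_periodic[of c T u "nat n"] assms by simp
next
  case False
  then show ?thesis using funpow_periodic[of c T "u + T * n" "nat (- n)"] assms by simp
qed

text \<open>One period meets each residue class modulo \<open>T\<close> once, so a single term
  survives, and periodicity moves it to \<open>e\<close>.\<close>

lemma periodic_sum_dvd:
  fixes c :: "int \<Rightarrow> int"
  assumes per: "\<And>u. c (u + int T) = c u" and T: "T > 0"
  shows "(\<Sum>v<T. c (int v) * (if int T dvd int v - e then 1 else 0)) = c e"
proof -
  define v0 where "v0 = nat (e mod int T)"
  have v0: "int v0 = e mod int T" "v0 < T" using T by (simp_all add: v0_def nat_less_iff)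
  have iff: "int T dvd int v - e \<longleftrightarrow> v = v0" if "v < T" for v
  proof -
    have "int T dvd int v - e \<longleftrightarrow> int v mod int T = e mod int T" by (metis mod_eq_dvd_iff)
    also have "\<dots> \<longleftrightarrow> int v = int v0" using that v0 by simp
    finally show ?thesis by simp
  qed
  have "(\<Sum>v<T. c (int v) * (if int T dvd int v - e then 1 else 0)) = (\<Sum>v<T. if v = v0 then c (int v0) else 0)"
    by (intro sum.cong) (auto simp: iff)
  also have "\<dots> = c (int v0)" using v0(2) by simp
  also have "\<dots> = c (int v0 + int T * (e div int T))" using periodic_int[of c "int T" "int v0"] per by simp
  finally show ?thesis by (simp add: v0(1))
qed

lemma q_telescopes_divide:
  assumes "q_telescopes Q F \<Phi>" "q_telescopes Q G \<Psi>"
  shows "q_telescopes Q (F / G) (\<Phi> * inverse \<Psi>)"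
proof -
  have "F / G = F * inverse G" using assms(2) by (simp add: fps_divide_unit q_telescopes_def)
  then show ?thesis using q_telescopes_mult[OF assms(1) q_telescopes_inverse[OF assms(2)]] by simp
qed

context folding begin

lemma qs_power_int: "qs D powi n = qpow (of_int n / of_nat r)"
  by (simp add: qs_def qpow_power_int)

text \<open>As \<open>q_s = q^(1/r)\<close>, the powers of \<open>q^(2 h)\<close> are the powers of
  \<open>q_s\<close> with exponent divisible by \<open>2 r h\<close>, the period of the mesh
  recursion.\<close>

lemma in_coset_qs: "in_coset D (qs D powi n) \<longleftrightarrow> 2 * int r * int (dual_coxeter D) dvd n"
proof -
  have "of_int n / of_nat r = (2 * of_int k * of_nat (dual_coxeter D) :: rat) \<longleftrightarrow> n = 2 * int r * int (dual_coxeter D) * k" for k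
  proof -
    have "of_int n / of_nat r = (2 * of_int k * of_nat (dual_coxeter D) :: rat) \<longleftrightarrow>
        of_int n = (of_int (2 * int r * int (dual_coxeter D) * k) :: rat)"
      using r_pos by (simp add: field_simps)
    then show ?thesis by (simp only: of_int_eq_iff)
  qed
  then show ?thesis by (simp add: in_coset_def qs_power_int dvd_def)
qed

text \<open>The number \<open>T = 2 r h\<close> has two roles: it is the period of the exponents,
  and \<open>q_s^T = q^(2 h)\<close> is the step of \<open>varphi\<close>. Blocks of length
  \<open>T\<close> therefore telescope to a finite product of scaled \<open>varphi\<close>, of which
  only those at powers of \<open>q^(2 h)\<close> count.\<close>

lemma fundamental_product_Deg:
  fixes c :: "int \<Rightarrow> int"
  assumes per: "\<And>u. c (u + 2 * int r * int (dual_coxeter D)) = c u"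
    and A: "has_fps_prod (\<lambda>u. ((1 - fps_const (qs D powi (int u - d) * qs D powi t) * fps_X) /
           (1 - fps_const (qs D powi (int u + d) * qs D powi t) * fps_X)) powi c (int u)) A"
  shows "Deg_rel D (fps_to_fls A) (c (d - t) - c (- d - t))"
proof -
  note h = dual_coxeter_pos
  define T where "T = 2 * r * dual_coxeter D"
  have T: "T > 0" "int T = 2 * int r * int (dual_coxeter D)" using h r_pos by (simp_all add: T_def)
  define w where "w n = qs D powi (n + t)" for n
  have qs0: "qs D \<noteq> 0" by (simp add: qs_def)
  have wn: "qs D powi n * qs D powi t = w n" for n using qs0 by (simp add: w_def power_int_add)
  have w0: "w n \<noteq> 0" for n using qs0 by (simp add: w_def)
  define f where "f u = (linear_fps (w (int u - d)) / linear_fps (w (int u + d))) powi c (int u)" for u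
  define Q where "Q = qpow (2 * of_nat (dual_coxeter D))"
  define \<Phi> where "\<Phi> v = (fps_scale (w (int v - d)) (varphi D) * inverse (fps_scale (w (int v + d)) (varphi D))) powi c (int v)" for v
  have tele: "q_telescopes Q (f v) (\<Phi> v)" for v
    unfolding f_def \<Phi>_def Q_def
    by (intro q_telescopes_power_int q_telescopes_divide varphi_scaled_telescopes[OF h])
  have shift: "f (v + T * m) = fps_scale (Q ^ m) (f v)" for v m
  proof -
    have c: "c (int (v + T * m)) = c (int v)" using funpow_periodic[of c "int T" "int v" m] per T(2) by simp
    have "Q ^ m = qs D powi (int T * int m)"
    proof -
      have e: "of_int (int T * int m) / of_nat r = (of_nat m * (2 * of_nat (dual_coxeter D)) :: rat)" using r_pos by (simp add: T_def)
      show ?thesis unfolding Q_def qpow_power qs_power_int e ..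
    qed
    then have "w (n + int T * int m) = w n * Q ^ m" for n
      using qs0 by (simp add: w_def power_int_add[symmetric] algebra_simps)
    from this[of "int v - d"] this[of "int v + d"]
    have w: "w (int (v + T * m) - d) = w (int v - d) * Q ^ m" "w (int (v + T * m) + d) = w (int v + d) * Q ^ m"
      by (simp_all add: algebra_simps)
    show ?thesis unfolding f_def c w fps_scale_linear[symmetric]
      by (simp add: fps_divide_unit fps_scale_power_int fps_scale_mult fps_scale_inverse)
  qed
  have "has_fps_prod f A" using A unfolding f_def linear_fps_def wn .
  from has_fps_prod_blocks[OF this T(1)]
  have "has_fps_prod (\<lambda>m. fps_scale (Q ^ m) (\<Prod>v<T. f v)) A" unfolding shift fps_scale_prod .
  moreover have "has_fps_prod (\<lambda>m. fps_scale (Q ^ m) (\<Prod>v<T. f v)) (\<Prod>v<T. \<Phi> v)"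
    unfolding Q_def by (rule has_fps_prod_telescopes) (use tele h in \<open>auto intro: q_telescopes_prod simp: Q_def\<close>)
  ultimately have A: "A = (\<Prod>v<T. \<Phi> v)" by (rule has_fps_prod_unique)
  have nz: "fps_nth (fps_scale a (varphi D)) 0 \<noteq> 0" for a by (simp add: varphi_nth_0[OF h])
  have to_fls: "fps_to_fls (\<Phi> v) = (varphi_scaled D (w (int v - d)) * inverse (varphi_scaled D (w (int v + d)))) powi c (int v)" for v
  proof -
    have i: "fps_to_fls (inverse F) = inverse (fps_to_fls F)" if "fps_nth F 0 \<noteq> 0" for F :: "qfield fps"
    proof -
      have "fps_to_fls (inverse F) * fps_to_fls F = 1"
        unfolding fls_times_fps_to_fls[symmetric] inverse_mult_eq_1[OF that] by simp
      then show ?thesis by (metis inverse_unique mult.commute)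
    qed
    have p: "fps_to_fls (F powi n) = fps_to_fls F powi n" if "fps_nth F 0 \<noteq> 0" for F :: "qfield fps" and n
      using i that by (simp add: power_int_def fps_to_fls_power)
    show ?thesis unfolding \<Phi>_def varphi_scaled_conv
      using nz by (subst p) (simp_all add: fls_times_fps_to_fls i)
  qed
  have prod: "fps_to_fls (\<Prod>v<n. \<Phi> v) = (\<Prod>v<n. fps_to_fls (\<Phi> v))" for n
    by (induction n) (simp_all add: fls_times_fps_to_fls)
  have ic: "in_coset D (w n) \<longleftrightarrow> int T dvd n + t" for n unfolding w_def in_coset_qs T(2) ..
  have "Deg_rel D (fps_to_fls A) (\<Sum>v<T. c (int v) * ((if in_coset D (w (int v - d)) then 1 else 0) + - (if in_coset D (w (int v + d)) then 1 else 0)))"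
    unfolding A prod to_fls
    by (intro Deg_rel_prod Deg_rel_power_int Deg_rel_mult Deg_rel_inverse Deg_rel_varphi w0 h) simp_all
  also have "(\<Sum>v<T. c (int v) * ((if in_coset D (w (int v - d)) then 1 else 0) + - (if in_coset D (w (int v + d)) then 1 else 0))) =
      (\<Sum>v<T. c (int v) * (if int T dvd int v - (d - t) then 1 else 0)) - (\<Sum>v<T. c (int v) * (if int T dvd int v - (- d - t) then 1 else 0))"
    unfolding ic sum_subtractf[symmetric] by (intro sum.cong refl) (simp add: algebra_simps)
  also have "\<dots> = c (d - t) - c (- d - t)"
    by (simp only: periodic_sum_dvd[of c T, OF per[folded T(2)] T(1)])
  finally show ?thesis .
qed

end

section \<open>Denominators\<close>

lemma rf_z_nonzero: "rf_z \<noteq> 0" by (simp add: rf_z_def)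

lemma is_laurent_poly: "is_laurent (to_fract p)"
  unfolding is_laurent_def by (intro exI[of _ p] exI[of _ 0]) simp

lemma is_laurent_diff:
  assumes "is_laurent f" "is_laurent g" shows "is_laurent (f - g)"
proof -
  obtain p n p' n' where f: "f = to_fract p / rf_z ^ n" "g = to_fract p' / rf_z ^ n'"
    using assms by (auto simp: is_laurent_def)
  have z: "rf_z ^ k = to_fract ([:0, 1:] ^ k)" for k
    unfolding rf_z_def by (induction k) (simp_all add: to_fract_mult[symmetric])
  have "f - g = (to_fract p * rf_z ^ n' - to_fract p' * rf_z ^ n) / rf_z ^ (n + n')"
    using rf_z_nonzero by (simp add: f diff_frac_eq power_add)
  then have "f - g = to_fract (p * [:0, 1:] ^ n' - p' * [:0, 1:] ^ n) / rf_z ^ (n + n')"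
    unfolding z by simp
  then show ?thesis unfolding is_laurent_def by blast
qed

lemma is_laurent_mult:
  assumes "is_laurent f" shows "is_laurent (to_fract p * f)"
proof -
  obtain p' n where "f = to_fract p' / rf_z ^ n" using assms by (auto simp: is_laurent_def)
  then have "to_fract p * f = to_fract (p * p') / rf_z ^ n" by simp
  then show ?thesis unfolding is_laurent_def by blast
qed

lemma clears_mult: "clears_denominators D V W d \<Longrightarrow> clears_denominators D V W (p * d)"
  unfolding clears_denominators_def by (auto simp: mult.assoc intro: is_laurent_mult)

lemma clears_diff: "clears_denominators D V W d \<Longrightarrow> clears_denominators D V W d' \<Longrightarrow> clears_denominators D V W (d - d')"
  unfolding clears_denominators_def by (auto simp: left_diff_distrib intro: is_laurent_diff)

lemma fract_clear: "\<exists>b. b \<noteq> 0 \<and> is_laurent (to_fract b * f)"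
proof -
  obtain a b where f: "f = Fract a b" "b \<noteq> 0" by (cases f) auto
  then have "f = to_fract a / to_fract b" by (simp add: Fract_conv_to_fract)
  then have "to_fract b * f = to_fract a" using f(2) by simp
  then show ?thesis using f(2) is_laurent_poly by metis
qed

lemma clears_exists: "\<exists>d. d \<noteq> 0 \<and> clears_denominators D V W d"
proof -
  let ?R = "R_norm D V W"
  define b where "b st = (SOME b. b \<noteq> 0 \<and> is_laurent (to_fract b * ?R $$ st))" for st
  have b: "b st \<noteq> 0" "is_laurent (to_fract (b st) * ?R $$ st)" for st
    using someI_ex[OF fract_clear[of "?R $$ st"]] unfolding b_def by blast+
  define S where "S = {..<dm W * dm V} \<times> {..<dm V * dm W}"
  have S: "finite S" by (simp add: S_def)
  have "is_laurent (to_fract (\<Prod>st\<in>S. b st) * ?R $$ st)" if "st \<in> S" for st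
  proof -
    have "(\<Prod>st\<in>S. b st) = (\<Prod>st\<in>S - {st}. b st) * b st" using prod.remove[OF S that, of b] by (simp add: mult.commute)
    then show ?thesis using is_laurent_mult[OF b(2)] by (simp add: mult.assoc)
  qed
  then have "clears_denominators D V W (\<Prod>st\<in>S. b st)" unfolding clears_denominators_def S_def by auto
  moreover have "(\<Prod>st\<in>S. b st) \<noteq> 0" using b S by simp
  ultimately show ?thesis by blast
qed

text \<open>Two distinct monic polynomials of minimal degree clearing all denominators would differ
  by one of smaller degree that clears them too; made monic, it contradicts minimality. So the
  description has a value, and that value is monic.\<close>

lemma denominator_nonzero: "denominator D V W \<noteq> 0"
proof -
  let ?P = "\<lambda>d. Polynomial.lead_coeff d = 1 \<and> clears_denominators D V W d"
  have monic: "\<exists>d'. ?P d' \<and> Polynomial.degree d' = Polynomial.degree d" if d: "d \<noteq> 0" "clears_denominators D V W d" for d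
  proof -
    have "clears_denominators D V W ([:inverse (Polynomial.lead_coeff d):] * d)" by (rule clears_mult[OF d(2)])
    then show ?thesis using d(1) by (intro exI[of _ "Polynomial.smult (inverse (Polynomial.lead_coeff d)) d"]) simp
  qed
  then have "\<exists>d. ?P d" using clears_exists[of D V W] by blast
  then obtain d0 where "?P d0" by blast
  from ex_has_least_nat[of ?P d0 Polynomial.degree, OF this]
  obtain d where d0: "?P d" "\<And>e. ?P e \<Longrightarrow> Polynomial.degree d \<le> Polynomial.degree e" by blast
  define n where "n = Polynomial.degree d"
  have d: "?P d" "Polynomial.degree d = n" and n_le: "\<And>e. ?P e \<Longrightarrow> n \<le> Polynomial.degree e"
    using d0 by (simp_all add: n_def)
  have uniq: "d' = d" if d': "?P d'" "Polynomial.degree d' \<le> n" for d'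
  proof (rule ccontr)
    assume ne: "d' \<noteq> d"
    have deg: "Polynomial.degree d' = n" using n_le[OF d'(1)] d'(2) by simp
    have "n > 0"
    proof (rule ccontr)
      assume "\<not> ?thesis"
      have "e = 1" if e: "Polynomial.lead_coeff e = 1" "Polynomial.degree e = 0" for e :: "qfield poly"
      proof -
        obtain a where "e = [:a:]" using e(2) by (rule degree_eq_zeroE)
        then show ?thesis using e(1) by (simp add: one_pCons)
      qed
      then have "d = 1" "d' = 1" using d d' deg \<open>\<not> n > 0\<close> by auto
      then show False using ne by simp
    qed
    have "Polynomial.degree (d' - d) < n"
    proof -
      have "Polynomial.degree (d' - d) \<le> n" using deg d(2) by (intro degree_diff_le) auto
      moreover have "Polynomial.coeff (d' - d) n = 0" using d d' deg by simp
      ultimately show ?thesis using ne by (metis eq_iff_diff_eq_0 le_neq_implies_less leading_coeff_0_iff)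
    qed
    moreover obtain e where "?P e" "Polynomial.degree e = Polynomial.degree (d' - d)"
      using monic[of "d' - d"] clears_diff[of D V W d' d] d d' ne by auto
    ultimately show False using n_le[of e] by simp
  qed
  have "denominator D V W = d"
    unfolding denominator_def
  proof (rule the_equality)
    show "Polynomial.lead_coeff d = 1 \<and> clears_denominators D V W d \<and>
        (\<forall>d'. Polynomial.lead_coeff d' = 1 \<and> clears_denominators D V W d' \<longrightarrow> Polynomial.degree d \<le> Polynomial.degree d')"
      using d n_le by blast
    show "d' = d" if "Polynomial.lead_coeff d' = 1 \<and> clears_denominators D V W d' \<and>
        (\<forall>d''. Polynomial.lead_coeff d'' = 1 \<and> clears_denominators D V W d'' \<longrightarrow> Polynomial.degree d' \<le> Polynomial.degree d'')" for d'
      using that d uniq by blast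
  qed
  then show ?thesis using d by auto
qed

section \<open>The invariant on monomials\<close>

lemma (in folding) Lambda_inf_eq:
  assumes "Deg_rel D (fps_to_fls (univ_coeff D V W)) n"
  shows "Lambda_inf D V W = - n" "Deg_inf D (fps_to_fls (univ_coeff D V W)) = n"
proof -
  note h = dual_coxeter_pos
  have "Deg_rel D (fps_to_fls (fps_of_poly (denominator D V W)) * inverse (fps_to_fls (univ_coeff D V W))) (0 + - n)"
    by (intro Deg_rel_mult Deg_rel_poly Deg_rel_inverse assms h denominator_nonzero)
  then show "Lambda_inf D V W = - n" unfolding Lambda_inf_def by (simp add: Deg_inf_eqI[OF h] divide_inverse)
  show "Deg_inf D (fps_to_fls (univ_coeff D V W)) = n" by (rule Deg_inf_eqI[OF h assms])
qed

lemma (in folding) Deg_rel_nonzero: "Deg_rel D (fps_to_fls F) n \<Longrightarrow> F \<noteq> 0"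
  using dual_coxeter_pos by (auto simp: Deg_rel_def factorization_def prod_zero_iff power_int_eq_0_iff varphi_scaled_nonzero)

lemma monomial_tuple_single: "monomial_tuple D {#(i, p)#} = fund_tuple i (qs D powi p)"
  by (simp add: monomial_tuple_def)

lemma monomial_tuple_empty: "monomial_tuple D {#} = (\<lambda>_. 1)"
  by (simp add: monomial_tuple_def)

lemma monomial_tuple_add: "monomial_tuple D (add_mset a m) = (\<lambda>i. monomial_tuple D {#a#} i * monomial_tuple D m i)"
  by (simp add: monomial_tuple_def)

lemma drinfeld_monomial: "drinfeld_tuple D (monomial_tuple D m)"
proof (induction m)
  case empty
  show ?case by (simp add: drinfeld_tuple_def monomial_tuple_empty)
next
  case (add a m)
  have "Polynomial.coeff (monomial_tuple D {#a#} i) 0 = 1" for i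
    by (cases a) (simp add: monomial_tuple_single fund_tuple_def)
  then show ?case using add unfolding monomial_tuple_add[of D a m] drinfeld_tuple_def by (simp add: coeff_mult)
qed

locale universal_coefficients = q_datum D \<epsilon> \<xi> for D :: "('v::finite) folding" and \<epsilon> \<xi> +
  assumes simple_objects: "simple_objects_exist D"
    and multiplicative: "univ_coeff_multiplicative D"
    and fundamental: "univ_coeff_fundamental D"
begin

abbreviation L :: "('v set \<times> int) multiset \<Rightarrow> 'v qrep \<Rightarrow> bool" where
  "L m \<equiv> is_L D (monomial_tuple D m)"

lemma L_exists: obtains V where "L m V"
  using simple_objects drinfeld_monomial unfolding simple_objects_exist_def by blast

lemma univ_coeff_add:
  assumes "L {#a#} V1" "L m V2" "L (add_mset a m) V" "L m' W"
  shows "univ_coeff D V W = univ_coeff D V1 W * univ_coeff D V2 W" "univ_coeff D W V = univ_coeff D W V1 * univ_coeff D W V2"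
  using multiplicative assms unfolding univ_coeff_multiplicative_def monomial_tuple_add[of D a m] by blast+

lemma Deg_fundamental:
  assumes a: "a \<in> I_hat D \<epsilon>" and b: "b \<in> I_hat D \<epsilon>" and V: "L {#a#} V" and W: "L {#b#} W"
  shows "\<exists>n. Deg_rel D (fps_to_fls (univ_coeff D V W)) n \<and> of_int n = form D (signed_root a) (signed_root b)"
proof -
  obtain i p j s where ab: "a = (i, p)" "b = (j, s)" by (cases a, cases b)
  have ij: "i \<in> nodes D" "j \<in> nodes D" using a b ab by (auto simp: I_hat_def)
  have qs0: "qs D \<noteq> 0" by (simp add: qs_def)
  have q0: "qs D powi n \<noteq> 0" for n using qs0 by simp
  have q: "qs D powi s / qs D powi p = qs D powi (s - p)" using qs0 by (simp add: power_int_diff)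
  obtain A where A: "has_fps_prod (\<lambda>u. ((1 - fps_const (qs D powi (int u - int (card i)) * (qs D powi s / qs D powi p)) * fps_X) /
           (1 - fps_const (qs D powi (int u + int (card i)) * (qs D powi s / qs D powi p)) * fps_X)) powi qcartan_inv_coeff D i j (int u)) A"
    and UA: "univ_coeff D V W = fps_const (qpow (of_nat (card i) * cartan_inv D i j / of_nat r)) * A"
    using fundamental[unfolded univ_coeff_fundamental_def, rule_format, OF ij, of "qs D powi p" "qs D powi s" V W] q0 V W
    unfolding ab monomial_tuple_single by blast
  obtain c :: "int \<Rightarrow> int" where c: "\<And>n. qcartan_inv_coeff D i j (int n) = c (int n)"
    "\<And>u. c (u + 2 * int r * int (dual_coxeter D)) = c u"
    "form D (signed_root (i, p)) (signed_root (j, s)) = of_int (c (p - s + int (card i)) - c (p - s - int (card i)))"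
    using signed_root_form(2)[OF a[unfolded ab] b[unfolded ab]] by blast
  have "Deg_rel D (fps_to_fls A) (c (int (card i) - (s - p)) - c (- int (card i) - (s - p)))"
    by (rule fundamental_product_Deg[OF c(2) A[unfolded q c(1)]])
  moreover have "int (card i) - (s - p) = p - s + int (card i)" "- int (card i) - (s - p) = p - s - int (card i)" by simp_all
  ultimately have "Deg_rel D (fps_to_fls A) (c (p - s + int (card i)) - c (p - s - int (card i)))" by simp
  from Deg_rel_mult[OF dual_coxeter_pos Deg_rel_const[OF dual_coxeter_pos qpow_nonzero] this]
  have "Deg_rel D (fps_to_fls (univ_coeff D V W)) (c (p - s + int (card i)) - c (p - s - int (card i)))"
    by (simp add: UA fls_times_fps_to_fls)
  then show ?thesis using c(3) ab by metis
qed

abbreviation wt_sum :: "('v set \<times> int) multiset \<Rightarrow> 'v \<Rightarrow> int" where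
  "wt_sum \<equiv> Q_weight D \<epsilon> \<xi>"

lemma wt_sum_add: "wt_sum (add_mset a m) = (\<lambda>y. 1 * signed_root a y + 1 * wt_sum m y)"
  by (simp add: Q_weight_def signed_root_def fun_eq_iff split: prod.splits)

lemma wt_sum_empty: "wt_sum {#} = (\<lambda>_. 0)"
  by (simp add: Q_weight_def)

lemma zero_in_root_lattice: "in_root_lattice (\<lambda>_. 0)"
  unfolding in_root_lattice_def by (rule exI[of _ "\<lambda>_. 0"]) (simp add: root_comb_def)

lemma signed_root_lattice: "a \<in> I_hat D \<epsilon> \<Longrightarrow> in_root_lattice (signed_root a)"
  using signed_root_form(1) by (cases a) blast

lemma wt_sum_lattice: "set_mset m \<subseteq> I_hat D \<epsilon> \<Longrightarrow> in_root_lattice (wt_sum m)"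
proof (induction m)
  case (add a m)
  then show ?case unfolding wt_sum_add by (intro in_root_lattice_lin signed_root_lattice) auto
qed (simp add: wt_sum_empty zero_in_root_lattice)

lemma form_zero: "form D (\<lambda>_. 0) \<mu> = 0" "form D \<mu> (\<lambda>_. 0) = 0"
  using form_lin_left[of 0 "\<lambda>_. 0" 0 "\<lambda>_. 0" \<mu>] form_lin_right[OF zero_in_root_lattice zero_in_root_lattice, of \<mu> 0 0] by simp_all

lemma Deg_fundamental_monomial:
  assumes a: "a \<in> I_hat D \<epsilon>" and V: "L {#a#} V" and "set_mset m \<subseteq> I_hat D \<epsilon>" "L m W"
  shows "\<exists>n. Deg_rel D (fps_to_fls (univ_coeff D V W)) n \<and> of_int n = form D (signed_root a) (wt_sum m)"
  using assms(3,4)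
proof (induction m arbitrary: W)
  case empty
  \<comment> \<open>The coefficient of the trivial object is 1 by cancellation: multiplication by
    the empty monomial changes nothing, and the series of \<open>V\<close> with itself is nonzero
    because it has a degree.\<close>
  obtain n where "Deg_rel D (fps_to_fls (univ_coeff D V V)) n" using Deg_fundamental[OF a a V V] by blast
  then have "univ_coeff D V V \<noteq> 0" by (rule Deg_rel_nonzero)
  moreover have "univ_coeff D V V = univ_coeff D V V * univ_coeff D V W"
    by (rule univ_coeff_add(2)[OF V empty(2) _ V]) (use V in simp)
  ultimately have "univ_coeff D V W = 1" by simp
  then show ?case using Deg_rel_1[OF dual_coxeter_pos] by (auto simp: wt_sum_empty form_zero intro!: exI[of _ 0])
next
  case (add b m)
  obtain W1 W2 where W: "L {#b#} W1" "L m W2" using L_exists by metis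
  obtain n1 where n1: "Deg_rel D (fps_to_fls (univ_coeff D V W1)) n1" "of_int n1 = form D (signed_root a) (signed_root b)"
    using Deg_fundamental[OF a _ V W(1)] add.prems by auto
  obtain n2 where n2: "Deg_rel D (fps_to_fls (univ_coeff D V W2)) n2" "of_int n2 = form D (signed_root a) (wt_sum m)"
    using add.IH[OF _ W(2)] add.prems by auto
  have "univ_coeff D V W = univ_coeff D V W1 * univ_coeff D V W2" by (rule univ_coeff_add(2)[OF W add.prems(2) V])
  then have "Deg_rel D (fps_to_fls (univ_coeff D V W)) (n1 + n2)"
    using Deg_rel_mult[OF dual_coxeter_pos n1(1) n2(1)] by (simp add: fls_times_fps_to_fls)
  moreover have "of_int (n1 + n2) = form D (signed_root a) (wt_sum (add_mset b m))"
    unfolding wt_sum_add using add.prems n1(2) n2(2)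
    by (subst form_lin_right) (auto intro: signed_root_lattice wt_sum_lattice)
  ultimately show ?case by blast
qed

lemma Deg_monomials:
  assumes "set_mset m \<subseteq> I_hat D \<epsilon>" "L m V" and m': "set_mset m' \<subseteq> I_hat D \<epsilon>" "L m' W"
  shows "\<exists>n. Deg_rel D (fps_to_fls (univ_coeff D V W)) n \<and> of_int n = form D (wt_sum m) (wt_sum m')"
  using assms(1,2)
proof (induction m arbitrary: V)
  case empty
  \<comment> \<open>An auxiliary fundamental module, at an arbitrary vertex of the diagram, permits
    the same cancellation in the other argument.\<close>
  obtain x :: 'v where True by blast
  define a where "a = (orbit D x, \<epsilon> x)"
  have "a \<in> I_hat D \<epsilon>" unfolding a_def by (rule vertex_I_hat[OF vertex_eps])
  obtain V1 where V1: "L {#a#} V1" using L_exists by blast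
  obtain n where "Deg_rel D (fps_to_fls (univ_coeff D V1 W)) n"
    using Deg_fundamental_monomial[OF \<open>a \<in> I_hat D \<epsilon>\<close> V1 m'] by blast
  then have "univ_coeff D V1 W \<noteq> 0" by (rule Deg_rel_nonzero)
  moreover have "univ_coeff D V1 W = univ_coeff D V1 W * univ_coeff D V W"
    by (rule univ_coeff_add(1)[OF V1 empty(2) _ m'(2)]) (use V1 in simp)
  ultimately have "univ_coeff D V W = 1" by simp
  then show ?case using Deg_rel_1[OF dual_coxeter_pos] by (auto simp: wt_sum_empty form_zero intro!: exI[of _ 0])
next
  case (add b m)
  obtain V1 V2 where V: "L {#b#} V1" "L m V2" using L_exists by metis
  obtain n1 where n1: "Deg_rel D (fps_to_fls (univ_coeff D V1 W)) n1" "of_int n1 = form D (signed_root b) (wt_sum m')"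
    using Deg_fundamental_monomial[OF _ V(1) m'] add.prems by auto
  obtain n2 where n2: "Deg_rel D (fps_to_fls (univ_coeff D V2 W)) n2" "of_int n2 = form D (wt_sum m) (wt_sum m')"
    using add.IH[OF _ V(2)] add.prems by auto
  have "univ_coeff D V W = univ_coeff D V1 W * univ_coeff D V2 W" by (rule univ_coeff_add(1)[OF V add.prems(2) m'(2)])
  then have "Deg_rel D (fps_to_fls (univ_coeff D V W)) (n1 + n2)"
    using Deg_rel_mult[OF dual_coxeter_pos n1(1) n2(1)] by (simp add: fls_times_fps_to_fls)
  moreover have "of_int (n1 + n2) = form D (wt_sum (add_mset b m)) (wt_sum m')"
    unfolding wt_sum_add form_lin_left using n1(2) n2(2) by simp
  ultimately show ?case by blast
qed

end

theorem theorem5p16: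
  fixes D :: "('v::finite) folding" and \<epsilon> \<xi> :: "'v \<Rightarrow> int"
  assumes "is_folding D" and "parity_function D \<epsilon>"
    and "simple_objects_exist D" and "R_norm_exists D"
    and "univ_coeff_multiplicative D" and "univ_coeff_fundamental D"
    and "height_function D \<epsilon> \<xi>"
  shows "(\<forall>i p j s V W \<alpha> k \<beta> l.
        (i, p) \<in> I_hat D \<epsilon> \<and> (j, s) \<in> I_hat D \<epsilon> \<and>
        is_L D (monomial_tuple D {#(i, p)#}) V \<and> is_L D (monomial_tuple D {#(j, s)#}) W \<and>
        phi_bar D \<epsilon> \<xi> (i, p) = (\<alpha>, k) \<and> phi_bar D \<epsilon> \<xi> (j, s) = (\<beta>, l) \<longrightarrow>
        - Lambda_inf D V W = Deg_inf D (fps_to_fls (univ_coeff D V W)) \<and>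
        of_int (Deg_inf D (fps_to_fls (univ_coeff D V W))) = (- 1) powi (k + l) * form D \<alpha> \<beta>) \<and>
     (\<forall>m m' V W.
        m \<in> monomials D \<epsilon> \<and> m' \<in> monomials D \<epsilon> \<and>
        is_L D (monomial_tuple D m) V \<and> is_L D (monomial_tuple D m') W \<longrightarrow>
        of_int (Lambda_inf D V W) = - form D (Q_weight D \<epsilon> \<xi> m) (Q_weight D \<epsilon> \<xi> m'))"
proof -
  interpret universal_coefficients D \<epsilon> \<xi>
    by unfold_locales (rule assms)+
  show ?thesis
  proof (intro conjI allI impI; elim conjE)
    fix i p j s V W \<alpha> k \<beta> l
    assume a: "(i, p) \<in> I_hat D \<epsilon>" and b: "(j, s) \<in> I_hat D \<epsilon>" and V: "L {#(i, p)#} V" and W: "L {#(j, s)#} W"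
      and phi: "phi_bar D \<epsilon> \<xi> (i, p) = (\<alpha>, k)" "phi_bar D \<epsilon> \<xi> (j, s) = (\<beta>, l)"
    obtain n where n: "Deg_rel D (fps_to_fls (univ_coeff D V W)) n" "of_int n = form D (signed_root (i, p)) (signed_root (j, s))"
      using Deg_fundamental[OF a b V W] by blast
    \<comment> \<open>The sign squares to 1, so each root is recovered from its signed version. The
      summand with factor 0 brings it into the shape of the bilinearity lemmas.\<close>
    have \<alpha>: "\<alpha> = (\<lambda>y. sg k * signed_root (i, p) y + 0 * signed_root (i, p) y)"
      and \<beta>: "\<beta> = (\<lambda>y. sg l * signed_root (j, s) y + 0 * signed_root (j, s) y)"
      using phi by (auto simp: signed_root_def fun_eq_iff)
    have "form D \<alpha> \<beta> = of_int (sg k * sg l) * of_int n"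
      unfolding n(2) by (subst \<alpha>, subst \<beta>, subst form_lin_left, subst (1 2) form_lin_right)
        (simp_all add: signed_root_lattice[OF b])
    moreover have "(- 1) powi (k + l) = (of_int (sg k * sg l) :: rat)"
      by (auto simp: power_int_minus_left)
    ultimately have "of_int n = (- 1) powi (k + l) * form D \<alpha> \<beta>" by auto
    then show "- Lambda_inf D V W = Deg_inf D (fps_to_fls (univ_coeff D V W))"
      "of_int (Deg_inf D (fps_to_fls (univ_coeff D V W))) = (- 1) powi (k + l) * form D \<alpha> \<beta>"
      using Lambda_inf_eq[OF n(1)] by simp_all
  next
    fix m m' V W
    assume "m \<in> monomials D \<epsilon>" "m' \<in> monomials D \<epsilon>" "L m V" "L m' W"
    then obtain n where "Deg_rel D (fps_to_fls (univ_coeff D V W)) n" "of_int n = form D (wt_sum m) (wt_sum m')"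
      using Deg_monomials[of m V m' W] by (auto simp: monomials_def)
    then show "of_int (Lambda_inf D V W) = - form D (Q_weight D \<epsilon> \<xi> m) (Q_weight D \<epsilon> \<xi> m')"
      using Lambda_inf_eq(1) by simp
  qed
qed

end
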